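(* Let $p$ be a prime, let $n$ be a positive integer, and write $\mathrm{GL}_n=\mathrm{GL}_n(\mathbb{F}_p)$. Let $G$ be a finite $p$-group, let $H\subseteq G$ be any subgroup, and let $Y$ be any pointed $(G\times \mathrm{GL}_n)$-space. Then the map $$(\mathbf{B}_n^{\Diamond}\wedge Y^H)\wedge_{\mathrm{GL}_n} (E\mathrm{GL}_n)_+ \longrightarrow \left((\mathbf{B}_n^{\Diamond}\wedge Y)\wedge_{\mathrm{GL}_n} (E_G\mathrm{GL}_n)_+\right)^H$$ induced by the inclusion of fixed points $E\mathrm{GL}_n\simeq (E_G\mathrm{GL}_n)^G\hookrightarrow E_G\mathrm{GL}_n$ is a homotopy equivalence. Consequently the induced natural map $e_n(Y^H)\to (e_nY)^H$, from the Steinberg summand of the $H$-fixed points to the $H$-fixed points of the Steinberg summand, is an equivalence of spectra.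
   Context: Flag complex: $\mathbf{B}_n$ is (the geometric realization of) the nerve of the poset of subspaces of $\mathbb{F}_p^n$ other than $0$ and $\mathbb{F}_p^n$, with its left $\mathrm{GL}_n$-action. $\mathbf{B}_n^{\Diamond}$ is the unreduced suspension of $\mathbf{B}_n$, whose two cone points are labelled by the subspaces $0$ and $\mathbb{F}_p^n$; it is a pointed $\mathrm{GL}_n$-space with basepoint the vertex $0$. The group $G$ acts trivially on $\mathbf{B}_n^{\Diamond}$. Equivariant universal spaces: for finite groups $G$ and $\Lambda$, $E_G\Lambda$ denotes the $(G\times\Lambda)$-space (of the homotopy type of a $(G\times\Lambda)$-CW complex) characterized up to equivalence by: for each subgroup $\Gamma\subseteq G\times\Lambda$, the fixed point space $(E_G\Lambda)^{\Gamma}$ is contractible if $\Gamma\cap(1\times\Lambda)=1$ and is empty otherwise. The $G$-fixed points $(E_G\Lambda)^G$ (for $G=G\times 1$) form a contractible free $\Lambda$-space, i.e. a model of $E\Lambda$, with trivial $G$-action. Steinberg summands: for a pointed space or spectrum $X$ with $\mathrm{GL}_n$-action, $e_nX=(\Sigma^{1-n}\mathbf{B}_n^{\Diamond}\wedge X)\wedge_{\mathrm{GL}_n}(E\mathrm{GL}_n)_+$, a spectrum. For a pointed space or spectrum $X$ with $(G\times\mathrm{GL}_n)$-action, $e_nX=(\Sigma^{1-n}\mathbf{B}_n^{\Diamond}\wedge X)\wedge_{\mathrm{GL}_n}(E_G\mathrm{GL}_n)_+$, a naïve $G$-spectrum (a spectrum with $G$-action, whose $H$-fixed points are taken levelwise).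 Here $\mathrm{GL}_n$ acts diagonally, $\wedge_{\mathrm{GL}_n}$ denotes the orbits of the diagonal action on the smash product, and $\Sigma^{1-n}$ denotes the formal $(n-1)$-fold desuspension. Thus $(e_nY)^H$ is the $(n-1)$-fold desuspension of (the suspension spectrum of) the target of the map in the claim, and $e_n(Y^H)$ that of the source. *)

theory Defs
  imports "HOL-Analysis.Analysis" "HOL-Algebra.Coset"
begin

(* Conventions.  A space is an arbitrary topological space ('a topology), products carry the
   product topology, quotients the quotient topology.  Since all groups that occur are finite
   (and discrete), a continuous action is an action by continuous maps. *)

section \<open>Final topologies, pointed spaces, smash products\<close>

definition final_topology :: "'b set \<Rightarrow> 'a topology \<Rightarrow> ('a \<Rightarrow> 'b) \<Rightarrow> 'b topology" where
  "final_topology S X q = topology (\<lambda>U. U \<subseteq> S \<and> openin X {x \<in> topspace X. q x \<in> U})"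

lemma openin_final_topology:
  "openin (final_topology S X q) U \<longleftrightarrow> U \<subseteq> S \<and> openin X {x \<in> topspace X. q x \<in> U}"
proof -
  have int: "openin X {x \<in> topspace X. q x \<in> U \<inter> V}"
    if "openin X {x \<in> topspace X. q x \<in> U}" "openin X {x \<in> topspace X. q x \<in> V}" for U V
  proof -
    have "{x \<in> topspace X. q x \<in> U \<inter> V} =
        {x \<in> topspace X. q x \<in> U} \<inter> {x \<in> topspace X. q x \<in> V}" by auto
    with that show ?thesis by auto
  qed
  have un: "openin X {x \<in> topspace X. q x \<in> \<Union>\<K>}"
    if "\<And>K. K \<in> \<K> \<Longrightarrow> openin X {x \<in> topspace X. q x \<in> K}" for \<K>
  proof -
    have "{x \<in> topspace X. q x \<in> \<Union>\<K>} = (\<Union>K\<in>\<K>. {x \<in> topspace X. q x \<in> K})" by auto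
    with that show ?thesis by auto
  qed
  have "istopology (\<lambda>U. U \<subseteq> S \<and> openin X {x \<in> topspace X. q x \<in> U})"
    unfolding istopology_def using int un by (auto simp del: Int_iff Union_iff)
  then show ?thesis by (simp add: final_topology_def topology_inverse')
qed

lemma topspace_final_topology:
  assumes "q ` topspace X \<subseteq> S"
  shows "topspace (final_topology S X q) = S"
proof -
  have "{x \<in> topspace X. q x \<in> S} = topspace X" using assms by auto
  then have "openin (final_topology S X q) S" by (simp add: openin_final_topology)
  then show ?thesis
    by (metis openin_final_topology openin_subset openin_topspace subset_antisym)
qed

definition quotient_topology :: "'a topology \<Rightarrow> ('a \<Rightarrow> 'b) \<Rightarrow> 'b topology" where
  "quotient_topology X q = final_topology (q ` topspace X) X q"

record 'a pspace =
  ptop :: "'a topology"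
  pt :: 'a

definition pointed_map :: "'a pspace \<Rightarrow> 'b pspace \<Rightarrow> ('a \<Rightarrow> 'b) \<Rightarrow> bool" where
  "pointed_map X Y f \<longleftrightarrow> continuous_map (ptop X) (ptop Y) f \<and> f (pt X) = pt Y"

definition pointed_homotopic :: "'a pspace \<Rightarrow> 'b pspace \<Rightarrow> ('a \<Rightarrow> 'b) \<Rightarrow> ('a \<Rightarrow> 'b) \<Rightarrow> bool" where
  "pointed_homotopic X Y = homotopic_with (\<lambda>h. h (pt X) = pt Y) (ptop X) (ptop Y)"

definition pointed_homotopy_equivalence :: "'a pspace \<Rightarrow> 'b pspace \<Rightarrow> ('a \<Rightarrow> 'b) \<Rightarrow> bool" where
  "pointed_homotopy_equivalence X Y f \<longleftrightarrow> pointed_map X Y f \<and>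
     (\<exists>g. pointed_map Y X g \<and> pointed_homotopic X X (g \<circ> f) id \<and> pointed_homotopic Y Y (f \<circ> g) id)"

(* X/A as a pointed space, with the convention that X/{} is X with a disjoint base point. *)
definition collapse :: "'a topology \<Rightarrow> 'a set \<Rightarrow> 'a option pspace" where
  "collapse X A = \<lparr>ptop = final_topology (insert None (Some ` (topspace X - A))) X
                            (\<lambda>x. if x \<in> A then None else Some x),
                   pt = None\<rparr>"

abbreviation adjoin_base :: "'a topology \<Rightarrow> 'a option pspace" where
  "adjoin_base X \<equiv> collapse X {}"

(* The smash product is the quotient of the product in which each class has a chosen
   representative: all points with one coordinate at the base point are sent to the pair of
   base points. *)
definition smash_pt :: "'a pspace \<Rightarrow> 'b pspace \<Rightarrow> 'a \<times> 'b \<Rightarrow> 'a \<times> 'b" where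
  "smash_pt X Y z = (if fst z = pt X \<or> snd z = pt Y then (pt X, pt Y) else z)"

definition smash :: "'a pspace \<Rightarrow> 'b pspace \<Rightarrow> ('a \<times> 'b) pspace" where
  "smash X Y = \<lparr>ptop = quotient_topology (prod_topology (ptop X) (ptop Y)) (smash_pt X Y),
                pt = (pt X, pt Y)\<rparr>"

section \<open>Actions of finite groups\<close>

definition continuous_action ::
    "('g, 'm) monoid_scheme \<Rightarrow> 'a topology \<Rightarrow> ('g \<Rightarrow> 'a \<Rightarrow> 'a) \<Rightarrow> bool" where
  "continuous_action K X a \<longleftrightarrow>
     (\<forall>k\<in>carrier K. continuous_map X X (a k)) \<and>
     (\<forall>x\<in>topspace X. a \<one>\<^bsub>K\<^esub> x = x) \<and>
     (\<forall>k\<in>carrier K. \<forall>l\<in>carrier K. \<forall>x\<in>topspace X. a (k \<otimes>\<^bsub>K\<^esub> l) x = a k (a l x))"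

definition pointed_action ::
    "('g, 'm) monoid_scheme \<Rightarrow> 'a pspace \<Rightarrow> ('g \<Rightarrow> 'a \<Rightarrow> 'a) \<Rightarrow> bool" where
  "pointed_action K X a \<longleftrightarrow> pt X \<in> topspace (ptop X) \<and> continuous_action K (ptop X) a \<and>
     (\<forall>k\<in>carrier K. a k (pt X) = pt X)"

definition fixed_space :: "'g set \<Rightarrow> ('g \<Rightarrow> 'a \<Rightarrow> 'a) \<Rightarrow> 'a topology \<Rightarrow> 'a topology" where
  "fixed_space H a X = subtopology X {x. \<forall>h\<in>H. a h x = x}"

definition fixed_pspace :: "'g set \<Rightarrow> ('g \<Rightarrow> 'a \<Rightarrow> 'a) \<Rightarrow> 'a pspace \<Rightarrow> 'a pspace" where
  "fixed_pspace H a X = \<lparr>ptop = fixed_space H a (ptop X), pt = pt X\<rparr>"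

definition orbit_of :: "('g, 'm) monoid_scheme \<Rightarrow> ('g \<Rightarrow> 'a \<Rightarrow> 'a) \<Rightarrow> 'a \<Rightarrow> 'a set" where
  "orbit_of K a x = (\<lambda>k. a k x) ` carrier K"

definition orbit_pspace ::
    "('g, 'm) monoid_scheme \<Rightarrow> ('g \<Rightarrow> 'a \<Rightarrow> 'a) \<Rightarrow> 'a pspace \<Rightarrow> 'a set pspace" where
  "orbit_pspace K a X = \<lparr>ptop = quotient_topology (ptop X) (orbit_of K a),
                         pt = orbit_of K a (pt X)\<rparr>"

definition smash_act :: "('g \<Rightarrow> 'a \<Rightarrow> 'a) \<Rightarrow> ('g \<Rightarrow> 'b \<Rightarrow> 'b) \<Rightarrow> 'g \<Rightarrow> 'a \<times> 'b \<Rightarrow> 'a \<times> 'b" where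
  "smash_act a b g = map_prod (a g) (b g)"

definition base_act :: "('g \<Rightarrow> 'a \<Rightarrow> 'a) \<Rightarrow> 'g \<Rightarrow> 'a option \<Rightarrow> 'a option" where
  "base_act a g = map_option (a g)"

(* The two restrictions of an action of a product group to its factors. *)
definition fst_act :: "('l, 'm) monoid_scheme \<Rightarrow> ('g \<times> 'l \<Rightarrow> 'a \<Rightarrow> 'a) \<Rightarrow> 'g \<Rightarrow> 'a \<Rightarrow> 'a" where
  "fst_act L a g = a (g, \<one>\<^bsub>L\<^esub>)"

definition snd_act :: "('g, 'm) monoid_scheme \<Rightarrow> ('g \<times> 'l \<Rightarrow> 'a \<Rightarrow> 'a) \<Rightarrow> 'l \<Rightarrow> 'a \<Rightarrow> 'a" where
  "snd_act G a l = a (\<one>\<^bsub>G\<^esub>, l)"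

definition equivariant_map ::
    "('g, 'm) monoid_scheme \<Rightarrow> 'a topology \<Rightarrow> ('g \<Rightarrow> 'a \<Rightarrow> 'a) \<Rightarrow>
      'b topology \<Rightarrow> ('g \<Rightarrow> 'b \<Rightarrow> 'b) \<Rightarrow> ('a \<Rightarrow> 'b) \<Rightarrow> bool" where
  "equivariant_map K X a Y b f \<longleftrightarrow> continuous_map X Y f \<and>
     (\<forall>k\<in>carrier K. \<forall>x\<in>topspace X. f (a k x) = b k (f x))"

definition equivariantly_homotopic ::
    "('g, 'm) monoid_scheme \<Rightarrow> 'a topology \<Rightarrow> ('g \<Rightarrow> 'a \<Rightarrow> 'a) \<Rightarrow>
      'b topology \<Rightarrow> ('g \<Rightarrow> 'b \<Rightarrow> 'b) \<Rightarrow> ('a \<Rightarrow> 'b) \<Rightarrow> ('a \<Rightarrow> 'b) \<Rightarrow> bool" where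
  "equivariantly_homotopic K X a Y b = homotopic_with (equivariant_map K X a Y b) X Y"

definition equivariant_homotopy_equivalence ::
    "('g, 'm) monoid_scheme \<Rightarrow> 'a topology \<Rightarrow> ('g \<Rightarrow> 'a \<Rightarrow> 'a) \<Rightarrow>
      'b topology \<Rightarrow> ('g \<Rightarrow> 'b \<Rightarrow> 'b) \<Rightarrow> ('a \<Rightarrow> 'b) \<Rightarrow> bool" where
  "equivariant_homotopy_equivalence K X a Y b f \<longleftrightarrow> equivariant_map K X a Y b f \<and>
     (\<exists>g. equivariant_map K Y b X a g \<and> equivariantly_homotopic K X a X a (g \<circ> f) id \<and>
          equivariantly_homotopic K Y b Y b (f \<circ> g) id)"

section \<open>Equivariant CW complexes and universal spaces\<close>

definition disk :: "nat \<Rightarrow> (nat \<Rightarrow> real) topology" where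
  "disk n = subtopology (Euclidean_space n) {x. (\<Sum>i<n. (x i)\<^sup>2) \<le> 1}"

definition open_disk :: "nat \<Rightarrow> (nat \<Rightarrow> real) set" where
  "open_disk n = {x \<in> topspace (disk n). (\<Sum>i<n. (x i)\<^sup>2) < 1}"

(* C n is a set of characteristic maps of n-cells.  For a finite group K, a K-CW structure is a
   CW structure whose cells are permuted by K in such a way that an element of K stabilizing a
   cell fixes it pointwise; the latter holds because distinct characteristic maps have disjoint
   open cells, and translates of characteristic maps are characteristic maps.  Maps are compared
   on the disk only. *)
definition equivariant_cw_structure ::
    "('g, 'm) monoid_scheme \<Rightarrow> 'a topology \<Rightarrow> ('g \<Rightarrow> 'a \<Rightarrow> 'a) \<Rightarrow>
      (nat \<Rightarrow> ((nat \<Rightarrow> real) \<Rightarrow> 'a) set) \<Rightarrow> bool" where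
  "equivariant_cw_structure K X a C \<longleftrightarrow>
     Hausdorff_space X \<and>
     (\<forall>n. \<forall>\<phi>\<in>C n. continuous_map (disk n) X \<phi> \<and> inj_on \<phi> (open_disk n)) \<and>
     (\<Union>n. \<Union>\<phi>\<in>C n. \<phi> ` open_disk n) = topspace X \<and>
     (\<forall>m n. \<forall>\<phi>\<in>C m. \<forall>\<psi>\<in>C n. \<phi> ` open_disk m \<inter> \<psi> ` open_disk n \<noteq> {} \<longrightarrow>
        m = n \<and> (\<forall>x\<in>topspace (disk n). \<phi> x = \<psi> x)) \<and>
     (\<forall>n. \<forall>\<phi>\<in>C n. \<exists>F. finite F \<and> F \<subseteq> (SIGMA m:{..<n}. C m) \<and>
        \<phi> ` (topspace (disk n) - open_disk n) \<subseteq> (\<Union>(m, \<psi>)\<in>F. \<psi> ` open_disk m)) \<and>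
     (\<forall>A\<subseteq>topspace X. (\<forall>n. \<forall>\<phi>\<in>C n. closedin (disk n) {x \<in> topspace (disk n). \<phi> x \<in> A})
        \<longrightarrow> closedin X A) \<and>
     (\<forall>k\<in>carrier K. \<forall>n. \<forall>\<phi>\<in>C n. \<exists>\<psi>\<in>C n. \<forall>x\<in>topspace (disk n). \<psi> x = a k (\<phi> x))"

(* The type argument is the type of points of the CW complex. *)
definition equivariant_cw_homotopy_type ::
    "'w itself \<Rightarrow> ('g, 'm) monoid_scheme \<Rightarrow> 'a topology \<Rightarrow> ('g \<Rightarrow> 'a \<Rightarrow> 'a) \<Rightarrow> bool" where
  "equivariant_cw_homotopy_type _ K X a \<longleftrightarrow>
     (\<exists>(W :: 'w topology) b C f. continuous_action K W b \<and> equivariant_cw_structure K W b C \<and>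
        equivariant_homotopy_equivalence K X a W b f)"

(* contractible_space holds for the empty space, so nonemptiness has to be required. *)
definition universal_space ::
    "'w itself \<Rightarrow> ('g, 'm) monoid_scheme \<Rightarrow> ('l, 'k) monoid_scheme \<Rightarrow>
      'e topology \<Rightarrow> ('g \<times> 'l \<Rightarrow> 'e \<Rightarrow> 'e) \<Rightarrow> bool" where
  "universal_space W G L E a \<longleftrightarrow>
     continuous_action (G \<times>\<times> L) E a \<and> equivariant_cw_homotopy_type W (G \<times>\<times> L) E a \<and>
     (\<forall>\<Gamma>. subgroup \<Gamma> (G \<times>\<times> L) \<longrightarrow>
        (if \<Gamma> \<inter> ({\<one>\<^bsub>G\<^esub>} \<times> carrier L) = {(\<one>\<^bsub>G\<^esub>, \<one>\<^bsub>L\<^esub>)}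
         then contractible_space (fixed_space \<Gamma> a E) \<and> topspace (fixed_space \<Gamma> a E) \<noteq> {}
         else topspace (fixed_space \<Gamma> a E) = {}))"

definition contractible_free_space ::
    "('l, 'k) monoid_scheme \<Rightarrow> 'e topology \<Rightarrow> ('l \<Rightarrow> 'e \<Rightarrow> 'e) \<Rightarrow> bool" where
  "contractible_free_space L E a \<longleftrightarrow>
     continuous_action L E a \<and> contractible_space E \<and> topspace E \<noteq> {} \<and>
     (\<forall>l\<in>carrier L. \<forall>x\<in>topspace E. a l x = x \<longrightarrow> l = \<one>\<^bsub>L\<^esub>)"

section \<open>The suspended flag complex\<close>

definition GL :: "('k::field ^ 'n ^ 'n) monoid" where
  "GL = \<lparr>carrier = {A. invertible A}, mult = (**), one = mat 1\<rparr>"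

lemma group_GL: "group (GL :: ('k::field ^ 'n ^ 'n) monoid)"
proof (rule groupI)
  fix A :: "'k ^ 'n ^ 'n"
  assume "A \<in> carrier GL"
  then obtain B where "A ** B = mat 1" "B ** A = mat 1"
    by (auto simp: GL_def invertible_def)
  then show "\<exists>B\<in>carrier GL. B \<otimes>\<^bsub>GL\<^esub> A = \<one>\<^bsub>GL\<^esub>"
    by (auto simp: GL_def invertible_def)
qed (auto simp: GL_def invertible_mult matrix_mul_assoc invertible_def[of "mat 1"])

definition order_simplex :: "'v set \<Rightarrow> ('v \<Rightarrow> real) set" where
  "order_simplex c = {t. (\<forall>v. 0 \<le> t v) \<and> (\<forall>v. v \<notin> c \<longrightarrow> t v = 0) \<and> (\<Sum>v\<in>c. t v) = 1}"

definition finite_chains :: "'v::order set \<Rightarrow> 'v set set" where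
  "finite_chains P = {c. finite c \<and> c \<subseteq> P \<and> (\<forall>v\<in>c. \<forall>w\<in>c. v \<le> w \<or> w \<le> v)}"

(* Geometric realization of the nerve of P.  Each point lies in the interior of the simplex of
   exactly one nondegenerate chain and is recorded by its barycentric coordinates; the topology is
   the coherent one with respect to the Euclidean simplices. *)
definition nerve_realization :: "'v::order set \<Rightarrow> ('v \<Rightarrow> real) topology" where
  "nerve_realization P = topology (\<lambda>U. U \<subseteq> (\<Union>c\<in>finite_chains P. order_simplex c) \<and>
     (\<forall>c\<in>finite_chains P.
        openin (subtopology (powertop_real UNIV) (order_simplex c)) (U \<inter> order_simplex c)))"

lemma openin_nerve_realization:
  "openin (nerve_realization P) U \<longleftrightarrow> U \<subseteq> (\<Union>c\<in>finite_chains P. order_simplex c) \<and>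
     (\<forall>c\<in>finite_chains P.
        openin (subtopology (powertop_real UNIV) (order_simplex c)) (U \<inter> order_simplex c))"
proof -
  have int: "openin T (U \<inter> V \<inter> S)" if "openin T (U \<inter> S)" "openin T (V \<inter> S)"
    for T :: "('a \<Rightarrow> real) topology" and U V S
  proof -
    have "U \<inter> V \<inter> S = (U \<inter> S) \<inter> (V \<inter> S)" by auto
    with that show ?thesis by auto
  qed
  have un: "openin T (\<Union>\<K> \<inter> S)" if "\<And>K. K \<in> \<K> \<Longrightarrow> openin T (K \<inter> S)"
    for T :: "('a \<Rightarrow> real) topology" and \<K> S
  proof -
    have eq: "\<Union>\<K> \<inter> S = (\<Union>K\<in>\<K>. K \<inter> S)" by auto
    show ?thesis unfolding eq using that by (intro openin_Union) blast
  qed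
  have "istopology (\<lambda>U. U \<subseteq> (\<Union>c\<in>finite_chains P. order_simplex c) \<and>
     (\<forall>c\<in>finite_chains P.
        openin (subtopology (powertop_real UNIV) (order_simplex c)) (U \<inter> order_simplex c)))"
    unfolding istopology_def
    by (intro conjI allI impI ballI int un Union_least) blast+
  then show ?thesis by (simp add: nerve_realization_def topology_inverse')
qed

datatype 'a susp = Bot | Top | Mid 'a real

definition susp_pt :: "'a \<times> real \<Rightarrow> 'a susp" where
  "susp_pt z = (if snd z = 0 then Bot else if snd z = 1 then Top else Mid (fst z) (snd z))"

(* The cone points are present even if X is empty, so the suspension of the empty space is the
   discrete space with two points. *)
definition suspension :: "'a topology \<Rightarrow> 'a susp topology" where
  "suspension X =
     final_topology ({Bot, Top} \<union> {Mid x t |x t. x \<in> topspace X \<and> 0 < t \<and> t < 1})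
       (prod_topology X (top_of_set {0..1})) susp_pt"

definition flag_complex :: "(('k::field ^ 'n) set \<Rightarrow> real) topology" where
  "flag_complex = nerve_realization {V. vec.subspace V \<and> V \<noteq> {0} \<and> V \<noteq> UNIV}"

(* The coordinate of A t at V is the coordinate of t at the preimage of V under A. *)
definition flag_act ::
    "'k::field ^ 'n ^ 'n \<Rightarrow> (('k ^ 'n) set \<Rightarrow> real) \<Rightarrow> ('k ^ 'n) set \<Rightarrow> real" where
  "flag_act A t = (\<lambda>V. t ((*v) A -` V))"

(* Bot is the vertex labelled by the zero subspace, Top the one labelled by the whole space. *)
definition B_diamond :: "(('k::field ^ 'n) set \<Rightarrow> real) susp pspace" where
  "B_diamond = \<lparr>ptop = suspension flag_complex, pt = Bot\<rparr>"

definition B_diamond_act ::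
    "'k::field ^ 'n ^ 'n \<Rightarrow> (('k ^ 'n) set \<Rightarrow> real) susp \<Rightarrow> (('k ^ 'n) set \<Rightarrow> real) susp" where
  "B_diamond_act A = map_susp (flag_act A)"

(* The orbits of L on the smash product of X and E with a disjoint base point. *)
definition orbit_smash ::
    "('l, 'm) monoid_scheme \<Rightarrow> 'x pspace \<Rightarrow> ('l \<Rightarrow> 'x \<Rightarrow> 'x) \<Rightarrow>
      'e topology \<Rightarrow> ('l \<Rightarrow> 'e \<Rightarrow> 'e) \<Rightarrow> ('x \<times> 'e option) set pspace" where
  "orbit_smash L X a E e =
     orbit_pspace L (smash_act a (base_act e)) (smash X (adjoin_base E))"

(* The map on orbits induced by an equivariant map \<phi> between the universal spaces. *)
definition orbit_smash_map ::
    "('e \<Rightarrow> 'f) \<Rightarrow> ('x \<times> 'e option) set \<Rightarrow> ('x \<times> 'f option) set" where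
  "orbit_smash_map \<phi> Z = map_prod id (map_option \<phi>) ` Z"

section \<open>Spectra\<close>

(* A structure map from the reduced suspension of level k to level k + 1 is given as a map on
   level k times the unit interval. *)
record 'a spectrum =
  level :: "nat \<Rightarrow> 'a pspace"
  bond :: "nat \<Rightarrow> 'a \<times> real \<Rightarrow> 'a"

definition is_spectrum :: "'a spectrum \<Rightarrow> bool" where
  "is_spectrum X \<longleftrightarrow> (\<forall>k.
     pt (level X k) \<in> topspace (ptop (level X k)) \<and>
     continuous_map (prod_topology (ptop (level X k)) (top_of_set {0..1}))
       (ptop (level X (Suc k))) (bond X k) \<and>
     (\<forall>x\<in>topspace (ptop (level X k)).
        bond X k (x, 0) = pt (level X (Suc k)) \<and> bond X k (x, 1) = pt (level X (Suc k))) \<and>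
     (\<forall>t\<in>{0..1}. bond X k (pt (level X k), t) = pt (level X (Suc k))))"

definition spectrum_map :: "'a spectrum \<Rightarrow> 'b spectrum \<Rightarrow> (nat \<Rightarrow> 'a \<Rightarrow> 'b) \<Rightarrow> bool" where
  "spectrum_map X Y f \<longleftrightarrow> (\<forall>k. pointed_map (level X k) (level Y k) (f k) \<and>
     (\<forall>x\<in>topspace (ptop (level X k)). \<forall>t\<in>{0..1}.
        f (Suc k) (bond X k (x, t)) = bond Y k (f k x, t)))"

definition cube :: "nat \<Rightarrow> (nat \<Rightarrow> real) topology" where
  "cube q = subtopology (Euclidean_space q) {s. \<forall>i<q. 0 \<le> s i \<and> s i \<le> 1}"

definition cube_boundary :: "nat \<Rightarrow> (nat \<Rightarrow> real) set" where
  "cube_boundary q = {s. \<exists>i<q. s i = 0 \<or> s i = 1}"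

(* The cube modulo its boundary; for q = 0 these are the two points None and Some (\<lambda>_. 0). *)
definition sphere_pspace :: "nat \<Rightarrow> (nat \<Rightarrow> real) option pspace" where
  "sphere_pspace q = collapse (cube q) (cube_boundary q)"

(* The identification of the smash product of the q-sphere and the circle with the (q+1)-sphere:
   the new coordinate is placed at index q. *)
fun sphere_bond :: "nat \<Rightarrow> (nat \<Rightarrow> real) option \<times> real \<Rightarrow> (nat \<Rightarrow> real) option" where
  "sphere_bond q (None, t) = None"
| "sphere_bond q (Some s, t) = (if t = 0 \<or> t = 1 then None else Some (s(q := t)))"

definition suspension_spectrum :: "'a pspace \<Rightarrow> ((nat \<Rightarrow> real) option \<times> 'a) spectrum" where
  "suspension_spectrum X =
     \<lparr>level = (\<lambda>k. smash (sphere_pspace k) X),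
      bond = (\<lambda>k ((s, x), t). smash_pt (sphere_pspace (Suc k)) X (sphere_bond k (s, t), x))\<rparr>"

(* Formal m-fold desuspension: levels are shifted up by m, with points below. *)
definition desuspend :: "nat \<Rightarrow> 'a spectrum \<Rightarrow> 'a spectrum" where
  "desuspend m X =
     \<lparr>level = (\<lambda>k. if m \<le> k then level X (k - m)
                    else \<lparr>ptop = discrete_topology {pt (level X 0)}, pt = pt (level X 0)\<rparr>),
      bond = (\<lambda>k. if m \<le> k then bond X (k - m) else (\<lambda>_. pt (level X 0)))\<rparr>"

definition spectrum_smash :: "'a spectrum \<Rightarrow> 'b pspace \<Rightarrow> ('a \<times> 'b) spectrum" where
  "spectrum_smash X Y =
     \<lparr>level = (\<lambda>k. smash (level X k) Y),
      bond = (\<lambda>k ((x, y), t). smash_pt (level X (Suc k)) Y (bond X k (x, t), y))\<rparr>"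

(* A group acting on a spectrum acts by the same function on all levels. *)
definition spectrum_orbits ::
    "('g, 'm) monoid_scheme \<Rightarrow> ('g \<Rightarrow> 'a \<Rightarrow> 'a) \<Rightarrow> 'a spectrum \<Rightarrow> 'a set spectrum" where
  "spectrum_orbits K a X =
     \<lparr>level = (\<lambda>k. orbit_pspace K a (level X k)),
      bond = (\<lambda>k (Z, t). (\<lambda>x. bond X k (x, t)) ` Z)\<rparr>"

definition fixed_spectrum :: "'g set \<Rightarrow> ('g \<Rightarrow> 'a \<Rightarrow> 'a) \<Rightarrow> 'a spectrum \<Rightarrow> 'a spectrum" where
  "fixed_spectrum H a X = \<lparr>level = (\<lambda>k. fixed_pspace H a (level X k)), bond = bond X\<rparr>"

subsection \<open>Stable homotopy groups\<close>

(* The suspension of a map from the q-sphere to level k, followed by the structure map. *)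
definition stab ::
    "'a spectrum \<Rightarrow> nat \<Rightarrow> nat \<Rightarrow> ((nat \<Rightarrow> real) option \<Rightarrow> 'a) \<Rightarrow> (nat \<Rightarrow> real) option \<Rightarrow> 'a" where
  "stab X k q f u = (case u of None \<Rightarrow> pt (level X (Suc k))
                     | Some s \<Rightarrow> bond X k (f (Some (s(q := 0))), s q))"

primrec stab_iter ::
    "'a spectrum \<Rightarrow> nat \<Rightarrow> nat \<Rightarrow> nat \<Rightarrow> ((nat \<Rightarrow> real) option \<Rightarrow> 'a) \<Rightarrow>
      (nat \<Rightarrow> real) option \<Rightarrow> 'a" where
  "stab_iter X k q 0 f = f"
| "stab_iter X k q (Suc i) f = stab X (k + i) (q + i) (stab_iter X k q i f)"

definition stable_maps ::
    "'a spectrum \<Rightarrow> int \<Rightarrow> (nat \<times> ((nat \<Rightarrow> real) option \<Rightarrow> 'a)) set" where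
  "stable_maps X j =
     {(k, f). 0 \<le> int k + j \<and> pointed_map (sphere_pspace (nat (int k + j))) (level X k) f}"

definition stable_rel ::
    "'a spectrum \<Rightarrow> int \<Rightarrow>
      ((nat \<times> ((nat \<Rightarrow> real) option \<Rightarrow> 'a)) \<times> (nat \<times> ((nat \<Rightarrow> real) option \<Rightarrow> 'a))) set" where
  "stable_rel X j =
     {((k, f), (l, g)). (k, f) \<in> stable_maps X j \<and> (l, g) \<in> stable_maps X j \<and>
        (\<exists>i i'. k + i = l + i' \<and>
           pointed_homotopic (sphere_pspace (nat (int (k + i) + j))) (level X (k + i))
             (stab_iter X k (nat (int k + j)) i f) (stab_iter X l (nat (int l + j)) i' g))}"

(* The set underlying the j-th stable homotopy group, i.e. the colimit over k of the sets of
   pointed homotopy classes of maps from the (k+j)-sphere to level k. *)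
definition stable_homotopy ::
    "'a spectrum \<Rightarrow> int \<Rightarrow> (nat \<times> ((nat \<Rightarrow> real) option \<Rightarrow> 'a)) set set" where
  "stable_homotopy X j = stable_maps X j // stable_rel X j"

definition stable_homotopy_map ::
    "'b spectrum \<Rightarrow> int \<Rightarrow> (nat \<Rightarrow> 'a \<Rightarrow> 'b) \<Rightarrow>
      (nat \<times> ((nat \<Rightarrow> real) option \<Rightarrow> 'a)) set \<Rightarrow> (nat \<times> ((nat \<Rightarrow> real) option \<Rightarrow> 'b)) set" where
  "stable_homotopy_map Y j f c = stable_rel Y j `` ((\<lambda>(k, g). (k, f k \<circ> g)) ` c)"

(* Maps of spectra induce homomorphisms of stable homotopy groups, so these are isomorphisms as
   soon as they are bijective. *)
definition spectrum_equivalence :: "'a spectrum \<Rightarrow> 'b spectrum \<Rightarrow> (nat \<Rightarrow> 'a \<Rightarrow> 'b) \<Rightarrow> bool" where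
  "spectrum_equivalence X Y f \<longleftrightarrow> is_spectrum X \<and> is_spectrum Y \<and> spectrum_map X Y f \<and>
     (\<forall>j. bij_betw (stable_homotopy_map Y j f) (stable_homotopy X j) (stable_homotopy Y j))"

subsection \<open>Steinberg summands\<close>

(* X is a pointed space with an action a of GL, and E a universal space with the action e of GL.
   GL acts trivially on the sphere coordinate of the suspension spectrum. *)
definition steinberg ::
    "'x pspace \<Rightarrow> ('k::field ^ 'n ^ 'n \<Rightarrow> 'x \<Rightarrow> 'x) \<Rightarrow>
      'e topology \<Rightarrow> ('k ^ 'n ^ 'n \<Rightarrow> 'e \<Rightarrow> 'e) \<Rightarrow>
      (((((nat \<Rightarrow> real) option \<times> (('k ^ 'n) set \<Rightarrow> real) susp) \<times> 'x) \<times> 'e option) set) spectrum" where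
  "steinberg X a E e =
     spectrum_orbits GL
       (smash_act (smash_act (smash_act (\<lambda>_. id) B_diamond_act) a) (base_act e))
       (spectrum_smash
          (spectrum_smash (desuspend (CARD('n) - 1) (suspension_spectrum B_diamond)) X)
          (adjoin_base E))"

(* The action of a group on orbits induced by actions a and e on X and E; it acts trivially on the
   remaining factor 'b, which is the suspended flag complex or a suspension of it. *)
definition orbit_smash_act ::
    "('g \<Rightarrow> 'x \<Rightarrow> 'x) \<Rightarrow> ('g \<Rightarrow> 'e \<Rightarrow> 'e) \<Rightarrow>
      'g \<Rightarrow> (('b \<times> 'x) \<times> 'e option) set \<Rightarrow> (('b \<times> 'x) \<times> 'e option) set" where
  "orbit_smash_act a e g Z = smash_act (smash_act (\<lambda>_. id) a) (base_act e) g ` Z"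

end

theory Submission
  imports Defs "HOL-Algebra.Group_Action"
begin

text \<open>A point of the \<open>H\<close>-fixed points of the orbit space is the class of \<open>(b, y, w)\<close> such that for
  each \<open>h\<close> in \<open>H\<close> some \<open>l\<close> in \<open>GL\<close> satisfies \<open>h l w = w\<close>. Since \<open>E\<close> is free over \<open>GL\<close>, these \<open>l\<close> form
  a \<open>p\<close>-subgroup \<open>P\<close> of \<open>GL\<close>, and \<open>b\<close> is fixed by \<open>P\<close>. If \<open>P\<close> is trivial, \<open>(b, y, w)\<close> comes from fixed
  points of \<open>Y\<close> and \<open>E\<close>. If not, the vectors fixed by \<open>P\<close> form a proper nonzero subspace \<open>W\<close>, and every
  \<open>P\<close>-invariant subspace \<open>V\<close> has a nonzero intersection with \<open>W\<close>, so \<open>V \<supseteq> V \<inter> W \<subseteq> W\<close> contracts the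
  \<open>P\<close>-fixed points of the flag complex, compatibly with conjugation of \<open>P\<close>. Hence these components
  of the fixed points shrink to the base point. A \<open>(G \<times> GL)\<close>-CW model of \<open>E\<close> makes the pieces closed
  and finite in number, and obstruction theory on its \<open>GL\<close>-free cells compares \<open>H\<close>- and
  \<open>G\<close>-fixed points.\<close>

section \<open>Quotients and homotopies\<close>

text \<open>The spaces are arbitrary topological spaces, so a subspace of a quotient need not be a
  quotient of the corresponding subspace, and a product with a quotient map need not be a quotient
  map; only the product with the interval is harmless. The proof therefore works upstairs, on
  subsets of X x E, and much of it shows that the H-fixed points of the orbit space carry the
  quotient topology from there. For the same reason the smash product of B with the H-fixed points
  of Y may have a finer topology than the H-fixed points of the smash product. This is repaired by
  deforming the component with trivial P as well, by a homotopy that swallows a neighbourhood of the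
  base point of B. The universal space is known only up to equivalence, so its fixed-point sets need
  not be closed: the argument is made for the CW model, and two out of three carries the result
  back. It is stated for an abstract pointed GL-space B with contractible fixed points, because it
  has to be run at each level of the spectra, where B is the suspended flag complex smashed with a
  sphere, or a point.\<close>

abbreviation unit_interval :: "real topology" where
  "unit_interval \<equiv> top_of_set {0..1}"

lemma quotient_map_final_topology:
  "quotient_map X (final_topology (q ` topspace X) X q) q"
  by (auto simp: quotient_map_def topspace_final_topology openin_final_topology)

lemma topspace_quotient_topology [simp]: "topspace (quotient_topology X q) = q ` topspace X"
  by (simp add: quotient_topology_def topspace_final_topology)

lemma quotient_map_quotient_topology: "quotient_map X (quotient_topology X q) q"
  unfolding quotient_topology_def by (rule quotient_map_final_topology)

lemma continuous_map_final_topology: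
  assumes "q ` topspace X \<subseteq> S"
  shows "continuous_map X (final_topology S X q) q"
  using assms by (auto simp: continuous_map_def openin_final_topology topspace_final_topology)

text \<open>The interval is locally compact and Hausdorff, so the product with it preserves quotient
  maps. Almost all homotopies on quotient spaces below are produced from homotopies upstairs in this
  way.\<close>

lemma quotient_map_times_interval:
  assumes "quotient_map X Y f"
  shows "quotient_map (prod_topology unit_interval X) (prod_topology unit_interval Y) (\<lambda>(t, x). (t, f x))"
proof (rule quotient_map_prod_right[OF _ _ assms])
  show "locally_compact_space unit_interval"
    by (simp add: compact_imp_locally_compact_space compact_space_subtopology)
  show "Hausdorff_space unit_interval \<or> regular_space unit_interval"
    by (simp add: Hausdorff_space_subtopology)
qed

lemma continuous_map_times_interval_quotient:
  assumes "quotient_map X Y f"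
    and "continuous_map (prod_topology unit_interval X) Z (\<lambda>(t, x). h t (f x))"
  shows "continuous_map (prod_topology unit_interval Y) Z (\<lambda>(t, y). h t y)"
proof (rule continuous_compose_quotient_map[OF quotient_map_times_interval[OF assms(1)]])
  have "(\<lambda>(t, y). h t y) \<circ> (\<lambda>(t, x). (t, f x)) = (\<lambda>(t, x). h t (f x))" by auto
  with assms(2) show "continuous_map (prod_topology unit_interval X) Z
      ((\<lambda>(t, y). h t y) \<circ> (\<lambda>(t, x). (t, f x)))" by simp
qed

text \<open>The map X -> X/S, up to homeomorphism. It is a predicate on \<open>q\<close> because
  smash products record chosen representatives instead of cosets.\<close>

definition collapse_map :: "'a topology \<Rightarrow> 'b topology \<Rightarrow> ('a \<Rightarrow> 'b) \<Rightarrow> 'a set \<Rightarrow> bool" where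
  "collapse_map X Y q S \<longleftrightarrow> quotient_map X Y q \<and> S \<subseteq> topspace X \<and>
     (\<forall>x\<in>topspace X. \<forall>x'\<in>topspace X. q x = q x' \<longleftrightarrow> x = x' \<or> x \<in> S \<and> x' \<in> S)"

text \<open>Here \<open>A\<close> contains the collapsed set. If \<open>U\<close> is open in
  \<open>A\<close> and saturated there, then any open \<open>O'\<close> of \<open>X\<close> with
  trace \<open>U\<close> on \<open>A\<close> is already saturated, since outside of \<open>A\<close>
  nothing is identified.\<close>

lemma collapse_map_superset:
  assumes q: "collapse_map X Y q S" and A: "S \<subseteq> A" "A \<subseteq> topspace X"
  shows "collapse_map (subtopology X A) (subtopology Y (q ` A)) q S"
proof -
  have qm: "quotient_map X Y q" and S: "S \<subseteq> topspace X"
    and inj: "\<And>x x'. x \<in> topspace X \<Longrightarrow> x' \<in> topspace X \<Longrightarrow> q x = q x' \<longleftrightarrow> x = x' \<or> x \<in> S \<and> x' \<in> S"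
    using q by (auto simp: collapse_map_def)
  have cont: "continuous_map X Y q" and im: "q ` topspace X = topspace Y"
    using qm by (auto simp: quotient_imp_continuous_map quotient_imp_surjective_map)
  have eq: "{x \<in> topspace X. q x \<in> q ` A} = A"
    using A inj by (smt (verit, best) Collect_cong Collect_mem_eq image_iff subsetD)
  have "quotient_map (subtopology X A) (subtopology Y (q ` A)) q"
    unfolding quotient_map_saturated_open
  proof (intro conjI allI impI)
    show "continuous_map (subtopology X A) (subtopology Y (q ` A)) q"
      using cont by (auto simp: continuous_map_in_subtopology continuous_map_from_subtopology)
    show "q ` topspace (subtopology X A) = topspace (subtopology Y (q ` A))"
      using im A by auto
    fix U assume U: "openin (subtopology X A) U \<and>
      {x \<in> topspace (subtopology X A). q x \<in> q ` U} \<subseteq> U"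
    then obtain O' where O: "openin X O'" "U = O' \<inter> A" by (auto simp: openin_subtopology)
    have sat: "\<And>x y. x \<in> A \<Longrightarrow> y \<in> U \<Longrightarrow> q x = q y \<Longrightarrow> x \<in> U"
      using U A by auto
    have Osat: "{x \<in> topspace X. q x \<in> q ` O'} \<subseteq> O'"
    proof clarify
      fix x y assume x: "x \<in> topspace X" "y \<in> O'" "q x = q y"
      then have "y \<in> topspace X" using O openin_subset by blast
      then show "x \<in> O'" using inj x A O sat by blast
    qed
    then have "openin Y (q ` O')"
      using qm O(1) unfolding quotient_map_saturated_open by blast
    moreover have "q ` U = q ` O' \<inter> q ` A"
    proof
      show "q ` U \<subseteq> q ` O' \<inter> q ` A" using O by auto
      show "q ` O' \<inter> q ` A \<subseteq> q ` U"
      proof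
        fix z assume z: "z \<in> q ` O' \<inter> q ` A"
        then obtain x where x: "x \<in> A" "z = q x" by blast
        then have "x \<in> O'" using z Osat A by blast
        then show "z \<in> q ` U" using x O by blast
      qed
    qed
    ultimately show "openin (subtopology Y (q ` A)) (q ` U)"
      by (auto simp: openin_subtopology)
  qed
  then show ?thesis
    using A inj S by (auto simp: collapse_map_def)
qed

text \<open>Here \<open>A\<close> may contain only a part of the collapsed set, so an open set of
  \<open>A\<close> has to be enlarged to a saturated one. If it meets \<open>S\<close>, the open
  complement of \<open>A\<close> is added, which brings in the rest of \<open>S\<close>. If it
  misses \<open>S\<close>, assumption \<open>sep\<close> shrinks the neighbourhoods of its points
  until they miss all of \<open>S\<close>.\<close>

lemma collapse_map_closed:
  assumes q: "collapse_map X Y q S" and A: "closedin X A" "A \<inter> S \<noteq> {}"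
    and sep: "\<And>U x. openin X U \<Longrightarrow> x \<in> U \<inter> A \<Longrightarrow> U \<inter> A \<inter> S = {} \<Longrightarrow>
                \<exists>V. openin X V \<and> x \<in> V \<and> V \<subseteq> U \<and> V \<inter> S = {}"
  shows "collapse_map (subtopology X A) (subtopology Y (q ` A)) q (A \<inter> S)"
proof -
  have qm: "quotient_map X Y q" and S: "S \<subseteq> topspace X"
    and inj: "\<And>x x'. x \<in> topspace X \<Longrightarrow> x' \<in> topspace X \<Longrightarrow> q x = q x' \<longleftrightarrow> x = x' \<or> x \<in> S \<and> x' \<in> S"
    using q by (auto simp: collapse_map_def)
  have cont: "continuous_map X Y q" and im: "q ` topspace X = topspace Y"
    using qm by (auto simp: quotient_imp_continuous_map quotient_imp_surjective_map)
  have AX: "A \<subseteq> topspace X" using A(1) by (rule closedin_subset)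
  have "quotient_map (subtopology X A) (subtopology Y (q ` A)) q"
    unfolding quotient_map_saturated_open
  proof (intro conjI allI impI)
    show "continuous_map (subtopology X A) (subtopology Y (q ` A)) q"
      using cont by (auto simp: continuous_map_in_subtopology continuous_map_from_subtopology)
    show "q ` topspace (subtopology X A) = topspace (subtopology Y (q ` A))"
      using im AX by auto
    fix U assume U: "openin (subtopology X A) U \<and>
      {x \<in> topspace (subtopology X A). q x \<in> q ` U} \<subseteq> U"
    then obtain O' where O: "openin X O'" "U = O' \<inter> A" by (auto simp: openin_subtopology)
    have sat: "\<And>x y. x \<in> A \<Longrightarrow> y \<in> U \<Longrightarrow> q x = q y \<Longrightarrow> x \<in> U"
      using U AX by auto
    obtain V where V: "openin X V" "V \<inter> A = U" "V \<inter> S = {} \<or> S \<subseteq> V"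
    proof (cases "U \<inter> S = {}")
      case True
      let ?V = "\<Union>{W. openin X W \<and> W \<subseteq> O' \<and> W \<inter> S = {}}"
      have "openin X ?V" by blast
      moreover have "U \<subseteq> ?V"
      proof
        fix x assume "x \<in> U"
        then show "x \<in> ?V" using sep[OF O(1), of x] O(2) True by auto
      qed
      then have "?V \<inter> A = U" using O(2) by blast
      ultimately show ?thesis using that[of ?V] by blast
    next
      case False
      then obtain s where s: "s \<in> U" "s \<in> S" by blast
      have "S \<inter> A \<subseteq> U" using sat[OF _ s(1)] inj s(2) S by blast
      then have "S \<subseteq> O' \<union> (topspace X - A)" using S O by auto
      moreover have "openin X (O' \<union> (topspace X - A))"
        using O A by (auto intro!: openin_Un simp: openin_diff)
      moreover have "(O' \<union> (topspace X - A)) \<inter> A = U" using O by auto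
      ultimately show ?thesis using that by blast
    qed
    have Vsat: "{x \<in> topspace X. q x \<in> q ` V} \<subseteq> V"
    proof clarify
      fix x y assume x: "x \<in> topspace X" "y \<in> V" "q x = q y"
      then have "y \<in> topspace X" using V openin_subset by blast
      then show "x \<in> V" using inj x V by blast
    qed
    then have "openin Y (q ` V)"
      using qm V(1) unfolding quotient_map_saturated_open by blast
    moreover have "q ` U = q ` V \<inter> q ` A"
    proof
      show "q ` U \<subseteq> q ` V \<inter> q ` A" using V by auto
      show "q ` V \<inter> q ` A \<subseteq> q ` U"
      proof
        fix z assume z: "z \<in> q ` V \<inter> q ` A"
        then obtain x where x: "x \<in> A" "z = q x" by blast
        then have "x \<in> V" using z Vsat AX by blast
        then show "z \<in> q ` U" using x V by blast
      qed
    qed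
    ultimately show "openin (subtopology Y (q ` A)) (q ` U)"
      by (auto simp: openin_subtopology)
  qed
  then show ?thesis
    using AX inj S by (auto simp: collapse_map_def)
qed

section \<open>Smash products, disjoint base points and pointed homotopies\<close>

lemma topspace_smash:
  "topspace (ptop (smash X Y)) = smash_pt X Y ` (topspace (ptop X) \<times> topspace (ptop Y))"
  by (simp add: smash_def)

lemma pt_smash [simp]: "pt (smash X Y) = (pt X, pt Y)"
  by (simp add: smash_def)

lemma pt_in_smash [simp]:
  "pt X \<in> topspace (ptop X) \<Longrightarrow> pt Y \<in> topspace (ptop Y) \<Longrightarrow>
    (pt X, pt Y) \<in> topspace (ptop (smash X Y))"
  by (force simp: topspace_smash smash_pt_def)

lemma smash_collapse_map:
  assumes "pt X \<in> topspace (ptop X)" "pt Y \<in> topspace (ptop Y)"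
  shows "collapse_map (prod_topology (ptop X) (ptop Y)) (ptop (smash X Y)) (smash_pt X Y)
    ({pt X} \<times> topspace (ptop Y) \<union> topspace (ptop X) \<times> {pt Y})"
proof -
  have "quotient_map (prod_topology (ptop X) (ptop Y)) (ptop (smash X Y)) (smash_pt X Y)"
    by (simp add: smash_def quotient_map_quotient_topology)
  with assms show ?thesis
    by (auto simp: collapse_map_def smash_pt_def split: if_splits)
qed

lemma smash_quotient_map:
  "quotient_map (prod_topology (ptop X) (ptop Y)) (ptop (smash X Y)) (smash_pt X Y)"
  by (simp add: smash_def quotient_map_quotient_topology)

lemma topspace_adjoin_base [simp]:
  "topspace (ptop (adjoin_base E)) = insert None (Some ` topspace E)"
  by (subst collapse_def) (auto intro!: topspace_final_topology)

lemma pt_collapse [simp]: "pt (collapse X A) = None"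
  by (simp add: collapse_def)

lemma openin_adjoin_base:
  "openin (ptop (adjoin_base E)) U \<longleftrightarrow>
     U \<subseteq> insert None (Some ` topspace E) \<and> openin E {x \<in> topspace E. Some x \<in> U}"
  by (simp add: collapse_def openin_final_topology)

lemma continuous_map_Some: "continuous_map E (ptop (adjoin_base E)) Some"
  by (auto simp: continuous_map_def openin_adjoin_base)

lemma topspace_collapse:
  "topspace (ptop (collapse X A)) = insert None (Some ` (topspace X - A))"
  by (subst collapse_def) (auto intro!: topspace_final_topology split: if_splits)

lemma continuous_map_collapse:
  "continuous_map X (ptop (collapse X A)) (\<lambda>x. if x \<in> A then None else Some x)"
  unfolding collapse_def by (simp, rule continuous_map_final_topology) auto

lemma pointed_homotopicI:
  assumes "continuous_map (prod_topology unit_interval (ptop X)) (ptop Y) (\<lambda>(t, x). h t x)"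
    and "\<And>x. x \<in> topspace (ptop X) \<Longrightarrow> h 0 x = f x" "\<And>x. x \<in> topspace (ptop X) \<Longrightarrow> h 1 x = g x"
    and "\<And>t. t \<in> {0..1} \<Longrightarrow> h t (pt X) = pt Y" "pt X \<in> topspace (ptop X)"
  shows "pointed_homotopic X Y f g"
  unfolding pointed_homotopic_def
  by (subst homotopic_with, use assms in force)
     (rule exI[of _ "\<lambda>(t, x). h t x"], use assms in auto)

lemma pointed_homotopicE:
  assumes "pointed_homotopic X Y f g"
  obtains h where "continuous_map (prod_topology unit_interval (ptop X)) (ptop Y) (\<lambda>(t, x). h t x)"
    "\<And>x. h 0 x = f x" "\<And>x. h 1 x = g x" "\<And>t. t \<in> {0..1} \<Longrightarrow> h t (pt X) = pt Y"
proof -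
  obtain h where "continuous_map (prod_topology unit_interval (ptop X)) (ptop Y) h"
    "\<And>x. h (0, x) = f x" "\<And>x. h (1, x) = g x" "\<And>t. t \<in> {0..1} \<Longrightarrow> h (t, pt X) = pt Y"
    using assms unfolding pointed_homotopic_def homotopic_with_def by auto
  then show ?thesis using that[of "\<lambda>t x. h (t, x)"] by simp
qed

lemma pointed_homotopic_trans:
  "pointed_homotopic X Y f g \<Longrightarrow> pointed_homotopic X Y g h \<Longrightarrow> pointed_homotopic X Y f h"
  unfolding pointed_homotopic_def by (rule homotopic_with_trans)

lemma pointed_homotopic_sym: "pointed_homotopic X Y f g \<Longrightarrow> pointed_homotopic X Y g f"
  unfolding pointed_homotopic_def by (rule homotopic_with_symD)

lemma pointed_homotopic_equal:
  assumes "pointed_map X Y f" "\<And>x. x \<in> topspace (ptop X) \<Longrightarrow> f x = g x" "pt X \<in> topspace (ptop X)"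
  shows "pointed_homotopic X Y f g"
  using assms unfolding pointed_homotopic_def pointed_map_def by (intro homotopic_with_equal) auto

lemma pointed_homotopic_imp_maps:
  "pointed_homotopic X Y f g \<Longrightarrow> pointed_map X Y f \<and> pointed_map X Y g"
  unfolding pointed_homotopic_def pointed_map_def
  using homotopic_with_imp_continuous_maps homotopic_with_imp_property by blast

lemma pointed_homotopic_comp_left:
  "pointed_homotopic X Y f g \<Longrightarrow> pointed_map Y Z h \<Longrightarrow> pointed_homotopic X Z (h \<circ> f) (h \<circ> g)"
  unfolding pointed_homotopic_def pointed_map_def
  by (erule homotopic_with_compose_continuous_map_left) auto

lemma pointed_homotopic_comp_right:
  "pointed_homotopic Y Z f g \<Longrightarrow> pointed_map X Y h \<Longrightarrow> pointed_homotopic X Z (f \<circ> h) (g \<circ> h)"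
  unfolding pointed_homotopic_def pointed_map_def
  by (erule homotopic_with_compose_continuous_map_right) auto

lemma pointed_map_compose: "pointed_map X Y f \<Longrightarrow> pointed_map Y Z g \<Longrightarrow> pointed_map X Z (g \<circ> f)"
  by (auto simp: pointed_map_def intro: continuous_map_compose)

text \<open>One case of two out of three, with k' o g as the inverse of \<open>f\<close>: on the
  left k' g f = k' k, and on the right f k' g is homotopic to g' g f k' g = g' k k' g, hence to g'
  g.\<close>

lemma pointed_homotopy_equivalence_left_cancel:
  assumes g: "pointed_homotopy_equivalence Y Z g" and k: "pointed_homotopy_equivalence X Z k"
    and f: "pointed_map X Y f" and eq: "\<And>x. x \<in> topspace (ptop X) \<Longrightarrow> g (f x) = k x"
    and ptX: "pt X \<in> topspace (ptop X)"
  shows "pointed_homotopy_equivalence X Y f"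
proof -
  obtain g' where g': "pointed_map Z Y g'" "pointed_homotopic Y Y (g' \<circ> g) id"
      "pointed_homotopic Z Z (g \<circ> g') id" and gm: "pointed_map Y Z g"
    using g by (auto simp: pointed_homotopy_equivalence_def)
  obtain k' where k': "pointed_map Z X k'" "pointed_homotopic X X (k' \<circ> k) id"
      "pointed_homotopic Z Z (k \<circ> k') id" and km: "pointed_map X Z k"
    using k by (auto simp: pointed_homotopy_equivalence_def)
  have gfk: "pointed_homotopic X Z (g \<circ> f) k"
    by (rule pointed_homotopic_equal[OF pointed_map_compose[OF f gm]]) (auto simp: eq ptX)
  have m: "pointed_map Y X (k' \<circ> g)" using gm k'(1) by (rule pointed_map_compose)
  have "pointed_homotopic X X (k' \<circ> (g \<circ> f)) (k' \<circ> k)"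
    by (rule pointed_homotopic_comp_left[OF gfk k'(1)])
  then have 1: "pointed_homotopic X X ((k' \<circ> g) \<circ> f) id"
    using pointed_homotopic_trans[OF _ k'(2)] by (simp add: comp_assoc)
  have a: "pointed_homotopic Y Y (f \<circ> (k' \<circ> g)) (g' \<circ> g \<circ> (f \<circ> (k' \<circ> g)))"
    using pointed_homotopic_sym[OF pointed_homotopic_comp_right[OF g'(2) pointed_map_compose[OF m f]]]
    by simp
  have b: "pointed_homotopic Y Y (g' \<circ> ((g \<circ> f) \<circ> (k' \<circ> g))) (g' \<circ> (k \<circ> (k' \<circ> g)))"
    by (rule pointed_homotopic_comp_left[OF pointed_homotopic_comp_right[OF gfk m] g'(1)])
  have c: "pointed_homotopic Y Y (g' \<circ> ((k \<circ> k') \<circ> g)) (g' \<circ> (id \<circ> g))"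
    by (rule pointed_homotopic_comp_left[OF pointed_homotopic_comp_right[OF k'(3) gm] g'(1)])
  have "pointed_homotopic Y Y (f \<circ> (k' \<circ> g)) id"
    using pointed_homotopic_trans[OF a pointed_homotopic_trans[OF _ pointed_homotopic_trans[OF _ g'(2)]]]
      b c by (simp add: comp_assoc)
  with 1 m f show ?thesis by (auto simp: pointed_homotopy_equivalence_def)
qed

lemma pointed_homotopy_equivalence_compose:
  assumes f: "pointed_homotopy_equivalence X Y f" and g: "pointed_homotopy_equivalence Y Z g"
  shows "pointed_homotopy_equivalence X Z (g \<circ> f)"
proof -
  obtain g' where g': "pointed_map Z Y g'" "pointed_homotopic Y Y (g' \<circ> g) id"
      "pointed_homotopic Z Z (g \<circ> g') id" and gm: "pointed_map Y Z g"
    using g by (auto simp: pointed_homotopy_equivalence_def)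
  obtain f' where f': "pointed_map Y X f'" "pointed_homotopic X X (f' \<circ> f) id"
      "pointed_homotopic Y Y (f \<circ> f') id" and fm: "pointed_map X Y f"
    using f by (auto simp: pointed_homotopy_equivalence_def)
  have "pointed_homotopic X X (f' \<circ> ((g' \<circ> g) \<circ> f)) (f' \<circ> (id \<circ> f))"
    by (rule pointed_homotopic_comp_left[OF pointed_homotopic_comp_right[OF g'(2) fm] f'(1)])
  then have "pointed_homotopic X X ((f' \<circ> g') \<circ> (g \<circ> f)) id"
    using pointed_homotopic_trans[OF _ f'(2)] by (simp add: comp_assoc)
  moreover have "pointed_homotopic Z Z (g \<circ> ((f \<circ> f') \<circ> g')) (g \<circ> (id \<circ> g'))"
    by (rule pointed_homotopic_comp_left[OF pointed_homotopic_comp_right[OF f'(3) g'(1)] gm])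
  then have "pointed_homotopic Z Z ((g \<circ> f) \<circ> (f' \<circ> g')) id"
    using pointed_homotopic_trans[OF _ g'(3)] by (simp add: comp_assoc)
  ultimately show ?thesis
    using pointed_map_compose[OF fm gm] pointed_map_compose[OF g'(1) f'(1)]
    by (auto simp: pointed_homotopy_equivalence_def)
qed

section \<open>Orbits of half smash products\<close>

text \<open>\<open>smash_pt\<close> is applied once more at the end, because \<open>h t\<close> and
  \<open>k t\<close> may send further points to a base point, and such a pair must be replaced by
  the chosen representative.\<close>

lemma continuous_map_smash_homotopy:
  assumes "continuous_map (prod_topology unit_interval (ptop X)) (ptop X') (\<lambda>(t, x). h t x)"
    and "continuous_map (prod_topology unit_interval (ptop Y)) (ptop Y') (\<lambda>(t, y). k t y)"
    and "\<And>t. t \<in> {0..1} \<Longrightarrow> h t (pt X) = pt X'" "\<And>t. t \<in> {0..1} \<Longrightarrow> k t (pt Y) = pt Y'"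
  shows "continuous_map (prod_topology unit_interval (ptop (smash X Y))) (ptop (smash X' Y'))
           (\<lambda>(t, z). smash_pt X' Y' (h t (fst z), k t (snd z)))"
proof (rule continuous_map_times_interval_quotient[OF smash_quotient_map])
  let ?D = "prod_topology unit_interval (prod_topology (ptop X) (ptop Y))"
  have 1: "continuous_map ?D (ptop X') (\<lambda>u. h (fst u) (fst (snd u)))"
    using continuous_map_compose[OF _ assms(1), of ?D "\<lambda>u. (fst u, fst (snd u))"]
    by (simp add: o_def case_prod_beta' continuous_map_pairedI continuous_map_fst
        continuous_map_fst_of continuous_map_snd continuous_map_of_fst continuous_map_compose[OF continuous_map_snd continuous_map_fst, unfolded o_def])
  have 2: "continuous_map ?D (ptop Y') (\<lambda>u. k (fst u) (snd (snd u)))"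
    using continuous_map_compose[OF _ assms(2), of ?D "\<lambda>u. (fst u, snd (snd u))"]
    by (simp add: o_def case_prod_beta' continuous_map_pairedI continuous_map_fst
        continuous_map_compose[OF continuous_map_snd continuous_map_snd, unfolded o_def])
  have "continuous_map ?D (ptop (smash X' Y'))
      (\<lambda>u. smash_pt X' Y' (h (fst u) (fst (snd u)), k (fst u) (snd (snd u))))"
    using continuous_map_compose[OF continuous_map_pairedI[OF 1 2]
        quotient_imp_continuous_map[OF smash_quotient_map]] by (simp add: o_def)
  then show "continuous_map ?D (ptop (smash X' Y'))
      (\<lambda>(t, z). smash_pt X' Y' (h t (fst (smash_pt X Y z)), k t (snd (smash_pt X Y z))))"
    by (rule continuous_map_eq) (auto simp: smash_pt_def assms(3,4))
qed

lemma continuous_map_smash: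
  assumes "pointed_map X X' f" "pointed_map Y Y' g"
  shows "continuous_map (ptop (smash X Y)) (ptop (smash X' Y'))
           (\<lambda>z. smash_pt X' Y' (f (fst z), g (snd z)))"
proof -
  have "continuous_map (prod_topology unit_interval (ptop (smash X Y))) (ptop (smash X' Y'))
           (\<lambda>(t, z). smash_pt X' Y' (f (fst z), g (snd z)))"
    using assms unfolding pointed_map_def
    by (intro continuous_map_smash_homotopy[where h = "\<lambda>t. f" and k = "\<lambda>t. g"])
       (auto simp: case_prod_beta' intro: continuous_map_compose[OF continuous_map_snd, unfolded o_def])
  from continuous_map_o_Pair[OF this, of 0] show ?thesis by (simp add: o_def)
qed

section \<open>Actions and their orbit maps\<close>

lemma action_inv:
  assumes "group L" "continuous_action L X a" "l \<in> carrier L" "x \<in> topspace X"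
  shows "a (inv\<^bsub>L\<^esub> l) (a l x) = x" "a l (a (inv\<^bsub>L\<^esub> l) x) = x"
proof -
  interpret group L by fact
  have mult: "a (k \<otimes>\<^bsub>L\<^esub> l) x = a k (a l x)" if "k \<in> carrier L" "l \<in> carrier L" for k l
    using assms(2,4) that by (auto simp: continuous_action_def)
  have one: "a \<one>\<^bsub>L\<^esub> x = x" using assms(2,4) by (auto simp: continuous_action_def)
  show "a (inv\<^bsub>L\<^esub> l) (a l x) = x" "a l (a (inv\<^bsub>L\<^esub> l) x) = x"
    using mult[of "inv\<^bsub>L\<^esub> l" l] mult[of l "inv\<^bsub>L\<^esub> l"] one assms(3) by simp_all
qed

lemma action_inj:
  assumes "group L" "continuous_action L X a" "l \<in> carrier L" "x \<in> topspace X" "y \<in> topspace X"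
    "a l x = a l y"
  shows "x = y"
  using action_inv(1)[OF assms(1-3)] assms(4-6) by metis

lemma action_closed:
  "continuous_action L X a \<Longrightarrow> l \<in> carrier L \<Longrightarrow> x \<in> topspace X \<Longrightarrow> a l x \<in> topspace X"
  unfolding continuous_action_def using continuous_map_funspace by blast

lemma orbit_of_eq_iff:
  assumes "group L" "continuous_action L X a" "x \<in> topspace X" "y \<in> topspace X"
  shows "orbit_of L a x = orbit_of L a y \<longleftrightarrow> (\<exists>l\<in>carrier L. y = a l x)"
proof
  interpret group L by fact
  have mult: "a (k \<otimes>\<^bsub>L\<^esub> l) z = a k (a l z)" if "k \<in> carrier L" "l \<in> carrier L" "z \<in> topspace X" for k l z
    using assms(2) that by (auto simp: continuous_action_def)
  have one: "a \<one>\<^bsub>L\<^esub> z = z" if "z \<in> topspace X" for z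
    using assms(2) that by (auto simp: continuous_action_def)
  { assume eq: "orbit_of L a x = orbit_of L a y"
    have "y \<in> orbit_of L a y" unfolding orbit_of_def using one[OF assms(4)] by (metis image_eqI one_closed)
    then show "\<exists>l\<in>carrier L. y = a l x" using eq by (auto simp: orbit_of_def) }
  { assume "\<exists>l\<in>carrier L. y = a l x"
    then obtain l where l: "l \<in> carrier L" "y = a l x" by blast
    have x: "x = a (inv\<^bsub>L\<^esub> l) y" using l action_inv(1)[OF assms(1,2)] assms(3) by simp
    have "a k y \<in> orbit_of L a x" if "k \<in> carrier L" for k
      using that l mult[OF that l(1) assms(3)] unfolding orbit_of_def
      by (metis image_eqI m_closed)
    moreover have "a k x \<in> orbit_of L a y" if "k \<in> carrier L" for k
      unfolding orbit_of_def using that l x mult[OF that inv_closed[OF l(1)] assms(4)]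
      by (metis image_eqI m_closed inv_closed)
    ultimately show "orbit_of L a x = orbit_of L a y" unfolding orbit_of_def by blast }
qed

lemma image_orbit_of:
  assumes "\<And>l. l \<in> carrier L \<Longrightarrow> f (a l x) = b l (f x)"
  shows "f ` orbit_of L a x = orbit_of L b (f x)"
  using assms by (auto simp: orbit_of_def image_image)

text \<open>The saturation of an open set is the union of its translates. An open quotient map
  restricts to any saturated subset as a quotient map, which is how \<open>Q_quotient_map\<close>
  uses this.\<close>

lemma orbit_open_map:
  assumes "group L" "continuous_action L X a"
  shows "open_map X (quotient_topology X (orbit_of L a)) (orbit_of L a)"
  unfolding open_map_def
proof (intro allI impI)
  interpret group L by fact
  fix U assume U: "openin X U"
  have UX: "U \<subseteq> topspace X" using U by (rule openin_subset)
  have "{x \<in> topspace X. orbit_of L a x \<in> orbit_of L a ` U} =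
      (\<Union>l\<in>carrier L. {x \<in> topspace X. a l x \<in> U})"
    using orbit_of_eq_iff[OF assms] UX by (auto simp: image_iff) (metis subsetD)+
  moreover have "openin X {x \<in> topspace X. a l x \<in> U}" if "l \<in> carrier L" for l
    using assms(2) that U by (auto simp: continuous_action_def intro: openin_continuous_map_preimage)
  ultimately have "openin X {x \<in> topspace X. orbit_of L a x \<in> orbit_of L a ` U}" by auto
  then show "openin (quotient_topology X (orbit_of L a)) (orbit_of L a ` U)"
    unfolding quotient_topology_def openin_final_topology using UX by auto
qed

text \<open>Presents the smash product of \<open>X\<close> with E+ as a quotient of X x E, where
  {x0} x E is collapsed; the disjoint base point of E+ then needs no separate treatment.\<close>

definition half_smash_pt :: "'x \<Rightarrow> 'x \<times> 'e \<Rightarrow> 'x \<times> 'e option" where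
  "half_smash_pt x0 u = (if fst u = x0 then (x0, None) else (fst u, Some (snd u)))"

definition orbit_smash_pt ::
    "('l, 'm) monoid_scheme \<Rightarrow> ('l \<Rightarrow> 'x \<Rightarrow> 'x) \<Rightarrow> 'x \<Rightarrow> ('l \<Rightarrow> 'e \<Rightarrow> 'e) \<Rightarrow> 'x \<times> 'e \<Rightarrow> ('x \<times> 'e option) set" where
  "orbit_smash_pt L a x0 e u = orbit_of L (smash_act a (base_act e)) (half_smash_pt x0 u)"

text \<open>A point of \<open>E\<close> is required, for otherwise X x E is empty and misses the
  base point of the smash product.\<close>

lemma half_smash_collapse_map:
  assumes "pt X \<in> topspace (ptop X)" "topspace E \<noteq> {}"
  shows "collapse_map (prod_topology (ptop X) E) (ptop (smash X (adjoin_base E)))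
           (half_smash_pt (pt X)) ({pt X} \<times> topspace E)"
proof -
  let ?c = "half_smash_pt (pt X) :: 'a \<times> 'b \<Rightarrow> _" and ?s = "smash_pt X (adjoin_base E)"
  have cs: "?c u = ?s (fst u, Some (snd u))" for u
    by (simp add: half_smash_pt_def smash_pt_def)
  have s: "continuous_map (prod_topology (ptop X) (ptop (adjoin_base E))) (ptop (smash X (adjoin_base E))) ?s"
    by (rule quotient_imp_continuous_map[OF smash_quotient_map])
  have "continuous_map (prod_topology (ptop X) E) (prod_topology (ptop X) (ptop (adjoin_base E)))
      (\<lambda>u. (fst u, Some (snd u)))"
    using continuous_map_compose[OF continuous_map_snd continuous_map_Some, of "ptop X" E]
    by (intro continuous_map_pairedI) (auto simp: o_def continuous_map_fst)
  from continuous_map_compose[OF this s]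
  have cont: "continuous_map (prod_topology (ptop X) E) (ptop (smash X (adjoin_base E))) ?c"
    by (rule continuous_map_eq) (simp add: cs)
  have im: "?c ` (topspace (ptop X) \<times> topspace E) = topspace (ptop (smash X (adjoin_base E)))"
  proof
    show "?c ` (topspace (ptop X) \<times> topspace E) \<subseteq> topspace (ptop (smash X (adjoin_base E)))"
      unfolding topspace_smash cs by auto
    show "topspace (ptop (smash X (adjoin_base E))) \<subseteq> ?c ` (topspace (ptop X) \<times> topspace E)"
    proof
      fix u assume "u \<in> topspace (ptop (smash X (adjoin_base E)))"
      then obtain x eo where u: "u = ?s (x, eo)" "x \<in> topspace (ptop X)" "eo \<in> insert None (Some ` topspace E)"
        unfolding topspace_smash by auto
      obtain w0 where "w0 \<in> topspace E" using assms(2) by blast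
      show "u \<in> ?c ` (topspace (ptop X) \<times> topspace E)"
      proof (cases eo)
        case None
        then have "u = ?c (pt X, w0)" using u by (simp add: smash_pt_def half_smash_pt_def)
        with \<open>w0 \<in> topspace E\<close> assms show ?thesis by blast
      next
        case (Some w)
        then have "u = ?c (x, w)" using u by (simp add: cs)
        with u Some show ?thesis by blast
      qed
    qed
  qed
  have "quotient_map (prod_topology (ptop X) E) (ptop (smash X (adjoin_base E))) ?c"
    unfolding quotient_map_def
  proof (intro conjI allI impI)
    show "?c ` topspace (prod_topology (ptop X) E) = topspace (ptop (smash X (adjoin_base E)))"
      using im by simp
    fix U assume U: "U \<subseteq> topspace (ptop (smash X (adjoin_base E)))"
    show "openin (prod_topology (ptop X) E) {x \<in> topspace (prod_topology (ptop X) E). ?c x \<in> U} =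
        openin (ptop (smash X (adjoin_base E))) U"
    proof
      assume "openin (ptop (smash X (adjoin_base E))) U"
      then show "openin (prod_topology (ptop X) E) {x \<in> topspace (prod_topology (ptop X) E). ?c x \<in> U}"
        using cont by (rule openin_continuous_map_preimage[rotated])
    next
      assume O: "openin (prod_topology (ptop X) E) {x \<in> topspace (prod_topology (ptop X) E). ?c x \<in> U}"
      let ?V = "{x \<in> topspace (prod_topology (ptop X) (ptop (adjoin_base E))). ?s x \<in> U}"
      have "openin (prod_topology (ptop X) (ptop (adjoin_base E))) ?V"
        unfolding openin_prod_topology_alt
      proof (intro allI impI)
        fix x eo assume x: "(x, eo) \<in> ?V"
        show "\<exists>A B. openin (ptop X) A \<and> openin (ptop (adjoin_base E)) B \<and> x \<in> A \<and> eo \<in> B \<and> A \<times> B \<subseteq> ?V"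
        proof (cases eo)
          case None
          \<comment> \<open>The added point is isolated in E+, and every pair with second coordinate
            \<open>None\<close> goes to the base point, so the whole slice over \<open>None\<close>
            is an open set inside the preimage.\<close>
          then have "openin (ptop (adjoin_base E)) {None}" "(pt X, None) \<in> U"
            using x by (auto simp: openin_adjoin_base smash_pt_def)
          with None x show ?thesis
            by (intro exI[of _ "topspace (ptop X)"] exI[of _ "{None}"]) (auto simp: smash_pt_def)
        next
          case (Some w)
          then have "(x, w) \<in> {x \<in> topspace (prod_topology (ptop X) E). ?c x \<in> U}"
            using x by (auto simp: cs)
          then obtain A B where AB: "openin (ptop X) A" "openin E B" "x \<in> A" "w \<in> B"
              "A \<times> B \<subseteq> {x \<in> topspace (prod_topology (ptop X) E). ?c x \<in> U}"
            using O unfolding openin_prod_topology_alt by meson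
          have "{x \<in> topspace E. Some x \<in> Some ` B} = B" using openin_subset[OF AB(2)] by auto
          then have "openin (ptop (adjoin_base E)) (Some ` B)"
            using AB(2) openin_subset[OF AB(2)] by (auto simp: openin_adjoin_base)
          moreover have "A \<times> Some ` B \<subseteq> ?V" using AB(5) by (auto simp: cs)
          ultimately show ?thesis using AB Some by blast
        qed
      qed
      then show "openin (ptop (smash X (adjoin_base E))) U"
        using smash_quotient_map[of X "adjoin_base E"] U unfolding quotient_map_def by blast
    qed
  qed
  with assms show ?thesis by (auto simp: collapse_map_def half_smash_pt_def split: if_splits)
qed

text \<open>Group elements act injectively, hence move no other point to the base point. It follows
  that acting on a chosen representative of a smash product yields a chosen representative.\<close>

lemma pointed_action_eq_pt:
  "group L \<Longrightarrow> pointed_action L X a \<Longrightarrow> l \<in> carrier L \<Longrightarrow> z \<in> topspace (ptop X) \<Longrightarrow>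
    a l z = pt X \<longleftrightarrow> z = pt X"
  using action_inj[of L "ptop X" a l z "pt X"] by (auto simp: pointed_action_def)

lemma pointed_action_smash:
  assumes "group L" "pointed_action L X a" "pointed_action L Y b"
  shows "pointed_action L (smash X Y) (smash_act a b)"
proof -
  have cX: "continuous_action L (ptop X) a" and cY: "continuous_action L (ptop Y) b"
    using assms by (auto simp: pointed_action_def)
  have top: "topspace (ptop (smash X Y)) \<subseteq> topspace (ptop X) \<times> topspace (ptop Y)"
    using assms by (auto simp: topspace_smash smash_pt_def pointed_action_def)
  have eq: "smash_act a b l z = smash_pt X Y (a l (fst z), b l (snd z))"
    if "l \<in> carrier L" "z \<in> topspace (ptop (smash X Y))" for l z
    using that assms top pointed_action_eq_pt[OF assms(1,2) that(1)] pointed_action_eq_pt[OF assms(1,3) that(1)]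
    by (auto simp: topspace_smash smash_pt_def smash_act_def pointed_action_def split: if_splits)
  have "continuous_map (ptop (smash X Y)) (ptop (smash X Y)) (smash_act a b l)" if l: "l \<in> carrier L" for l
  proof (rule continuous_map_eq[OF continuous_map_smash])
    show "pointed_map X X (a l)" "pointed_map Y Y (b l)"
      using assms l by (auto simp: pointed_map_def pointed_action_def continuous_action_def)
  qed (simp add: eq[OF l])
  then show ?thesis
    using assms top unfolding pointed_action_def continuous_action_def
    by (auto simp: smash_act_def intro!: pt_in_smash)
qed

lemma pointed_action_adjoin_base:
  assumes "continuous_action L E e"
  shows "pointed_action L (adjoin_base E) (base_act e)"
proof -
  have "continuous_map (ptop (adjoin_base E)) (ptop (adjoin_base E)) (base_act e l)" if "l \<in> carrier L" for l
    unfolding continuous_map_def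
  proof (intro conjI allI impI)
    have e: "continuous_map E E (e l)" using assms that by (auto simp: continuous_action_def)
    show "base_act e l \<in> topspace (ptop (adjoin_base E)) \<rightarrow> topspace (ptop (adjoin_base E))"
      using e by (auto simp: base_act_def dest!: continuous_map_funspace)
    fix U assume U: "openin (ptop (adjoin_base E)) U"
    then have "openin E {w \<in> topspace E. e l w \<in> {w \<in> topspace E. Some w \<in> U}}"
      by (intro openin_continuous_map_preimage[OF e]) (use U in \<open>auto simp: openin_adjoin_base\<close>)
    moreover have "{x \<in> topspace E. Some x \<in> {x \<in> topspace (ptop (adjoin_base E)). base_act e l x \<in> U}} =
        {w \<in> topspace E. e l w \<in> {w \<in> topspace E. Some w \<in> U}}"
      using e by (auto simp: base_act_def dest!: continuous_map_funspace)
    ultimately show "openin (ptop (adjoin_base E)) {x \<in> topspace (ptop (adjoin_base E)). base_act e l x \<in> U}"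
      unfolding openin_adjoin_base[of E "{x \<in> _. _ x}"] by auto
  qed
  with assms show ?thesis
    by (auto simp: pointed_action_def continuous_action_def base_act_def)
qed

lemma smash_act_half_smash_pt:
  assumes "group L" "pointed_action L X a" "l \<in> carrier L" "z \<in> topspace (ptop X)"
  shows "smash_act a (base_act e) l (half_smash_pt (pt X) (z, w)) = half_smash_pt (pt X) (a l z, e l w)"
  using assms pointed_action_eq_pt[OF assms] by (auto simp: half_smash_pt_def smash_act_def base_act_def)

lemma orbit_smash_quotient_map:
  assumes "group L" "pointed_action L X a" "continuous_action L E e" "topspace E \<noteq> {}"
  shows "quotient_map (prod_topology (ptop X) E) (ptop (orbit_smash L X a E e)) (orbit_smash_pt L a (pt X) e)"
proof -
  have "quotient_map (prod_topology (ptop X) E) (ptop (smash X (adjoin_base E))) (half_smash_pt (pt X))"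
    using half_smash_collapse_map[of X E] assms by (simp add: collapse_map_def pointed_action_def)
  from quotient_map_compose[OF this quotient_map_quotient_topology]
  show ?thesis by (simp add: orbit_smash_def orbit_pspace_def orbit_smash_pt_def[abs_def] o_def)
qed

lemma topspace_orbit_smash:
  assumes "group L" "pointed_action L X a" "continuous_action L E e" "topspace E \<noteq> {}"
  shows "topspace (ptop (orbit_smash L X a E e)) =
    orbit_smash_pt L a (pt X) e ` (topspace (ptop X) \<times> topspace E)"
  using quotient_imp_surjective_map[OF orbit_smash_quotient_map[OF assms]] by simp

lemma pt_orbit_smash:
  assumes "pointed_action L X a"
  shows "pt (orbit_smash L X a E e) = orbit_smash_pt L a (pt X) e (pt X, w)"
  by (simp add: orbit_smash_def orbit_pspace_def orbit_smash_pt_def half_smash_pt_def)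

lemma orbit_smash_pt_eq_iff:
  assumes "group L" "pointed_action L X a" "continuous_action L E e"
    "z \<in> topspace (ptop X)" "z' \<in> topspace (ptop X)" "w \<in> topspace E" "w' \<in> topspace E"
  shows "orbit_smash_pt L a (pt X) e (z, w) = orbit_smash_pt L a (pt X) e (z', w') \<longleftrightarrow>
    z = pt X \<and> z' = pt X \<or> z \<noteq> pt X \<and> (\<exists>l\<in>carrier L. z' = a l z \<and> w' = e l w)"
proof -
  have act: "continuous_action L (ptop (smash X (adjoin_base E))) (smash_act a (base_act e))"
    using pointed_action_smash[OF assms(1,2) pointed_action_adjoin_base[OF assms(3)]]
    by (simp add: pointed_action_def)
  have ptX: "pt X \<in> topspace (ptop X)" using assms by (simp add: pointed_action_def)
  have in_top: "half_smash_pt (pt X) (z, w) \<in> topspace (ptop (smash X (adjoin_base E)))"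
    if "z \<in> topspace (ptop X)" "w \<in> topspace E" for z w
  proof -
    have "half_smash_pt (pt X) (z, w) = smash_pt X (adjoin_base E) (z, Some w)"
      by (simp add: half_smash_pt_def smash_pt_def)
    then show ?thesis using that unfolding topspace_smash by auto
  qed
  have "orbit_smash_pt L a (pt X) e (z, w) = orbit_smash_pt L a (pt X) e (z', w') \<longleftrightarrow>
      (\<exists>l\<in>carrier L. half_smash_pt (pt X) (z', w') = half_smash_pt (pt X) (a l z, e l w))"
    unfolding orbit_smash_pt_def
    by (subst orbit_of_eq_iff[OF assms(1) act]) (use in_top assms in
        \<open>auto simp: smash_act_half_smash_pt[OF assms(1,2)]\<close>)
  also have "\<dots> \<longleftrightarrow> z = pt X \<and> z' = pt X \<or> z \<noteq> pt X \<and> (\<exists>l\<in>carrier L. z' = a l z \<and> w' = e l w)"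
  proof (cases "z = pt X")
    case True
    then have "a l z = pt X" if "l \<in> carrier L" for l
      using that assms(2) by (simp add: pointed_action_def)
    moreover have "\<exists>l. l \<in> carrier L" using assms(1) group.is_monoid monoid.one_closed by blast
    ultimately show ?thesis using True by (auto simp: half_smash_pt_def)
  next
    case False
    then have "a l z \<noteq> pt X" if "l \<in> carrier L" for l
      using pointed_action_eq_pt[OF assms(1,2) that assms(4)] by simp
    then show ?thesis using False by (auto simp: half_smash_pt_def; blast)
  qed
  finally show ?thesis .
qed

lemma orbit_smash_map_pt:
  assumes "group L" "pointed_action L X a" "z \<in> topspace (ptop X)"
    "\<And>l. l \<in> carrier L \<Longrightarrow> f (e l w) = e' l (f w)"
  shows "orbit_smash_map f (orbit_smash_pt L a (pt X) e (z, w)) = orbit_smash_pt L a (pt X) e' (z, f w)"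
proof -
  have "map_prod id (map_option f) (half_smash_pt (pt X) (z, w)) = half_smash_pt (pt X) (z, f w)"
    by (simp add: half_smash_pt_def)
  moreover have "map_prod id (map_option f) (smash_act a (base_act e) l (half_smash_pt (pt X) (z, w))) =
      smash_act a (base_act e') l (map_prod id (map_option f) (half_smash_pt (pt X) (z, w)))"
    if "l \<in> carrier L" for l
    using that assms(4) by (auto simp: half_smash_pt_def smash_act_def base_act_def)
  ultimately show ?thesis
    unfolding orbit_smash_map_def orbit_smash_pt_def
    by (subst image_orbit_of[where b = "smash_act a (base_act e')"]) auto
qed

lemma continuous_map_orbit_smash_homotopy:
  assumes L: "group L" "pointed_action L X a" and E: "continuous_action L E e" "topspace E \<noteq> {}"
    and E': "continuous_action L E' e'"
    and h: "continuous_map (prod_topology unit_interval E) E' (\<lambda>(t, w). h t w)"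
    and eqv: "\<And>t l w. t \<in> {0..1} \<Longrightarrow> l \<in> carrier L \<Longrightarrow> w \<in> topspace E \<Longrightarrow> h t (e l w) = e' l (h t w)"
  shows "continuous_map (prod_topology unit_interval (ptop (orbit_smash L X a E e)))
    (ptop (orbit_smash L X a E' e')) (\<lambda>(t, Z). orbit_smash_map (h t) Z)"
proof (rule continuous_map_times_interval_quotient[OF orbit_smash_quotient_map[OF L E]])
  let ?D = "prod_topology unit_interval (prod_topology (ptop X) E)"
  have "h 0 ` topspace E \<subseteq> topspace E'"
    using continuous_map_image_subset_topspace[OF h] by (auto simp: image_subset_iff)
  then have ne: "topspace E' \<noteq> {}" using E(2) by auto
  have 1: "continuous_map ?D E' (\<lambda>u. h (fst u) (snd (snd u)))"
    using continuous_map_compose[OF _ h, of ?D "\<lambda>u. (fst u, snd (snd u))"]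
    by (simp add: o_def case_prod_beta' continuous_map_pairedI continuous_map_fst
        continuous_map_compose[OF continuous_map_snd continuous_map_snd, unfolded o_def])
  have "continuous_map ?D (prod_topology (ptop X) E') (\<lambda>u. (fst (snd u), h (fst u) (snd (snd u))))"
    by (intro continuous_map_pairedI 1 continuous_map_compose[OF continuous_map_snd continuous_map_fst, unfolded o_def])
  from continuous_map_compose[OF this quotient_imp_continuous_map[OF orbit_smash_quotient_map[OF L E' ne]]]
  show "continuous_map ?D (ptop (orbit_smash L X a E' e'))
      (\<lambda>(t, u). orbit_smash_map (h t) (orbit_smash_pt L a (pt X) e u))"
    by (rule continuous_map_eq) (auto simp: orbit_smash_map_pt[OF L] eqv)
qed

lemma orbit_smash_carrier:
  assumes "group L" "pointed_action L X a" "continuous_action L E e"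
    "Z \<in> topspace (ptop (orbit_smash L X a E e))"
  shows "Z \<subseteq> topspace (ptop X) \<times> insert None (Some ` topspace E)"
proof -
  have act: "continuous_action L (ptop (smash X (adjoin_base E))) (smash_act a (base_act e))"
    using pointed_action_smash[OF assms(1,2) pointed_action_adjoin_base[OF assms(3)]]
    by (simp add: pointed_action_def)
  have "topspace (ptop (smash X (adjoin_base E))) \<subseteq> topspace (ptop X) \<times> insert None (Some ` topspace E)"
    using assms(2) by (auto simp: topspace_smash smash_pt_def pointed_action_def)
  moreover obtain u where "u \<in> topspace (ptop (smash X (adjoin_base E)))"
      "Z = (\<lambda>l. smash_act a (base_act e) l u) ` carrier L"
    using assms(4) by (auto simp: orbit_smash_def orbit_pspace_def orbit_of_def)
  ultimately show ?thesis using action_closed[OF act] by blast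
qed

text \<open>Relative to a mere set of elements, so that the same notion covers the group
  \<open>L\<close>, the subgroup \<open>H\<close> and, for plain orbit spaces, the empty
  set.\<close>

definition commutes_on :: "'g set \<Rightarrow> 'a topology \<Rightarrow> ('g \<Rightarrow> 'a \<Rightarrow> 'a) \<Rightarrow> ('g \<Rightarrow> 'b \<Rightarrow> 'b) \<Rightarrow> ('a \<Rightarrow> 'b) \<Rightarrow> bool" where
  "commutes_on H X a b f \<longleftrightarrow> (\<forall>g\<in>H. \<forall>x\<in>topspace X. f (a g x) = b g (f x))"

abbreviation fixed_orbit_smash where
  "fixed_orbit_smash L X a E e H aH eH \<equiv>
     fixed_pspace H (\<lambda>g Z. smash_act aH (base_act eH) g ` Z) (orbit_smash L X a E e)"

lemma orbit_smash_map_commute: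
  assumes "Z \<subseteq> S \<times> insert None (Some ` topspace E)" "commutes_on H E u u' f" "g \<in> H"
  shows "smash_act aH (base_act u') g ` orbit_smash_map f Z = orbit_smash_map f (smash_act aH (base_act u) g ` Z)"
  unfolding orbit_smash_map_def image_image
proof (rule image_cong[OF refl])
  fix v assume "v \<in> Z"
  then show "smash_act aH (base_act u') g (map_prod id (map_option f) v) =
      map_prod id (map_option f) (smash_act aH (base_act u) g v)"
    using assms by (auto simp: smash_act_def base_act_def commutes_on_def)
qed

lemma topspace_fixed_pspace:
  "topspace (ptop (fixed_pspace H a X)) = {x \<in> topspace (ptop X). \<forall>h\<in>H. a h x = x}"
  by (auto simp: fixed_pspace_def fixed_space_def)

lemma topspace_fixed_space:
  "topspace (fixed_space H a X) = {x \<in> topspace X. \<forall>h\<in>H. a h x = x}"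
  by (auto simp: fixed_space_def)

lemma pt_fixed_pspace [simp]: "pt (fixed_pspace H a X) = pt X"
  by (simp add: fixed_pspace_def)

lemma pt_orbit_smash_singleton:
  assumes "group L" "pointed_action L X a"
  shows "pt (orbit_smash L X a E e) = {(pt X, None)}"
proof -
  have "\<one>\<^bsub>L\<^esub> \<in> carrier L" using assms(1) group.is_monoid monoid.one_closed by blast
  then show ?thesis
    using assms(2) by (auto simp: orbit_smash_def orbit_pspace_def orbit_of_def smash_act_def
        base_act_def pointed_action_def)
qed

lemma pt_in_fixed_orbit_smash:
  assumes L: "group L" "pointed_action L X a" and E: "continuous_action L E e" "topspace E \<noteq> {}"
    and ptH: "\<And>g. g \<in> H \<Longrightarrow> aH g (pt X) = pt X"
  shows "{(pt X, None)} \<in> topspace (ptop (fixed_orbit_smash L X a E e H aH eH))"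
proof -
  obtain w where "w \<in> topspace E" using E(2) by blast
  have "pt (orbit_smash L X a E e) \<in> topspace (ptop (orbit_smash L X a E e))"
    unfolding topspace_orbit_smash[OF L E] pt_orbit_smash[OF L(2), of E e w]
    using L(2) \<open>w \<in> topspace E\<close> by (auto simp: pointed_action_def)
  then show ?thesis
    using pt_orbit_smash_singleton[OF L, of E e] ptH
    by (auto simp: topspace_fixed_pspace smash_act_def base_act_def)
qed

text \<open>Commuting with \<open>L\<close> lets the homotopy descend to orbits, and commuting with
  \<open>H\<close> keeps it inside the fixed points.\<close>

lemma fixed_orbit_smash_homotopic:
  assumes L: "group L" "pointed_action L X a" and E: "continuous_action L E e" "topspace E \<noteq> {}"
    and E': "continuous_action L E' e'"
    and ptH: "\<And>g. g \<in> H \<Longrightarrow> aH g (pt X) = pt X"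
    and hom: "homotopic_with (\<lambda>f. commutes_on (carrier L) E e e' f \<and> commutes_on H E u u' f) E E' f0 f1"
  shows "pointed_homotopic (fixed_orbit_smash L X a E e H aH u) (fixed_orbit_smash L X a E' e' H aH u')
           (orbit_smash_map f0) (orbit_smash_map f1)"
proof -
  obtain h where hc: "continuous_map (prod_topology unit_interval E) E' h"
    and h0: "\<And>x. h (0, x) = f0 x" and h1: "\<And>x. h (1, x) = f1 x"
    and hL: "\<And>t. t \<in> {0..1} \<Longrightarrow> commutes_on (carrier L) E e e' (\<lambda>x. h (t, x))"
    and hH: "\<And>t. t \<in> {0..1} \<Longrightarrow> commutes_on H E u u' (\<lambda>x. h (t, x))"
    using hom unfolding homotopic_with_def by auto
  let ?Q = "fixed_orbit_smash L X a E e H aH u" and ?Q' = "fixed_orbit_smash L X a E' e' H aH u'"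
  have "h ` (topspace (prod_topology unit_interval E)) \<subseteq> topspace E'"
    using continuous_map_image_subset_topspace[OF hc] .
  moreover obtain w where "w \<in> topspace E" using E(2) by blast
  ultimately have "h (0, w) \<in> topspace E'" by (auto simp: image_subset_iff)
  then have ne': "topspace E' \<noteq> {}" by blast
  show ?thesis
  proof (rule pointed_homotopicI[where h = "\<lambda>t. orbit_smash_map (\<lambda>x. h (t, x))"])
    have "continuous_map (prod_topology unit_interval (ptop (orbit_smash L X a E e)))
        (ptop (orbit_smash L X a E' e')) (\<lambda>(t, Z). orbit_smash_map (\<lambda>x. h (t, x)) Z)"
      using hc hL by (intro continuous_map_orbit_smash_homotopy[OF L E E']) (auto simp: commutes_on_def case_prod_eta)
    moreover have "prod_topology unit_interval (ptop ?Q) = subtopology (prod_topology unit_interval (ptop (orbit_smash L X a E e)))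
        (UNIV \<times> {Z. \<forall>g\<in>H. smash_act aH (base_act u) g ` Z = Z})"
      by (simp add: fixed_pspace_def fixed_space_def subtopology_Times)
    ultimately have "continuous_map (prod_topology unit_interval (ptop ?Q))
        (ptop (orbit_smash L X a E' e')) (\<lambda>(t, Z). orbit_smash_map (\<lambda>x. h (t, x)) Z)"
      by (simp add: continuous_map_from_subtopology)
    moreover have "smash_act aH (base_act u') g ` orbit_smash_map (\<lambda>x. h (t, x)) Z = orbit_smash_map (\<lambda>x. h (t, x)) Z"
      if "t \<in> {0..1}" "Z \<in> topspace (ptop ?Q)" "g \<in> H" for t Z g
      using orbit_smash_map_commute[OF orbit_smash_carrier[OF L E(1)] hH[OF that(1)] that(3), of Z aH]
        that by (auto simp: topspace_fixed_pspace)
    ultimately show "continuous_map (prod_topology unit_interval (ptop ?Q)) (ptop ?Q')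
        (\<lambda>(t, Z). orbit_smash_map (\<lambda>x. h (t, x)) Z)"
      unfolding fixed_pspace_def[of _ _ "orbit_smash L X a E' e'"] fixed_space_def[of H _ "ptop (orbit_smash L X a E' e')"]
      by (simp add: continuous_map_in_subtopology Pi_def split_beta)
  next
    show "pt ?Q \<in> topspace (ptop ?Q)"
      using pt_in_fixed_orbit_smash[OF L E, of H aH u] ptH pt_orbit_smash_singleton[OF L, of E e] by simp
    show "orbit_smash_map (\<lambda>x. h (t, x)) (pt ?Q) = pt ?Q'" for t
      using pt_orbit_smash_singleton[OF L, of E e] pt_orbit_smash_singleton[OF L, of E' e']
      by (simp add: orbit_smash_map_def)
  qed (auto simp: h0 h1)
qed

lemma orbit_smash_map_comp:
  "orbit_smash_map g \<circ> orbit_smash_map f = (orbit_smash_map (g \<circ> f) :: ('x \<times> 'a option) set \<Rightarrow> _)"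
proof -
  have "map_prod id (map_option g) (map_prod id (map_option f) u) = map_prod id (map_option (g \<circ> f)) u"
    for u :: "'x \<times> 'a option"
    by (cases u) (simp add: option.map_comp)
  then show ?thesis unfolding orbit_smash_map_def fun_eq_iff by (simp add: image_image)
qed

lemma orbit_smash_map_id: "orbit_smash_map id = id"
  by (rule ext) (simp add: orbit_smash_map_def option.map_id0 prod.map_id0)

definition biequivariant_equivalence where
  "biequivariant_equivalence L E e E' e' H u u' f \<longleftrightarrow>
     continuous_map E E' f \<and> commutes_on (carrier L) E e e' f \<and> commutes_on H E u u' f \<and>
     (\<exists>g. continuous_map E' E g \<and> commutes_on (carrier L) E' e' e g \<and> commutes_on H E' u' u g \<and>
       homotopic_with (\<lambda>f. commutes_on (carrier L) E e e f \<and> commutes_on H E u u f) E E (g \<circ> f) id \<and>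
       homotopic_with (\<lambda>f. commutes_on (carrier L) E' e' e' f \<and> commutes_on H E' u' u' f) E' E' (f \<circ> g) id)"

lemma fixed_orbit_smash_equivalence:
  assumes L: "group L" "pointed_action L X a" and E: "continuous_action L E e" "topspace E \<noteq> {}"
    and E': "continuous_action L E' e'"
    and ptH: "\<And>g. g \<in> H \<Longrightarrow> aH g (pt X) = pt X"
    and f: "biequivariant_equivalence L E e E' e' H u u' f"
  shows "pointed_homotopy_equivalence (fixed_orbit_smash L X a E e H aH u)
    (fixed_orbit_smash L X a E' e' H aH u') (orbit_smash_map f)"
proof -
  obtain g where fm: "continuous_map E E' f" "commutes_on (carrier L) E e e' f" "commutes_on H E u u' f"
    and gm: "continuous_map E' E g" "commutes_on (carrier L) E' e' e g" "commutes_on H E' u' u g"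
    and gf: "homotopic_with (\<lambda>f. commutes_on (carrier L) E e e f \<and> commutes_on H E u u f) E E (g \<circ> f) id"
    and fg: "homotopic_with (\<lambda>f. commutes_on (carrier L) E' e' e' f \<and> commutes_on H E' u' u' f) E' E' (f \<circ> g) id"
    using f by (auto simp: biequivariant_equivalence_def)
  have "f ` topspace E \<subseteq> topspace E'" using fm(1) by (rule continuous_map_image_subset_topspace)
  then have ne': "topspace E' \<noteq> {}" using E(2) by blast
  show ?thesis
    unfolding pointed_homotopy_equivalence_def
  proof (intro conjI exI[of _ "orbit_smash_map g"])
    have "pointed_homotopic (fixed_orbit_smash L X a E e H aH u) (fixed_orbit_smash L X a E' e' H aH u')
        (orbit_smash_map f) (orbit_smash_map f)"
      by (rule fixed_orbit_smash_homotopic[OF L E E']) (use fm ptH in auto)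
    then show "pointed_map (fixed_orbit_smash L X a E e H aH u) (fixed_orbit_smash L X a E' e' H aH u') (orbit_smash_map f)"
      by (auto dest: pointed_homotopic_imp_maps)
    have "pointed_homotopic (fixed_orbit_smash L X a E' e' H aH u') (fixed_orbit_smash L X a E e H aH u)
        (orbit_smash_map g) (orbit_smash_map g)"
      by (rule fixed_orbit_smash_homotopic[OF L E' ne' E(1)]) (use gm ptH in auto)
    then show "pointed_map (fixed_orbit_smash L X a E' e' H aH u') (fixed_orbit_smash L X a E e H aH u) (orbit_smash_map g)"
      by (auto dest: pointed_homotopic_imp_maps)
    have "pointed_homotopic (fixed_orbit_smash L X a E e H aH u) (fixed_orbit_smash L X a E e H aH u)
        (orbit_smash_map (g \<circ> f)) (orbit_smash_map id)"
      by (rule fixed_orbit_smash_homotopic[OF L E E(1)]) (use gf ptH in auto)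
    then show "pointed_homotopic (fixed_orbit_smash L X a E e H aH u) (fixed_orbit_smash L X a E e H aH u)
        (orbit_smash_map g \<circ> orbit_smash_map f) id"
      by (simp add: orbit_smash_map_comp orbit_smash_map_id)
    have "pointed_homotopic (fixed_orbit_smash L X a E' e' H aH u') (fixed_orbit_smash L X a E' e' H aH u')
        (orbit_smash_map (f \<circ> g)) (orbit_smash_map id)"
      by (rule fixed_orbit_smash_homotopic[OF L E' ne' E']) (use fg ptH in auto)
    then show "pointed_homotopic (fixed_orbit_smash L X a E' e' H aH u') (fixed_orbit_smash L X a E' e' H aH u')
        (orbit_smash_map f \<circ> orbit_smash_map g) id"
      by (simp add: orbit_smash_map_comp orbit_smash_map_id)
  qed
qed

lemma fixed_pspace_empty: "fixed_pspace {} a X = (X :: 'a pspace)"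
  by (cases X) (simp add: fixed_pspace_def fixed_space_def)

lemma orbit_smash_equivalence:
  assumes L: "group L" "pointed_action L X a" and E: "continuous_action L E e" "topspace E \<noteq> {}"
    and E': "continuous_action L E' e'"
    and f: "equivariant_homotopy_equivalence L E e E' e' f"
  shows "pointed_homotopy_equivalence (orbit_smash L X a E e) (orbit_smash L X a E' e') (orbit_smash_map f)"
proof -
  \<comment> \<open>With no elements to be fixed by, the fixed points are the whole orbit space, so
    this is a case of \<open>fixed_orbit_smash_equivalence\<close>.\<close>
  have "biequivariant_equivalence L E e E' e' ({} :: unit set) (\<lambda>_. id) (\<lambda>_. id) f"
  proof -
    obtain g where g: "equivariant_map L E' e' E e g"
      "equivariantly_homotopic L E e E e (g \<circ> f) id" "equivariantly_homotopic L E' e' E' e' (f \<circ> g) id"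
      using f by (auto simp: equivariant_homotopy_equivalence_def)
    have "homotopic_with (\<lambda>f. commutes_on (carrier L) E e e f \<and> commutes_on {} E (\<lambda>_. id) (\<lambda>_. id) f) E E (g \<circ> f) id"
      using g(2) unfolding equivariantly_homotopic_def
      by (rule homotopic_with_mono) (auto simp: equivariant_map_def commutes_on_def)
    moreover have "homotopic_with (\<lambda>f. commutes_on (carrier L) E' e' e' f \<and> commutes_on {} E' (\<lambda>_. id) (\<lambda>_. id) f) E' E' (f \<circ> g) id"
      using g(3) unfolding equivariantly_homotopic_def
      by (rule homotopic_with_mono) (auto simp: equivariant_map_def commutes_on_def)
    ultimately show ?thesis
      using f g(1) unfolding biequivariant_equivalence_def equivariant_homotopy_equivalence_def
      by (intro conjI exI[of _ g]) (auto simp: equivariant_map_def commutes_on_def)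
  qed
  then have "pointed_homotopy_equivalence (fixed_orbit_smash L X a E e ({} :: unit set) (\<lambda>_. id) (\<lambda>_. id))
      (fixed_orbit_smash L X a E' e' ({} :: unit set) (\<lambda>_. id) (\<lambda>_. id)) (orbit_smash_map f)"
    using fixed_orbit_smash_equivalence[OF L E E', of "{} :: unit set" "\<lambda>_. id" "\<lambda>_. id" "\<lambda>_. id" f]
    by blast
  then show ?thesis by (simp add: fixed_pspace_empty)
qed

section \<open>Fixed points of orbit spaces\<close>

text \<open>\<open>X\<close> stands for the smash product of a good space with \<open>Y\<close>, and
  \<open>E\<close> for a CW model of the universal space. The model is Hausdorff, which makes the
  sets \<open>E_part\<close> closed.\<close>

locale fixed_orbits =
  fixes L :: "('l, 'm) monoid_scheme" and G :: "('g, 'k) monoid_scheme" and H :: "'g set"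
    and X :: "'x pspace" and aL :: "'l \<Rightarrow> 'x \<Rightarrow> 'x" and aH :: "'g \<Rightarrow> 'x \<Rightarrow> 'x"
    and E :: "'e topology" and eL :: "'l \<Rightarrow> 'e \<Rightarrow> 'e" and eH :: "'g \<Rightarrow> 'e \<Rightarrow> 'e"
  assumes L: "group L" "finite (carrier L)" and G: "group G" "subgroup H G" "finite H"
    and XL: "pointed_action L X aL" and XG: "pointed_action G X aH"
    and Xcomm: "\<And>l g z. l \<in> carrier L \<Longrightarrow> g \<in> carrier G \<Longrightarrow> z \<in> topspace (ptop X) \<Longrightarrow>
      aL l (aH g z) = aH g (aL l z)"
    and EL: "continuous_action L E eL" and EG: "continuous_action G E eH"
    and Ecomm: "\<And>l g w. l \<in> carrier L \<Longrightarrow> g \<in> carrier G \<Longrightarrow> w \<in> topspace E \<Longrightarrow>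
      eL l (eH g w) = eH g (eL l w)"
    and free: "\<And>l w. l \<in> carrier L \<Longrightarrow> w \<in> topspace E \<Longrightarrow> eL l w = w \<Longrightarrow> l = \<one>\<^bsub>L\<^esub>"
    and Hausdorff: "Hausdorff_space E"
    and EH_ne: "topspace (fixed_space H eH E) \<noteq> {}"
begin

sublocale group_L: group L by (rule L)
sublocale group_G: group G by (rule G)

lemma H_carrier: "h \<in> H \<Longrightarrow> h \<in> carrier G"
  using G(2) subgroup.mem_carrier by metis

lemma E_ne: "topspace E \<noteq> {}"
  using EH_ne by (auto simp: topspace_fixed_space)

abbreviation x0 where "x0 \<equiv> pt X"
abbreviation "q \<equiv> orbit_smash_pt L aL x0 eL"
abbreviation "T \<equiv> orbit_smash L X aL E eL"
abbreviation "Q \<equiv> fixed_orbit_smash L X aL E eL H aH eH"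
abbreviation "XE \<equiv> prod_topology (ptop X) E"

lemma x0: "x0 \<in> topspace (ptop X)"
  using XL by (simp add: pointed_action_def)

lemma XL': "continuous_action L (ptop X) aL" and XG': "continuous_action G (ptop X) aH"
  using XL XG by (auto simp: pointed_action_def)

lemmas aL_closed = action_closed[OF XL'] and aH_closed = action_closed[OF XG' H_carrier]
lemmas eL_closed = action_closed[OF EL] and eH_closed = action_closed[OF EG H_carrier]

definition stab :: "'e \<Rightarrow> ('g \<times> 'l) set" where
  "stab w = {(h, l). h \<in> H \<and> l \<in> carrier L \<and> eL l (eH h w) = w}"

text \<open>For \<open>w\<close> in this set, \<open>stab w\<close> is the graph of a map from \<open>H\<close> to \<open>L\<close>.\<close>

definition E_fix :: "'e set" where
  "E_fix = {w \<in> topspace E. \<forall>h\<in>H. \<exists>l\<in>carrier L. eL l (eH h w) = w}"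

definition X_fix :: "('g \<times> 'l) set \<Rightarrow> 'x set" where
  "X_fix \<Gamma> = {z \<in> topspace (ptop X). \<forall>(h, l)\<in>\<Gamma>. aL l (aH h z) = z}"

definition E_part :: "('g \<times> 'l) set \<Rightarrow> 'e set" where
  "E_part \<Gamma> = {w \<in> topspace E. \<forall>(h, l)\<in>\<Gamma>. eL l (eH h w) = w}"

text \<open>The union of the products of the \<Gamma>-fixed points of \<open>X\<close> and of
  \<open>E\<close>, over the isotropy groups \<Gamma> of points of \<open>E\<close> that project
  onto \<open>H\<close>.\<close>

definition XE_fix :: "('x \<times> 'e) set" where
  "XE_fix = {(z, w). w \<in> E_fix \<and> z \<in> X_fix (stab w)}"

lemma eL_cancel:
  assumes "l \<in> carrier L" "l' \<in> carrier L" "u \<in> topspace E" "eL l u = eL l' u"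
  shows "l = l'"
proof -
  have "eL (inv\<^bsub>L\<^esub> l' \<otimes>\<^bsub>L\<^esub> l) u = u"
    using assms EL action_inv(1)[OF L(1) EL] by (simp add: continuous_action_def)
  then have "inv\<^bsub>L\<^esub> l' \<otimes>\<^bsub>L\<^esub> l = \<one>\<^bsub>L\<^esub>" using free assms by simp
  then show ?thesis using assms(1,2)
    by (metis group_L.inv_equality group_L.inv_inv group_L.inv_closed)
qed

lemma stab_unique:
  assumes "w \<in> topspace E" "(h, l) \<in> stab w" "(h, l') \<in> stab w"
  shows "l = l'"
  using assms eL_cancel[of l l' "eH h w"] eH_closed by (auto simp: stab_def)

text \<open>\<open>stab w0\<close> contains an element over each \<open>h\<close> in
  \<open>H\<close>, and by freeness there is at most one, so a point fixed by \<open>stab w0\<close>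
  has no larger isotropy group. Hence the sets \<open>E_part\<close> partition
  \<open>E_fix\<close>.\<close>

lemma E_part_stab:
  assumes "w0 \<in> E_fix" "w \<in> E_part (stab w0)"
  shows "stab w = stab w0" "w \<in> E_fix"
proof -
  have w: "w \<in> topspace E" and sub: "stab w0 \<subseteq> stab w"
    using assms(2) by (auto simp: E_part_def stab_def)
  have "(h, l) \<in> stab w0" if "(h, l) \<in> stab w" for h l
  proof -
    have "h \<in> H" using that by (simp add: stab_def)
    then obtain l' where "(h, l') \<in> stab w0" using assms(1) by (auto simp: E_fix_def stab_def)
    then show ?thesis using stab_unique[OF w that] sub by blast
  qed
  then show "stab w = stab w0" using sub by auto
  show "w \<in> E_fix" using assms(1) sub w by (fastforce simp: E_fix_def stab_def)
qed

lemma E_part_self: "w \<in> E_fix \<Longrightarrow> w \<in> E_part (stab w)"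
  by (auto simp: E_part_def E_fix_def stab_def)

lemma finite_stabs: "finite (stab ` E_fix)"
proof (rule finite_subset)
  show "stab ` E_fix \<subseteq> Pow (H \<times> carrier L)" by (auto simp: stab_def)
  show "finite (Pow (H \<times> carrier L))" using L G by simp
qed

lemma E_part_closed: "\<Gamma> \<in> stab ` E_fix \<Longrightarrow> closedin E (E_part \<Gamma>)"
proof -
  assume "\<Gamma> \<in> stab ` E_fix"
  then have sub: "\<Gamma> \<subseteq> H \<times> carrier L" by (auto simp: stab_def)
  have "closedin E {w \<in> topspace E. eL l (eH h w) = w}" if "(h, l) \<in> \<Gamma>" for h l
  proof -
    have hl: "h \<in> H" "l \<in> carrier L" using sub that by auto
    then have "continuous_map E E (eH h)" "continuous_map E E (eL l)"
      using EL EG H_carrier by (auto simp: continuous_action_def)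
    then have "continuous_map E E (\<lambda>w. eL l (eH h w))"
      using continuous_map_compose[of E E "eH h" E "eL l"] by (simp add: o_def)
    then show ?thesis
      using closedin_continuous_maps_eq[OF Hausdorff, of E "\<lambda>w. eL l (eH h w)" "\<lambda>w. w"] by simp
  qed
  then have "closedin E (\<Inter>(insert (topspace E) ((\<lambda>(h, l). {w \<in> topspace E. eL l (eH h w) = w}) ` \<Gamma>)))"
    by (intro closedin_Inter) auto
  moreover have "\<Inter>(insert (topspace E) ((\<lambda>(h, l). {w \<in> topspace E. eL l (eH h w) = w}) ` \<Gamma>)) = E_part \<Gamma>"
    by (auto simp: E_part_def)
  ultimately show ?thesis by simp
qed

lemma E_fix_closed: "closedin E E_fix"
proof -
  have "E_fix = \<Union>(E_part ` stab ` E_fix)"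
    using E_part_self E_part_stab(2) by fastforce
  moreover have "closedin E (\<Union>(E_part ` stab ` E_fix))"
    using finite_stabs E_part_closed by (intro closedin_Union) auto
  ultimately show ?thesis by simp
qed

lemma XE_fix_sub: "XE_fix \<subseteq> topspace XE"
  by (auto simp: XE_fix_def X_fix_def E_fix_def)

lemma stab_fixed: "w \<in> topspace (fixed_space H eH E) \<Longrightarrow> stab w = H \<times> {\<one>\<^bsub>L\<^esub>}"
  using free EL by (auto simp: stab_def topspace_fixed_space continuous_action_def)

lemma fixed_in_E_fix: "w \<in> topspace (fixed_space H eH E) \<Longrightarrow> w \<in> E_fix"
  using EL by (auto simp: E_fix_def topspace_fixed_space continuous_action_def)

lemma x0_fix: "w \<in> E_fix \<Longrightarrow> x0 \<in> X_fix (stab w)"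
  using XL XG H_carrier x0 by (auto simp: X_fix_def stab_def pointed_action_def)

lemma smash_act_q:
  assumes "h \<in> H" "z \<in> topspace (ptop X)" "w \<in> topspace E"
  shows "smash_act aH (base_act eH) h ` q (z, w) = q (aH h z, eH h w)"
proof -
  have "smash_act aH (base_act eH) h (half_smash_pt x0 (z, w)) = half_smash_pt x0 (aH h z, eH h w)"
    by (rule smash_act_half_smash_pt[OF G(1) XG H_carrier[OF assms(1)] assms(2)])
  moreover have "smash_act aH (base_act eH) h (smash_act aL (base_act eL) l (half_smash_pt x0 (z, w))) =
      smash_act aL (base_act eL) l (smash_act aH (base_act eH) h (half_smash_pt x0 (z, w)))"
    if "l \<in> carrier L" for l
    using that assms Xcomm Ecomm H_carrier x0 by (auto simp: half_smash_pt_def smash_act_def base_act_def)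
  ultimately show ?thesis
    unfolding orbit_smash_pt_def
    by (subst image_orbit_of[where b = "smash_act aL (base_act eL)"]) auto
qed

text \<open>Over the base point the coordinate \<open>w\<close> is forgotten and may be arbitrary.
  Elsewhere, being fixed by \<open>h\<close> means that some \<open>l\<close> undoes
  \<open>h\<close> on both coordinates; this \<open>l\<close> is determined by \<open>w\<close>
  alone, because \<open>L\<close> acts freely on \<open>E\<close>.\<close>

lemma q_in_Q_iff:
  assumes z: "z \<in> topspace (ptop X)" and w: "w \<in> topspace E"
  shows "q (z, w) \<in> topspace (ptop Q) \<longleftrightarrow> z = x0 \<or> (z, w) \<in> XE_fix"
proof -
  have "q (z, w) \<in> topspace (ptop T)"
    using topspace_orbit_smash[OF L(1) XL EL E_ne] assms by simp
  then have "q (z, w) \<in> topspace (ptop Q) \<longleftrightarrow> (\<forall>h\<in>H. q (aH h z, eH h w) = q (z, w))"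
    using smash_act_q[OF _ z w] by (simp add: topspace_fixed_pspace)
  also have "\<dots> \<longleftrightarrow> z = x0 \<or> (\<forall>h\<in>H. \<exists>l\<in>carrier L. z = aL l (aH h z) \<and> w = eL l (eH h w))"
  proof -
    have "aH h z = x0 \<longleftrightarrow> z = x0" if "h \<in> H" for h
      using pointed_action_eq_pt[OF G(1) XG H_carrier[OF that] z] .
    then show ?thesis
      using orbit_smash_pt_eq_iff[OF L(1) XL EL] aH_closed eH_closed z w by auto
  qed
  also have "\<dots> \<longleftrightarrow> z = x0 \<or> (z, w) \<in> XE_fix"
  proof -
    have "(\<forall>h\<in>H. \<exists>l\<in>carrier L. z = aL l (aH h z) \<and> w = eL l (eH h w)) \<longleftrightarrow> (z, w) \<in> XE_fix"
    proof
      assume *: "\<forall>h\<in>H. \<exists>l\<in>carrier L. z = aL l (aH h z) \<and> w = eL l (eH h w)"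
      have "aL l (aH h z) = z" if "(h, l) \<in> stab w" for h l
      proof -
        have "h \<in> H" using that by (simp add: stab_def)
        then obtain l' where l': "l' \<in> carrier L" "z = aL l' (aH h z)" "w = eL l' (eH h w)" using * by blast
        then have "l = l'" using stab_unique[OF w that] \<open>h \<in> H\<close> by (simp add: stab_def)
        then show ?thesis using l' by simp
      qed
      then show "(z, w) \<in> XE_fix" using * z w unfolding XE_fix_def X_fix_def E_fix_def by auto metis
    next
      assume zw: "(z, w) \<in> XE_fix"
      show "\<forall>h\<in>H. \<exists>l\<in>carrier L. z = aL l (aH h z) \<and> w = eL l (eH h w)"
      proof
        fix h assume "h \<in> H"
        then obtain l where l: "l \<in> carrier L" "eL l (eH h w) = w"
          using zw by (auto simp: XE_fix_def E_fix_def)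
        then have "(h, l) \<in> stab w" using \<open>h \<in> H\<close> by (simp add: stab_def)
        then have "aL l (aH h z) = z" using zw by (auto simp: XE_fix_def X_fix_def)
        then show "\<exists>l\<in>carrier L. z = aL l (aH h z) \<and> w = eL l (eH h w)" using l by metis
      qed
    qed
    then show ?thesis by simp
  qed
  finally show ?thesis .
qed

text \<open>The fixed points are a subspace of a quotient of X x E; they turn out to be a quotient
  of the subspace \<open>XE_fix\<close> as well. The map is the collapse of {x0} x E followed by the
  orbit map. The collapse is first cut down to the full preimage \<open>?A\<close> of the fixed
  points, which contains {x0} x E, and then to its closed part \<open>XE_fix\<close>. The orbit map
  is open, hence restricts to the preimage of the fixed points.\<close>

lemma Q_quotient_map: "quotient_map (subtopology XE XE_fix) (ptop Q) q"
proof -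
  let ?C = "ptop (smash X (adjoin_base E))" and ?c = "half_smash_pt x0 :: 'x \<times> 'e \<Rightarrow> _"
  let ?S = "{x0} \<times> topspace E" and ?A = "{u \<in> topspace XE. fst u = x0 \<or> u \<in> XE_fix}"
  let ?act = "smash_act aL (base_act eL)"
  obtain w1 where w1: "w1 \<in> topspace (fixed_space H eH E)" using EH_ne by blast
  have c1: "collapse_map XE ?C ?c ?S" by (rule half_smash_collapse_map[OF x0 E_ne])
  have c2: "collapse_map (subtopology XE ?A) (subtopology ?C (?c ` ?A)) ?c ?S"
    by (rule collapse_map_superset[OF c1]) (use x0 in auto)
  have eqA: "XE_fix = ?A \<inter> {u \<in> topspace XE. snd u \<in> E_fix}"
    using x0_fix XE_fix_sub by (auto simp: XE_fix_def)
  have "closedin XE {u \<in> topspace XE. snd u \<in> E_fix}"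
    using closedin_continuous_map_preimage[OF continuous_map_snd E_fix_closed] .
  then have cl: "closedin (subtopology XE ?A) XE_fix"
    by (subst eqA) (auto simp: closedin_subtopology)
  have c3: "collapse_map (subtopology (subtopology XE ?A) XE_fix)
      (subtopology (subtopology ?C (?c ` ?A)) (?c ` XE_fix)) ?c (XE_fix \<inter> ?S)"
  proof (rule collapse_map_closed[OF c2 cl])
    have "(x0, w1) \<in> XE_fix" using x0_fix fixed_in_E_fix[OF w1] by (simp add: XE_fix_def)
    moreover have "(x0, w1) \<in> ?S" using w1 by (simp add: topspace_fixed_space)
    ultimately show "XE_fix \<inter> ?S \<noteq> {}" by blast
    fix U u assume U: "openin (subtopology XE ?A) U" and u: "u \<in> U \<inter> XE_fix" and dis: "U \<inter> XE_fix \<inter> ?S = {}"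
    obtain O' where O: "openin XE O'" "U = O' \<inter> ?A" using U by (auto simp: openin_subtopology)
    obtain z w where zw: "u = (z, w)" by force
    obtain M N where MN: "openin (ptop X) M" "openin E N" "z \<in> M" "w \<in> N" "M \<times> N \<subseteq> O'"
    proof -
      have "(z, w) \<in> O'" using O u zw by simp
      with O(1) show ?thesis using that unfolding openin_prod_topology_alt by meson
    qed
    \<comment> \<open>If \<open>M\<close> contained \<open>x0\<close>, then (x0, w) would be a point
      of \<open>U\<close> lying both in \<open>XE_fix\<close> and in the collapsed set, and there is
      none.\<close>
    have "x0 \<notin> M"
    proof
      assume "x0 \<in> M"
      have w: "w \<in> E_fix" using u zw by (simp add: XE_fix_def)
      then have "(x0, w) \<in> XE_fix" using x0_fix by (simp add: XE_fix_def)
      moreover have "(x0, w) \<in> U" using \<open>x0 \<in> M\<close> MN O w x0 by (auto simp: E_fix_def)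
      ultimately show False using dis w by (auto simp: E_fix_def)
    qed
    moreover have "openin (subtopology XE ?A) (M \<times> N \<inter> ?A)"
    proof -
      have "openin XE (M \<times> N)" using MN by (simp add: openin_prod_Times_iff)
      then show ?thesis by (meson openin_subtopology)
    qed
    ultimately show "\<exists>V. openin (subtopology XE ?A) V \<and> u \<in> V \<and> V \<subseteq> U \<and> V \<inter> ?S = {}"
      using MN O u zw by (intro exI[of _ "M \<times> N \<inter> ?A"]) auto
  qed
  have XA: "XE_fix \<subseteq> ?A" using XE_fix_sub by auto
  have c4: "quotient_map (subtopology XE XE_fix) (subtopology ?C (?c ` XE_fix)) ?c"
  proof -
    have "subtopology (subtopology XE ?A) XE_fix = subtopology XE XE_fix"
      using XA by (simp add: subtopology_subtopology inf_absorb2)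
    moreover have "subtopology (subtopology ?C (?c ` ?A)) (?c ` XE_fix) = subtopology ?C (?c ` XE_fix)"
      using image_mono[OF XA, of ?c] by (simp add: subtopology_subtopology inf_absorb2)
    ultimately show ?thesis using c3 by (simp add: collapse_map_def)
  qed
  have act: "continuous_action L ?C ?act"
    using pointed_action_smash[OF L(1) XL pointed_action_adjoin_base[OF EL]] by (simp add: pointed_action_def)
  have Ttop: "ptop T = quotient_topology ?C (orbit_of L ?act)"
    by (simp add: orbit_smash_def orbit_pspace_def)
  have qc: "q u = orbit_of L ?act (?c u)" for u by (simp add: orbit_smash_pt_def)
  have imc: "?c ` topspace XE = topspace ?C"
    using c1 by (auto simp: collapse_map_def quotient_map_def)
  have pre: "{v \<in> topspace ?C. orbit_of L ?act v \<in> topspace (ptop Q)} = ?c ` XE_fix"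
  proof -
    have "?c u \<in> ?c ` XE_fix \<longleftrightarrow> q u \<in> topspace (ptop Q)" if u: "u \<in> topspace XE" for u
    proof -
      obtain z w where zw: "u = (z, w)" "z \<in> topspace (ptop X)" "w \<in> topspace E" using u by auto
      have "?c u \<in> ?c ` XE_fix \<longleftrightarrow> z = x0 \<or> u \<in> XE_fix"
      proof
        assume "?c u \<in> ?c ` XE_fix"
        then show "z = x0 \<or> u \<in> XE_fix" using zw by (auto simp: half_smash_pt_def split: if_splits)
      next
        have "?c (x0, w) = ?c (x0, w1)" by (simp add: half_smash_pt_def)
        moreover have "(x0, w1) \<in> XE_fix" using x0_fix fixed_in_E_fix[OF w1] by (simp add: XE_fix_def)
        ultimately show "z = x0 \<or> u \<in> XE_fix \<Longrightarrow> ?c u \<in> ?c ` XE_fix" using zw by auto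
      qed
      then show ?thesis using q_in_Q_iff[OF zw(2,3)] zw(1) by simp
    qed
    note * = this
    show ?thesis
    proof (intro equalityI subsetI)
      fix v assume v: "v \<in> {v \<in> topspace ?C. orbit_of L ?act v \<in> topspace (ptop Q)}"
      then have "v \<in> ?c ` topspace XE" unfolding imc by simp
      then obtain u where "u \<in> topspace XE" "v = ?c u" by (rule imageE)
      then show "v \<in> ?c ` XE_fix" using v * qc by simp
    next
      fix v assume v: "v \<in> ?c ` XE_fix"
      then obtain u where u: "v = ?c u" "u \<in> XE_fix" by (rule imageE)
      have uX: "u \<in> topspace XE" by (rule subsetD[OF XE_fix_sub u(2)])
      then have "v \<in> topspace ?C" unfolding imc[symmetric] u(1) by (rule imageI)
      moreover have "q u \<in> topspace (ptop Q)" using *[OF uX] imageI[OF u(2), of ?c] by (rule iffD1)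
      ultimately show "v \<in> {v \<in> topspace ?C. orbit_of L ?act v \<in> topspace (ptop Q)}"
        unfolding u(1) qc by (intro CollectI conjI)
    qed
  qed
  have o1: "open_map ?C (ptop T) (orbit_of L ?act)"
    unfolding Ttop by (rule orbit_open_map[OF L(1) act])
  have "quotient_map (subtopology ?C (?c ` XE_fix)) (subtopology (ptop T) (topspace (ptop Q))) (orbit_of L ?act)"
  proof (rule continuous_open_imp_quotient_map)
    have cont: "continuous_map ?C (ptop T) (orbit_of L ?act)"
      unfolding Ttop by (rule quotient_imp_continuous_map[OF quotient_map_quotient_topology])
    then show "continuous_map (subtopology ?C (?c ` XE_fix)) (subtopology (ptop T) (topspace (ptop Q))) (orbit_of L ?act)"
      using pre by (auto simp: continuous_map_in_subtopology continuous_map_from_subtopology)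
    show "open_map (subtopology ?C (?c ` XE_fix)) (subtopology (ptop T) (topspace (ptop Q))) (orbit_of L ?act)"
      by (rule open_map_restriction[OF o1 pre])
    have aux: "B \<subseteq> D \<Longrightarrow> D = f ` A \<Longrightarrow> f ` (A \<inter> {v \<in> A. f v \<in> B}) = D \<inter> B" for f A B D
      by blast
    have "topspace (ptop Q) \<subseteq> topspace (ptop T)" by (auto simp: topspace_fixed_pspace)
    moreover have "topspace (ptop T) = orbit_of L ?act ` topspace ?C" by (simp add: Ttop)
    ultimately show "orbit_of L ?act ` topspace (subtopology ?C (?c ` XE_fix)) =
        topspace (subtopology (ptop T) (topspace (ptop Q)))"
      unfolding pre[symmetric] topspace_subtopology by (rule aux)
  qed
  from quotient_map_compose[OF c4 this]
  have "quotient_map (subtopology XE XE_fix) (subtopology (ptop T) (topspace (ptop Q))) q"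
    unfolding o_def qc[abs_def] .
  moreover have "subtopology (ptop T) (topspace (ptop Q)) = ptop Q"
    by (simp add: fixed_pspace_def fixed_space_def subtopology_restrict)
  ultimately show ?thesis by (rule subst[rotated])
qed

text \<open>On the piece of \<Gamma> the isotropy group does not vary, so a map whose formula
  depends on \<open>stab w\<close> can be checked with that group held constant.\<close>

lemma continuous_map_XE_fix_pieces:
  assumes "\<And>\<Gamma>. \<Gamma> \<in> stab ` E_fix \<Longrightarrow>
    continuous_map (prod_topology unit_interval (subtopology XE (X_fix \<Gamma> \<times> E_part \<Gamma>))) Z f"
  shows "continuous_map (prod_topology unit_interval (subtopology XE XE_fix)) Z f"
proof (rule pasting_lemma_closed[OF finite_stabs])
  let ?D = "prod_topology unit_interval (subtopology XE XE_fix)"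
  fix \<Gamma> assume \<Gamma>: "\<Gamma> \<in> stab ` E_fix"
  have eq: "X_fix \<Gamma> \<times> E_part \<Gamma> = XE_fix \<inter> {u \<in> topspace XE. snd u \<in> E_part \<Gamma>}"
  proof -
    obtain w0 where w0: "w0 \<in> E_fix" "\<Gamma> = stab w0" using \<Gamma> by blast
    have "(z, w) \<in> XE_fix \<longleftrightarrow> z \<in> X_fix \<Gamma>" if "w \<in> E_part \<Gamma>" for z w
      using E_part_stab[OF w0(1)] that w0(2) by (simp add: XE_fix_def)
    moreover have "X_fix \<Gamma> \<subseteq> topspace (ptop X)" "E_part \<Gamma> \<subseteq> topspace E"
      by (auto simp: X_fix_def E_part_def)
    ultimately show ?thesis by auto
  qed
  have "closedin XE {u \<in> topspace XE. snd u \<in> E_part \<Gamma>}"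
    using closedin_continuous_map_preimage[OF continuous_map_snd E_part_closed[OF \<Gamma>]] .
  then have "closedin (subtopology XE XE_fix) (X_fix \<Gamma> \<times> E_part \<Gamma>)"
    unfolding eq by (auto simp: closedin_subtopology)
  then show "closedin ?D ({0..1} \<times> (X_fix \<Gamma> \<times> E_part \<Gamma>))"
    by (simp add: closedin_prod_Times_iff)
  have "subtopology ?D ({0..1} \<times> (X_fix \<Gamma> \<times> E_part \<Gamma>)) =
      prod_topology unit_interval (subtopology XE (X_fix \<Gamma> \<times> E_part \<Gamma>))"
    using eq by (simp add: subtopology_Times subtopology_subtopology inf_absorb2)
  then show "continuous_map (subtopology ?D ({0..1} \<times> (X_fix \<Gamma> \<times> E_part \<Gamma>))) Z f"
    using assms[OF \<Gamma>] by simp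
next
  fix x assume "x \<in> topspace (prod_topology unit_interval (subtopology XE XE_fix))"
  then obtain t z w where "x = (t, z, w)" "t \<in> {0..1}" "(z, w) \<in> XE_fix" by auto
  then show "\<exists>\<Gamma>. \<Gamma> \<in> stab ` E_fix \<and> x \<in> {0..1} \<times> (X_fix \<Gamma> \<times> E_part \<Gamma>) \<and> f x = f x"
    using E_part_self by (intro exI[of _ "stab w"]) (auto simp: XE_fix_def)
qed auto

end

text \<open>\<open>X'\<close> has the points of the \<open>H\<close>-fixed part of \<open>X\<close>,
  in a topology that may be finer. The deformation \<Phi> depends on \<Gamma> only through its
  projection to \<open>L\<close>. For a nontrivial projection it ends at the base point; for the
  trivial one it ends in a map that is continuous even into the finer topology, and this makes the
  retraction of \<open>Q\<close> onto \<open>S\<close> continuous.\<close>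

locale deformed_fixed_orbits = fixed_orbits L G H X aL aH E eL eH
  for L :: "('l, 'm) monoid_scheme" and G :: "('g, 'k) monoid_scheme" and H :: "'g set"
    and X :: "'x pspace" and aL :: "'l \<Rightarrow> 'x \<Rightarrow> 'x" and aH :: "'g \<Rightarrow> 'x \<Rightarrow> 'x"
    and E :: "'e topology" and eL :: "'l \<Rightarrow> 'e \<Rightarrow> 'e" and eH :: "'g \<Rightarrow> 'e \<Rightarrow> 'e" +
  fixes X' :: "'x pspace" and \<Phi> :: "'l set \<Rightarrow> real \<Rightarrow> 'x \<Rightarrow> 'x"
  assumes X': "topspace (ptop X') = {z \<in> topspace (ptop X). \<forall>h\<in>H. aH h z = z}" "pt X' = pt X"
      "pointed_action L X' aL" "continuous_map (ptop X') (ptop X) id"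
    and \<Phi>_cont: "\<And>\<Gamma>. \<Gamma> \<in> stab ` E_fix \<Longrightarrow>
      continuous_map (prod_topology unit_interval (subtopology (ptop X) (X_fix \<Gamma>))) (ptop X)
        (\<lambda>(t, z). \<Phi> (snd ` \<Gamma>) t z)"
    and \<Phi>_0: "\<And>w z. w \<in> E_fix \<Longrightarrow> z \<in> X_fix (stab w) \<Longrightarrow> \<Phi> (snd ` stab w) 0 z = z"
    and \<Phi>_pt: "\<And>w t. w \<in> E_fix \<Longrightarrow> t \<in> {0..1} \<Longrightarrow> \<Phi> (snd ` stab w) t (pt X) = pt X"
    and \<Phi>_fix: "\<And>w t z. w \<in> E_fix \<Longrightarrow> t \<in> {0..1} \<Longrightarrow> z \<in> X_fix (stab w) \<Longrightarrow>
      \<Phi> (snd ` stab w) t z \<in> X_fix (stab w)"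
    and \<Phi>_eqv: "\<And>w t z k. w \<in> E_fix \<Longrightarrow> t \<in> {0..1} \<Longrightarrow> z \<in> X_fix (stab w) \<Longrightarrow> k \<in> carrier L \<Longrightarrow>
      \<Phi> (snd ` stab (eL k w)) t (aL k z) = aL k (\<Phi> (snd ` stab w) t z)"
    and \<Phi>_1: "\<And>w z. w \<in> E_fix \<Longrightarrow> z \<in> X_fix (stab w) \<Longrightarrow> snd ` stab w \<noteq> {\<one>\<^bsub>L\<^esub>} \<Longrightarrow>
      \<Phi> (snd ` stab w) 1 z = pt X"
    and \<Phi>_X': "continuous_map (prod_topology unit_interval (ptop X')) (ptop X') (\<lambda>(t, z). \<Phi> {\<one>\<^bsub>L\<^esub>} t z)"
    and \<Phi>_1_X': "continuous_map (subtopology (ptop X) (topspace (ptop X'))) (ptop X') (\<Phi> {\<one>\<^bsub>L\<^esub>} 1)"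
begin

abbreviation "E\<^sub>H \<equiv> fixed_space H eH E"
abbreviation "S \<equiv> orbit_smash L X' aL E\<^sub>H eL"

lemma E\<^sub>H_action: "continuous_action L E\<^sub>H eL"
  unfolding continuous_action_def
proof (intro conjI ballI)
  show "continuous_map E\<^sub>H E\<^sub>H (eL l)" if l: "l \<in> carrier L" for l
  proof -
    have "continuous_map E E (eL l)" using EL l by (auto simp: continuous_action_def)
    moreover have "eL l w \<in> {w. \<forall>h\<in>H. eH h w = w}" if "w \<in> topspace E\<^sub>H" for w
      using that Ecomm[OF l H_carrier] by (auto simp: topspace_fixed_space) metis
    ultimately show ?thesis
      unfolding fixed_space_def by (auto simp: continuous_map_in_subtopology continuous_map_from_subtopology)
  qed
qed (use EL in \<open>auto simp: continuous_action_def topspace_fixed_space\<close>)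

lemma E\<^sub>H_sub: "w \<in> topspace E\<^sub>H \<Longrightarrow> w \<in> topspace E"
  by (simp add: topspace_fixed_space)

lemma S_quotient_map: "quotient_map (prod_topology (ptop X') E\<^sub>H) (ptop S) q"
  using orbit_smash_quotient_map[OF L(1) X'(3) E\<^sub>H_action EH_ne] X'(2) by simp

lemma snd_stab: "w \<in> topspace E\<^sub>H \<Longrightarrow> snd ` stab w = {\<one>\<^bsub>L\<^esub>}"
proof -
  assume "w \<in> topspace E\<^sub>H"
  moreover have "H \<noteq> {}" using subgroup.one_closed[OF G(2)] by blast
  ultimately show ?thesis using stab_fixed[of w] by auto
qed

lemma fixed_in_XE_fix:
  assumes "z \<in> topspace (ptop X')" "w \<in> topspace E\<^sub>H"
  shows "(z, w) \<in> XE_fix"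
  using assms X'(1) stab_fixed[OF assms(2)] fixed_in_E_fix[OF assms(2)] XL'
  by (auto simp: XE_fix_def X_fix_def continuous_action_def)

lemma trivial_stab:
  assumes "w \<in> E_fix" "snd ` stab w = {\<one>\<^bsub>L\<^esub>}"
  shows "w \<in> topspace E\<^sub>H" "stab w = H \<times> {\<one>\<^bsub>L\<^esub>}"
proof -
  have wE: "w \<in> topspace E" using assms(1) by (simp add: E_fix_def)
  have "eH h w = w" if h: "h \<in> H" for h
  proof -
    obtain l where l: "l \<in> carrier L" "eL l (eH h w) = w" using assms(1) h by (auto simp: E_fix_def)
    then have "l \<in> snd ` stab w" using h by (force simp: stab_def)
    then have "l = \<one>\<^bsub>L\<^esub>" using assms(2) by simp
    then show ?thesis using l(2) EL eH_closed[OF h wE] by (simp add: continuous_action_def)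
  qed
  then show "w \<in> topspace E\<^sub>H" using wE by (simp add: topspace_fixed_space)
  then show "stab w = H \<times> {\<one>\<^bsub>L\<^esub>}" by (rule stab_fixed)
qed

lemma trivial_X_fix:
  assumes "w \<in> E_fix" "snd ` stab w = {\<one>\<^bsub>L\<^esub>}"
  shows "X_fix (stab w) = topspace (ptop X')"
  using trivial_stab(2)[OF assms] X'(1) XL' aH_closed by (auto simp: X_fix_def continuous_action_def)

lemma q_eq_iff:
  assumes "(z, w) \<in> topspace XE" "(z', w') \<in> topspace XE"
  shows "q (z, w) = q (z', w') \<longleftrightarrow> z = x0 \<and> z' = x0 \<or> z \<noteq> x0 \<and> (\<exists>l\<in>carrier L. z' = aL l z \<and> w' = eL l w)"
  using orbit_smash_pt_eq_iff[OF L(1) XL EL] assms by simp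

lemma XE_fixD:
  assumes "(z, w) \<in> XE_fix"
  shows "z \<in> topspace (ptop X)" "w \<in> topspace E" "w \<in> E_fix" "z \<in> X_fix (stab w)"
  using assms by (auto simp: XE_fix_def X_fix_def E_fix_def)

lemma q_in_Q: "u \<in> XE_fix \<Longrightarrow> q u \<in> topspace (ptop Q)"
  using q_in_Q_iff XE_fixD by (metis surj_pair)

lemma q_cont: "continuous_map XE (ptop T) q"
  by (rule quotient_imp_continuous_map[OF orbit_smash_quotient_map[OF L(1) XL EL E_ne]])

lemma ptop_Q: "ptop Q = subtopology (ptop T) (topspace (ptop Q))"
  by (simp add: fixed_pspace_def fixed_space_def subtopology_restrict)

lemma pt_T: "pt T = q (x0, w)"
  by (rule pt_orbit_smash[OF XL])

lemma pt_S: "pt S = q (x0, w)"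
  using pt_orbit_smash[OF X'(3), of E\<^sub>H eL w] X'(2) by simp

abbreviation P where "P w \<equiv> snd ` stab w"

text \<open>Translating \<open>w\<close> by \<open>l\<close> conjugates its group, and
  \<open>\<Phi>_eqv\<close> says that the deformations match under the translation; so the
  deformation is well defined on orbits.\<close>

lemma Q_homotopy:
  obtains J where "continuous_map (prod_topology unit_interval (ptop Q)) (ptop Q) (\<lambda>(t, Z). J t Z)"
    "\<And>t z w. t \<in> {0..1} \<Longrightarrow> (z, w) \<in> XE_fix \<Longrightarrow> J t (q (z, w)) = q (\<Phi> (P w) t z, w)"
proof -
  let ?D = "prod_topology unit_interval (subtopology XE XE_fix)"
  let ?f = "\<lambda>(t, u). q (\<Phi> (P (snd u)) t (fst u), snd u)"
  have f_fix: "(\<Phi> (P w) t z, w) \<in> XE_fix" if "t \<in> {0..1}" "(z, w) \<in> XE_fix" for t z w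
    using that \<Phi>_fix XE_fixD[OF that(2)] by (simp add: XE_fix_def)
  have fT: "continuous_map ?D (ptop T) ?f"
  proof (rule continuous_map_XE_fix_pieces)
    fix \<Gamma> assume \<Gamma>: "\<Gamma> \<in> stab ` E_fix"
    let ?G = "prod_topology unit_interval (subtopology XE (X_fix \<Gamma> \<times> E_part \<Gamma>))"
    have G: "subtopology XE (X_fix \<Gamma> \<times> E_part \<Gamma>) = prod_topology (subtopology (ptop X) (X_fix \<Gamma>)) (subtopology E (E_part \<Gamma>))"
      by (simp add: subtopology_Times)
    have s: "continuous_map ?G (subtopology (ptop X) (X_fix \<Gamma>)) (\<lambda>u. fst (snd u))"
      "continuous_map ?G (subtopology E (E_part \<Gamma>)) (\<lambda>u. snd (snd u))"
      unfolding G using continuous_map_compose[OF continuous_map_snd continuous_map_fst]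
        continuous_map_compose[OF continuous_map_snd continuous_map_snd] by (auto simp: o_def)
    have "continuous_map ?G (ptop X) (\<lambda>u. \<Phi> (snd ` \<Gamma>) (fst u) (fst (snd u)))"
      using continuous_map_compose[OF continuous_map_pairedI[OF continuous_map_fst s(1)] \<Phi>_cont[OF \<Gamma>]]
      by (simp add: o_def)
    moreover have "continuous_map ?G E (\<lambda>u. snd (snd u))"
      using s(2) by (rule continuous_map_into_fulltopology)
    ultimately have "continuous_map ?G XE (\<lambda>u. (\<Phi> (snd ` \<Gamma>) (fst u) (fst (snd u)), snd (snd u)))"
      by (rule continuous_map_pairedI)
    from continuous_map_compose[OF this q_cont]
    show "continuous_map ?G (ptop T) ?f"
    proof (rule continuous_map_eq)
      fix x assume "x \<in> topspace ?G"
      then have "snd (snd x) \<in> E_part \<Gamma>" by auto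
      then have "stab (snd (snd x)) = \<Gamma>" using \<Gamma> E_part_stab(1) by auto
      then show "(q \<circ> (\<lambda>u. (\<Phi> (snd ` \<Gamma>) (fst u) (fst (snd u)), snd (snd u)))) x = ?f x"
        by (simp add: split_beta)
    qed
  qed
  have fQ: "continuous_map ?D (ptop Q) ?f"
    by (subst ptop_Q, rule continuous_map_into_subtopology[OF fT]) (use f_fix q_in_Q in auto)
  let ?g = "\<lambda>(t, u). (t :: real, q u)"
  have qm: "quotient_map ?D (prod_topology unit_interval (ptop Q)) ?g"
    by (rule quotient_map_times_interval[OF Q_quotient_map])
  have inv: "?f (t, z, w) = ?f (t', z', w')"
    if "t \<in> {0..1}" "(z, w) \<in> XE_fix" "(z', w') \<in> XE_fix" "t = t'" "q (z, w) = q (z', w')" for t t' z w z' w'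
  proof -
    have top: "(z, w) \<in> topspace XE" "(z', w') \<in> topspace XE" using that XE_fix_sub by blast+
    note D = XE_fixD[OF that(2)] and D' = XE_fixD[OF that(3)]
    have "z = x0 \<and> z' = x0 \<or> (\<exists>l\<in>carrier L. z' = aL l z \<and> w' = eL l w)"
      using q_eq_iff[OF top] that by blast
    then show ?thesis
    proof
      assume "z = x0 \<and> z' = x0"
      then show ?thesis using that \<Phi>_pt D D' q_eq_iff[of x0 w x0 w'] x0 by simp
    next
      assume "\<exists>l\<in>carrier L. z' = aL l z \<and> w' = eL l w"
      then obtain l where l: "l \<in> carrier L" "z' = aL l z" "w' = eL l w" by blast
      have "\<Phi> (P w') t z' = aL l (\<Phi> (P w) t z)"
        using \<Phi>_eqv[OF D(3) that(1) D(4) l(1)] l by simp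
      moreover have "\<Phi> (P w) t z \<in> topspace (ptop X)"
        using f_fix[OF that(1,2)] XE_fixD(1) by blast
      moreover have "aL l (\<Phi> (P w) t z) \<in> topspace (ptop X)" "eL l w \<in> topspace E"
        using aL_closed[OF l(1)] eL_closed[OF l(1)] D(2) calculation(2) by auto
      moreover have "aL l x0 = x0" using XL l(1) by (simp add: pointed_action_def)
      ultimately have "q (\<Phi> (P w) t z, w) = q (\<Phi> (P w') t z', w')"
        using q_eq_iff[of "\<Phi> (P w) t z" w "\<Phi> (P w') t z'" w'] D(2) D'(2) l by auto
      then show ?thesis using that(4) by simp
    qed
  qed
  obtain J where J: "continuous_map (prod_topology unit_interval (ptop Q)) (ptop Q) J"
    "\<And>x. x \<in> topspace ?D \<Longrightarrow> J (?g x) = ?f x"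
  proof (rule quotient_map_lift_exists[OF qm fQ])
    fix x y assume xy: "x \<in> topspace ?D" "y \<in> topspace ?D" "?g x = ?g y"
    obtain t z w where x: "x = (t, z, w)" by (cases x)
    obtain t' z' w' where y: "y = (t', z', w')" by (cases y)
    have "t \<in> {0..1}" "(z, w) \<in> XE_fix" "(z', w') \<in> XE_fix" "t = t'" "q (z, w) = q (z', w')"
      using xy x y by simp_all
    then show "?f x = ?f y" unfolding x y by (rule inv)
  qed blast
  show thesis
  proof (rule that[of "\<lambda>t Z. J (t, Z)"])
    show "continuous_map (prod_topology unit_interval (ptop Q)) (ptop Q) (\<lambda>(t, Z). J (t, Z))"
      using J(1) by simp
    fix t z w assume "t \<in> {0..1::real}" "(z, w) \<in> XE_fix"
    then have "(t, z, w) \<in> topspace ?D" using XE_fix_sub by auto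
    from J(2)[OF this] show "J (t, q (z, w)) = q (\<Phi> (P w) t z, w)" by simp
  qed
qed

lemma S_homotopy:
  obtains J where "continuous_map (prod_topology unit_interval (ptop S)) (ptop S) (\<lambda>(t, Z). J t Z)"
    "\<And>t z w. t \<in> {0..1} \<Longrightarrow> (z, w) \<in> topspace (ptop X') \<times> topspace E\<^sub>H \<Longrightarrow>
       J t (q (z, w)) = q (\<Phi> {\<one>\<^bsub>L\<^esub>} t z, w)"
proof -
  let ?D = "prod_topology unit_interval (prod_topology (ptop X') E\<^sub>H)"
  let ?f = "\<lambda>(t, u). q (\<Phi> {\<one>\<^bsub>L\<^esub>} t (fst u), snd u)"
  have s: "continuous_map ?D (ptop X') (\<lambda>u. fst (snd u))" "continuous_map ?D E\<^sub>H (\<lambda>u. snd (snd u))"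
    using continuous_map_compose[OF continuous_map_snd continuous_map_fst]
      continuous_map_compose[OF continuous_map_snd continuous_map_snd] by (auto simp: o_def)
  have "continuous_map ?D (ptop X') (\<lambda>u. \<Phi> {\<one>\<^bsub>L\<^esub>} (fst u) (fst (snd u)))"
    using continuous_map_compose[OF continuous_map_pairedI[OF continuous_map_fst s(1)] \<Phi>_X']
    by (simp add: o_def)
  from continuous_map_compose[OF continuous_map_pairedI[OF this s(2)] quotient_imp_continuous_map[OF S_quotient_map]]
  have fS: "continuous_map ?D (ptop S) ?f" by (simp add: o_def split_beta')
  let ?g = "\<lambda>(t, u). (t :: real, q u)"
  have qm: "quotient_map ?D (prod_topology unit_interval (ptop S)) ?g"
    by (rule quotient_map_times_interval[OF S_quotient_map])
  obtain w1 where w1: "w1 \<in> topspace E\<^sub>H" using EH_ne by blast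
  \<comment> \<open>Equal classes in \<open>S\<close> are equal classes in \<open>Q\<close>, and the
    formula agrees with \<open>JQ\<close> there, so its independence of representatives is inherited
    from \<open>Q\<close>.\<close>
  obtain JQ where JQ: "\<And>t z w. t \<in> {0..1} \<Longrightarrow> (z, w) \<in> XE_fix \<Longrightarrow> JQ t (q (z, w)) = q (\<Phi> (P w) t z, w)"
    using Q_homotopy by metis
  have f_JQ: "?f (t, z, w) = JQ t (q (z, w))"
    if "t \<in> {0..1}" "z \<in> topspace (ptop X')" "w \<in> topspace E\<^sub>H" for t z w
    using JQ[OF that(1) fixed_in_XE_fix[OF that(2,3)]] snd_stab[OF that(3)] by simp
  obtain J where J: "continuous_map (prod_topology unit_interval (ptop S)) (ptop S) J"
    "\<And>x. x \<in> topspace ?D \<Longrightarrow> J (?g x) = ?f x"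
  proof (rule quotient_map_lift_exists[OF qm fS])
    fix x y assume xy: "x \<in> topspace ?D" "y \<in> topspace ?D" "?g x = ?g y"
    obtain t z w where x: "x = (t, z, w)" by (cases x)
    obtain t' z' w' where y: "y = (t', z', w')" by (cases y)
    show "?f x = ?f y" using xy f_JQ[of t z w] f_JQ[of t' z' w'] unfolding x y by simp
  qed blast
  show thesis
  proof (rule that[of "\<lambda>t Z. J (t, Z)"])
    show "continuous_map (prod_topology unit_interval (ptop S)) (ptop S) (\<lambda>(t, Z). J (t, Z))"
      using J(1) by simp
    fix t z w assume "t \<in> {0..1::real}" "(z, w) \<in> topspace (ptop X') \<times> topspace E\<^sub>H"
    then have "(t, z, w) \<in> topspace ?D" by auto
    from J(2)[OF this] show "J (t, q (z, w)) = q (\<Phi> {\<one>\<^bsub>L\<^esub>} t z, w)" by simp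
  qed
qed

lemma Q_retraction:
  obtains j where "continuous_map (ptop Q) (ptop S) j"
    "\<And>z w. (z, w) \<in> XE_fix \<Longrightarrow> j (q (z, w)) = q (\<Phi> (P w) 1 z, w)"
proof -
  let ?D = "prod_topology unit_interval (subtopology XE XE_fix)"
  let ?f = "\<lambda>u. q (\<Phi> (P (snd u)) 1 (fst u), snd u)"
  obtain JQ where JQ: "\<And>t z w. t \<in> {0..1} \<Longrightarrow> (z, w) \<in> XE_fix \<Longrightarrow> JQ t (q (z, w)) = q (\<Phi> (P w) t z, w)"
    using Q_homotopy by metis
  have S_cont: "continuous_map (prod_topology (ptop X') E\<^sub>H) (ptop S) q"
    by (rule quotient_imp_continuous_map[OF S_quotient_map])
  obtain w1 where w1: "w1 \<in> topspace E\<^sub>H" using EH_ne by blast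
  have "pt X' \<in> topspace (ptop X')" using X'(3) by (simp add: pointed_action_def)
  then have base: "q (x0, w) \<in> topspace (ptop S)" for w
    using quotient_imp_surjective_map[OF S_quotient_map] w1 X'(2) pt_S[of w] pt_S[of w1] by auto
  \<comment> \<open>The interval factor is a dummy, present because the gluing lemma speaks of
    homotopies; evaluation at 0 removes it afterwards.\<close>
  have "continuous_map ?D (ptop S) (?f \<circ> snd)"
  proof (rule continuous_map_XE_fix_pieces)
    fix \<Gamma> assume \<Gamma>: "\<Gamma> \<in> stab ` E_fix"
    obtain w0 where w0: "w0 \<in> E_fix" "\<Gamma> = stab w0" using \<Gamma> by blast
    let ?G = "prod_topology unit_interval (subtopology XE (X_fix \<Gamma> \<times> E_part \<Gamma>))"
    have GE: "stab (snd (snd x)) = \<Gamma>" "snd (snd x) \<in> E_fix" "fst (snd x) \<in> X_fix \<Gamma>" if "x \<in> topspace ?G" for x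
      using that E_part_stab[OF w0(1)] w0(2) by auto
    show "continuous_map ?G (ptop S) (?f \<circ> snd)"
    proof (cases "snd ` \<Gamma> = {\<one>\<^bsub>L\<^esub>}")
      case False
      have "continuous_map ?G (ptop S) (\<lambda>_. q (x0, w1))" using base by simp
      then show ?thesis
      proof (rule continuous_map_eq)
        fix x assume x: "x \<in> topspace ?G"
        have "\<Phi> (P (snd (snd x))) 1 (fst (snd x)) = x0"
          using \<Phi>_1[OF GE(2)[OF x]] GE[OF x] False by simp
        then show "q (x0, w1) = (?f \<circ> snd) x" using pt_S[of w1] pt_S[of "snd (snd x)"] by simp
      qed
    next
      case True
      have X_fix: "X_fix \<Gamma> = topspace (ptop X')"
        using trivial_X_fix[OF w0(1)] w0(2) True by simp
      have Epart: "E_part \<Gamma> = topspace E\<^sub>H"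
      proof
        show "E_part \<Gamma> \<subseteq> topspace E\<^sub>H"
        proof
          fix w assume "w \<in> E_part \<Gamma>"
          then show "w \<in> topspace E\<^sub>H" using E_part_stab[OF w0(1)] w0(2) trivial_stab(1)[of w] True by simp
        qed
        show "topspace E\<^sub>H \<subseteq> E_part \<Gamma>"
        proof
          fix w assume w: "w \<in> topspace E\<^sub>H"
          have "stab w = \<Gamma>" using stab_fixed[OF w] trivial_stab(2)[OF w0(1)] w0(2) True by simp
          then show "w \<in> E_part \<Gamma>" using E_part_self[OF fixed_in_E_fix[OF w]] by simp
        qed
      qed
      have "subtopology E (topspace E\<^sub>H) = E\<^sub>H"
        unfolding fixed_space_def by (simp add: subtopology_restrict)
      then have G: "subtopology XE (X_fix \<Gamma> \<times> E_part \<Gamma>) = prod_topology (subtopology (ptop X) (topspace (ptop X'))) E\<^sub>H"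
        by (simp add: subtopology_Times X_fix Epart)
      have s: "continuous_map ?G (subtopology (ptop X) (topspace (ptop X'))) (\<lambda>u. fst (snd u))"
        "continuous_map ?G E\<^sub>H (\<lambda>u. snd (snd u))"
        unfolding G using continuous_map_compose[OF continuous_map_snd continuous_map_fst]
          continuous_map_compose[OF continuous_map_snd continuous_map_snd] by (auto simp: o_def)
      \<comment> \<open>So far the first coordinate varies continuously only in the topology of
        \<open>X\<close>; \<open>\<Phi>_1_X'\<close> turns this into continuity in
        \<open>X'\<close>.\<close>
      have "continuous_map ?G (ptop X') (\<lambda>u. \<Phi> {\<one>\<^bsub>L\<^esub>} 1 (fst (snd u)))"
        using continuous_map_compose[OF s(1) \<Phi>_1_X'] by (simp add: o_def)
      from continuous_map_compose[OF continuous_map_pairedI[OF this s(2)] S_cont]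
      show ?thesis by (rule continuous_map_eq) (use GE True in simp)
    qed
  qed
  from continuous_map_o_Pair[OF this, of 0]
  have fS: "continuous_map (subtopology XE XE_fix) (ptop S) ?f" by (simp add: o_def)
  obtain j where j: "continuous_map (ptop Q) (ptop S) j"
    "\<And>u. u \<in> topspace (subtopology XE XE_fix) \<Longrightarrow> j (q u) = ?f u"
  proof (rule quotient_map_lift_exists[OF Q_quotient_map fS])
    fix x y assume xy: "x \<in> topspace (subtopology XE XE_fix)" "y \<in> topspace (subtopology XE XE_fix)" "q x = q y"
    have "?f u = JQ 1 (q u)" if "u \<in> XE_fix" for u using JQ[of 1 "fst u" "snd u"] that by simp
    then show "?f x = ?f y" using xy by simp
  qed blast
  show thesis
  proof (rule that[OF j(1)])
    fix z w assume "(z, w) \<in> XE_fix"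
    then have "(z, w) \<in> topspace (subtopology XE XE_fix)" using XE_fix_sub by auto
    from j(2)[OF this] show "j (q (z, w)) = q (\<Phi> (P w) 1 z, w)" by simp
  qed
qed

lemma pt_in_Q: "pt Q \<in> topspace (ptop Q)"
  using pt_in_fixed_orbit_smash[OF L(1) XL EL E_ne, of H aH eH] XG H_carrier
    pt_orbit_smash_singleton[OF L(1) XL, of E eL]
  by (simp add: pointed_action_def)

lemma pt_in_S: "pt S \<in> topspace (ptop S)"
  using quotient_imp_surjective_map[OF S_quotient_map] EH_ne X'(2,3) pt_S
  unfolding pointed_action_def by (metis (no_types, lifting) SigmaI ex_in_conv imageI topspace_prod_topology)

text \<open>The inclusion is \<open>id\<close> because an orbit of pairs is literally the same set
  in \<open>S\<close> and in \<open>Q\<close>. Its inverse is the end \<open>j\<close> of the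
  deformation, and the deformation itself, run on \<open>Q\<close> and on \<open>S\<close>, gives
  both homotopies.\<close>

theorem inclusion_equivalence: "pointed_homotopy_equivalence S Q id"
proof -
  obtain w1 where w1: "w1 \<in> topspace E\<^sub>H" using EH_ne by blast
  have w1': "(x0, w1) \<in> XE_fix" "w1 \<in> E_fix"
    using x0_fix fixed_in_E_fix[OF w1] by (auto simp: XE_fix_def)
  obtain JQ where JQ: "continuous_map (prod_topology unit_interval (ptop Q)) (ptop Q) (\<lambda>(t, Z). JQ t Z)"
    "\<And>t z w. t \<in> {0..1} \<Longrightarrow> (z, w) \<in> XE_fix \<Longrightarrow> JQ t (q (z, w)) = q (\<Phi> (P w) t z, w)"
    using Q_homotopy by metis
  obtain JS where JS: "continuous_map (prod_topology unit_interval (ptop S)) (ptop S) (\<lambda>(t, Z). JS t Z)"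
    "\<And>t z w. t \<in> {0..1} \<Longrightarrow> (z, w) \<in> topspace (ptop X') \<times> topspace E\<^sub>H \<Longrightarrow>
       JS t (q (z, w)) = q (\<Phi> {\<one>\<^bsub>L\<^esub>} t z, w)"
    using S_homotopy by metis
  obtain j where j: "continuous_map (ptop Q) (ptop S) j"
    "\<And>z w. (z, w) \<in> XE_fix \<Longrightarrow> j (q (z, w)) = q (\<Phi> (P w) 1 z, w)"
    using Q_retraction by metis
  have Q_top: "topspace (ptop Q) = q ` XE_fix"
    using quotient_imp_surjective_map[OF Q_quotient_map] XE_fix_sub by (simp add: inf_absorb2)
  have S_top: "topspace (ptop S) = q ` (topspace (ptop X') \<times> topspace E\<^sub>H)"
    using quotient_imp_surjective_map[OF S_quotient_map] by simp
  have ptQ: "pt Q = q (x0, w1)" using pt_T by simp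
  have ptS: "pt S = q (x0, w1)" by (rule pt_S)
  have x0': "x0 \<in> topspace (ptop X')" using X'(2,3) by (simp add: pointed_action_def)
  have inc: "continuous_map (ptop S) (ptop Q) id"
  proof (rule continuous_compose_quotient_map[OF S_quotient_map])
    have "continuous_map (prod_topology (ptop X') E\<^sub>H) XE (\<lambda>u. (fst u, snd u))"
    proof (rule continuous_map_pairedI)
      show "continuous_map (prod_topology (ptop X') E\<^sub>H) (ptop X) fst"
        using continuous_map_compose[OF continuous_map_fst X'(4)] by simp
      show "continuous_map (prod_topology (ptop X') E\<^sub>H) E snd"
        using continuous_map_snd[of "ptop X'" E\<^sub>H] unfolding fixed_space_def
        by (rule continuous_map_into_fulltopology)
    qed
    from continuous_map_compose[OF this q_cont]
    have "continuous_map (prod_topology (ptop X') E\<^sub>H) (ptop T) q" by (simp add: o_def)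
    then show "continuous_map (prod_topology (ptop X') E\<^sub>H) (ptop Q) (id \<circ> q)"
      by (subst ptop_Q, simp only: id_comp, intro continuous_map_into_subtopology)
         (use fixed_in_XE_fix q_in_Q in auto)
  qed
  have jpt: "j (pt Q) = pt S"
    using j(2)[OF w1'(1)] \<Phi>_pt[OF w1'(2), of 1] ptQ ptS by simp
  have 1: "pointed_homotopic Q Q j id"
  proof (rule pointed_homotopic_sym, rule pointed_homotopicI[where h = JQ])
    show "JQ 0 Z = id Z" if "Z \<in> topspace (ptop Q)" for Z
    proof -
      obtain z w where "(z, w) \<in> XE_fix" "Z = q (z, w)" using \<open>Z \<in> topspace (ptop Q)\<close> unfolding Q_top by auto
      then show ?thesis using JQ(2)[of 0 z w] \<Phi>_0 XE_fixD(3,4) by simp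
    qed
    show "JQ 1 Z = j Z" if "Z \<in> topspace (ptop Q)" for Z
    proof -
      obtain z w where "(z, w) \<in> XE_fix" "Z = q (z, w)" using \<open>Z \<in> topspace (ptop Q)\<close> unfolding Q_top by auto
      then show ?thesis using JQ(2)[of 1 z w] j(2) by simp
    qed
    show "JQ t (pt Q) = pt Q" if "t \<in> {0..1}" for t
      using JQ(2)[OF that w1'(1)] \<Phi>_pt[OF w1'(2) that] ptQ by simp
  qed (use JQ(1) pt_in_Q in auto)
  have 2: "pointed_homotopic S S j id"
  proof (rule pointed_homotopic_sym, rule pointed_homotopicI[where h = JS])
    show "JS 0 Z = id Z" if "Z \<in> topspace (ptop S)" for Z
    proof -
      obtain z w where zw: "z \<in> topspace (ptop X')" "w \<in> topspace E\<^sub>H" "Z = q (z, w)"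
        using \<open>Z \<in> topspace (ptop S)\<close> unfolding S_top by auto
      then have "\<Phi> (P w) 0 z = z" using \<Phi>_0 XE_fixD(3,4)[OF fixed_in_XE_fix] by blast
      then show ?thesis using JS(2)[of 0 z w] zw snd_stab[OF zw(2)] by simp
    qed
    show "JS 1 Z = j Z" if "Z \<in> topspace (ptop S)" for Z
    proof -
      obtain z w where zw: "z \<in> topspace (ptop X')" "w \<in> topspace E\<^sub>H" "Z = q (z, w)"
        using \<open>Z \<in> topspace (ptop S)\<close> unfolding S_top by auto
      then show ?thesis using JS(2)[of 1 z w] j(2)[OF fixed_in_XE_fix] snd_stab[OF zw(2)] by simp
    qed
    show "JS t (pt S) = pt S" if "t \<in> {0..1}" for t
      using JS(2)[OF that, of x0 w1] \<Phi>_pt[OF w1'(2) that] snd_stab[OF w1] w1 x0' ptS by simp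
  qed (use JS(1) pt_in_S in auto)
  show ?thesis
    unfolding pointed_homotopy_equivalence_def
    using inc j(1) jpt 1 2 ptQ ptS by (auto simp: pointed_map_def intro!: exI[of _ j])
qed

end

section \<open>Equivariant extension over cells\<close>

lemma topspace_disk: "topspace (disk n) = {x. (\<forall>i\<ge>n. x i = 0) \<and> (\<Sum>i<n. (x i)\<^sup>2) \<le> 1}"
  by (auto simp: disk_def topspace_Euclidean_space)

lemma disk_eq: "disk n = subtopology (powertop_real UNIV) (topspace (disk n))"
  by (auto simp: disk_def Euclidean_space_def subtopology_subtopology intro!: arg_cong[where f = "subtopology _"])

lemma continuous_map_powertop_coord:
  "continuous_map (powertop_real UNIV) euclideanreal (\<lambda>x. x i)"
  by (rule continuous_map_product_projection) simp

lemma continuous_map_disk_coord: "continuous_map (disk n) euclideanreal (\<lambda>x. x i)"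
  by (subst disk_eq, rule continuous_map_from_subtopology[OF continuous_map_powertop_coord])

lemma continuous_map_into_disk:
  "continuous_map X (disk n) f \<longleftrightarrow> (\<forall>i. continuous_map X euclideanreal (\<lambda>x. f x i)) \<and> f ` topspace X \<subseteq> topspace (disk n)"
  by (subst disk_eq, subst continuous_map_in_subtopology)
     (auto simp: continuous_map_componentwise_UNIV image_subset_iff_funcset)

lemma closedin_disk: "closedin (powertop_real UNIV) (topspace (disk n))"
proof -
  let ?P = "powertop_real (UNIV :: nat set)"
  have "closedin ?P {x \<in> topspace ?P. x i \<in> {0}}" for i
    by (rule closedin_continuous_map_preimage[OF continuous_map_powertop_coord]) simp
  moreover have "closedin ?P {x \<in> topspace ?P. (\<Sum>i<n. (x i)\<^sup>2) \<in> {..1}}"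
    by (rule closedin_continuous_map_preimage)
       (auto intro!: continuous_map_sum continuous_map_real_pow continuous_map_powertop_coord)
  moreover have "topspace (disk n) = \<Inter>(insert {x \<in> topspace ?P. (\<Sum>i<n. (x i)\<^sup>2) \<in> {..1}}
      ((\<lambda>i. {x \<in> topspace ?P. x i \<in> {0}}) ` {n..}))"
    by (auto simp: topspace_disk)
  ultimately show ?thesis by (auto intro!: closedin_Inter simp del: Inter_insert Inf_insert)
qed

lemma disk_coord_le: "x \<in> topspace (disk n) \<Longrightarrow> \<bar>x i\<bar> \<le> 1"
proof (cases "i < n")
  case True
  assume x: "x \<in> topspace (disk n)"
  have "(x i)\<^sup>2 \<le> (\<Sum>i<n. (x i)\<^sup>2)"
    using True by (intro member_le_sum) auto
  then have "(x i)\<^sup>2 \<le> 1" using x by (simp add: topspace_disk)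
  then show ?thesis by (simp add: abs_square_le_1)
qed (simp add: topspace_disk)

lemma compact_space_disk: "compact_space (disk n)"
proof -
  have "compactin (powertop_real UNIV) (PiE UNIV (\<lambda>_ :: nat. {-1..1}))"
    by (simp add: compactin_PiE)
  moreover have "topspace (disk n) \<subseteq> PiE UNIV (\<lambda>_. {-1..1})"
    using disk_coord_le by (auto simp: abs_le_iff)
  ultimately have "compactin (powertop_real UNIV) (topspace (disk n))"
    using closedin_disk closed_compactin by blast
  then show ?thesis by (subst disk_eq) (simp add: compact_space_subtopology)
qed

lemma closedin_sphere: "closedin (disk n) (topspace (disk n) - open_disk n)"
proof -
  have "topspace (disk n) - open_disk n = {x \<in> topspace (disk n). (\<Sum>i<n. (x i)\<^sup>2) \<in> {1..}}"
    by (auto simp: open_disk_def)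
  moreover have "closedin (disk n) {x \<in> topspace (disk n). (\<Sum>i<n. (x i)\<^sup>2) \<in> {1..}}"
    by (rule closedin_continuous_map_preimage)
       (auto intro!: continuous_map_sum continuous_map_real_pow continuous_map_disk_coord)
  ultimately show ?thesis by simp
qed

lemma open_disk_sub: "open_disk n \<subseteq> topspace (disk n)"
  by (auto simp: open_disk_def)

lemma zero_in_open_disk: "(\<lambda>_. 0) \<in> open_disk n"
  by (simp add: open_disk_def topspace_disk)

text \<open>A map given on the sides and the ends over the finite set \<open>A\<close> of a cylinder over a disk
  is extended along the rays from the centre of the cylinder (of its axis, if \<open>A\<close> is empty).\<close>

lemma extend_to_cylinder:
  assumes Z: "contractible_space Z" "topspace Z \<noteq> {}" and A: "A = {} \<or> A = {0, 1 :: real}"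
    and f: "continuous_map (subtopology (prod_topology unit_interval (disk n))
        ({0..1} \<times> (topspace (disk n) - open_disk n) \<union> A \<times> topspace (disk n))) Z f"
  obtains g where "continuous_map (prod_topology unit_interval (disk n)) Z g"
    "\<And>u. u \<in> {0..1} \<times> (topspace (disk n) - open_disk n) \<union> A \<times> topspace (disk n) \<Longrightarrow> g u = f u"
proof -
  let ?C = "prod_topology unit_interval (disk n)"
  let ?B = "{0..1} \<times> (topspace (disk n) - open_disk n) \<union> A \<times> topspace (disk n)"
  obtain a h where h: "continuous_map (prod_topology unit_interval Z) Z h"
    "\<And>z. h (0, z) = z" "\<And>z. h (1, z) = a"
    using Z(1) unfolding contractible_space_def homotopic_with_def by auto
  obtain z0 where z0: "z0 \<in> topspace Z" using Z(2) by blast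
  have "h (1, z0) \<in> topspace Z"
    using continuous_map_image_subset_topspace[OF h(1)] z0 by (auto simp: image_subset_iff)
  then have a: "a \<in> topspace Z" by (simp add: h)
  define r :: "(nat \<Rightarrow> real) \<Rightarrow> real" where "r x = sqrt (\<Sum>i<n. (x i)\<^sup>2)" for x
  \<comment> \<open>A gauge on the cylinder: its level set 1 is the part of the boundary on which
    \<open>f\<close> is given. If \<open>A\<close> is empty, the ends do not belong to that part and
    only the radius counts.\<close>
  define \<mu> where "\<mu> u = (if A = {} then r (snd u) else max (r (snd u)) \<bar>2 * fst u - 1\<bar>)" for u :: "real \<times> (nat \<Rightarrow> real)"
  \<comment> \<open>Projection onto that part, from the centre (1/2, 0) or from the axis. It is used
    only where \<mu> is at least 1/2, away from division by zero.\<close>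
  define \<rho> where "\<rho> u = (if A = {} then fst u else 1/2 + (fst u - 1/2) / \<mu> u, \<lambda>i. snd u i / \<mu> u)"
    for u :: "real \<times> (nat \<Rightarrow> real)"
  have r_cont: "continuous_map ?C euclideanreal (\<lambda>u. r (snd u))"
    unfolding r_def
    by (intro continuous_map_sqrt continuous_map_sum continuous_map_real_pow
        continuous_map_compose[OF continuous_map_snd continuous_map_disk_coord, unfolded o_def]) auto
  have t_cont: "continuous_map ?C euclideanreal fst"
    using continuous_map_fst continuous_map_in_subtopology by blast
  have x_cont: "continuous_map ?C euclideanreal (\<lambda>u. snd u i)" for i
    by (rule continuous_map_compose[OF continuous_map_snd continuous_map_disk_coord, unfolded o_def])
  have \<mu>_cont: "continuous_map ?C euclideanreal \<mu>"
  proof (cases "A = {}")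
    case True
    then show ?thesis using r_cont by (simp add: \<mu>_def[abs_def])
  next
    case False
    have "continuous_map ?C euclideanreal (\<lambda>u. max (r (snd u)) \<bar>2 * fst u - 1\<bar>)"
      by (intro continuous_map_real_max r_cont continuous_map_real_abs continuous_map_diff
          continuous_map_real_mult t_cont) auto
    then show ?thesis using False by (simp add: \<mu>_def[abs_def])
  qed
  have r_le: "r x \<le> 1" if "x \<in> topspace (disk n)" for x
    using that by (simp add: r_def topspace_disk)
  have r_1: "r x = 1 \<longleftrightarrow> x \<notin> open_disk n" if "x \<in> topspace (disk n)" for x
    using that by (auto simp: r_def topspace_disk open_disk_def)
  have r_div: "r (\<lambda>i. x i / c) = r x / c" if "c > 0" for x c
    using that by (simp add: r_def power_divide real_sqrt_divide flip: sum_divide_distrib)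
  have r_nn: "0 \<le> r x" for x by (simp add: r_def sum_nonneg)
  have \<mu>_le: "\<mu> u \<le> 1" if "u \<in> topspace ?C" for u
    using that r_le by (auto simp: \<mu>_def abs_le_iff)
  have \<rho>_B: "\<rho> u \<in> ?B" if u: "u \<in> topspace ?C" "1/2 \<le> \<mu> u" for u
  proof -
    obtain t x where tx: "u = (t, x)" "t \<in> {0..1}" "x \<in> topspace (disk n)" using u by auto
    let ?y = "\<lambda>i. x i / \<mu> u"
    have "r ?y \<le> 1" using r_div[of "\<mu> u" x] u(2) tx by (auto simp: \<mu>_def)
    then have y: "?y \<in> topspace (disk n)" using tx(3) by (auto simp: topspace_disk r_def)
    show ?thesis
    proof (cases "\<mu> u = r x")
      case True
      then have "?y \<notin> open_disk n" using r_1[OF y] r_div[of "\<mu> u" x] u(2) by simp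
      moreover have "fst (\<rho> u) \<in> {0..1}"
      proof (cases "A = {}")
        case False
        then have "\<bar>2 * t - 1\<bar> \<le> \<mu> u" using tx by (simp add: \<mu>_def)
        then have "\<bar>(t - 1/2) / \<mu> u\<bar> \<le> 1/2" using u(2) by (simp add: abs_divide field_simps)
        moreover have "fst (\<rho> u) = 1/2 + (t - 1/2) / \<mu> u" using False tx by (simp add: \<rho>_def)
        ultimately show ?thesis unfolding atLeastAtMost_iff by linarith
      qed (use tx in \<open>simp add: \<rho>_def\<close>)
      ultimately show ?thesis using y tx by (auto simp: \<rho>_def)
    next
      case False
      then have A1: "A = {0, 1}" and eq: "\<mu> u = \<bar>2 * t - 1\<bar>" using A tx by (auto simp: \<mu>_def max_def split: if_splits)
      have "1/2 + (t - 1/2) / \<mu> u = 0 \<or> 1/2 + (t - 1/2) / \<mu> u = 1"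
        using u(2) unfolding eq by (cases "2 * t - 1 \<ge> 0") (auto simp: field_simps)
      then show ?thesis using A1 y tx by (auto simp: \<rho>_def)
    qed
  qed
  have \<rho>_id: "\<rho> u = u \<and> \<mu> u = 1" if u: "u \<in> ?B" "u \<in> topspace ?C" for u
  proof -
    obtain t x where tx: "u = (t, x)" "t \<in> {0..1}" "x \<in> topspace (disk n)" using u by auto
    have "\<mu> u = 1"
    proof (cases "x \<in> open_disk n")
      case False
      then have "r x = 1" using r_1 tx by blast
      then show ?thesis using tx by (auto simp: \<mu>_def max_def)
    next
      case True
      then have "t \<in> A" using u tx by auto
      then show ?thesis using A r_le[OF tx(3)] tx by (auto simp: \<mu>_def max_def)
    qed
    then show ?thesis by (simp add: \<rho>_def tx)
  qed
  let ?U = "{u \<in> topspace ?C. 1/2 \<le> \<mu> u}"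
  have \<mu>_cont': "continuous_map (subtopology ?C ?U) euclideanreal \<mu>"
    by (rule continuous_map_from_subtopology[OF \<mu>_cont])
  have "continuous_map (subtopology ?C ?U) (subtopology ?C ?B) \<rho>"
    unfolding continuous_map_in_subtopology
  proof
    show "\<rho> \<in> topspace (subtopology ?C ?U) \<rightarrow> ?B" using \<rho>_B by auto
    have 1: "continuous_map (subtopology ?C ?U) euclideanreal (\<lambda>u. fst (\<rho> u))"
      unfolding \<rho>_def fst_conv
    proof (cases "A = {}")
      case True
      then show "continuous_map (subtopology ?C ?U) euclideanreal
          (\<lambda>u. if A = {} then fst u else 1/2 + (fst u - 1/2) / \<mu> u)"
        using continuous_map_from_subtopology[OF t_cont] by simp
    next
      case False
      have "continuous_map (subtopology ?C ?U) euclideanreal (\<lambda>u. 1/2 + (fst u - 1/2) / \<mu> u)"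
        by (intro continuous_map_add continuous_map_real_divide continuous_map_diff \<mu>_cont'
            continuous_map_from_subtopology[OF t_cont]) auto
      then show "continuous_map (subtopology ?C ?U) euclideanreal
          (\<lambda>u. if A = {} then fst u else 1/2 + (fst u - 1/2) / \<mu> u)"
        using False by simp
    qed
    have 2: "continuous_map (subtopology ?C ?U) euclideanreal (\<lambda>u. snd (\<rho> u) i)" for i
      unfolding \<rho>_def snd_conv
      by (intro continuous_map_real_divide continuous_map_from_subtopology[OF x_cont] \<mu>_cont') auto
    have "?B \<subseteq> {0..1} \<times> topspace (disk n)" using A by auto
    then have "fst (\<rho> u) \<in> {0..1}" "snd (\<rho> u) \<in> topspace (disk n)" if "u \<in> ?U" for u
      using \<rho>_B[of u] that by (auto simp: mem_Times_iff)
    then have "continuous_map (subtopology ?C ?U) ?C (\<lambda>u. (fst (\<rho> u), snd (\<rho> u)))"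
      using 1 2 by (intro continuous_map_pairedI)
        (auto simp: continuous_map_in_subtopology continuous_map_into_disk)
    then show "continuous_map (subtopology ?C ?U) ?C \<rho>" by simp
  qed
  from continuous_map_compose[OF this f]
  have f\<rho>: "continuous_map (subtopology ?C ?U) Z (\<lambda>u. f (\<rho> u))" by (simp add: o_def)
  have "continuous_map (subtopology ?C ?U) euclideanreal (\<lambda>u. 2 - 2 * \<mu> u)"
    by (intro continuous_map_diff continuous_map_real_mult \<mu>_cont') auto
  then have "continuous_map (subtopology ?C ?U) unit_interval (\<lambda>u. 2 - 2 * \<mu> u)"
    using \<mu>_le by (auto simp: continuous_map_in_subtopology)
  from continuous_map_compose[OF continuous_map_pairedI[OF this f\<rho>] h(1)]
  have hf: "continuous_map (subtopology ?C ?U) Z (\<lambda>u. h (2 - 2 * \<mu> u, f (\<rho> u)))" by (simp add: o_def)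
  show thesis
  proof (rule that)
    \<comment> \<open>While \<mu> falls from 1 to 1/2 the contraction of \<open>Z\<close> runs from
      time 0 to time 1, so the map has become constant when the inner half is reached.\<close>
    show "continuous_map ?C Z (\<lambda>u. if 1/2 \<le> \<mu> u then h (2 - 2 * \<mu> u, f (\<rho> u)) else a)"
    proof (rule continuous_map_cases_le[OF _ \<mu>_cont hf])
      fix u assume "1/2 = \<mu> u"
      then have "2 - 2 * \<mu> u = 1" by simp
      then show "h (2 - 2 * \<mu> u, f (\<rho> u)) = a" by (simp only: h)
    qed (use a in auto)
    fix u assume u: "u \<in> ?B"
    then have "u \<in> topspace ?C" using A by auto
    then show "(if 1/2 \<le> \<mu> u then h (2 - 2 * \<mu> u, f (\<rho> u)) else a) = f u"
      using \<rho>_id[OF u] h by simp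
  qed
qed


text \<open>By the weak topology the complex is a quotient of the disjoint union of its disks, and
  the product with the interval preserves this.\<close>

lemma continuous_map_cells:
  assumes C: "equivariant_cw_structure K X a C"
    and cont: "\<And>n \<phi>. \<phi> \<in> C n \<Longrightarrow> continuous_map (prod_topology unit_interval (disk n)) Z (\<lambda>(t, x). F t (\<phi> x))"
  shows "continuous_map (prod_topology unit_interval X) Z (\<lambda>(t, x). F t x)"
proof -
  let ?I = "SIGMA n:UNIV. C n"
  let ?S = "sum_topology (\<lambda>(n, \<phi>). disk n) ?I" and ?p = "\<lambda>((n, \<phi>), x). \<phi> x"
  have cell_cont: "continuous_map (disk n) X \<phi>" if "\<phi> \<in> C n" for n \<phi>
    using C that by (auto simp: equivariant_cw_structure_def)
  have cover: "(\<Union>n. \<Union>\<phi>\<in>C n. \<phi> ` open_disk n) = topspace X"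
    using C by (simp add: equivariant_cw_structure_def)
  have weak: "closedin X A" if "A \<subseteq> topspace X"
      "\<And>n \<phi>. \<phi> \<in> C n \<Longrightarrow> closedin (disk n) {x \<in> topspace (disk n). \<phi> x \<in> A}" for A
    using C that unfolding equivariant_cw_structure_def by meson
  have q: "quotient_map ?S X ?p"
    unfolding quotient_map_closedin
  proof (intro conjI allI impI)
    show "?p ` topspace ?S = topspace X"
    proof
      show "?p ` topspace ?S \<subseteq> topspace X"
        using continuous_map_image_subset_topspace[OF cell_cont] by (force simp: image_subset_iff)
      show "topspace X \<subseteq> ?p ` topspace ?S"
      proof
        fix y assume "y \<in> topspace X"
        then obtain n \<phi> x where "\<phi> \<in> C n" "x \<in> open_disk n" "y = \<phi> x" using cover by blast
        then show "y \<in> ?p ` topspace ?S"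
          using open_disk_sub by (intro image_eqI[of _ _ "((n, \<phi>), x)"]) auto
      qed
    qed
    fix A assume A: "A \<subseteq> topspace X"
    have eq: "{x. (i, x) \<in> {u \<in> topspace ?S. ?p u \<in> A}} = {x \<in> topspace (disk (fst i)). snd i x \<in> A}"
      if "i \<in> ?I" for i
      using that by auto
    have "closedin ?S {u \<in> topspace ?S. ?p u \<in> A} \<longleftrightarrow>
        (\<forall>i\<in>?I. closedin (disk (fst i)) {x \<in> topspace (disk (fst i)). snd i x \<in> A})"
      unfolding closedin_sum_topology using eq by (auto simp: split_beta)
    also have "\<dots> \<longleftrightarrow> closedin X A"
    proof
      assume "\<forall>i\<in>?I. closedin (disk (fst i)) {x \<in> topspace (disk (fst i)). snd i x \<in> A}"
      then show "closedin X A" by (intro weak[OF A]) force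
    next
      assume "closedin X A"
      then show "\<forall>i\<in>?I. closedin (disk (fst i)) {x \<in> topspace (disk (fst i)). snd i x \<in> A}"
        using closedin_continuous_map_preimage[OF cell_cont] by auto
    qed
    finally show "closedin ?S {u \<in> topspace ?S. ?p u \<in> A} = closedin X A" .
  qed
  have "continuous_map (prod_topology unit_interval ?S) Z (\<lambda>(t, u). F t (?p u))"
  proof (rule pasting_lemma[of ?I "prod_topology unit_interval ?S" "\<lambda>i. {0..1} \<times> ({i} \<times> topspace (disk (fst i)))"
        Z "\<lambda>_. \<lambda>(t, u). F t (?p u)"])
    fix i assume i: "i \<in> ?I"
    have slice: "openin ?S ({i} \<times> U)" if "openin (disk (fst i)) U" for U
    proof -
      have "{x. (j, x) \<in> {i} \<times> U} = (if j = i then U else {})" for j by auto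
      then show ?thesis
        using that openin_subset[OF that] i by (auto simp: openin_sum_topology split_beta)
    qed
    have o: "openin ?S ({i} \<times> topspace (disk (fst i)))" by (rule slice) simp
    then show "openin (prod_topology unit_interval ?S) ({0..1} \<times> ({i} \<times> topspace (disk (fst i))))"
      by (simp add: openin_prod_Times_iff)
    have "continuous_map (subtopology ?S ({i} \<times> topspace (disk (fst i)))) (disk (fst i)) snd"
      unfolding continuous_map_def
    proof (intro conjI allI impI)
      show "snd \<in> topspace (subtopology ?S ({i} \<times> topspace (disk (fst i)))) \<rightarrow> topspace (disk (fst i))" by auto
      fix U assume U: "openin (disk (fst i)) U"
      have "openin ?S ({i} \<times> U)" using U by (rule slice)
      moreover have "{x \<in> topspace (subtopology ?S ({i} \<times> topspace (disk (fst i)))). snd x \<in> U} =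
          {i} \<times> U \<inter> ({i} \<times> topspace (disk (fst i)))"
        using i openin_subset[OF U] by auto
      ultimately show "openin (subtopology ?S ({i} \<times> topspace (disk (fst i))))
          {x \<in> topspace (subtopology ?S ({i} \<times> topspace (disk (fst i)))). snd x \<in> U}"
        by (auto simp: openin_subtopology)
    qed
    then have "continuous_map (prod_topology unit_interval (subtopology ?S ({i} \<times> topspace (disk (fst i)))))
        (prod_topology unit_interval (disk (fst i))) (\<lambda>u. (fst u, snd (snd u)))"
      by (intro continuous_map_pairedI continuous_map_fst
          continuous_map_compose[OF continuous_map_snd, unfolded o_def])
    from continuous_map_compose[OF this cont[of "snd i" "fst i"]]
    have "continuous_map (prod_topology unit_interval (subtopology ?S ({i} \<times> topspace (disk (fst i))))) Z
        (\<lambda>u. F (fst u) (snd i (snd (snd u))))"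
      using i by (auto simp: o_def)
    then have "continuous_map (prod_topology unit_interval (subtopology ?S ({i} \<times> topspace (disk (fst i))))) Z
        (\<lambda>(t, u). F t (?p u))"
      by (rule continuous_map_eq) (auto simp: split_beta)
    moreover have "subtopology (prod_topology unit_interval ?S) ({0..1} \<times> ({i} \<times> topspace (disk (fst i)))) =
        prod_topology unit_interval (subtopology ?S ({i} \<times> topspace (disk (fst i))))"
      by (simp add: subtopology_Times subtopology_subtopology)
    ultimately show "continuous_map (subtopology (prod_topology unit_interval ?S) ({0..1} \<times> ({i} \<times> topspace (disk (fst i))))) Z
        (\<lambda>(t, u). F t (?p u))"
      by simp
  next
    fix x assume "x \<in> topspace (prod_topology unit_interval ?S)"
    then show "\<exists>j. j \<in> ?I \<and> x \<in> {0..1} \<times> {j} \<times> topspace (disk (fst j)) \<and>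
        (case x of (t, u) \<Rightarrow> F t (?p u)) = (case x of (t, u) \<Rightarrow> F t (?p u))"
      by (intro exI[of _ "fst (snd x)"]) auto
  qed auto
  then show ?thesis
    by (rule continuous_map_times_interval_quotient[OF q])
qed

text \<open>Maps from a free complex \<open>X\<close> to a space \<open>Z\<close> are extended cell
  by cell. Since cells are permuted freely, equivariance imposes no condition within a single cell,
  and contractibility of \<open>Z\<close> as a plain space makes the extension possible.\<close>

locale free_cw =
  fixes L :: "('l, 'm) monoid_scheme" and X :: "'a topology" and a :: "'l \<Rightarrow> 'a \<Rightarrow> 'a"
    and C :: "nat \<Rightarrow> ((nat \<Rightarrow> real) \<Rightarrow> 'a) set" and Z :: "'z topology" and b :: "'l \<Rightarrow> 'z \<Rightarrow> 'z"
  assumes L: "group L" and cw: "equivariant_cw_structure L X a C"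
    and Xact: "continuous_action L X a"
    and free: "\<And>l x. l \<in> carrier L \<Longrightarrow> x \<in> topspace X \<Longrightarrow> a l x = x \<Longrightarrow> l = \<one>\<^bsub>L\<^esub>"
    and Zact: "continuous_action L Z b" and Z: "contractible_space Z" "topspace Z \<noteq> {}"
begin

sublocale group L by (rule L)

section \<open>Cells and skeleta of a free complex\<close>

lemma open_diskD: "u \<in> open_disk n \<Longrightarrow> u \<in> topspace (disk n)"
  using open_disk_sub by blast

text \<open>The index is shifted by one: \<open>skel n\<close> is the skeleton of dimension n - 1,
  and \<open>skel 0\<close> is empty.\<close>

definition skel :: "nat \<Rightarrow> 'a set" where
  "skel n = (\<Union>m\<in>{..<n}. \<Union>\<phi>\<in>C m. \<phi> ` open_disk m)"

lemma cell_cont: "\<phi> \<in> C n \<Longrightarrow> continuous_map (disk n) X \<phi>"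
  using cw by (auto simp: equivariant_cw_structure_def)

lemma cell_in: "\<phi> \<in> C n \<Longrightarrow> x \<in> topspace (disk n) \<Longrightarrow> \<phi> x \<in> topspace X"
  using continuous_map_image_subset_topspace[OF cell_cont] by blast

lemma cell_eq:
  assumes "\<phi> \<in> C m" "\<psi> \<in> C n" "u \<in> open_disk m" "v \<in> open_disk n" "\<phi> u = \<psi> v"
  shows "m = n" "u = v" "\<And>x. x \<in> topspace (disk n) \<Longrightarrow> \<phi> x = \<psi> x"
proof -
  have ne: "\<phi> ` open_disk m \<inter> \<psi> ` open_disk n \<noteq> {}" using assms by blast
  have *: "m = n \<and> (\<forall>x\<in>topspace (disk n). \<phi> x = \<psi> x)"
    using cw assms(1,2) ne unfolding equivariant_cw_structure_def by meson
  then show "m = n" "\<And>x. x \<in> topspace (disk n) \<Longrightarrow> \<phi> x = \<psi> x" by auto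
  have "\<phi> u = \<phi> v" using * assms open_disk_sub by (metis subsetD)
  moreover have "inj_on \<phi> (open_disk m)" using cw assms(1) by (auto simp: equivariant_cw_structure_def)
  ultimately show "u = v" using assms * by (auto dest: inj_onD)
qed

lemma cell_translate:
  assumes "\<phi> \<in> C n" "l \<in> carrier L"
  obtains \<psi> where "\<psi> \<in> C n" "\<And>x. x \<in> topspace (disk n) \<Longrightarrow> \<psi> x = a l (\<phi> x)"
proof -
  have "\<forall>l\<in>carrier L. \<forall>n. \<forall>\<phi>\<in>C n. \<exists>\<psi>\<in>C n. \<forall>x\<in>topspace (disk n). \<psi> x = a l (\<phi> x)"
    using cw by (simp add: equivariant_cw_structure_def)
  with assms obtain \<psi> where "\<psi> \<in> C n" "\<forall>x\<in>topspace (disk n). \<psi> x = a l (\<phi> x)" by blast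
  with that show thesis by blast
qed

lemma cell_boundary:
  assumes "\<phi> \<in> C n"
  obtains F where "finite F" "F \<subseteq> (SIGMA m:{..<n}. C m)"
    "\<phi> ` (topspace (disk n) - open_disk n) \<subseteq> (\<Union>(m, \<psi>)\<in>F. \<psi> ` open_disk m)"
  using cw assms unfolding equivariant_cw_structure_def by meson

lemma cells_cover: "x \<in> topspace X \<Longrightarrow> \<exists>n. x \<in> skel n"
proof -
  assume "x \<in> topspace X"
  moreover have "(\<Union>n. \<Union>\<phi>\<in>C n. \<phi> ` open_disk n) = topspace X"
    using cw by (simp add: equivariant_cw_structure_def)
  ultimately obtain n \<phi> where "\<phi> \<in> C n" "x \<in> \<phi> ` open_disk n" by blast
  then show ?thesis by (intro exI[of _ "Suc n"]) (auto simp: skel_def)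
qed

lemma skel_mono: "m \<le> n \<Longrightarrow> skel m \<subseteq> skel n"
  by (fastforce simp: skel_def)

lemma skel_sub: "skel n \<subseteq> topspace X"
  using cell_in open_disk_sub by (force simp: skel_def)

lemma boundary_in_skel:
  assumes "\<phi> \<in> C n" "x \<in> topspace (disk n)" "x \<notin> open_disk n"
  shows "\<phi> x \<in> skel n"
proof -
  obtain F where F: "F \<subseteq> (SIGMA m:{..<n}. C m)"
      "\<phi> ` (topspace (disk n) - open_disk n) \<subseteq> (\<Union>(m, \<psi>)\<in>F. \<psi> ` open_disk m)"
    using cell_boundary[OF assms(1)] by metis
  have "\<phi> x \<in> (\<Union>(m, \<psi>)\<in>F. \<psi> ` open_disk m)" using F(2) assms(2,3) by blast
  then obtain m \<psi> where "(m, \<psi>) \<in> F" "\<phi> x \<in> \<psi> ` open_disk m" by blast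
  then show ?thesis using F(1) by (force simp: skel_def)
qed

lemma cell_in_skel: "\<phi> \<in> C n \<Longrightarrow> x \<in> topspace (disk n) \<Longrightarrow> \<phi> x \<in> skel (Suc n)"
proof (cases "x \<in> open_disk n")
  case False
  assume "\<phi> \<in> C n" "x \<in> topspace (disk n)"
  then show ?thesis using boundary_in_skel False skel_mono[of n "Suc n"] by auto
qed (auto simp: skel_def)

lemma open_cell_notin_skel: "\<phi> \<in> C n \<Longrightarrow> u \<in> open_disk n \<Longrightarrow> \<phi> u \<notin> skel n"
  using cell_eq(1) by (fastforce simp: skel_def)

lemma skel_SucE:
  assumes "x \<in> skel (Suc n)" "x \<notin> skel n"
  obtains \<phi> u where "\<phi> \<in> C n" "u \<in> open_disk n" "x = \<phi> u"
proof -
  obtain m \<phi> u where m: "m < Suc n" "\<phi> \<in> C m" "u \<in> open_disk m" "x = \<phi> u"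
    using assms(1) by (auto simp: skel_def)
  moreover have "\<not> m < n" using m assms(2) by (auto simp: skel_def)
  ultimately show thesis using that by (simp add: less_Suc_eq)
qed

lemma skel_act: "x \<in> skel n \<Longrightarrow> l \<in> carrier L \<Longrightarrow> a l x \<in> skel n"
proof -
  assume "x \<in> skel n" and l: "l \<in> carrier L"
  then obtain m \<phi> u where m: "m < n" "\<phi> \<in> C m" "u \<in> open_disk m" "x = \<phi> u" by (auto simp: skel_def)
  obtain \<psi> where "\<psi> \<in> C m" "\<And>x. x \<in> topspace (disk m) \<Longrightarrow> \<psi> x = a l (\<phi> x)"
    using cell_translate[OF m(2) l] by blast
  then have "a l x = \<psi> u" "\<psi> \<in> C m" using m open_diskD by auto
  then show ?thesis using m by (auto simp: skel_def)
qed

lemma skel_act_iff: "x \<in> topspace X \<Longrightarrow> l \<in> carrier L \<Longrightarrow> a l x \<in> skel n \<longleftrightarrow> x \<in> skel n"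
  using skel_act action_inv(1)[OF L Xact] by (metis inv_closed)

text \<open>\<open>A\<close> is the set of times at which the values are prescribed by
  \<open>g\<close>: the empty set when a map is to be constructed, the two end points when a
  homotopy is. Continuity is asked on the disks, cell by cell, which is the form that the extension
  over the next cells uses.\<close>

definition partial_map :: "real set \<Rightarrow> (real \<Rightarrow> 'a \<Rightarrow> 'z) \<Rightarrow> nat \<Rightarrow> (real \<Rightarrow> 'a \<Rightarrow> 'z) \<Rightarrow> bool" where
  "partial_map A g n F \<longleftrightarrow>
     (\<forall>m<n. \<forall>\<phi>\<in>C m. continuous_map (prod_topology unit_interval (disk m)) Z (\<lambda>(t, x). F t (\<phi> x))) \<and>
     (\<forall>t\<in>{0..1}. \<forall>l\<in>carrier L. \<forall>x\<in>skel n. F t (a l x) = b l (F t x)) \<and>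
     (\<forall>t\<in>A. \<forall>x\<in>skel n. F t x = g t x)"

text \<open>The boundary of the cell lies in finitely many closed cells of lower dimension. Each of
  these is a quotient of its disk, by compactness, so \<open>F\<close> is continuous on it as a
  function of points of \<open>X\<close>; finitely many closed pieces then glue, together with the
  ends over \<open>A\<close>.\<close>

lemma boundary_map_continuous:
  assumes A: "A = {} \<or> A = {0, 1 :: real}"
    and g: "\<And>t. t \<in> A \<Longrightarrow> continuous_map X Z (g t)"
    and F: "partial_map A g n F" and \<phi>: "\<phi> \<in> C n"
  shows "continuous_map (subtopology (prod_topology unit_interval (disk n))
        ({0..1} \<times> (topspace (disk n) - open_disk n) \<union> A \<times> topspace (disk n))) Z
      (\<lambda>(t, x). if t \<in> A then g t (\<phi> x) else F t (\<phi> x))"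
proof -
  let ?D = "prod_topology unit_interval (disk n)" and ?S = "topspace (disk n) - open_disk n"
  let ?B = "{0..1} \<times> ?S \<union> A \<times> topspace (disk n)"
  let ?f = "\<lambda>(t, x). if t \<in> A then g t (\<phi> x) else F t (\<phi> x)"
  obtain N where N: "finite N" "N \<subseteq> (SIGMA m:{..<n}. C m)" "\<phi> ` ?S \<subseteq> (\<Union>(m, \<psi>)\<in>N. \<psi> ` open_disk m)"
    using cell_boundary[OF \<phi>] by metis
  let ?K = "\<lambda>(m, \<psi>). {x \<in> topspace (disk n). \<phi> x \<in> \<psi> ` topspace (disk m)} \<inter> ?S"
  let ?T = "\<lambda>i. case i of Inl k \<Rightarrow> {0..1} \<times> ?K k | Inr t \<Rightarrow> {t} \<times> topspace (disk n)"
  have A01: "A \<subseteq> {0..1}" "finite A" using A by auto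
  have Haus: "Hausdorff_space X" using cw by (simp add: equivariant_cw_structure_def)
  have F_closed: "closedin X (\<psi> ` topspace (disk m))" if "\<psi> \<in> C m" for m \<psi>
    using compactin_imp_closedin[OF Haus] image_compactin[OF _ cell_cont[OF that]] compact_space_disk
    by (simp add: compact_space_def)
  have agree: "?f (t, x) = F t (\<phi> x)" if "x \<in> ?S" "t \<in> {0..1}" for t x
    using that F boundary_in_skel[OF \<phi>] by (auto simp: partial_map_def)
  show ?thesis
  proof (rule pasting_lemma_closed[of "Inl ` N \<union> Inr ` A" _ "\<lambda>i. ?T i" Z "\<lambda>i. ?f"])
    show "finite (Inl ` N \<union> Inr ` A)" using N A01 by simp
    fix i assume i: "i \<in> Inl ` N \<union> Inr ` A"
    have sub: "?T i \<subseteq> ?B" using i by auto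
    show "closedin (subtopology ?D ?B) (?T i)"
    proof -
      have "closedin ?D (?T i)"
      proof (cases i)
        case (Inl k)
        then obtain m \<psi> where k: "k = (m, \<psi>)" "\<psi> \<in> C m" using i N(2) by auto
        have "closedin (disk n) {x \<in> topspace (disk n). \<phi> x \<in> \<psi> ` topspace (disk m)}"
          by (rule closedin_continuous_map_preimage[OF cell_cont[OF \<phi>] F_closed[OF k(2)]])
        then show ?thesis using k Inl closedin_sphere[of n]
          by (simp add: closedin_prod_Times_iff closedin_Int)
      next
        case (Inr t)
        then have "t \<in> {0..1}" using i A01 by auto
        then have "closedin unit_interval {t}" by (simp add: closedin_subtopology_Int_closed closed_subset)
        then show ?thesis using Inr by (simp add: closedin_prod_Times_iff)
      qed
      then show ?thesis using sub by (rule closedin_subset_topspace)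
    qed
    have "continuous_map (subtopology ?D (?T i)) Z ?f"
    proof (cases i)
      case (Inl k)
      then obtain m \<psi> where k: "k = (m, \<psi>)" "\<psi> \<in> C m" "m < n" using i N(2) by auto
      let ?Y = "subtopology X (\<psi> ` topspace (disk m))"
      have \<psi>c: "continuous_map (disk m) ?Y \<psi>"
        using cell_cont[OF k(2)] by (simp add: continuous_map_in_subtopology)
      have q: "quotient_map (disk m) ?Y \<psi>"
      proof (rule continuous_closed_imp_quotient_map[OF \<psi>c])
        show "closed_map (disk m) ?Y \<psi>"
          by (rule continuous_imp_closed_map[OF \<psi>c compact_space_disk]) (simp add: Haus Hausdorff_space_subtopology)
        show "\<psi> ` topspace (disk m) = topspace ?Y"
          using continuous_map_image_subset_topspace[OF cell_cont[OF k(2)]] by auto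
      qed
      have "continuous_map (prod_topology unit_interval (disk m)) Z (\<lambda>(t, x). F t (\<psi> x))"
        using F k by (simp add: partial_map_def)
      then have FY: "continuous_map (prod_topology unit_interval ?Y) Z (\<lambda>(t, y). F t y)"
        by (rule continuous_map_times_interval_quotient[OF q])
      let ?E = "prod_topology unit_interval (subtopology (disk n) (?K k))"
      have "continuous_map (subtopology (disk n) (?K k)) ?Y \<phi>"
        using continuous_map_from_subtopology[OF cell_cont[OF \<phi>]] k by (auto simp: continuous_map_in_subtopology)
      then have "continuous_map ?E (prod_topology unit_interval ?Y) (\<lambda>u. (fst u, \<phi> (snd u)))"
        by (intro continuous_map_pairedI continuous_map_fst continuous_map_compose[OF continuous_map_snd, unfolded o_def])
      from continuous_map_compose[OF this FY]
      have "continuous_map ?E Z (\<lambda>u. F (fst u) (\<phi> (snd u)))" by (simp add: o_def)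
      then have "continuous_map ?E Z ?f"
      proof (rule continuous_map_eq)
        fix u assume u: "u \<in> topspace ?E"
        then have "snd u \<in> ?S" "fst u \<in> {0..1}" using k by auto
        then show "F (fst u) (\<phi> (snd u)) = ?f u" using agree[of "snd u" "fst u"] by simp
      qed
      moreover have "?E = subtopology ?D ({0..1} \<times> ?K k)"
        by (simp add: subtopology_Times subtopology_subtopology)
      ultimately show ?thesis using Inl by simp
    next
      case (Inr t)
      then have t: "t \<in> A" using i by auto
      have "continuous_map ?D Z (g t \<circ> (\<phi> \<circ> snd))"
        by (rule continuous_map_compose[OF continuous_map_compose[OF continuous_map_snd cell_cont[OF \<phi>]] g[OF t]])
      then have "continuous_map (subtopology ?D (?T i)) Z (g t \<circ> (\<phi> \<circ> snd))"
        by (rule continuous_map_from_subtopology)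
      then show ?thesis by (rule continuous_map_eq) (use Inr t in auto)
    qed
    moreover have "subtopology (subtopology ?D ?B) (?T i) = subtopology ?D (?T i)"
      using sub by (simp add: subtopology_subtopology Int_absorb1)
    ultimately show "continuous_map (subtopology (subtopology ?D ?B) (?T i)) Z ?f" by simp
  next
    fix u assume u: "u \<in> topspace (subtopology ?D ?B)"
    obtain t x where tx: "u = (t, x)" by force
    show "\<exists>j. j \<in> Inl ` N \<union> Inr ` A \<and> u \<in> ?T j \<and> ?f u = ?f u"
    proof (cases "t \<in> A")
      case True
      then show ?thesis using u tx by (intro exI[of _ "Inr t"]) auto
    next
      case False
      then have x: "x \<in> ?S" "t \<in> {0..1}" using u tx by auto
      then have "\<phi> x \<in> (\<Union>(m, \<psi>)\<in>N. \<psi> ` open_disk m)" using N(3) by blast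
      then obtain m \<psi> where "(m, \<psi>) \<in> N" "\<phi> x \<in> \<psi> ` open_disk m" by blast
      then have "(m, \<psi>) \<in> N" "\<phi> x \<in> \<psi> ` topspace (disk m)" using open_disk_sub by blast+
      then show ?thesis using x tx by (intro exI[of _ "Inl (m, \<psi>)"]) auto
    qed
  qed auto
qed

text \<open>The cells in the orbit of the open n-cell that contains \<open>x\<close>. The set is the
  same for all points of an open cell and for all their translates, so a choice made from it is a
  choice of one cell per orbit.\<close>

definition orbit_cells :: "nat \<Rightarrow> 'a \<Rightarrow> ((nat \<Rightarrow> real) \<Rightarrow> 'a) set" where
  "orbit_cells n x = {\<psi> \<in> C n. \<exists>l\<in>carrier L. \<exists>u\<in>open_disk n. a l x = \<psi> u}"

text \<open>The translate of \<phi> is again a characteristic map and shares an interior point with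
  \<psi>, so the two agree on the whole disk.\<close>

lemma orbit_cells_cell:
  assumes \<phi>: "\<phi> \<in> C n" and v: "v \<in> open_disk n" and \<psi>: "\<psi> \<in> orbit_cells n (\<phi> v)"
  obtains l where "l \<in> carrier L" "\<And>x. x \<in> topspace (disk n) \<Longrightarrow> a l (\<phi> x) = \<psi> x"
proof -
  obtain l u where l: "\<psi> \<in> C n" "l \<in> carrier L" "u \<in> open_disk n" "a l (\<phi> v) = \<psi> u"
    using \<psi> by (auto simp: orbit_cells_def)
  obtain \<xi> where \<xi>: "\<xi> \<in> C n" "\<And>x. x \<in> topspace (disk n) \<Longrightarrow> \<xi> x = a l (\<phi> x)"
    using cell_translate[OF \<phi> l(2)] by blast
  have "\<xi> v = \<psi> u" using \<xi>(2) v open_disk_sub l(4) by (metis subsetD)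
  then have "\<xi> x = \<psi> x" if "x \<in> topspace (disk n)" for x
    using cell_eq(3)[OF \<xi>(1) l(1) v l(3)] that by blast
  then show thesis using that[OF l(2)] \<xi>(2) by simp
qed

lemma orbit_cells_const:
  assumes "\<phi> \<in> C n" "v \<in> open_disk n" "v' \<in> open_disk n"
  shows "orbit_cells n (\<phi> v) = orbit_cells n (\<phi> v')"
proof -
  have "orbit_cells n (\<phi> v) \<subseteq> orbit_cells n (\<phi> v')"
    if v: "v \<in> open_disk n" "v' \<in> open_disk n" for v v'
  proof
    fix \<psi> assume \<psi>: "\<psi> \<in> orbit_cells n (\<phi> v)"
    obtain l where "l \<in> carrier L" "\<And>x. x \<in> topspace (disk n) \<Longrightarrow> a l (\<phi> x) = \<psi> x"
      using orbit_cells_cell[OF assms(1) v(1) \<psi>] by blast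
    then have "l \<in> carrier L" "a l (\<phi> v') = \<psi> v'" using open_diskD[OF v(2)] by auto
    moreover have "\<psi> \<in> C n" using \<psi> by (simp add: orbit_cells_def)
    ultimately show "\<psi> \<in> orbit_cells n (\<phi> v')" using v(2) by (auto simp: orbit_cells_def)
  qed
  with assms show ?thesis by blast
qed

lemma orbit_cells_act:
  assumes "x \<in> topspace X" "k \<in> carrier L"
  shows "orbit_cells n (a k x) = orbit_cells n x"
proof -
  have "orbit_cells n (a k x) \<subseteq> orbit_cells n x" if "x \<in> topspace X" "k \<in> carrier L" for x k
  proof
    fix \<psi> assume "\<psi> \<in> orbit_cells n (a k x)"
    then obtain l u where l: "\<psi> \<in> C n" "l \<in> carrier L" "u \<in> open_disk n" "a l (a k x) = \<psi> u"
      by (auto simp: orbit_cells_def)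
    then have "a (l \<otimes>\<^bsub>L\<^esub> k) x = \<psi> u" using Xact that by (simp add: continuous_action_def)
    then show "\<psi> \<in> orbit_cells n x" using l that by (auto simp: orbit_cells_def)
  qed
  from this[OF assms] this[of "a k x" "inv\<^bsub>L\<^esub> k"] show ?thesis
    using action_inv(1)[OF L Xact assms(2,1)] action_closed[OF Xact assms(2,1)] assms(2) by auto
qed

lemma orbit_cells_nonempty: "\<phi> \<in> C n \<Longrightarrow> u \<in> open_disk n \<Longrightarrow> \<phi> \<in> orbit_cells n (\<phi> u)"
proof -
  assume *: "\<phi> \<in> C n" "u \<in> open_disk n"
  then have "a \<one>\<^bsub>L\<^esub> (\<phi> u) = \<phi> u"
    using Xact cell_in open_diskD by (auto simp: continuous_action_def)
  with * show ?thesis using one_closed by (auto simp: orbit_cells_def)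
qed

text \<open>An element that carries a point of an open cell into that cell fixes the cell pointwise,
  hence is trivial by freeness. So a point has only one translate in the chosen cell of its
  orbit.\<close>

lemma orbit_cells_unique:
  assumes "x \<in> topspace X" "\<psi> \<in> C n" "l \<in> carrier L" "l' \<in> carrier L" "u \<in> open_disk n" "u' \<in> open_disk n"
    "a l x = \<psi> u" "a l' x = \<psi> u'"
  shows "l = l' \<and> u = u'"
proof -
  let ?k = "l' \<otimes>\<^bsub>L\<^esub> inv\<^bsub>L\<^esub> l"
  have k: "?k \<in> carrier L" using assms by simp
  have "a (inv\<^bsub>L\<^esub> l) (\<psi> u) = x" using action_inv(1)[OF L Xact assms(3,1)] assms(7) by simp
  moreover have "a ?k (\<psi> u) = a l' (a (inv\<^bsub>L\<^esub> l) (\<psi> u))"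
    using Xact assms(3,4) cell_in[OF assms(2) open_diskD[OF assms(5)]] by (simp add: continuous_action_def)
  ultimately have ku: "a ?k (\<psi> u) = \<psi> u'" using assms(8) by simp
  obtain \<xi> where \<xi>: "\<xi> \<in> C n" "\<And>x. x \<in> topspace (disk n) \<Longrightarrow> \<xi> x = a ?k (\<psi> x)"
    using cell_translate[OF assms(2) k] by blast
  have "\<xi> u = \<psi> u'" using \<xi>(2) ku assms(5) open_diskD by auto
  then have "u = u'" using cell_eq(2)[OF \<xi>(1) assms(2,5,6)] by blast
  then have "?k = \<one>\<^bsub>L\<^esub>" using free[OF k] ku cell_in[OF assms(2)] open_diskD assms(5) by auto
  then have "l = l'" using assms(3,4) by (metis inv_closed inv_equality inv_inv)
  with \<open>u = u'\<close> show ?thesis by simp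
qed

text \<open>The extension is chosen by \<open>extend_to_cylinder\<close> on one cell of each orbit,
  and equivariance dictates the values on the other cells.\<close>

lemma extend_skeleton:
  assumes A: "A = {} \<or> A = {0, 1 :: real}"
    and g: "\<And>t. t \<in> A \<Longrightarrow> continuous_map X Z (g t)"
    and geq: "\<And>t l x. t \<in> A \<Longrightarrow> l \<in> carrier L \<Longrightarrow> x \<in> topspace X \<Longrightarrow> g t (a l x) = b l (g t x)"
    and F: "partial_map A g n F"
  shows "\<exists>F'. partial_map A g (Suc n) F' \<and> (\<forall>t\<in>{0..1}. \<forall>x\<in>skel n. F' t x = F t x)"
proof -
  let ?D = "prod_topology unit_interval (disk n)"
  let ?B = "{0..1} \<times> (topspace (disk n) - open_disk n) \<union> A \<times> topspace (disk n)"
  let ?P = "\<lambda>\<phi> e. continuous_map ?D Z e \<and>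
      (\<forall>u\<in>?B. e u = (\<lambda>(t, x). if t \<in> A then g t (\<phi> x) else F t (\<phi> x)) u)"
  have ex: "\<exists>e. ?P \<phi> e" if "\<phi> \<in> C n" for \<phi>
  proof (rule extend_to_cylinder[OF Z A boundary_map_continuous[OF A g F that]])
    fix e assume "continuous_map ?D Z e"
      "\<And>u. u \<in> ?B \<Longrightarrow> e u = (\<lambda>(t, x). if t \<in> A then g t (\<phi> x) else F t (\<phi> x)) u"
    then show "\<exists>e. ?P \<phi> e" by blast
  qed
  define ext where "ext \<phi> = (SOME e. ?P \<phi> e)" for \<phi>
  have ext: "?P \<phi> (ext \<phi>)" if "\<phi> \<in> C n" for \<phi>
    unfolding ext_def by (rule someI_ex[OF ex[OF that]])
  define rep where "rep x = (SOME \<psi>. \<psi> \<in> orbit_cells n x)" for x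
  define lu where "lu x = (SOME (l, u). l \<in> carrier L \<and> u \<in> open_disk n \<and> a l x = rep x u)" for x
  \<comment> \<open>With l x = \<open>rep x\<close> u, where (l, u) is \<open>lu x\<close>,
    equivariance forces the value at \<open>x\<close> to be the inverse of l applied to the value at
    \<open>rep x\<close> u.\<close>
  define F' where "F' t x = (if x \<in> skel n then F t x
      else b (inv\<^bsub>L\<^esub> (fst (lu x))) (ext (rep x) (t, snd (lu x))))" for t x
  have rep: "rep x \<in> orbit_cells n x" if "x \<in> skel (Suc n)" "x \<notin> skel n" for x
  proof -
    obtain \<phi> u where "\<phi> \<in> C n" "u \<in> open_disk n" "x = \<phi> u" using skel_SucE \<open>x \<in> skel (Suc n)\<close> \<open>x \<notin> skel n\<close> by metis
    then have "\<phi> \<in> orbit_cells n x" using orbit_cells_nonempty by simp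
    then show ?thesis unfolding rep_def by (rule someI[where P = "\<lambda>\<psi>. \<psi> \<in> orbit_cells n x"])
  qed
  have lu: "fst (lu x) \<in> carrier L \<and> snd (lu x) \<in> open_disk n \<and> a (fst (lu x)) x = rep x (snd (lu x))"
    if x: "x \<in> skel (Suc n)" "x \<notin> skel n" for x
  proof -
    obtain l u where "l \<in> carrier L" "u \<in> open_disk n" "a l x = rep x u"
      using rep[OF x] by (auto simp: orbit_cells_def)
    then have "case (l, u) of (l, u) \<Rightarrow> l \<in> carrier L \<and> u \<in> open_disk n \<and> a l x = rep x u" by simp
    from someI[where P = "\<lambda>(l, u). l \<in> carrier L \<and> u \<in> open_disk n \<and> a l x = rep x u", OF this]
    show ?thesis unfolding lu_def by (simp add: split_beta)
  qed
  have F'_new: "F' t x = b (inv\<^bsub>L\<^esub> l) (ext (rep x) (t, u))"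
    if "x \<in> skel (Suc n)" "x \<notin> skel n" "l \<in> carrier L" "u \<in> open_disk n" "a l x = rep x u" for t x l u
  proof -
    have "rep x \<in> C n" using rep[OF that(1,2)] by (simp add: orbit_cells_def)
    moreover have "x \<in> topspace X" using skel_sub that(1) by blast
    ultimately have "fst (lu x) = l \<and> snd (lu x) = u"
      using orbit_cells_unique lu[OF that(1,2)] that(3-5) by metis
    then show ?thesis using that(2) by (simp add: F'_def)
  qed
  have cells: "continuous_map ?D Z (\<lambda>(t, x). F' t (\<phi> x))" if \<phi>: "\<phi> \<in> C n" for \<phi>
  proof -
    define v0 :: "nat \<Rightarrow> real" where "v0 = (\<lambda>_. 0)"
    have v0: "v0 \<in> open_disk n" unfolding v0_def by (rule zero_in_open_disk)
    have new: "\<phi> v \<in> skel (Suc n)" "\<phi> v \<notin> skel n" if "v \<in> open_disk n" for v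
      using cell_in_skel[OF \<phi>] open_cell_notin_skel[OF \<phi>] that open_diskD by auto
    let ?\<psi> = "rep (\<phi> v0)"
    have rep_eq: "rep (\<phi> v) = ?\<psi>" if "v \<in> open_disk n" for v
      unfolding rep_def using orbit_cells_const[OF \<phi> that v0] by simp
    have \<psi>: "?\<psi> \<in> orbit_cells n (\<phi> v0)" "?\<psi> \<in> C n"
      using rep[OF new[OF v0]] by (auto simp: orbit_cells_def)
    obtain l where l: "l \<in> carrier L" "\<And>x. x \<in> topspace (disk n) \<Longrightarrow> a l (\<phi> x) = ?\<psi> x"
      using orbit_cells_cell[OF \<phi> v0 \<psi>(1)] by blast
    have bcont: "continuous_map Z Z (b (inv\<^bsub>L\<^esub> l))" using Zact l(1) by (simp add: continuous_action_def)
    have "continuous_map ?D Z (b (inv\<^bsub>L\<^esub> l) \<circ> ext ?\<psi>)"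
      using ext[OF \<psi>(2)] bcont by (blast intro: continuous_map_compose)
    then show ?thesis
    proof (rule continuous_map_eq)
      fix y assume y: "y \<in> topspace ?D"
      then obtain t x where tx: "y = (t, x)" "t \<in> {0..1}" "x \<in> topspace (disk n)" by auto
      show "(b (inv\<^bsub>L\<^esub> l) \<circ> ext ?\<psi>) y = (\<lambda>(t, x). F' t (\<phi> x)) y"
      proof (cases "x \<in> open_disk n")
        case True
        then show ?thesis
          using F'_new[OF new[OF True] l(1) True, of t] l(2)[OF tx(3)] rep_eq[OF True] tx by simp
      next
        case False
        \<comment> \<open>On the boundary of the cell the translated extension must agree with
          \<open>F\<close>; it does, because \<open>F\<close> is equivariant on the lower
          skeleton.\<close>
        have \<phi>x: "\<phi> x \<in> skel n" by (rule boundary_in_skel[OF \<phi> tx(3) False])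
        then have lx: "a l (\<phi> x) \<in> skel n" using skel_act l(1) by blast
        have "(t, x) \<in> ?B" using tx False by auto
        then have "ext ?\<psi> (t, x) = (if t \<in> A then g t (?\<psi> x) else F t (?\<psi> x))"
          using ext[OF \<psi>(2)] by auto
        also have "\<dots> = F t (a l (\<phi> x))"
          using F lx l(2)[OF tx(3)] by (auto simp: partial_map_def)
        also have "\<dots> = b l (F t (\<phi> x))" using F \<phi>x l(1) tx(2) by (simp add: partial_map_def)
        finally have e: "ext ?\<psi> (t, x) = b l (F t (\<phi> x))" .
        have "F t (\<phi> x) \<in> topspace Z"
        proof -
          obtain m \<xi> v where m: "m < n" "\<xi> \<in> C m" "v \<in> open_disk m" "\<phi> x = \<xi> v"
            using \<phi>x by (auto simp: skel_def)
          have "continuous_map (prod_topology unit_interval (disk m)) Z (\<lambda>(t, x). F t (\<xi> x))"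
            using F m by (simp add: partial_map_def)
          from continuous_map_image_subset_topspace[OF this] show ?thesis
            using m tx(2) open_diskD by (auto simp: image_subset_iff)
        qed
        then show ?thesis using e action_inv(1)[OF L Zact l(1)] \<phi>x tx by (simp add: F'_def)
      qed
    qed
  qed
  have "partial_map A g (Suc n) F'"
    unfolding partial_map_def
  proof (intro conjI allI impI ballI)
    fix m \<phi> assume m: "m < Suc n" and \<phi>: "\<phi> \<in> C m"
    show "continuous_map (prod_topology unit_interval (disk m)) Z (\<lambda>(t, x). F' t (\<phi> x))"
    proof (cases "m = n")
      case True
      then show ?thesis using cells \<phi> by simp
    next
      case False
      then have mn: "m < n" using m by simp
      then have "continuous_map (prod_topology unit_interval (disk m)) Z (\<lambda>(t, x). F t (\<phi> x))"
        using F \<phi> by (simp add: partial_map_def)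
      then show ?thesis
      proof (rule continuous_map_eq)
        fix y assume "y \<in> topspace (prod_topology unit_interval (disk m))"
        then have "\<phi> (snd y) \<in> skel n" using cell_in_skel[OF \<phi>] skel_mono[of "Suc m" n] mn by auto
        then show "(case y of (t, x) \<Rightarrow> F t (\<phi> x)) = (case y of (t, x) \<Rightarrow> F' t (\<phi> x))"
          by (simp add: F'_def split_beta)
      qed
    qed
  next
    fix t :: real and l x assume t: "t \<in> {0..1}" and l: "l \<in> carrier L" and x: "x \<in> skel (Suc n)"
    have xX: "x \<in> topspace X" using skel_sub x by blast
    show "F' t (a l x) = b l (F' t x)"
    proof (cases "x \<in> skel n")
      case True
      then show ?thesis using F t l skel_act by (simp add: F'_def partial_map_def)
    next
      case False
      let ?l = "fst (lu x)" and ?u = "snd (lu x)"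
      note lux = lu[OF x False]
      have lx: "a l x \<in> skel (Suc n)" "a l x \<notin> skel n"
        using skel_act[OF x l] skel_act_iff[OF xX l] False by auto
      have rep_eq: "rep (a l x) = rep x" unfolding rep_def using orbit_cells_act[OF xX l] by simp
      have k: "?l \<otimes>\<^bsub>L\<^esub> inv\<^bsub>L\<^esub> l \<in> carrier L" using lux l by simp
      have "a (?l \<otimes>\<^bsub>L\<^esub> inv\<^bsub>L\<^esub> l) (a l x) = a ?l (a (inv\<^bsub>L\<^esub> l) (a l x))"
        using Xact lux l action_closed[OF Xact l xX] by (simp add: continuous_action_def)
      then have "a (?l \<otimes>\<^bsub>L\<^esub> inv\<^bsub>L\<^esub> l) (a l x) = rep (a l x) ?u"
        using action_inv(1)[OF L Xact l xX] lux rep_eq by simp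
      from F'_new[OF lx k _ this, of t]
      have 1: "F' t (a l x) = b (inv\<^bsub>L\<^esub> (?l \<otimes>\<^bsub>L\<^esub> inv\<^bsub>L\<^esub> l)) (ext (rep x) (t, ?u))" using lux rep_eq by simp
      have "rep x \<in> C n" using rep[OF x False] by (simp add: orbit_cells_def)
      then have "continuous_map ?D Z (ext (rep x))" using ext by blast
      moreover have "(t, ?u) \<in> topspace ?D" using t lux open_diskD by auto
      ultimately have eZ: "ext (rep x) (t, ?u) \<in> topspace Z"
        using continuous_map_image_subset_topspace by blast
      have "inv\<^bsub>L\<^esub> (?l \<otimes>\<^bsub>L\<^esub> inv\<^bsub>L\<^esub> l) = l \<otimes>\<^bsub>L\<^esub> inv\<^bsub>L\<^esub> ?l" using lux l by (simp add: inv_mult_group)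
      then have "F' t (a l x) = b l (b (inv\<^bsub>L\<^esub> ?l) (ext (rep x) (t, ?u)))"
        using 1 Zact lux l eZ by (simp add: continuous_action_def)
      then show ?thesis using F'_new[OF x False, of ?l ?u t] lux by simp
    qed
  next
    fix t x assume t: "t \<in> A" and x: "x \<in> skel (Suc n)"
    have xX: "x \<in> topspace X" using skel_sub x by blast
    show "F' t x = g t x"
    proof (cases "x \<in> skel n")
      case True
      then show ?thesis using F t by (simp add: F'_def partial_map_def)
    next
      case False
      note lux = lu[OF x False]
      have "rep x \<in> C n" using rep[OF x False] by (simp add: orbit_cells_def)
      moreover have "(t, snd (lu x)) \<in> ?B" using t lux open_diskD by auto
      ultimately have "ext (rep x) (t, snd (lu x)) = g t (rep x (snd (lu x)))" using ext t by auto
      also have "\<dots> = b (fst (lu x)) (g t x)" using geq[OF t _ xX] lux by metis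
      finally have "F' t x = b (inv\<^bsub>L\<^esub> (fst (lu x))) (b (fst (lu x)) (g t x))"
        using F'_new[OF x False, of "fst (lu x)" "snd (lu x)" t] lux by simp
      moreover have "g t x \<in> topspace Z" using continuous_map_image_subset_topspace[OF g[OF t]] xX by blast
      ultimately show ?thesis using action_inv(1)[OF L Zact] lux by simp
    qed
  qed
  then show ?thesis by (intro exI[of _ F']) (auto simp: F'_def)
qed

lemma equivariant_extension:
  assumes A: "A = {} \<or> A = {0, 1 :: real}"
    and g: "\<And>t. t \<in> A \<Longrightarrow> continuous_map X Z (g t)"
    and geq: "\<And>t l x. t \<in> A \<Longrightarrow> l \<in> carrier L \<Longrightarrow> x \<in> topspace X \<Longrightarrow> g t (a l x) = b l (g t x)"
  obtains F where "continuous_map (prod_topology unit_interval X) Z (\<lambda>(t, x). F t x)"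
    "\<And>t l x. t \<in> {0..1} \<Longrightarrow> l \<in> carrier L \<Longrightarrow> x \<in> topspace X \<Longrightarrow> F t (a l x) = b l (F t x)"
    "\<And>t x. t \<in> A \<Longrightarrow> x \<in> topspace X \<Longrightarrow> F t x = g t x"
proof -
  have A01: "A \<subseteq> {0..1}" using A by auto
  \<comment> \<open>Any map will do here, since \<open>skel 0\<close> is empty.\<close>
  have "partial_map A g 0 undefined" by (simp add: partial_map_def skel_def)
  then have "\<exists>F. \<forall>n. partial_map A g n (F n) \<and> (\<forall>t\<in>{0..1}. \<forall>x\<in>skel n. F (Suc n) t x = F n t x)"
    using extend_skeleton[OF A g geq]
    by (intro dependent_nat_choice[where Q = "\<lambda>n F F'. \<forall>t\<in>{0..1}. \<forall>x\<in>skel n. F' t x = F t x"]) auto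
  then obtain F where F: "\<And>n. partial_map A g n (F n)"
      "\<And>n. \<forall>t\<in>{0..1}. \<forall>x\<in>skel n. F (Suc n) t x = F n t x" by blast
  have F_le: "F m t x = F n t x" if "n \<le> m" "t \<in> {0..1}" "x \<in> skel n" for m n t x
    using that(1)
  proof (induction m rule: dec_induct)
    case (step k)
    then show ?case using F(2)[of k] that skel_mono[of n k] by auto
  qed simp
  define k where "k x = (LEAST n. x \<in> skel n)" for x
  \<comment> \<open>On \<open>skel n\<close> the maps no longer change after stage \<open>n\<close>,
    so the first stage that sees \<open>x\<close> gives the limit.\<close>
  define G where "G t x = F (k x) t x" for t x
  have k: "x \<in> skel (k x)" if "x \<in> topspace X" for x
    unfolding k_def using cells_cover[OF that] by (rule LeastI_ex)
  have G: "G t x = F n t x" if "x \<in> skel n" "t \<in> {0..1}" for t x n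
  proof -
    have "k x \<le> n" unfolding k_def using that(1) by (rule Least_le)
    moreover have "x \<in> topspace X" using skel_sub that(1) by blast
    ultimately show ?thesis using F_le[of "k x" n t x] that k by (simp add: G_def)
  qed
  show thesis
  proof (rule that)
    show "continuous_map (prod_topology unit_interval X) Z (\<lambda>(t, x). G t x)"
    proof (rule continuous_map_cells[OF cw])
      fix n \<phi> assume \<phi>: "\<phi> \<in> C n"
      have "continuous_map (prod_topology unit_interval (disk n)) Z (\<lambda>(t, x). F (Suc n) t (\<phi> x))"
        using F(1)[of "Suc n"] \<phi> by (simp add: partial_map_def)
      then show "continuous_map (prod_topology unit_interval (disk n)) Z (\<lambda>(t, x). G t (\<phi> x))"
        by (rule continuous_map_eq) (use G[OF cell_in_skel[OF \<phi>]] in auto)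
    qed
    show "G t (a l x) = b l (G t x)" if "t \<in> {0..1}" "l \<in> carrier L" "x \<in> topspace X" for t l x
    proof -
      have "x \<in> skel (k x)" "a l x \<in> skel (k x)" using k that skel_act by auto
      then show ?thesis using G[of _ "k x" t] F(1)[of "k x"] that by (simp add: partial_map_def)
    qed
    show "G t x = g t x" if "t \<in> A" "x \<in> topspace X" for t x
      using F(1)[of "k x"] k that by (auto simp: G_def partial_map_def)
  qed
qed

end

section \<open>Universal spaces\<close>

lemma equivariant_map_compose:
  assumes "equivariant_map K X a Y b f" "equivariant_map K Y b Z c g"
  shows "equivariant_map K X a Z c (g \<circ> f)"
proof -
  have "f ` topspace X \<subseteq> topspace Y"
    using assms(1) by (simp add: equivariant_map_def continuous_map_image_subset_topspace)
  then show ?thesis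
    using assms by (auto simp: equivariant_map_def intro: continuous_map_compose)
qed

lemma equivariantly_homotopic_trans:
  "equivariantly_homotopic K X a Y b f g \<Longrightarrow> equivariantly_homotopic K X a Y b g h \<Longrightarrow>
    equivariantly_homotopic K X a Y b f h"
  unfolding equivariantly_homotopic_def by (rule homotopic_with_trans)

lemma equivariantly_homotopic_comp_left:
  assumes "equivariantly_homotopic K X a Y b f g" "equivariant_map K Y b Z c h"
  shows "equivariantly_homotopic K X a Z c (h \<circ> f) (h \<circ> g)"
  using assms unfolding equivariantly_homotopic_def
  by (elim homotopic_with_compose_continuous_map_left)
     (auto simp: equivariant_map_def[of K Y] intro: equivariant_map_compose)

lemma equivariantly_homotopic_comp_right:
  assumes "equivariantly_homotopic K Y b Z c f g" "equivariant_map K X a Y b h"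
  shows "equivariantly_homotopic K X a Z c (f \<circ> h) (g \<circ> h)"
proof -
  have "continuous_map X Y h" using assms(2) by (simp add: equivariant_map_def)
  with assms(1) show ?thesis
    unfolding equivariantly_homotopic_def
    by (rule homotopic_with_compose_continuous_map_right) (rule equivariant_map_compose[OF assms(2)])
qed

lemma equivariant_homotopy_equivalence_compose:
  assumes f: "equivariant_homotopy_equivalence K X a Y b f" and g: "equivariant_homotopy_equivalence K Y b Z c g"
  shows "equivariant_homotopy_equivalence K X a Z c (g \<circ> f)"
proof -
  obtain g' where g': "equivariant_map K Z c Y b g'" "equivariantly_homotopic K Y b Y b (g' \<circ> g) id"
      "equivariantly_homotopic K Z c Z c (g \<circ> g') id" and gm: "equivariant_map K Y b Z c g"
    using g by (auto simp: equivariant_homotopy_equivalence_def)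
  obtain f' where f': "equivariant_map K Y b X a f'" "equivariantly_homotopic K X a X a (f' \<circ> f) id"
      "equivariantly_homotopic K Y b Y b (f \<circ> f') id" and fm: "equivariant_map K X a Y b f"
    using f by (auto simp: equivariant_homotopy_equivalence_def)
  have "equivariantly_homotopic K X a X a (f' \<circ> ((g' \<circ> g) \<circ> f)) (f' \<circ> (id \<circ> f))"
    by (rule equivariantly_homotopic_comp_left[OF equivariantly_homotopic_comp_right[OF g'(2) fm] f'(1)])
  then have "equivariantly_homotopic K X a X a ((f' \<circ> g') \<circ> (g \<circ> f)) id"
    using equivariantly_homotopic_trans[OF _ f'(2)] by (simp add: comp_assoc)
  moreover have "equivariantly_homotopic K Z c Z c (g \<circ> ((f \<circ> f') \<circ> g')) (g \<circ> (id \<circ> g'))"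
    by (rule equivariantly_homotopic_comp_left[OF equivariantly_homotopic_comp_right[OF f'(3) g'(1)] gm])
  then have "equivariantly_homotopic K Z c Z c ((g \<circ> f) \<circ> (f' \<circ> g')) id"
    using equivariantly_homotopic_trans[OF _ g'(3)] by (simp add: comp_assoc)
  ultimately show ?thesis
    using equivariant_map_compose[OF fm gm] equivariant_map_compose[OF g'(1) f'(1)]
    by (auto simp: equivariant_homotopy_equivalence_def)
qed

text \<open>The extension theorem with nothing prescribed yields an equivariant map back, and with
  both ends prescribed it yields a homotopy from any equivariant self-map to the identity.\<close>

lemma equivariant_map_between_free_contractible:
  assumes X: "free_cw L X a C X a" and Y: "free_cw L Y b D Y b" and i: "equivariant_map L X a Y b i"
  shows "equivariant_homotopy_equivalence L X a Y b i"
proof -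
  interpret X: free_cw L X a C X a by fact
  interpret Y: free_cw L Y b D Y b by fact
  interpret YX: free_cw L Y b D X a
    by unfold_locales (fact Y.cw Y.Xact Y.free X.Zact X.Z)+
  obtain F where F: "continuous_map (prod_topology unit_interval Y) X (\<lambda>(t, x). F t x)"
    "\<And>t l x. t \<in> {0..1} \<Longrightarrow> l \<in> carrier L \<Longrightarrow> x \<in> topspace Y \<Longrightarrow> F t (b l x) = a l (F t x)"
    using YX.equivariant_extension[of "{}" undefined] by (metis empty_iff)
  \<comment> \<open>Any time slice would serve: a map is obtained as a homotopy with no prescribed
    ends.\<close>
  define g where "g = F 0"
  have g: "equivariant_map L Y b X a g"
    using continuous_map_o_Pair[OF F(1), of 0] F(2)[of 0] by (simp add: equivariant_map_def g_def o_def)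
  have hom: "equivariantly_homotopic L V c V c k id"
    if V: "free_cw L V c M V c" and k: "equivariant_map L V c V c k" for V :: "'z topology" and c M k
  proof -
    interpret V: free_cw L V c M V c by fact
    define gg where "gg t = (if t = (0::real) then k else id)" for t
    have gg: "\<And>t. t \<in> {0, 1} \<Longrightarrow> continuous_map V V (gg t)"
      "\<And>t l x. t \<in> {0, 1} \<Longrightarrow> l \<in> carrier L \<Longrightarrow> x \<in> topspace V \<Longrightarrow> gg t (c l x) = c l (gg t x)"
      using k by (auto simp: gg_def equivariant_map_def)
    obtain F where F: "continuous_map (prod_topology unit_interval V) V (\<lambda>(t, x). F t x)"
      "\<And>t l x. t \<in> {0..1} \<Longrightarrow> l \<in> carrier L \<Longrightarrow> x \<in> topspace V \<Longrightarrow> F t (c l x) = c l (F t x)"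
      "\<And>t x. t \<in> {0, 1} \<Longrightarrow> x \<in> topspace V \<Longrightarrow> F t x = gg t x"
    proof (rule V.equivariant_extension[of "{0, 1}" gg])
      show "continuous_map V V (gg t)" if "t \<in> {0, 1}" for t using that by (rule gg(1))
      show "gg t (c l x) = c l (gg t x)" if "t \<in> {0, 1}" "l \<in> carrier L" "x \<in> topspace V" for t l x
        using that by (rule gg(2))
    qed (simp, rule that)
    have "homotopic_with (equivariant_map L V c V c) V V k id"
    proof (subst homotopic_with)
      fix h h' :: "'z \<Rightarrow> 'z" assume *: "\<And>x. x \<in> topspace V \<Longrightarrow> h x = h' x"
      have "continuous_map V V h \<longleftrightarrow> continuous_map V V h'" using * by (metis continuous_map_eq)
      then show "equivariant_map L V c V c h = equivariant_map L V c V c h'"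
        using * action_closed[OF V.Xact] by (auto simp: equivariant_map_def)
    next
      have "equivariant_map L V c V c (F t)" if t: "t \<in> {0..1}" for t
        using continuous_map_o_Pair[OF F(1), of t] F(2)[OF t] t by (simp add: equivariant_map_def o_def)
      then show "\<exists>h. continuous_map (prod_topology unit_interval V) V h \<and>
          (\<forall>x\<in>topspace V. h (0, x) = k x) \<and> (\<forall>x\<in>topspace V. h (1, x) = id x) \<and>
          (\<forall>t\<in>{0..1}. equivariant_map L V c V c (\<lambda>x. h (t, x)))"
        using F(1) F(3)[of 0] F(3)[of 1] by (intro exI[of _ "\<lambda>(t, x). F t x"]) (auto simp: gg_def)
    qed
    then show ?thesis by (simp add: equivariantly_homotopic_def)
  qed
  show ?thesis
    unfolding equivariant_homotopy_equivalence_def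
    using i g hom[OF X equivariant_map_compose[OF i g]] hom[OF Y equivariant_map_compose[OF g i]] by blast
qed

section \<open>Fixed spaces under one factor of a product group\<close>

lemma fst_snd_actions:
  assumes "group G" "group L" "continuous_action (G \<times>\<times> L) X a"
  shows "continuous_action G X (fst_act L a)" "continuous_action L X (snd_act G a)"
    "\<And>l g x. l \<in> carrier L \<Longrightarrow> g \<in> carrier G \<Longrightarrow> x \<in> topspace X \<Longrightarrow>
      snd_act G a l (fst_act L a g x) = fst_act L a g (snd_act G a l x)"
proof -
  interpret G: group G by fact
  interpret L: group L by fact
  have mult: "a (g \<otimes>\<^bsub>G\<^esub> g', l \<otimes>\<^bsub>L\<^esub> l') x = a (g, l) (a (g', l') x)"
    if "g \<in> carrier G" "g' \<in> carrier G" "l \<in> carrier L" "l' \<in> carrier L" "x \<in> topspace X" for g g' l l' x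
    using assms(3) that by (auto simp: continuous_action_def DirProd_def)
  have cont: "continuous_map X X (a (g, l))" if "g \<in> carrier G" "l \<in> carrier L" for g l
    using assms(3) that by (auto simp: continuous_action_def DirProd_def)
  have one: "a (\<one>\<^bsub>G\<^esub>, \<one>\<^bsub>L\<^esub>) x = x" if "x \<in> topspace X" for x
    using assms(3) that by (auto simp: continuous_action_def DirProd_def)
  show "continuous_action G X (fst_act L a)"
    unfolding continuous_action_def fst_act_def
    using cont one mult[of _ _ "\<one>\<^bsub>L\<^esub>" "\<one>\<^bsub>L\<^esub>"] by simp
  show "continuous_action L X (snd_act G a)"
    unfolding continuous_action_def snd_act_def
    using cont one mult[of "\<one>\<^bsub>G\<^esub>" "\<one>\<^bsub>G\<^esub>"] by simp
  show "snd_act G a l (fst_act L a g x) = fst_act L a g (snd_act G a l x)"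
    if "l \<in> carrier L" "g \<in> carrier G" "x \<in> topspace X" for l g x
    using mult[of "\<one>\<^bsub>G\<^esub>" g l "\<one>\<^bsub>L\<^esub>" x] mult[of g "\<one>\<^bsub>G\<^esub>" "\<one>\<^bsub>L\<^esub>" l x] that
    by (simp add: fst_act_def snd_act_def)
qed

lemma fixed_space_action:
  assumes act: "continuous_action L X aL"
    and comm: "\<And>l g x. l \<in> carrier L \<Longrightarrow> g \<in> K \<Longrightarrow> x \<in> topspace X \<Longrightarrow> aL l (aG g x) = aG g (aL l x)"
  shows "continuous_action L (fixed_space K aG X) aL"
  unfolding continuous_action_def
proof (intro conjI ballI)
  show "continuous_map (fixed_space K aG X) (fixed_space K aG X) (aL l)" if l: "l \<in> carrier L" for l
  proof -
    have "continuous_map X X (aL l)" using act l by (auto simp: continuous_action_def)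
    moreover have "aL l w \<in> {w. \<forall>h\<in>K. aG h w = w}" if "w \<in> topspace (fixed_space K aG X)" for w
      using that comm[OF l] by (auto simp: topspace_fixed_space) metis
    ultimately show ?thesis
      unfolding fixed_space_def by (auto simp: continuous_map_in_subtopology continuous_map_from_subtopology)
  qed
qed (use act in \<open>auto simp: continuous_action_def topspace_fixed_space\<close>)

lemma equivariant_map_fixed:
  assumes "group G" "group L" "K \<subseteq> carrier G" "equivariant_map (G \<times>\<times> L) X a Y b f"
  shows "equivariant_map L (fixed_space K (fst_act L a) X) (snd_act G a)
    (fixed_space K (fst_act L b) Y) (snd_act G b) f"
proof -
  have one: "\<one>\<^bsub>G\<^esub> \<in> carrier G" "\<one>\<^bsub>L\<^esub> \<in> carrier L"
    using assms group.is_monoid monoid.one_closed by blast+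
  have eqv: "f (a (g, l) x) = b (g, l) (f x)" if "g \<in> carrier G" "l \<in> carrier L" "x \<in> topspace X" for g l x
    using assms(4) that by (auto simp: equivariant_map_def DirProd_def)
  have "continuous_map (fixed_space K (fst_act L a) X) Y f"
    using assms(4) by (simp add: equivariant_map_def fixed_space_def continuous_map_from_subtopology)
  moreover have "fst_act L b g (f x) = f x" if "x \<in> topspace (fixed_space K (fst_act L a) X)" "g \<in> K" for x g
    using that eqv[of g "\<one>\<^bsub>L\<^esub>" x] one assms(3) by (auto simp: topspace_fixed_space fst_act_def)
  ultimately have "continuous_map (fixed_space K (fst_act L a) X) (fixed_space K (fst_act L b) Y) f"
    unfolding fixed_space_def[of K "fst_act L b"] by (auto simp: continuous_map_in_subtopology)
  then show ?thesis
    using eqv[OF one(1)] by (simp add: equivariant_map_def snd_act_def topspace_fixed_space)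
qed

lemma equivariantly_homotopic_fixed:
  assumes "group G" "group L" "K \<subseteq> carrier G" "equivariantly_homotopic (G \<times>\<times> L) X a Y b f g"
  shows "equivariantly_homotopic L (fixed_space K (fst_act L a) X) (snd_act G a)
    (fixed_space K (fst_act L b) Y) (snd_act G b) f g"
proof -
  obtain h where h: "continuous_map (prod_topology unit_interval X) Y h"
    "\<And>x. h (0, x) = f x" "\<And>x. h (1, x) = g x"
    "\<And>t. t \<in> {0..1} \<Longrightarrow> equivariant_map (G \<times>\<times> L) X a Y b (\<lambda>x. h (t, x))"
    using assms(4) unfolding equivariantly_homotopic_def homotopic_with_def by auto
  have eqv: "equivariant_map L (fixed_space K (fst_act L a) X) (snd_act G a)
    (fixed_space K (fst_act L b) Y) (snd_act G b) (\<lambda>x. h (t, x))" if "t \<in> {0..1}" for t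
    by (rule equivariant_map_fixed[OF assms(1-3) h(4)[OF that]])
  have "prod_topology unit_interval (fixed_space K (fst_act L a) X) =
      subtopology (prod_topology unit_interval X) (UNIV \<times> {x. \<forall>h\<in>K. fst_act L a h x = x})"
    by (simp add: fixed_space_def subtopology_Times)
  then have "continuous_map (prod_topology unit_interval (fixed_space K (fst_act L a) X)) Y h"
    using continuous_map_from_subtopology[OF h(1)] by simp
  moreover have "h (t, x) \<in> topspace (fixed_space K (fst_act L b) Y)"
    if "t \<in> {0..1}" "x \<in> topspace (fixed_space K (fst_act L a) X)" for t x
    using eqv[OF that(1)] that(2) unfolding equivariant_map_def
    using continuous_map_image_subset_topspace by blast
  ultimately have "continuous_map (prod_topology unit_interval (fixed_space K (fst_act L a) X))
      (fixed_space K (fst_act L b) Y) h"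
    unfolding fixed_space_def[of K "fst_act L b"]
    by (intro continuous_map_into_subtopology) auto
  then show ?thesis
    unfolding equivariantly_homotopic_def homotopic_with_def using h(2,3) eqv by blast
qed

lemma equivariant_homotopy_equivalence_fixed:
  assumes "group G" "group L" "K \<subseteq> carrier G" "equivariant_homotopy_equivalence (G \<times>\<times> L) X a Y b f"
  shows "equivariant_homotopy_equivalence L (fixed_space K (fst_act L a) X) (snd_act G a)
    (fixed_space K (fst_act L b) Y) (snd_act G b) f"
proof -
  obtain g where f: "equivariant_map (G \<times>\<times> L) X a Y b f" and g: "equivariant_map (G \<times>\<times> L) Y b X a g"
    and gf: "equivariantly_homotopic (G \<times>\<times> L) X a X a (g \<circ> f) id"
    and fg: "equivariantly_homotopic (G \<times>\<times> L) Y b Y b (f \<circ> g) id"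
    using assms(4) by (auto simp: equivariant_homotopy_equivalence_def)
  show ?thesis
    unfolding equivariant_homotopy_equivalence_def
    by (intro conjI exI[of _ g] equivariant_map_fixed[OF assms(1-3) f] equivariant_map_fixed[OF assms(1-3) g]
        equivariantly_homotopic_fixed[OF assms(1-3) gf] equivariantly_homotopic_fixed[OF assms(1-3) fg])
qed

lemma equivariant_homotopy_equivalence_space:
  assumes "equivariant_homotopy_equivalence K X a Y b f"
  shows "X homotopy_equivalent_space Y"
proof -
  obtain g where "equivariant_map K X a Y b f" "equivariant_map K Y b X a g"
    "equivariantly_homotopic K X a X a (g \<circ> f) id" "equivariantly_homotopic K Y b Y b (f \<circ> g) id"
    using assms by (auto simp: equivariant_homotopy_equivalence_def)
  then have "continuous_map X Y f" "continuous_map Y X g"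
    "homotopic_with (\<lambda>_. True) X X (g \<circ> f) id" "homotopic_with (\<lambda>_. True) Y Y (f \<circ> g) id"
    unfolding equivariantly_homotopic_def by (auto simp: equivariant_map_def elim: homotopic_with_mono)
  then show ?thesis unfolding homotopy_equivalent_space_def by blast
qed

text \<open>If an element of \<open>K\<close> fixes one interior point of a cell, the translated
  characteristic map meets the original one and so equals it. Thus the fixed space is a union of
  whole closed cells.\<close>

lemma fixed_cw_structure:
  assumes G: "group G" "group L" "K \<subseteq> carrier G" and c: "continuous_action (G \<times>\<times> L) W c"
    and cw: "equivariant_cw_structure (G \<times>\<times> L) W c C"
  defines "V \<equiv> fixed_space K (fst_act L c) W"
  shows "equivariant_cw_structure L V (snd_act G c) (\<lambda>n. {\<phi> \<in> C n. \<phi> ` topspace (disk n) \<subseteq> topspace V})"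
proof -
  interpret G: group G by fact
  interpret L: group L by fact
  let ?C = "\<lambda>n. {\<phi> \<in> C n. \<phi> ` topspace (disk n) \<subseteq> topspace V}"
  have Haus: "Hausdorff_space W"
    and cell: "\<And>n \<phi>. \<phi> \<in> C n \<Longrightarrow> continuous_map (disk n) W \<phi> \<and> inj_on \<phi> (open_disk n)"
    and cover: "(\<Union>n. \<Union>\<phi>\<in>C n. \<phi> ` open_disk n) = topspace W"
    using cw by (auto simp: equivariant_cw_structure_def)
  have disj: "m = n \<and> (\<forall>x\<in>topspace (disk n). \<phi> x = \<psi> x)"
    if "\<phi> \<in> C m" "\<psi> \<in> C n" "u \<in> open_disk m" "v \<in> open_disk n" "\<phi> u = \<psi> v" for m n \<phi> \<psi> u v
  proof -
    have "\<phi> ` open_disk m \<inter> \<psi> ` open_disk n \<noteq> {}" using that by blast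
    then show ?thesis using cw that(1,2) unfolding equivariant_cw_structure_def by meson
  qed
  have bd: "\<exists>F. finite F \<and> F \<subseteq> (SIGMA m:{..<n}. C m) \<and>
        \<phi> ` (topspace (disk n) - open_disk n) \<subseteq> (\<Union>(m, \<psi>)\<in>F. \<psi> ` open_disk m)" if "\<phi> \<in> C n" for n \<phi>
    using cw that by (simp add: equivariant_cw_structure_def)
  have weak: "closedin W A" if "A \<subseteq> topspace W"
      "\<And>n \<phi>. \<phi> \<in> C n \<Longrightarrow> closedin (disk n) {x \<in> topspace (disk n). \<phi> x \<in> A}" for A
    using cw that unfolding equivariant_cw_structure_def by meson
  have trans: "\<exists>\<psi>\<in>C n. \<forall>x\<in>topspace (disk n). \<psi> x = c (g, l) (\<phi> x)"
    if "g \<in> carrier G" "l \<in> carrier L" "\<phi> \<in> C n" for g l n \<phi>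
    using cw that by (auto simp: equivariant_cw_structure_def DirProd_def)
  have VW: "topspace V \<subseteq> topspace W" by (auto simp: V_def topspace_fixed_space)
  have V_sub: "V = subtopology W (topspace V)"
    by (simp add: V_def fixed_space_def subtopology_restrict)
  have cell_V: "\<phi> \<in> ?C n" if \<phi>: "\<phi> \<in> C n" "u \<in> open_disk n" "\<phi> u \<in> topspace V" for n \<phi> u
  proof -
    have "\<phi> x \<in> topspace V" if x: "x \<in> topspace (disk n)" for x
    proof -
      have "fst_act L c h (\<phi> x) = \<phi> x" if h: "h \<in> K" for h
      proof -
        have hG: "h \<in> carrier G" using h G(3) by blast
        obtain \<psi> where \<psi>: "\<psi> \<in> C n" "\<And>x. x \<in> topspace (disk n) \<Longrightarrow> \<psi> x = c (h, \<one>\<^bsub>L\<^esub>) (\<phi> x)"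
          using trans[OF hG L.one_closed \<phi>(1)] by blast
        have "\<psi> u = fst_act L c h (\<phi> u)" using \<psi>(2)[OF subsetD[OF open_disk_sub \<phi>(2)]] by (simp add: fst_act_def)
        then have "\<psi> u = \<phi> u" using \<phi>(3) h by (simp add: V_def topspace_fixed_space)
        then have "\<psi> x = \<phi> x" using disj[OF \<psi>(1) \<phi>(1,2,2)] x by blast
        then show ?thesis using \<psi>(2)[OF x] by (simp add: fst_act_def)
      qed
      moreover have "\<phi> x \<in> topspace W"
        using cell[OF \<phi>(1)] x continuous_map_image_subset_topspace by blast
      ultimately show ?thesis by (simp add: V_def topspace_fixed_space)
    qed
    then show ?thesis using \<phi>(1) by blast
  qed
  show ?thesis
    unfolding equivariant_cw_structure_def
  proof (intro conjI allI ballI impI)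
    show "Hausdorff_space V" using Haus by (simp add: V_def fixed_space_def Hausdorff_space_subtopology)
    show "continuous_map (disk n) V \<phi>" if "\<phi> \<in> ?C n" for n \<phi>
      using that cell[of \<phi> n] by (subst V_sub) (auto simp: continuous_map_in_subtopology)
    show "inj_on \<phi> (open_disk n)" if "\<phi> \<in> ?C n" for n \<phi> using that cell by blast
    show "(\<Union>n. \<Union>\<phi>\<in>?C n. \<phi> ` open_disk n) = topspace V"
    proof
      show "(\<Union>n. \<Union>\<phi>\<in>?C n. \<phi> ` open_disk n) \<subseteq> topspace V" using open_disk_sub by blast
      show "topspace V \<subseteq> (\<Union>n. \<Union>\<phi>\<in>?C n. \<phi> ` open_disk n)"
      proof
        fix x assume x: "x \<in> topspace V"
        then have "x \<in> (\<Union>n. \<Union>\<phi>\<in>C n. \<phi> ` open_disk n)" using VW cover by blast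
        then obtain n \<phi> u where u: "\<phi> \<in> C n" "u \<in> open_disk n" "x = \<phi> u" by blast
        then have "\<phi> \<in> ?C n" using cell_V x by blast
        then show "x \<in> (\<Union>n. \<Union>\<phi>\<in>?C n. \<phi> ` open_disk n)" using u by blast
      qed
    qed
    show "m = n" if "\<phi> \<in> ?C m" "\<psi> \<in> ?C n" "\<phi> ` open_disk m \<inter> \<psi> ` open_disk n \<noteq> {}" for m n \<phi> \<psi>
      using that disj[of \<phi> m \<psi> n] by blast
    show "\<phi> x = \<psi> x"
      if "\<phi> \<in> ?C m" "\<psi> \<in> ?C n" "\<phi> ` open_disk m \<inter> \<psi> ` open_disk n \<noteq> {}" "x \<in> topspace (disk n)" for m n \<phi> \<psi> x
      using that disj[of \<phi> m \<psi> n] by blast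
    show "\<exists>F. finite F \<and> F \<subseteq> (SIGMA m:{..<n}. ?C m) \<and>
        \<phi> ` (topspace (disk n) - open_disk n) \<subseteq> (\<Union>(m, \<psi>)\<in>F. \<psi> ` open_disk m)" if \<phi>: "\<phi> \<in> ?C n" for n \<phi>
    proof -
      obtain F where F: "finite F" "F \<subseteq> (SIGMA m:{..<n}. C m)"
          "\<phi> ` (topspace (disk n) - open_disk n) \<subseteq> (\<Union>(m, \<psi>)\<in>F. \<psi> ` open_disk m)"
        using bd[of \<phi> n] \<phi> by auto
      let ?F = "F \<inter> (SIGMA m:{..<n}. ?C m)"
      have "\<phi> ` (topspace (disk n) - open_disk n) \<subseteq> (\<Union>(m, \<psi>)\<in>?F. \<psi> ` open_disk m)"
      proof
        fix y assume y: "y \<in> \<phi> ` (topspace (disk n) - open_disk n)"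
        then have yV: "y \<in> topspace V" using \<phi> by blast
        have "y \<in> (\<Union>(m, \<psi>)\<in>F. \<psi> ` open_disk m)" using F(3) y by blast
        then obtain m \<psi> u where m: "(m, \<psi>) \<in> F" "u \<in> open_disk m" "y = \<psi> u" by blast
        moreover have "m < n" "\<psi> \<in> C m" using m(1) F(2) by auto
        moreover have "\<psi> \<in> ?C m" using cell_V calculation yV by blast
        ultimately show "y \<in> (\<Union>(m, \<psi>)\<in>?F. \<psi> ` open_disk m)" by blast
      qed
      then show ?thesis using F(1) by (intro exI[of _ ?F]) auto
    qed
    show "closedin V A" if A: "A \<subseteq> topspace V"
        "\<forall>n. \<forall>\<phi>\<in>?C n. closedin (disk n) {x \<in> topspace (disk n). \<phi> x \<in> A}" for A
    proof -
      have "closedin W A"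
      proof (rule weak)
        show "A \<subseteq> topspace W" using A(1) VW by blast
        fix n \<psi> assume \<psi>: "\<psi> \<in> C n"
        show "closedin (disk n) {x \<in> topspace (disk n). \<psi> x \<in> A}"
        proof (cases "\<psi> \<in> ?C n")
          case True
          then show ?thesis using A(2) by blast
        next
          case False
          \<comment> \<open>This cell is not in \<open>V\<close>, so it meets \<open>A\<close> at
            most on its boundary, hence within finitely many cells of \<open>V\<close>. The part of
            \<open>A\<close> in each of those is compact, being the image of a closed subset of a
            disk.\<close>
          obtain F where F: "finite F" "F \<subseteq> (SIGMA m:{..<n}. C m)"
              "\<psi> ` (topspace (disk n) - open_disk n) \<subseteq> (\<Union>(m, \<psi>)\<in>F. \<psi> ` open_disk m)"
            using bd[OF \<psi>] by auto
          let ?F = "F \<inter> (SIGMA m:{..<n}. ?C m)"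
          let ?B = "\<lambda>(m, \<xi>). \<xi> ` {u \<in> topspace (disk m). \<xi> u \<in> A}"
          have clB: "closedin W (?B k)" if k: "k \<in> ?F" for k
          proof -
            obtain m \<xi> where m: "k = (m, \<xi>)" "\<xi> \<in> ?C m" using k by auto
            have "closedin (disk m) {u \<in> topspace (disk m). \<xi> u \<in> A}" using A(2) m(2) by blast
            then have "compactin (disk m) {u \<in> topspace (disk m). \<xi> u \<in> A}"
              using compact_space_disk closedin_compact_space by blast
            moreover have "continuous_map (disk m) W \<xi>" using cell m(2) by blast
            ultimately have "compactin W (\<xi> ` {u \<in> topspace (disk m). \<xi> u \<in> A})" by (rule image_compactin)
            then show ?thesis using compactin_imp_closedin[OF Haus] m(1) by simp
          qed
          have "{x \<in> topspace (disk n). \<psi> x \<in> A} = (\<Union>k\<in>?F. {x \<in> topspace (disk n). \<psi> x \<in> ?B k})"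
          proof
            show "{x \<in> topspace (disk n). \<psi> x \<in> A} \<subseteq> (\<Union>k\<in>?F. {x \<in> topspace (disk n). \<psi> x \<in> ?B k})"
            proof
              fix x assume x: "x \<in> {x \<in> topspace (disk n). \<psi> x \<in> A}"
              have "x \<notin> open_disk n"
              proof
                assume "x \<in> open_disk n"
                moreover have "\<psi> x \<in> topspace V" using x A(1) by blast
                ultimately show False using cell_V[OF \<psi>] False by blast
              qed
              then have "\<psi> x \<in> (\<Union>(m, \<psi>)\<in>F. \<psi> ` open_disk m)" using F(3) x by blast
              then obtain m \<xi> u where m: "(m, \<xi>) \<in> F" "u \<in> open_disk m" "\<psi> x = \<xi> u" by blast
              moreover have "m < n" "\<xi> \<in> C m" using m(1) F(2) by auto
              moreover have "\<xi> \<in> ?C m"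
              proof (rule cell_V[OF \<open>\<xi> \<in> C m\<close> m(2)])
                show "\<xi> u \<in> topspace V" using m(3) x A(1) by auto
              qed
              moreover have "\<psi> x \<in> ?B (m, \<xi>)" using m x open_disk_sub by auto
              ultimately show "x \<in> (\<Union>k\<in>?F. {x \<in> topspace (disk n). \<psi> x \<in> ?B k})"
                using x by (intro UN_I[of "(m, \<xi>)"]) auto
            qed
            show "(\<Union>k\<in>?F. {x \<in> topspace (disk n). \<psi> x \<in> ?B k}) \<subseteq> {x \<in> topspace (disk n). \<psi> x \<in> A}" by auto
          qed
          moreover have "closedin (disk n) (\<Union>k\<in>?F. {x \<in> topspace (disk n). \<psi> x \<in> ?B k})"
          proof (rule closedin_Union)
            show "finite ((\<lambda>k. {x \<in> topspace (disk n). \<psi> x \<in> ?B k}) ` ?F)" using F(1) by simp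
            fix S assume "S \<in> (\<lambda>k. {x \<in> topspace (disk n). \<psi> x \<in> ?B k}) ` ?F"
            then obtain k where k: "k \<in> ?F" "S = {x \<in> topspace (disk n). \<psi> x \<in> ?B k}" by blast
            have "continuous_map (disk n) W \<psi>" using cell[OF \<psi>] by blast
            then show "closedin (disk n) S"
              unfolding k(2) by (rule closedin_continuous_map_preimage[OF _ clB[OF k(1)]])
          qed
          ultimately show ?thesis by simp
        qed
      qed
      then show ?thesis using A(1) by (subst V_sub) (rule closedin_subset_topspace)
    qed
    show "\<exists>\<psi>\<in>?C n. \<forall>x\<in>topspace (disk n). \<psi> x = snd_act G c l (\<phi> x)" if l: "l \<in> carrier L" and \<phi>: "\<phi> \<in> ?C n" for l n \<phi>
    proof -
      obtain \<psi> where \<psi>: "\<psi> \<in> C n" "\<And>x. x \<in> topspace (disk n) \<Longrightarrow> \<psi> x = c (\<one>\<^bsub>G\<^esub>, l) (\<phi> x)"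
        using trans[OF G.one_closed l, of \<phi> n] \<phi> by auto
      have act: "continuous_action L V (snd_act G c)"
        unfolding V_def
        by (rule fixed_space_action[OF fst_snd_actions(2)[OF G(1,2) c]])
           (use fst_snd_actions(3)[OF G(1,2) c] G(3) in blast)
      have "\<psi> x \<in> topspace V" if x: "x \<in> topspace (disk n)" for x
        using action_closed[OF act l, of "\<phi> x"] \<psi>(2)[OF x] \<phi> x by (auto simp: snd_act_def)
      then have "\<psi> \<in> ?C n" using \<psi>(1) by blast
      then show ?thesis using \<psi>(2) by (auto simp: snd_act_def)
    qed
  qed
qed

text \<open>Otherwise the isotropy group of \<open>x\<close> inside 1 x L is a subgroup that meets 1
  x L nontrivially, and its fixed space, which contains \<open>x\<close>, would have to be
  empty.\<close>

lemma universal_space_free: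
  assumes "group G" "group L" "universal_space TYPE('w) G L E aE"
    and l: "l \<in> carrier L" "x \<in> topspace E" "snd_act G aE l x = x"
  shows "l = \<one>\<^bsub>L\<^esub>"
proof (rule ccontr)
  assume "l \<noteq> \<one>\<^bsub>L\<^esub>"
  interpret G: group G by fact
  interpret L: group L by fact
  have act: "continuous_action (G \<times>\<times> L) E aE" using assms(3) by (simp add: universal_space_def)
  note actL = fst_snd_actions(2)[OF assms(1,2) act]
  let ?\<Gamma> = "{\<one>\<^bsub>G\<^esub>} \<times> {k \<in> carrier L. snd_act G aE k x = x}"
  have "subgroup ?\<Gamma> (G \<times>\<times> L)"
  proof (rule group.subgroupI[OF DirProd_group[OF assms(1,2)]])
    show "?\<Gamma> \<subseteq> carrier (G \<times>\<times> L)" by (auto simp: DirProd_def)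
    show "?\<Gamma> \<noteq> {}" using l by blast
    show "inv\<^bsub>G \<times>\<times> L\<^esub> k \<in> ?\<Gamma>" if "k \<in> ?\<Gamma>" for k
      using that inv_DirProd[OF assms(1,2), of "\<one>\<^bsub>G\<^esub>"] action_inv(1)[OF assms(2) actL _ l(2)] by auto metis
    show "k \<otimes>\<^bsub>G \<times>\<times> L\<^esub> k' \<in> ?\<Gamma>" if "k \<in> ?\<Gamma>" "k' \<in> ?\<Gamma>" for k k'
      using that actL l(2) by (auto simp: DirProd_def continuous_action_def)
  qed
  moreover have "?\<Gamma> \<inter> ({\<one>\<^bsub>G\<^esub>} \<times> carrier L) \<noteq> {(\<one>\<^bsub>G\<^esub>, \<one>\<^bsub>L\<^esub>)}" using l \<open>l \<noteq> \<one>\<^bsub>L\<^esub>\<close> by auto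
  ultimately have "topspace (fixed_space ?\<Gamma> aE E) = {}"
    using assms(3) unfolding universal_space_def by meson
  moreover have "x \<in> topspace (fixed_space ?\<Gamma> aE E)"
    using l(2) by (auto simp: topspace_fixed_space snd_act_def)
  ultimately show False by blast
qed

text \<open>The subgroup K x 1 meets 1 x L trivially.\<close>

lemma universal_space_fixed:
  assumes "group G" "group L" "universal_space TYPE('w) G L E aE" "subgroup K G"
  shows "contractible_space (fixed_space K (fst_act L aE) E)" "topspace (fixed_space K (fst_act L aE) E) \<noteq> {}"
proof -
  interpret G: group G by fact
  interpret L: group L by fact
  interpret K: subgroup K G by fact
  let ?\<Gamma> = "K \<times> {\<one>\<^bsub>L\<^esub>}"
  have "subgroup ?\<Gamma> (G \<times>\<times> L)"
    by (rule DirProd_subgroups[OF assms(1,4,2)]) (rule L.subgroupI, auto)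
  moreover have "?\<Gamma> \<inter> ({\<one>\<^bsub>G\<^esub>} \<times> carrier L) = {(\<one>\<^bsub>G\<^esub>, \<one>\<^bsub>L\<^esub>)}" by auto
  ultimately have "contractible_space (fixed_space ?\<Gamma> aE E) \<and> topspace (fixed_space ?\<Gamma> aE E) \<noteq> {}"
    using assms(3) unfolding universal_space_def by meson
  moreover have "fixed_space ?\<Gamma> aE E = fixed_space K (fst_act L aE) E"
    unfolding fixed_space_def by (rule arg_cong[where f = "subtopology E"]) (auto simp: fst_act_def)
  ultimately show "contractible_space (fixed_space K (fst_act L aE) E)" "topspace (fixed_space K (fst_act L aE) E) \<noteq> {}"
    by simp_all
qed

text \<open>All the fixed spaces of a universal space are models of the classifying space, since the
  fixed spaces of an equivalent CW complex are free contractible CW complexes.\<close>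

lemma universal_space_cw_model:
  assumes G: "group G" "group L" and E: "universal_space TYPE('w) G L E aE" and H: "subgroup H G"
    and \<phi>: "equivariant_homotopy_equivalence L E0 a0
           (fixed_space (carrier G) (fst_act L aE) E) (snd_act G aE) \<phi>"
  obtains W :: "'w topology" and c f where
    "continuous_action (G \<times>\<times> L) W c" "Hausdorff_space W"
    "\<And>l w. l \<in> carrier L \<Longrightarrow> w \<in> topspace W \<Longrightarrow> snd_act G c l w = w \<Longrightarrow> l = \<one>\<^bsub>L\<^esub>"
    "topspace (fixed_space H (fst_act L c) W) \<noteq> {}"
    "equivariant_homotopy_equivalence (G \<times>\<times> L) E aE W c f"
    "equivariant_homotopy_equivalence L E0 a0 (fixed_space H (fst_act L c) W) (snd_act G c) (f \<circ> \<phi>)"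
proof -
  obtain W :: "'w topology" and c C f where c: "continuous_action (G \<times>\<times> L) W c"
    and cw: "equivariant_cw_structure (G \<times>\<times> L) W c C"
    and f: "equivariant_homotopy_equivalence (G \<times>\<times> L) E aE W c f"
    using E unfolding universal_space_def equivariant_cw_homotopy_type_def by metis
  have one: "\<one>\<^bsub>G\<^esub> \<in> carrier G" using G(1) group.is_monoid monoid.one_closed by blast
  have free: "l = \<one>\<^bsub>L\<^esub>" if l: "l \<in> carrier L" "w \<in> topspace W" "snd_act G c l w = w" for l w
  proof -
    \<comment> \<open>The homotopy inverse carries a point of \<open>W\<close> fixed by
      \<open>l\<close> to a point of \<open>E\<close> fixed by \<open>l\<close>, so freeness is
      inherited from \<open>E\<close>.\<close>
    obtain g where g: "equivariant_map (G \<times>\<times> L) W c E aE g"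
      using f by (auto simp: equivariant_homotopy_equivalence_def)
    have "g (snd_act G c l w) = snd_act G aE l (g w)"
      using g l(1,2) one by (auto simp: equivariant_map_def snd_act_def)
    moreover have "g w \<in> topspace E"
      using g l(2) continuous_map_image_subset_topspace unfolding equivariant_map_def by blast
    ultimately show ?thesis using universal_space_free[OF G E l(1)] l(3) by simp
  qed
  have fixed_cw: "free_cw L (fixed_space K (fst_act L c) W) (snd_act G c)
      (\<lambda>n. {\<phi> \<in> C n. \<phi> ` topspace (disk n) \<subseteq> topspace (fixed_space K (fst_act L c) W)})
      (fixed_space K (fst_act L c) W) (snd_act G c)" if K: "subgroup K G" for K
  proof -
    have KG: "K \<subseteq> carrier G" by (rule subgroup.subset[OF K])
    have act: "continuous_action L (fixed_space K (fst_act L c) W) (snd_act G c)"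
      by (rule fixed_space_action[OF fst_snd_actions(2)[OF G c]])
         (use fst_snd_actions(3)[OF G c] KG in blast)
    have equiv: "fixed_space K (fst_act L aE) E homotopy_equivalent_space fixed_space K (fst_act L c) W"
      by (rule equivariant_homotopy_equivalence_space[OF equivariant_homotopy_equivalence_fixed[OF G KG f]])
    then have "contractible_space (fixed_space K (fst_act L c) W)"
      using universal_space_fixed(1)[OF G E K] homotopy_equivalent_space_contractibility by blast
    moreover have "topspace (fixed_space K (fst_act L c) W) \<noteq> {}"
    proof -
      have "equivariant_map L (fixed_space K (fst_act L aE) E) (snd_act G aE)
          (fixed_space K (fst_act L c) W) (snd_act G c) f"
        using equivariant_homotopy_equivalence_fixed[OF G KG f] by (simp add: equivariant_homotopy_equivalence_def)
      then have "f ` topspace (fixed_space K (fst_act L aE) E) \<subseteq> topspace (fixed_space K (fst_act L c) W)"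
        by (simp add: equivariant_map_def continuous_map_image_subset_topspace)
      then show ?thesis using universal_space_fixed(2)[OF G E K] by blast
    qed
    moreover have "l = \<one>\<^bsub>L\<^esub>" if "l \<in> carrier L" "w \<in> topspace (fixed_space K (fst_act L c) W)" "snd_act G c l w = w" for l w
      using free[OF that(1) _ that(3)] that(2) by (simp add: topspace_fixed_space)
    ultimately show ?thesis
      by (intro free_cw.intro G(2) act fixed_cw_structure[OF G KG c cw])
  qed
  have GG: "subgroup (carrier G) G" by (rule group.subgroup_self[OF G(1)])
  have HG: "H \<subseteq> carrier G" by (rule subgroup.subset[OF H])
  have "continuous_map (fixed_space (carrier G) (fst_act L c) W) (fixed_space H (fst_act L c) W) id"
    unfolding fixed_space_def using HG
    by (auto simp: continuous_map_in_subtopology continuous_map_from_subtopology)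
  then have "equivariant_map L (fixed_space (carrier G) (fst_act L c) W) (snd_act G c)
      (fixed_space H (fst_act L c) W) (snd_act G c) id"
    by (simp add: equivariant_map_def)
  \<comment> \<open>This compares \<open>G\<close> with \<open>H\<close>: the inclusion of the
    smaller fixed space is an equivariant map between free contractible complexes.\<close>
  from equivariant_map_between_free_contractible[OF fixed_cw[OF GG] fixed_cw[OF H] this]
  have inc: "equivariant_homotopy_equivalence L (fixed_space (carrier G) (fst_act L c) W) (snd_act G c)
      (fixed_space H (fst_act L c) W) (snd_act G c) id" .
  have "equivariant_homotopy_equivalence L E0 a0 (fixed_space (carrier G) (fst_act L c) W) (snd_act G c) (f \<circ> \<phi>)"
    by (rule equivariant_homotopy_equivalence_compose[OF \<phi> equivariant_homotopy_equivalence_fixed[OF G subset_refl f]])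
  from equivariant_homotopy_equivalence_compose[OF this inc]
  have model: "equivariant_homotopy_equivalence L E0 a0 (fixed_space H (fst_act L c) W) (snd_act G c) (f \<circ> \<phi>)"
    by simp
  show thesis
  proof (rule that[OF c _ _ _ f model])
    show "Hausdorff_space W" using cw by (simp add: equivariant_cw_structure_def)
    show "topspace (fixed_space H (fst_act L c) W) \<noteq> {}"
      by (rule free_cw.Z(2)[OF fixed_cw[OF H]])
    show "l = \<one>\<^bsub>L\<^esub>" if "l \<in> carrier L" "w \<in> topspace W" "snd_act G c l w = w" for l w
      by (rule free[OF that])
  qed
qed

section \<open>Smash products with contractible fixed point spaces\<close>

abbreviation fixed_points :: "'l set \<Rightarrow> ('l \<Rightarrow> 'b \<Rightarrow> 'b) \<Rightarrow> 'b pspace \<Rightarrow> 'b set" where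
  "fixed_points P a B \<equiv> {x \<in> topspace (ptop B). \<forall>l\<in>P. a l x = x}"

abbreviation conjugate :: "('l, 'm) monoid_scheme \<Rightarrow> 'l \<Rightarrow> 'l set \<Rightarrow> 'l set" where
  "conjugate L k P \<equiv> (\<lambda>l. k \<otimes>\<^bsub>L\<^esub> l \<otimes>\<^bsub>L\<^esub> inv\<^bsub>L\<^esub> k) ` P"

text \<open>The homotopy \<open>r\<close> retracts a neighbourhood of the base point to the base point. It makes up
  for the difference between the smash product with a subspace and the subspace of the smash
  product, which is felt because \<open>Y\<close> is an arbitrary topological space.\<close>

locale well_pointed =
  fixes B :: "'b pspace" and r :: "real \<Rightarrow> 'b \<Rightarrow> 'b" and N :: "'b set"
  assumes pt_B: "pt B \<in> topspace (ptop B)" and pt_closed: "closedin (ptop B) {pt B}"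
    and r_cont: "continuous_map (prod_topology unit_interval (ptop B)) (ptop B) (\<lambda>(t, x). r t x)"
    and r_0: "\<And>x. x \<in> topspace (ptop B) \<Longrightarrow> r 0 x = x"
    and r_pt: "\<And>t. t \<in> {0..1} \<Longrightarrow> r t (pt B) = pt B"
    and N: "openin (ptop B) N" "pt B \<in> N" and r_1: "\<And>x. x \<in> N \<Longrightarrow> r 1 x = pt B"

text \<open>The properties of the suspended flag complex that the argument uses, with
  \<open>PP\<close> the nontrivial p-subgroups: \<open>K P\<close> contracts the
  \<open>P\<close>-fixed points within themselves to the base point, compatibly with conjugation.
  They persist under smash products with spheres and hold for a point, hence at all levels of the
  spectra.\<close>

locale good_space = well_pointed B r N
  for B :: "'b pspace" and r :: "real \<Rightarrow> 'b \<Rightarrow> 'b" and N :: "'b set" +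
  fixes L :: "('l, 'm) monoid_scheme" and bL :: "'l \<Rightarrow> 'b \<Rightarrow> 'b" and PP :: "'l set set"
    and K :: "'l set \<Rightarrow> real \<Rightarrow> 'b \<Rightarrow> 'b"
  assumes group: "group L" and B_action: "pointed_action L B bL"
    and r_eqv: "\<And>t l x. t \<in> {0..1} \<Longrightarrow> l \<in> carrier L \<Longrightarrow> x \<in> topspace (ptop B) \<Longrightarrow> r t (bL l x) = bL l (r t x)"
    and fixed_closed: "\<And>P. P \<in> PP \<Longrightarrow> closedin (ptop B) (fixed_points P bL B)"
    and K_cont: "\<And>P. P \<in> PP \<Longrightarrow>
      continuous_map (prod_topology unit_interval (subtopology (ptop B) (fixed_points P bL B))) (ptop B) (\<lambda>(t, x). K P t x)"
    and K_0: "\<And>P x. P \<in> PP \<Longrightarrow> x \<in> fixed_points P bL B \<Longrightarrow> K P 0 x = x"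
    and K_1: "\<And>P x. P \<in> PP \<Longrightarrow> x \<in> fixed_points P bL B \<Longrightarrow> K P 1 x = pt B"
    and K_pt: "\<And>P t. P \<in> PP \<Longrightarrow> t \<in> {0..1} \<Longrightarrow> K P t (pt B) = pt B"
    and K_fix: "\<And>P t x. P \<in> PP \<Longrightarrow> t \<in> {0..1} \<Longrightarrow> x \<in> fixed_points P bL B \<Longrightarrow> K P t x \<in> fixed_points P bL B"
    and K_eqv: "\<And>P t x k. P \<in> PP \<Longrightarrow> t \<in> {0..1} \<Longrightarrow> x \<in> fixed_points P bL B \<Longrightarrow> k \<in> carrier L \<Longrightarrow>
      K (conjugate L k P) t (bL k x) = bL k (K P t x)"
    and PP_sub: "\<And>P. P \<in> PP \<Longrightarrow> P \<subseteq> carrier L"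

section \<open>Smash products of closed subspaces\<close>

lemma smash_pt_in: "z \<in> topspace (ptop (smash X Y)) \<Longrightarrow> smash_pt X Y z = z"
  by (auto simp: topspace_smash smash_pt_def)

lemma smash_sub_prod:
  "pt X \<in> topspace (ptop X) \<Longrightarrow> pt Y \<in> topspace (ptop Y) \<Longrightarrow>
    topspace (ptop (smash X Y)) \<subseteq> topspace (ptop X) \<times> topspace (ptop Y)"
  by (auto simp: topspace_smash smash_pt_def)

text \<open>Both sides are quotients of A x A' by the same map, the left one by definition and the
  right one by \<open>collapse_map_closed\<close>. The separation condition holds because
  \<open>A\<close> and \<open>A'\<close> contain the base points: a box M x M' around a point of A x
  A' that misses the collapsed set within A x A' cannot contain a base point in either
  factor.\<close>

lemma smash_closed_subspaces:
  assumes X: "pt X \<in> topspace (ptop X)" and Y: "pt Y \<in> topspace (ptop Y)"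
    and A: "closedin (ptop X) A" "pt X \<in> A" and A': "closedin (ptop Y) A'" "pt Y \<in> A'"
  shows "ptop (smash \<lparr>ptop = subtopology (ptop X) A, pt = pt X\<rparr> \<lparr>ptop = subtopology (ptop Y) A', pt = pt Y\<rparr>) =
    subtopology (ptop (smash X Y)) (smash_pt X Y ` (A \<times> A'))"
proof -
  let ?A = "\<lparr>ptop = subtopology (ptop X) A, pt = pt X\<rparr>" and ?A' = "\<lparr>ptop = subtopology (ptop Y) A', pt = pt Y\<rparr>"
  let ?P = "prod_topology (ptop X) (ptop Y)" and ?s = "smash_pt X Y"
  let ?S = "{pt X} \<times> topspace (ptop Y) \<union> topspace (ptop X) \<times> {pt Y}" and ?C = "A \<times> A'"
  have AX: "A \<subseteq> topspace (ptop X)" "A' \<subseteq> topspace (ptop Y)"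
    using A(1) A'(1) by (auto dest: closedin_subset)
  have seq: "smash_pt ?A ?A' = ?s" by (rule ext) (simp add: smash_pt_def)
  have c: "collapse_map ?P (ptop (smash X Y)) ?s ?S" by (rule smash_collapse_map[OF X Y])
  have "collapse_map (subtopology ?P ?C) (subtopology (ptop (smash X Y)) (?s ` ?C)) ?s (?C \<inter> ?S)"
  proof (rule collapse_map_closed[OF c])
    show "closedin ?P ?C" using A(1) A'(1) by (simp add: closedin_prod_Times_iff)
    show "?C \<inter> ?S \<noteq> {}" using A(2) A'(2) Y by blast
    fix U u assume U: "openin ?P U" "u \<in> U \<inter> ?C" "U \<inter> ?C \<inter> ?S = {}"
    obtain x y where u: "u = (x, y)" by force
    have "(x, y) \<in> U" using U u by simp
    then obtain M M' where M: "openin (ptop X) M" "openin (ptop Y) M'" "x \<in> M" "y \<in> M'" "M \<times> M' \<subseteq> U"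
      using U(1) unfolding openin_prod_topology_alt by meson
    have xA: "x \<in> A" "y \<in> A'" using U(2) u by auto
    have "pt X \<notin> M" using M xA A(2) AX U(3) by blast
    moreover have "pt Y \<notin> M'" using M xA A'(2) AX U(3) by blast
    ultimately show "\<exists>V. openin ?P V \<and> u \<in> V \<and> V \<subseteq> U \<and> V \<inter> ?S = {}"
      using M u by (intro exI[of _ "M \<times> M'"]) (auto simp: openin_prod_Times_iff)
  qed
  then have q1: "quotient_map (subtopology ?P ?C) (subtopology (ptop (smash X Y)) (?s ` ?C)) ?s"
    by (simp add: collapse_map_def)
  have "quotient_map (prod_topology (ptop ?A) (ptop ?A')) (ptop (smash ?A ?A')) (smash_pt ?A ?A')"
    by (rule smash_quotient_map)
  moreover have "prod_topology (ptop ?A) (ptop ?A') = subtopology ?P ?C"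
    by (simp add: subtopology_Times)
  ultimately have q2: "quotient_map (subtopology ?P ?C) (ptop (smash ?A ?A')) ?s" by (simp add: seq)
  have tops: "topspace (ptop (smash ?A ?A')) = topspace (subtopology (ptop (smash X Y)) (?s ` ?C))"
    using quotient_imp_surjective_map[OF q1] quotient_imp_surjective_map[OF q2] by simp
  show ?thesis
    unfolding topology_eq
  proof
    fix U
    show "openin (ptop (smash ?A ?A')) U = openin (subtopology (ptop (smash X Y)) (?s ` ?C)) U"
    proof (cases "U \<subseteq> topspace (ptop (smash ?A ?A'))")
      case True
      then have "openin (subtopology ?P ?C) {x \<in> topspace (subtopology ?P ?C). ?s x \<in> U} = openin (ptop (smash ?A ?A')) U"
        using q2 unfolding quotient_map_def by blast
      moreover have "openin (subtopology ?P ?C) {x \<in> topspace (subtopology ?P ?C). ?s x \<in> U} =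
          openin (subtopology (ptop (smash X Y)) (?s ` ?C)) U"
        using q1 True[unfolded tops] unfolding quotient_map_def by blast
      ultimately show ?thesis by (rule trans[OF sym])
    next
      case False
      then have "\<not> openin (ptop (smash ?A ?A')) U" using openin_subset[of "ptop (smash ?A ?A')" U] by (rule contrapos_nn)
      moreover have "\<not> openin (subtopology (ptop (smash X Y)) (?s ` ?C)) U"
        using False[unfolded tops] openin_subset[of "subtopology (ptop (smash X Y)) (?s ` ?C)" U] by (rule contrapos_nn)
      ultimately show ?thesis by simp
    qed
  qed
qed

lemma pspace_topspace: "\<lparr>ptop = subtopology (ptop Y) (topspace (ptop Y)), pt = pt Y\<rparr> = (Y :: 'y pspace)"
  by (cases Y) simp

context good_space
begin

lemma B_action': "continuous_action L (ptop B) bL"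
  using B_action by (simp add: pointed_action_def)

lemma pt_fixed: "P \<in> PP \<Longrightarrow> pt B \<in> fixed_points P bL B"
  using B_action PP_sub by (auto simp: pointed_action_def)

lemma r_closed: "t \<in> {0..1} \<Longrightarrow> x \<in> topspace (ptop B) \<Longrightarrow> r t x \<in> topspace (ptop B)"
  using continuous_map_image_subset_topspace[OF r_cont] by (auto simp: image_subset_iff)

text \<open>\<open>K P\<close> is continuous only on the fixed points of \<open>P\<close>. These are
  closed, so their smash product with \<open>Y\<close> has the subspace topology and the homotopy
  can be formed there.\<close>

lemma K_smash_cont:
  assumes P: "P \<in> PP" and Y: "pt Y \<in> topspace (ptop Y)"
  shows "continuous_map (prod_topology unit_interval (subtopology (ptop (smash B Y))
      (smash_pt B Y ` (fixed_points P bL B \<times> topspace (ptop Y))))) (ptop (smash B Y))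
    (\<lambda>(t, z). smash_pt B Y (K P t (fst z), snd z))"
proof -
  let ?A = "\<lparr>ptop = subtopology (ptop B) (fixed_points P bL B), pt = pt B\<rparr>"
  have eq: "ptop (smash ?A Y) = subtopology (ptop (smash B Y)) (smash_pt B Y ` (fixed_points P bL B \<times> topspace (ptop Y)))"
    using smash_closed_subspaces[OF pt_B Y fixed_closed[OF P] pt_fixed[OF P] closedin_topspace Y]
    by (simp only: pspace_topspace)
  have "continuous_map (prod_topology unit_interval (ptop (smash ?A Y))) (ptop (smash B Y))
      (\<lambda>(t, z). smash_pt B Y (K P t (fst z), snd z))"
    by (rule continuous_map_smash_homotopy[where k = "\<lambda>_. id", simplified id_apply])
       (use K_cont[OF P] K_pt[OF P] in \<open>auto simp: case_prod_beta' intro: continuous_map_snd\<close>)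
  then show ?thesis by (simp only: eq)
qed

end

text \<open>In this part of the argument, the fact that \<open>G\<close> is a p-group enters through
  \<open>stab_PP\<close> alone.\<close>

locale smash_fixed_orbits = good_space B r N L bL PP K +
    fixed_orbits L G H "smash B Y" "smash_act bL yL" "smash_act (\<lambda>_. id) yH" E eL eH
  for B :: "'b pspace" and r N and L :: "('l, 'm) monoid_scheme" and bL PP K
    and G :: "('g, 'k) monoid_scheme" and H and Y :: "'y pspace" and yL yH
    and E :: "'e topology" and eL eH +
  assumes YL: "pointed_action L Y yL" and YG: "pointed_action G Y yH"
    and Ycomm: "\<And>l g y. l \<in> carrier L \<Longrightarrow> g \<in> carrier G \<Longrightarrow> y \<in> topspace (ptop Y) \<Longrightarrow>
      yL l (yH g y) = yH g (yL l y)"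
    and stab_PP: "\<And>w. w \<in> E_fix \<Longrightarrow> snd ` stab w \<noteq> {\<one>\<^bsub>L\<^esub>} \<Longrightarrow> snd ` stab w \<in> PP"
begin

abbreviation "Y\<^sub>H \<equiv> fixed_pspace H yH Y"
abbreviation "X \<equiv> smash B Y"
abbreviation "X' \<equiv> smash B Y\<^sub>H"

text \<open>For trivial \<open>P\<close> a constant homotopy would end in the identity, which need
  not be continuous into the smash product of \<open>B\<close> with the fixed points of
  \<open>Y\<close>; therefore \<open>r\<close> is used.\<close>

definition \<Phi> :: "'l set \<Rightarrow> real \<Rightarrow> 'b \<times> 'y \<Rightarrow> 'b \<times> 'y" where
  "\<Phi> P t z = smash_pt B Y (if P = {\<one>\<^bsub>L\<^esub>} then r t (fst z) else K P t (fst z), snd z)"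

lemma ptY: "pt Y \<in> topspace (ptop Y)"
  using YL by (simp add: pointed_action_def)

lemma ptY': "pt Y\<^sub>H \<in> topspace (ptop Y\<^sub>H)"
  using ptY YG H_carrier by (auto simp: topspace_fixed_pspace pointed_action_def)

lemma Y\<^sub>H_action: "pointed_action L Y\<^sub>H yL"
proof -
  have "continuous_action L (fixed_space H yH (ptop Y)) yL"
    using YL Ycomm H_carrier by (intro fixed_space_action) (auto simp: pointed_action_def)
  then show ?thesis using YL ptY' by (simp add: pointed_action_def fixed_pspace_def)
qed

lemma smash_pt_Y\<^sub>H: "smash_pt B Y\<^sub>H = smash_pt B Y"
  by (rule ext) (simp add: smash_pt_def)

lemma X_sub: "z \<in> topspace (ptop X) \<Longrightarrow> fst z \<in> topspace (ptop B) \<and> snd z \<in> topspace (ptop Y)"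
  using subsetD[OF smash_sub_prod[OF pt_B ptY], of z] by (simp add: mem_Times_iff)

lemma topspace_X': "topspace (ptop X') = {z \<in> topspace (ptop X). \<forall>h\<in>H. smash_act (\<lambda>_. id) yH h z = z}"
proof -
  have "z \<in> topspace (ptop X') \<longleftrightarrow> z \<in> topspace (ptop X) \<and> snd z \<in> topspace (ptop Y\<^sub>H)" for z
    using ptY' pt_B
    by (cases z) (force simp: topspace_smash smash_pt_Y\<^sub>H topspace_fixed_pspace smash_pt_def split: if_splits)
  then show ?thesis
    using X_sub by (auto simp: smash_act_def topspace_fixed_pspace split: prod.splits)
qed

lemma smash_act_smash_pt:
  assumes "l \<in> carrier L" "b \<in> topspace (ptop B)" "y \<in> topspace (ptop Y)"
  shows "smash_act bL yL l (smash_pt B Y (b, y)) = smash_pt B Y (bL l b, yL l y)"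
  using assms pointed_action_eq_pt[OF group B_action] pointed_action_eq_pt[OF group YL] B_action YL
  by (auto simp: smash_act_def smash_pt_def pointed_action_def)

text \<open>If (h, l) fixes \<open>w\<close>, then (h, k l k^-1) fixes k w, because the actions of
  \<open>H\<close> and \<open>L\<close> commute.\<close>

lemma P_conj:
  assumes "w \<in> E_fix" "k \<in> carrier L"
  shows "snd ` stab (eL k w) = conjugate L k (snd ` stab w)"
proof -
  have sub: "(h, k \<otimes>\<^bsub>L\<^esub> l \<otimes>\<^bsub>L\<^esub> inv\<^bsub>L\<^esub> k) \<in> stab (eL k w)"
    if "w \<in> topspace E" "k \<in> carrier L" "(h, l) \<in> stab w" for h l k w
  proof -
    have hl: "h \<in> H" "l \<in> carrier L" "eL l (eH h w) = w" using that by (auto simp: stab_def)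
    have 1: "eH h w \<in> topspace E" "eL k (eH h w) \<in> topspace E"
      using eH_closed[OF hl(1) that(1)] eL_closed[OF that(2)] by auto
    have "eL (k \<otimes>\<^bsub>L\<^esub> l \<otimes>\<^bsub>L\<^esub> inv\<^bsub>L\<^esub> k) (eH h (eL k w)) = eL (k \<otimes>\<^bsub>L\<^esub> l) (eL (inv\<^bsub>L\<^esub> k) (eL k (eH h w)))"
      using Ecomm[OF that(2) H_carrier[OF hl(1)] that(1)] EL hl that(2) 1 by (simp add: continuous_action_def)
    also have "\<dots> = eL k w"
      using action_inv(1)[OF L(1) EL that(2) 1(1)] EL hl that(2) 1 by (simp add: continuous_action_def)
    finally show ?thesis using hl that(2) by (simp add: stab_def)
  qed
  have w: "w \<in> topspace E" using assms(1) by (simp add: E_fix_def)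
  have kw: "eL k w \<in> topspace E" using eL_closed[OF assms(2) w] .
  show ?thesis
  proof
    show "conjugate L k (snd ` stab w) \<subseteq> snd ` stab (eL k w)"
      using sub[OF w assms(2)] by force
    show "snd ` stab (eL k w) \<subseteq> conjugate L k (snd ` stab w)"
    proof
      fix l assume "l \<in> snd ` stab (eL k w)"
      then obtain h where hl: "(h, l) \<in> stab (eL k w)" by auto
      have lL: "l \<in> carrier L" using hl by (simp add: stab_def)
      have "(h, inv\<^bsub>L\<^esub> k \<otimes>\<^bsub>L\<^esub> l \<otimes>\<^bsub>L\<^esub> k) \<in> stab w"
        using sub[OF kw group_L.inv_closed[OF assms(2)] hl] action_inv(1)[OF L(1) EL assms(2) w] assms(2) by simp
      moreover have "l = k \<otimes>\<^bsub>L\<^esub> (inv\<^bsub>L\<^esub> k \<otimes>\<^bsub>L\<^esub> l \<otimes>\<^bsub>L\<^esub> k) \<otimes>\<^bsub>L\<^esub> inv\<^bsub>L\<^esub> k"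
      proof -
        have "k \<otimes>\<^bsub>L\<^esub> (inv\<^bsub>L\<^esub> k \<otimes>\<^bsub>L\<^esub> l) = k \<otimes>\<^bsub>L\<^esub> inv\<^bsub>L\<^esub> k \<otimes>\<^bsub>L\<^esub> l"
          using lL assms(2) by (intro group_L.m_assoc[symmetric]) auto
        then show ?thesis using lL assms(2) by (simp add: group_L.m_assoc)
      qed
      ultimately show "l \<in> conjugate L k (snd ` stab w)"
        by (intro image_eqI[of _ _ "inv\<^bsub>L\<^esub> k \<otimes>\<^bsub>L\<^esub> l \<otimes>\<^bsub>L\<^esub> k"]) force+
    qed
  qed
qed

text \<open>An element (h, l) of the isotropy group acts on the coordinate in \<open>B\<close>
  through \<open>l\<close> only.\<close>

lemma X_fix_sub: "X_fix (stab w) \<subseteq> smash_pt B Y ` (fixed_points (snd ` stab w) bL B \<times> topspace (ptop Y))"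
proof
  fix z assume z: "z \<in> X_fix (stab w)"
  then have zX: "z \<in> topspace (ptop X)" by (simp add: X_fix_def)
  have "bL l (fst z) = fst z" if l: "l \<in> snd ` stab w" for l
  proof -
    obtain h where "(h, l) \<in> stab w" using l by auto
    then have "smash_act bL yL l (smash_act (\<lambda>_. id) yH h z) = z" using z by (auto simp: X_fix_def)
    then show ?thesis by (cases z) (simp add: smash_act_def)
  qed
  then have "z \<in> fixed_points (snd ` stab w) bL B \<times> topspace (ptop Y)"
    using X_sub[OF zX] by (simp add: mem_Times_iff)
  moreover have "z = smash_pt B Y z" using smash_pt_in[OF zX] by simp
  ultimately show "z \<in> smash_pt B Y ` (fixed_points (snd ` stab w) bL B \<times> topspace (ptop Y))" by (rule rev_image_eqI)
qed

lemma X_fix_fixed: "z \<in> X_fix (stab w) \<Longrightarrow> w \<in> E_fix \<Longrightarrow> fst z \<in> fixed_points (snd ` stab w) bL B"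
proof -
  assume z: "z \<in> X_fix (stab w)" and w: "w \<in> E_fix"
  have "pt B \<in> fixed_points (snd ` stab w) bL B"
    using B_action pt_B by (auto simp: pointed_action_def stab_def)
  moreover obtain b y where "b \<in> fixed_points (snd ` stab w) bL B" "z = smash_pt B Y (b, y)"
    using X_fix_sub z by blast
  ultimately show ?thesis by (simp add: smash_pt_def)
qed

lemma \<Phi>_triv_cont: "continuous_map (prod_topology unit_interval (ptop X)) (ptop X) (\<lambda>(t, z). \<Phi> {\<one>\<^bsub>L\<^esub>} t z)"
proof -
  have "continuous_map (prod_topology unit_interval (ptop X)) (ptop X)
      (\<lambda>(t, z). smash_pt B Y (r t (fst z), id (snd z)))"
    by (rule continuous_map_smash_homotopy[where k = "\<lambda>_. id"])
       (use r_cont r_pt in \<open>auto simp: case_prod_beta' intro: continuous_map_snd\<close>)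
  then show ?thesis by (simp add: \<Phi>_def)
qed

lemma \<Phi>_triv_cont': "continuous_map (prod_topology unit_interval (ptop X')) (ptop X') (\<lambda>(t, z). \<Phi> {\<one>\<^bsub>L\<^esub>} t z)"
proof -
  have "continuous_map (prod_topology unit_interval (ptop X')) (ptop X')
      (\<lambda>(t, z). smash_pt B Y\<^sub>H (r t (fst z), id (snd z)))"
    by (rule continuous_map_smash_homotopy[where k = "\<lambda>_. id"])
       (use r_cont r_pt in \<open>auto simp: case_prod_beta' intro: continuous_map_snd\<close>)
  then show ?thesis by (simp add: \<Phi>_def smash_pt_Y\<^sub>H)
qed

text \<open>The domain is covered by two open sets. Over \<open>N\<close> the map is constant. Where
  the coordinate in \<open>B\<close> differs from the base point, the coordinate in \<open>Y\<close>
  is an honest fixed point, so the map factors through the product of \<open>B\<close> with the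
  fixed points of \<open>Y\<close>.\<close>

lemma \<Phi>_1_cont: "continuous_map (subtopology (ptop X) (topspace (ptop X'))) (ptop X') (\<Phi> {\<one>\<^bsub>L\<^esub>} 1)"
proof -
  let ?P = "prod_topology (ptop B) (ptop Y)" and ?s = "smash_pt B Y"
  let ?S = "{pt B} \<times> topspace (ptop Y) \<union> topspace (ptop B) \<times> {pt Y}"
  \<comment> \<open>The full preimage of the points of \<open>X'\<close>. It includes pairs over
    \<open>pt B\<close> whose second coordinate is not fixed, and this makes it contain the
    collapsed set.\<close>
  let ?A = "{u \<in> topspace ?P. fst u = pt B \<or> snd u \<in> topspace (ptop Y\<^sub>H)}"
  have c: "collapse_map ?P (ptop X) ?s ?S" by (rule smash_collapse_map[OF pt_B ptY])
  have "collapse_map (subtopology ?P ?A) (subtopology (ptop X) (?s ` ?A)) ?s ?S"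
    by (rule collapse_map_superset[OF c]) (use pt_B ptY ptY' in auto)
  then have q: "quotient_map (subtopology ?P ?A) (subtopology (ptop X) (?s ` ?A)) ?s"
    by (simp add: collapse_map_def)
  have imA: "?s ` ?A = topspace (ptop X')"
  proof
    show "?s ` ?A \<subseteq> topspace (ptop X')"
    proof
      fix z assume "z \<in> ?s ` ?A"
      then obtain u where u: "u \<in> ?A" "z = ?s u" by blast
      obtain b y where uby: "u = (b, y)" by force
      have b: "b \<in> topspace (ptop B)" "b = pt B \<or> y \<in> topspace (ptop Y\<^sub>H)" "z = ?s (b, y)"
        using u uby by auto
      have "z = ?s (b, if b = pt B then pt Y else y)" using b(3) by (simp add: smash_pt_def)
      then show "z \<in> topspace (ptop X')"
        unfolding topspace_smash smash_pt_Y\<^sub>H using b ptY' by (intro image_eqI) auto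
    qed
    show "topspace (ptop X') \<subseteq> ?s ` ?A"
      unfolding topspace_smash smash_pt_Y\<^sub>H by (rule image_mono) (auto simp: topspace_fixed_pspace)
  qed
  have base: "(pt B, pt Y) \<in> topspace (ptop X')" using pt_in_smash[OF pt_B ptY'] by simp
  have "continuous_map (subtopology ?P ?A) (ptop X') (\<Phi> {\<one>\<^bsub>L\<^esub>} 1 \<circ> ?s)"
  proof (rule pasting_lemma[of "{True, False}" _ "\<lambda>i. ?A \<inter> (if i then N else topspace (ptop B) - {pt B}) \<times> topspace (ptop Y)"
        _ "\<lambda>_. \<Phi> {\<one>\<^bsub>L\<^esub>} 1 \<circ> ?s"])
    fix i :: bool
    let ?T = "?A \<inter> (if i then N else topspace (ptop B) - {pt B}) \<times> topspace (ptop Y)"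
    have "openin ?P ((if i then N else topspace (ptop B) - {pt B}) \<times> topspace (ptop Y))"
      using N(1) pt_closed by (simp add: openin_prod_Times_iff openin_diff)
    then show "openin (subtopology ?P ?A) ?T" by (auto simp: openin_subtopology)
    have sub: "subtopology (subtopology ?P ?A) ?T = subtopology ?P ?T"
      by (simp add: subtopology_subtopology Int_absorb1)
    show "continuous_map (subtopology (subtopology ?P ?A) ?T) (ptop X') (\<Phi> {\<one>\<^bsub>L\<^esub>} 1 \<circ> ?s)"
    proof (cases i)
      case True
      have "continuous_map (subtopology ?P ?T) (ptop X') (\<lambda>_. (pt B, pt Y))" using base by simp
      then have "continuous_map (subtopology ?P ?T) (ptop X') (\<Phi> {\<one>\<^bsub>L\<^esub>} 1 \<circ> ?s)"
        by (rule continuous_map_eq) (use True r_1 in \<open>auto simp: \<Phi>_def smash_pt_def\<close>)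
      then show ?thesis by (simp only: sub)
    next
      case False
      have 1: "continuous_map (subtopology ?P ?T) (ptop B) (\<lambda>u. r 1 (fst u))"
      proof -
        have "continuous_map (ptop B) (ptop B) (r 1)"
          using continuous_map_o_Pair[OF r_cont, of 1] by (simp add: o_def)
        from continuous_map_compose[OF continuous_map_from_subtopology[OF continuous_map_fst] this]
        show ?thesis unfolding o_def .
      qed
      have 2: "continuous_map (subtopology ?P ?T) (ptop Y\<^sub>H) snd"
      proof -
        have eq: "subtopology (ptop Y) (topspace (ptop Y\<^sub>H)) = ptop Y\<^sub>H"
          by (simp add: fixed_pspace_def fixed_space_def subtopology_restrict)
        have "continuous_map (subtopology ?P ?T) (subtopology (ptop Y) (topspace (ptop Y\<^sub>H))) snd"
          by (rule continuous_map_into_subtopology[OF continuous_map_from_subtopology[OF continuous_map_snd]])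
             (use False in auto)
        then show ?thesis by (simp only: eq)
      qed
      from continuous_map_compose[OF continuous_map_pairedI[OF 1 2] quotient_imp_continuous_map[OF smash_quotient_map]]
      have "continuous_map (subtopology ?P ?T) (ptop X') (\<lambda>u. ?s (r 1 (fst u), snd u))"
        by (simp add: o_def smash_pt_Y\<^sub>H)
      then have "continuous_map (subtopology ?P ?T) (ptop X') (\<Phi> {\<one>\<^bsub>L\<^esub>} 1 \<circ> ?s)"
        by (rule continuous_map_eq) (use False r_pt[of 1] in \<open>auto simp: \<Phi>_def smash_pt_def\<close>)
      then show ?thesis by (simp only: sub)
    qed
  next
    fix x assume "x \<in> topspace (subtopology ?P ?A)"
    then show "\<exists>j. j \<in> {True, False} \<and> x \<in> ?A \<inter> (if j then N else topspace (ptop B) - {pt B}) \<times> topspace (ptop Y) \<and>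
        (\<Phi> {\<one>\<^bsub>L\<^esub>} 1 \<circ> ?s) x = (\<Phi> {\<one>\<^bsub>L\<^esub>} 1 \<circ> ?s) x"
      using N(2) by (intro exI[of _ "fst x = pt B"]) auto
  qed auto
  then show ?thesis
    using continuous_compose_quotient_map[OF q] imA by simp
qed

lemma \<Phi>_in_X:
  assumes "w \<in> E_fix" "t \<in> {0..1}" "z \<in> X_fix (stab w)"
  shows "(if snd ` stab w = {\<one>\<^bsub>L\<^esub>} then r t (fst z) else K (snd ` stab w) t (fst z)) \<in> fixed_points (snd ` stab w) bL B"
proof (cases "snd ` stab w = {\<one>\<^bsub>L\<^esub>}")
  case True
  have "fst z \<in> topspace (ptop B)" using assms(3) X_sub by (auto simp: X_fix_def)
  then have "r t (fst z) \<in> topspace (ptop B)" using r_closed assms(2) by blast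
  then show ?thesis using True B_action' by (simp add: continuous_action_def)
next
  case False
  then show ?thesis using K_fix[OF stab_PP[OF assms(1) False] assms(2) X_fix_fixed[OF assms(3,1)]] by simp
qed

lemma conj_trivial: "P \<subseteq> carrier L \<Longrightarrow> k \<in> carrier L \<Longrightarrow> conjugate L k P = {\<one>\<^bsub>L\<^esub>} \<longleftrightarrow> P = {\<one>\<^bsub>L\<^esub>}"
proof
  assume P: "P \<subseteq> carrier L" and k: "k \<in> carrier L"
  { assume eq: "conjugate L k P = {\<one>\<^bsub>L\<^esub>}"
    have "l = \<one>\<^bsub>L\<^esub>" if "l \<in> P" for l
    proof -
      have l: "l \<in> carrier L" using P that by blast
      have "k \<otimes>\<^bsub>L\<^esub> l \<otimes>\<^bsub>L\<^esub> inv\<^bsub>L\<^esub> k = \<one>\<^bsub>L\<^esub>" using eq that by blast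
      then have "k \<otimes>\<^bsub>L\<^esub> l = k" using l k by (metis group_L.inv_closed group_L.inv_equality group_L.inv_inv group_L.m_closed)
      then show ?thesis using l k by (metis group_L.l_cancel_one')
    qed
    moreover have "P \<noteq> {}" using eq by auto
    ultimately show "P = {\<one>\<^bsub>L\<^esub>}" by blast }
  { assume "P = {\<one>\<^bsub>L\<^esub>}"
    then show "conjugate L k P = {\<one>\<^bsub>L\<^esub>}" using k by simp }
qed

theorem smash_inclusion_equivalence:
  "pointed_homotopy_equivalence (orbit_smash L X' (smash_act bL yL) (fixed_space H eH E) eL)
     (fixed_orbit_smash L X (smash_act bL yL) E eL H (smash_act (\<lambda>_. id) yH) eH) id"
proof -
  interpret deformed_fixed_orbits L G H X "smash_act bL yL" "smash_act (\<lambda>_. id) yH" E eL eH X' \<Phi>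
  proof unfold_locales
    show "topspace (ptop X') = {z \<in> topspace (ptop X). \<forall>h\<in>H. smash_act (\<lambda>_. id) yH h z = z}"
      by (rule topspace_X')
    show "pt X' = pt X" by simp
    show "pointed_action L X' (smash_act bL yL)"
      by (rule pointed_action_smash[OF group B_action Y\<^sub>H_action])
    have "pointed_map Y\<^sub>H Y id"
      by (simp add: pointed_map_def fixed_pspace_def fixed_space_def continuous_map_from_subtopology)
    then have "continuous_map (ptop X') (ptop X) (\<lambda>z. smash_pt B Y (id (fst z), id (snd z)))"
      by (intro continuous_map_smash) (simp_all add: pointed_map_def id_def)
    then show "continuous_map (ptop X') (ptop X) id"
      by (rule continuous_map_eq) (use smash_pt_in topspace_X' in auto)
    show "continuous_map (prod_topology unit_interval (subtopology (ptop X) (X_fix \<Gamma>))) (ptop X)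
        (\<lambda>(t, z). \<Phi> (snd ` \<Gamma>) t z)" if \<Gamma>: "\<Gamma> \<in> stab ` E_fix" for \<Gamma>
    proof -
      obtain w where w: "w \<in> E_fix" "\<Gamma> = stab w" using \<Gamma> by blast
      have sub: "prod_topology unit_interval (subtopology (ptop X) S) = subtopology (prod_topology unit_interval (ptop X)) (UNIV \<times> S)" for S
        by (simp add: subtopology_Times)
      show ?thesis
      proof (cases "snd ` \<Gamma> = {\<one>\<^bsub>L\<^esub>}")
        case True
        then show ?thesis unfolding True sub by (intro continuous_map_from_subtopology \<Phi>_triv_cont)
      next
        case False
        have P: "snd ` stab w \<in> PP" using stab_PP[OF w(1)] False w(2) by simp
        have "continuous_map (prod_topology unit_interval (subtopology (ptop X) (X_fix \<Gamma>))) (ptop X)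
            (\<lambda>(t, z). smash_pt B Y (K (snd ` \<Gamma>) t (fst z), snd z))"
          unfolding sub w(2)
          by (rule continuous_map_from_subtopology_mono[OF K_smash_cont[OF P ptY, unfolded sub]])
             (intro Sigma_mono order_refl X_fix_sub)
        then show ?thesis using False by (simp add: \<Phi>_def)
      qed
    qed
    show "\<Phi> (snd ` stab w) 0 z = z" if "w \<in> E_fix" "z \<in> X_fix (stab w)" for w z
    proof -
      have zX: "z \<in> topspace (ptop X)" using that(2) by (simp add: X_fix_def)
      have "K (snd ` stab w) 0 (fst z) = fst z" if "snd ` stab w \<noteq> {\<one>\<^bsub>L\<^esub>}"
        using K_0[OF stab_PP[OF \<open>w \<in> E_fix\<close> that] X_fix_fixed[OF \<open>z \<in> X_fix (stab w)\<close> \<open>w \<in> E_fix\<close>]] .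
      then show ?thesis using r_0 X_sub[OF zX] smash_pt_in[OF zX] by (simp add: \<Phi>_def)
    qed
    show "\<Phi> (snd ` stab w) t (pt X) = pt X" if "w \<in> E_fix" "t \<in> {0..1}" for w t
      using r_pt[OF that(2)] K_pt[OF stab_PP[OF that(1)] that(2)] by (auto simp: \<Phi>_def smash_pt_def)
    show "\<Phi> (snd ` stab w) t z \<in> X_fix (stab w)" if "w \<in> E_fix" "t \<in> {0..1}" "z \<in> X_fix (stab w)" for w t z
    proof -
      let ?b = "if snd ` stab w = {\<one>\<^bsub>L\<^esub>} then r t (fst z) else K (snd ` stab w) t (fst z)"
      have b: "?b \<in> fixed_points (snd ` stab w) bL B" by (rule \<Phi>_in_X[OF that])
      have zX: "z \<in> topspace (ptop X)" using that(3) by (simp add: X_fix_def)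
      have \<Phi>_eq: "\<Phi> (snd ` stab w) t z = smash_pt B Y (?b, snd z)" by (simp add: \<Phi>_def)
      have "smash_act bL yL l (smash_act (\<lambda>_. id) yH h (smash_pt B Y (?b, snd z))) = smash_pt B Y (?b, snd z)"
        if hl: "(h, l) \<in> stab w" for h l
      proof -
        have l: "l \<in> carrier L" "h \<in> H" "l \<in> snd ` stab w" using hl by (force simp: stab_def)+
        have "smash_act bL yL l (smash_act (\<lambda>_. id) yH h z) = z" using \<open>z \<in> X_fix (stab w)\<close> hl by (auto simp: X_fix_def)
        then have y: "yL l (yH h (snd z)) = snd z" by (cases z) (simp add: smash_act_def)
        have bl: "bL l ?b = ?b" using b l(3) by blast
        have pts: "bL l (pt B) = pt B" "yL l (pt Y) = pt Y" "yH h (pt Y) = pt Y"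
          using B_action YL YG l H_carrier by (auto simp: pointed_action_def)
        show ?thesis
          using y bl pts unfolding smash_act_def smash_pt_def by simp
      qed
      moreover have "smash_pt B Y (?b, snd z) \<in> topspace (ptop X)"
        unfolding topspace_smash by (rule imageI) (use b X_sub[OF zX] in auto)
      ultimately show ?thesis unfolding \<Phi>_eq X_fix_def by blast
    qed
    show "\<Phi> (snd ` stab (eL k w)) t (smash_act bL yL k z) = smash_act bL yL k (\<Phi> (snd ` stab w) t z)"
      if "w \<in> E_fix" "t \<in> {0..1}" "z \<in> X_fix (stab w)" "k \<in> carrier L" for w t z k
    proof -
      let ?P = "snd ` stab w"
      have PL: "?P \<subseteq> carrier L" by (auto simp: stab_def)
      have zX: "z \<in> topspace (ptop X)" using that(3) by (simp add: X_fix_def)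
      have b: "(if ?P = {\<one>\<^bsub>L\<^esub>} then r t (fst z) else K ?P t (fst z)) \<in> topspace (ptop B)"
        using \<Phi>_in_X[OF that(1-3)] by blast
      have eq: "(if conjugate L k ?P = {\<one>\<^bsub>L\<^esub>} then r t (bL k (fst z)) else K (conjugate L k ?P) t (bL k (fst z))) =
          bL k (if ?P = {\<one>\<^bsub>L\<^esub>} then r t (fst z) else K ?P t (fst z))"
        using conj_trivial[OF PL that(4)] r_eqv[OF that(2,4)] X_sub[OF zX]
          K_eqv[OF stab_PP[OF that(1)] that(2) X_fix_fixed[OF that(3,1)] that(4)] by auto
      have fz: "fst (smash_act bL yL k z) = bL k (fst z)" "snd (smash_act bL yL k z) = yL k (snd z)"
        by (simp_all add: smash_act_def)
      have "\<Phi> (conjugate L k ?P) t (smash_act bL yL k z) =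
          smash_pt B Y (bL k (if ?P = {\<one>\<^bsub>L\<^esub>} then r t (fst z) else K ?P t (fst z)), yL k (snd z))"
        unfolding \<Phi>_def fz by (simp only: eq)
      then show ?thesis
        using smash_act_smash_pt[OF that(4) b, of "snd z"] X_sub[OF zX] P_conj[OF that(1,4)] by (simp add: \<Phi>_def)
    qed
    show "\<Phi> (snd ` stab w) 1 z = pt X" if "w \<in> E_fix" "z \<in> X_fix (stab w)" "snd ` stab w \<noteq> {\<one>\<^bsub>L\<^esub>}" for w z
      using K_1[OF stab_PP[OF that(1,3)] X_fix_fixed[OF that(2,1)]] that(3) by (simp add: \<Phi>_def smash_pt_def)
    show "continuous_map (prod_topology unit_interval (ptop X')) (ptop X') (\<lambda>(t, z). \<Phi> {\<one>\<^bsub>L\<^esub>} t z)"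
      by (rule \<Phi>_triv_cont')
    show "continuous_map (subtopology (ptop X) (topspace (ptop X'))) (ptop X') (\<Phi> {\<one>\<^bsub>L\<^esub>} 1)"
      by (rule \<Phi>_1_cont)
  qed
  show ?thesis by (rule inclusion_equivalence)
qed

end

text \<open>The action on \<open>S\<close> is trivial, so the fixed points of \<open>P\<close> are
  the smash product of \<open>S\<close> with those of \<open>B\<close>, and contracting the second
  coordinate contracts them. A point lies near the base point as soon as one of its coordinates
  does.\<close>

lemma good_space_smash:
  assumes S: "well_pointed S rS NS" and B: "good_space B r N L bL PP K"
  shows "good_space (smash S B) (\<lambda>t z. smash_pt S B (rS t (fst z), r t (snd z)))
    {z \<in> topspace (ptop (smash S B)). fst z \<in> NS \<or> snd z \<in> N} L (smash_act (\<lambda>_. id) bL) PP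
    (\<lambda>P t z. smash_pt S B (fst z, K P t (snd z)))"
proof -
  interpret S: well_pointed S rS NS by fact
  interpret B: good_space B r N L bL PP K by fact
  let ?X = "smash S B" and ?s = "smash_pt S B" and ?P = "prod_topology (ptop S) (ptop B)"
  let ?a = "smash_act (\<lambda>_. id) bL"
  have q: "quotient_map ?P (ptop ?X) ?s" by (rule smash_quotient_map)
  have S_action: "pointed_action L S (\<lambda>_. id)"
    using S.pt_B by (simp add: pointed_action_def continuous_action_def)
  have a: "pointed_action L ?X ?a" by (rule pointed_action_smash[OF B.group S_action B.B_action])
  have X_sub: "fst z \<in> topspace (ptop S)" "snd z \<in> topspace (ptop B)" if "z \<in> topspace (ptop ?X)" for z
    using subsetD[OF smash_sub_prod[OF S.pt_B B.pt_B] that] by (auto simp: mem_Times_iff)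
  have base: "(pt S, pt B) \<in> topspace (ptop ?X)" using pt_in_smash[OF S.pt_B B.pt_B] .
  have in_X: "?s (x, y) \<in> topspace (ptop ?X)" if "x \<in> topspace (ptop S)" "y \<in> topspace (ptop B)" for x y
    unfolding topspace_smash using that by (intro imageI) auto
  have in_X': "(x, y) \<in> topspace (ptop ?X)"
    if "x \<in> topspace (ptop S)" "y \<in> topspace (ptop B)" "x \<noteq> pt S" "y \<noteq> pt B" for x y
    using in_X[OF that(1,2)] that(3,4) by (simp add: smash_pt_def)
  have NS_sub: "NS \<subseteq> topspace (ptop S)" and N_sub: "N \<subseteq> topspace (ptop B)"
    using S.N B.N openin_subset by auto
  have fixed: "fixed_points P ?a ?X = ?s ` (topspace (ptop S) \<times> fixed_points P bL B)" if "P \<in> PP" for P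
  proof
    show "fixed_points P ?a ?X \<subseteq> ?s ` (topspace (ptop S) \<times> fixed_points P bL B)"
    proof
      fix z assume z: "z \<in> fixed_points P ?a ?X"
      then have "z \<in> topspace (ptop S) \<times> fixed_points P bL B"
        using X_sub by (cases z) (auto simp: smash_act_def)
      moreover have "z = ?s z" using smash_pt_in[of z S B] z by simp
      ultimately show "z \<in> ?s ` (topspace (ptop S) \<times> fixed_points P bL B)" by (rule rev_image_eqI)
    qed
    show "?s ` (topspace (ptop S) \<times> fixed_points P bL B) \<subseteq> fixed_points P ?a ?X"
    proof
      fix z assume "z \<in> ?s ` (topspace (ptop S) \<times> fixed_points P bL B)"
      then obtain x y where xy: "x \<in> topspace (ptop S)" "y \<in> fixed_points P bL B" "z = ?s (x, y)" by blast
      have "bL l (pt B) = pt B" if "l \<in> P" for l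
        using B.pt_fixed[OF \<open>P \<in> PP\<close>] that by blast
      then have "?a l z = z" if "l \<in> P" for l
        using xy that by (auto simp: smash_pt_def smash_act_def)
      moreover have "z \<in> topspace (ptop ?X)" using in_X xy by auto
      ultimately show "z \<in> fixed_points P ?a ?X" by blast
    qed
  qed
  show ?thesis
  proof (intro good_space.intro well_pointed.intro good_space_axioms.intro)
    show "pt ?X \<in> topspace (ptop ?X)" using base by simp
    show "closedin (ptop ?X) {pt ?X}"
    proof -
      have "{u \<in> topspace ?P. ?s u \<in> {pt ?X}} = {pt S} \<times> topspace (ptop B) \<union> topspace (ptop S) \<times> {pt B}"
        using S.pt_B B.pt_B by (auto simp: smash_pt_def split: if_splits)
      moreover have "closedin ?P ({pt S} \<times> topspace (ptop B) \<union> topspace (ptop S) \<times> {pt B})"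
        using S.pt_closed B.pt_closed by (intro closedin_Un) (simp_all add: closedin_prod_Times_iff)
      moreover have "{pt ?X} \<subseteq> topspace (ptop ?X)" using base by simp
      ultimately show ?thesis
        using q[unfolded quotient_map_closedin, THEN conjunct2, rule_format, of "{pt ?X}"] by simp
    qed
    show "continuous_map (prod_topology unit_interval (ptop ?X)) (ptop ?X) (\<lambda>(t, z). ?s (rS t (fst z), r t (snd z)))"
      by (rule continuous_map_smash_homotopy) (use S.r_cont B.r_cont S.r_pt B.r_pt in auto)
    show "?s (rS 0 (fst z), r 0 (snd z)) = z" if "z \<in> topspace (ptop ?X)" for z
      using that X_sub S.r_0 B.r_0 smash_pt_in[OF that] by simp
    show "?s (rS t (fst (pt ?X)), r t (snd (pt ?X))) = pt ?X" if "t \<in> {0..1}" for t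
      using S.r_pt[OF that] by (simp add: smash_pt_def)
    show "openin (ptop ?X) {z \<in> topspace (ptop ?X). fst z \<in> NS \<or> snd z \<in> N}"
    proof -
      have "{u \<in> topspace ?P. ?s u \<in> {z \<in> topspace (ptop ?X). fst z \<in> NS \<or> snd z \<in> N}} =
          NS \<times> topspace (ptop B) \<union> topspace (ptop S) \<times> N"
        using in_X' base NS_sub N_sub S.N(2) B.N(2) by (auto simp: smash_pt_def split: if_splits)
      moreover have "openin ?P (NS \<times> topspace (ptop B) \<union> topspace (ptop S) \<times> N)"
        using S.N B.N by (intro openin_Un) (simp_all add: openin_prod_Times_iff)
      moreover have "{z \<in> topspace (ptop ?X). fst z \<in> NS \<or> snd z \<in> N} \<subseteq> topspace (ptop ?X)" by blast
      ultimately show ?thesis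
        using q[unfolded quotient_map_def, THEN conjunct2, rule_format, of "{z \<in> topspace (ptop ?X). fst z \<in> NS \<or> snd z \<in> N}"]
        by (simp only:)
    qed
    show "pt ?X \<in> {z \<in> topspace (ptop ?X). fst z \<in> NS \<or> snd z \<in> N}" using base S.N by simp
    show "?s (rS 1 (fst z), r 1 (snd z)) = pt ?X" if "z \<in> {z \<in> topspace (ptop ?X). fst z \<in> NS \<or> snd z \<in> N}" for z
      using that S.r_1 B.r_1 by (auto simp: smash_pt_def)
    show "group L" by (rule B.group)
    show "pointed_action L ?X ?a" by (rule a)
    show "?s (rS t (fst (?a l z)), r t (snd (?a l z))) = ?a l (?s (rS t (fst z), r t (snd z)))"
      if "t \<in> {0..1}" "l \<in> carrier L" "z \<in> topspace (ptop ?X)" for t l z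
    proof -
      have "r t (bL l (snd z)) = bL l (r t (snd z))" by (rule B.r_eqv[OF that(1,2) X_sub(2)[OF that(3)]])
      moreover have "bL l (r t (snd z)) = pt B \<longleftrightarrow> r t (snd z) = pt B"
        by (rule pointed_action_eq_pt[OF B.group B.B_action that(2) B.r_closed[OF that(1) X_sub(2)[OF that(3)]]])
      moreover have "bL l (pt B) = pt B" using B.B_action that(2) by (simp add: pointed_action_def)
      ultimately show ?thesis by (simp add: smash_act_def smash_pt_def)
    qed
    show "closedin (ptop ?X) (fixed_points P ?a ?X)" if P: "P \<in> PP" for P
    proof -
      have "{u \<in> topspace ?P. ?s u \<in> fixed_points P ?a ?X} =
          topspace (ptop S) \<times> fixed_points P bL B \<union> {pt S} \<times> topspace (ptop B)"
        using fixed[OF P] B.pt_fixed[OF P] S.pt_B in_X base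
        by (auto simp: smash_act_def smash_pt_def split: if_splits)
      moreover have "closedin ?P (topspace (ptop S) \<times> fixed_points P bL B \<union> {pt S} \<times> topspace (ptop B))"
        using S.pt_closed B.fixed_closed[OF P] by (intro closedin_Un) (simp_all add: closedin_prod_Times_iff)
      moreover have "fixed_points P ?a ?X \<subseteq> topspace (ptop ?X)" by blast
      ultimately show ?thesis
        using q[unfolded quotient_map_closedin, THEN conjunct2, rule_format, of "fixed_points P ?a ?X"] by simp
    qed
    show "continuous_map (prod_topology unit_interval (subtopology (ptop ?X) (fixed_points P ?a ?X))) (ptop ?X)
        (\<lambda>(t, z). ?s (fst z, K P t (snd z)))" if P: "P \<in> PP" for P
    proof -
      let ?A = "\<lparr>ptop = subtopology (ptop B) (fixed_points P bL B), pt = pt B\<rparr>"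
      have eq: "ptop (smash S ?A) = subtopology (ptop ?X) (fixed_points P ?a ?X)"
        unfolding fixed[OF P]
        using smash_closed_subspaces[OF S.pt_B B.pt_B closedin_topspace S.pt_B B.fixed_closed[OF P] B.pt_fixed[OF P]]
        by (simp only: pspace_topspace)
      have "continuous_map (prod_topology unit_interval (ptop (smash S ?A))) (ptop ?X)
          (\<lambda>(t, z). ?s (id (fst z), K P t (snd z)))"
        by (rule continuous_map_smash_homotopy[where h = "\<lambda>_. id"])
           (use B.K_cont[OF P] B.K_pt[OF P] in \<open>auto simp: case_prod_beta' intro: continuous_map_snd\<close>)
      then show ?thesis by (simp only: eq id_apply)
    qed
    fix P assume P: "P \<in> PP"
    have snd_fixed: "snd z \<in> fixed_points P bL B" if "z \<in> fixed_points P ?a ?X" for z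
      using that X_sub by (cases z) (auto simp: smash_act_def)
    show "?s (fst z, K P 0 (snd z)) = z" if "z \<in> fixed_points P ?a ?X" for z
      using B.K_0[OF P snd_fixed[OF that]] smash_pt_in[of z S B] that by simp
    show "?s (fst z, K P 1 (snd z)) = pt ?X" if "z \<in> fixed_points P ?a ?X" for z
      using B.K_1[OF P snd_fixed[OF that]] by (simp add: smash_pt_def)
    show "?s (fst (pt ?X), K P t (snd (pt ?X))) = pt ?X" if "t \<in> {0..1}" for t
      by (simp add: smash_pt_def)
    show "?s (fst z, K P t (snd z)) \<in> fixed_points P ?a ?X" if "t \<in> {0..1}" "z \<in> fixed_points P ?a ?X" for t z
      unfolding fixed[OF P] using B.K_fix[OF P that(1) snd_fixed[OF that(2)]] that(2) X_sub by (intro imageI) auto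
    show "?s (fst (?a k z), K (conjugate L k P) t (snd (?a k z))) = ?a k (?s (fst z, K P t (snd z)))"
      if "t \<in> {0..1}" "z \<in> fixed_points P ?a ?X" "k \<in> carrier L" for t z k
    proof -
      note z = snd_fixed[OF that(2)]
      have "K (conjugate L k P) t (bL k (snd z)) = bL k (K P t (snd z))" by (rule B.K_eqv[OF P that(1) z that(3)])
      moreover have "bL k (K P t (snd z)) = pt B \<longleftrightarrow> K P t (snd z) = pt B"
        using pointed_action_eq_pt[OF B.group B.B_action that(3)] B.K_fix[OF P that(1) z] by blast
      moreover have "bL k (pt B) = pt B" using B.B_action that(3) by (simp add: pointed_action_def)
      ultimately show ?thesis by (simp add: smash_act_def smash_pt_def)
    qed
    show "P \<subseteq> carrier L" by (rule B.PP_sub[OF P])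
  qed
qed

text \<open>For the levels of a desuspended spectrum below the shift.\<close>

lemma good_space_point:
  assumes "group L" "\<And>l. l \<in> carrier L \<Longrightarrow> a l c = c" "\<And>P. P \<in> PP \<Longrightarrow> P \<subseteq> carrier L"
  shows "good_space \<lparr>ptop = discrete_topology {c}, pt = c\<rparr> (\<lambda>_. id) {c} L a PP (\<lambda>_ _. id)"
proof (intro good_space.intro well_pointed.intro good_space_axioms.intro)
  interpret group L by fact
  let ?D = "discrete_topology {c}"
  show "continuous_map (prod_topology unit_interval (ptop \<lparr>ptop = ?D, pt = c\<rparr>)) (ptop \<lparr>ptop = ?D, pt = c\<rparr>) (\<lambda>(t, x). id x)"
    using continuous_map_snd[of unit_interval ?D] by (simp add: case_prod_beta')
  show "continuous_map (prod_topology unit_interval (subtopology (ptop \<lparr>ptop = ?D, pt = c\<rparr>)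
      (fixed_points P a \<lparr>ptop = ?D, pt = c\<rparr>))) (ptop \<lparr>ptop = ?D, pt = c\<rparr>) (\<lambda>(t, x). id x)" for P
    using continuous_map_into_fulltopology[OF continuous_map_snd[of unit_interval
        "subtopology ?D (fixed_points P a \<lparr>ptop = ?D, pt = c\<rparr>)"]] by (simp add: case_prod_beta')
  show "group L" by fact
  show "pointed_action L \<lparr>ptop = ?D, pt = c\<rparr> a"
    using assms(2) by (auto simp: pointed_action_def continuous_action_def)
qed (use assms in auto)

section \<open>Spheres as cubes modulo their boundary\<close>

lemma topspace_cube: "topspace (cube q) = {s. (\<forall>i\<ge>q. s i = 0) \<and> (\<forall>i<q. 0 \<le> s i \<and> s i \<le> 1)}"
  by (auto simp: cube_def topspace_Euclidean_space)

lemma cube_eq: "cube q = subtopology (powertop_real UNIV) (topspace (cube q))"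
  by (auto simp: cube_def Euclidean_space_def subtopology_subtopology intro!: arg_cong[where f = "subtopology _"])

lemma continuous_map_cube_coord: "continuous_map (cube q) euclideanreal (\<lambda>x. x i)"
  by (subst cube_eq, rule continuous_map_from_subtopology[OF continuous_map_powertop_coord])

lemma continuous_map_into_cube:
  "continuous_map X (cube q) f \<longleftrightarrow> (\<forall>i. continuous_map X euclideanreal (\<lambda>x. f x i)) \<and> f ` topspace X \<subseteq> topspace (cube q)"
  by (subst cube_eq, subst continuous_map_in_subtopology)
     (auto simp: continuous_map_componentwise_UNIV image_subset_iff_funcset)

definition sphere_pt :: "nat \<Rightarrow> (nat \<Rightarrow> real) \<Rightarrow> (nat \<Rightarrow> real) option" where
  "sphere_pt q s = (if s \<in> cube_boundary q then None else Some s)"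

lemma pt_sphere [simp]: "pt (sphere_pspace q) = None"
  by (simp add: sphere_pspace_def)

lemma topspace_sphere: "topspace (ptop (sphere_pspace q)) = insert None (Some ` (topspace (cube q) - cube_boundary q))"
  by (simp add: sphere_pspace_def topspace_collapse)

lemma continuous_map_sphere_pt: "continuous_map (cube q) (ptop (sphere_pspace q)) (sphere_pt q)"
  unfolding sphere_pspace_def sphere_pt_def[abs_def] by (rule continuous_map_collapse)

lemma openin_sphere:
  "openin (ptop (sphere_pspace q)) U \<longleftrightarrow> U \<subseteq> topspace (ptop (sphere_pspace q)) \<and>
    openin (cube q) {s \<in> topspace (cube q). sphere_pt q s \<in> U}"
  unfolding topspace_sphere
  by (simp add: sphere_pspace_def collapse_def openin_final_topology sphere_pt_def)

lemma cube_0: "topspace (cube 0) = {\<lambda>_. 0}"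
  by (auto simp: topspace_cube)

lemma sphere_0_discrete: "ptop (sphere_pspace 0) = discrete_topology {None, Some (\<lambda>_. 0)}"
proof -
  have "openin (cube 0) V" if "V \<subseteq> topspace (cube 0)" for V
  proof -
    have "V = {} \<or> V = topspace (cube 0)" using that cube_0 by (metis subset_singletonD)
    then show ?thesis by auto
  qed
  note * = this[unfolded cube_0]
  show ?thesis
    unfolding topology_eq by (auto simp: openin_sphere topspace_sphere cube_0 cube_boundary_def intro!: *)
qed

text \<open>For \<open>q\<close> = 0 the boundary of the cube is empty and the base point is not in
  the image; the 0-sphere is treated below as a discrete space.\<close>

lemma sphere_quotient_map:
  assumes "0 < q"
  shows "quotient_map (cube q) (ptop (sphere_pspace q)) (sphere_pt q)"
proof -
  have "(\<lambda>_. 0) \<in> topspace (cube q)" "(\<lambda>_. 0) \<in> cube_boundary q"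
    using assms by (auto simp: topspace_cube cube_boundary_def)
  then have "sphere_pt q ` topspace (cube q) = topspace (ptop (sphere_pspace q))"
    by (force simp: sphere_pt_def topspace_sphere image_iff)
  then show ?thesis
    by (auto simp: quotient_map_def openin_sphere)
qed

text \<open>Dilation of the cube from its centre by the factor 1 + t, clipped to the cube. At t = 1
  every coordinate below 1/4 or above 3/4 has reached the boundary, whence the neighbourhood in
  \<open>well_pointed_sphere\<close>.\<close>

definition push_out :: "nat \<Rightarrow> real \<Rightarrow> (nat \<Rightarrow> real) \<Rightarrow> nat \<Rightarrow> real" where
  "push_out q t s = (\<lambda>i. if i < q then min 1 (max 0 ((1 + t) * (s i - 1/2) + 1/2)) else 0)"

lemma push_out_boundary:
  assumes "s \<in> topspace (cube q)" "t \<in> {0..1}" "s \<in> cube_boundary q"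
  shows "push_out q t s \<in> cube_boundary q"
proof -
  obtain i where i: "i < q" "s i = 0 \<or> s i = 1" using assms(3) by (auto simp: cube_boundary_def)
  have "(1 + t) * (0 - 1/2) + 1/2 \<le> 0" "1 \<le> max 0 ((1 + t) * (1 - 1/2) + 1/2)"
    using assms(2) by (auto simp: le_max_iff_disj field_simps)
  from max_absorb1[OF this(1)] min_absorb1[OF this(2)]
  have "push_out q t s i = 0 \<or> push_out q t s i = 1"
    using i unfolding push_out_def by (elim disjE) (simp_all only: if_True, auto)
  then show ?thesis using i by (auto simp: cube_boundary_def)
qed

lemma push_out_cube: "push_out q t s \<in> topspace (cube q)"
  by (auto simp: push_out_def topspace_cube)

lemma well_pointed_sphere:
  "well_pointed (sphere_pspace q) (\<lambda>t u. case u of None \<Rightarrow> None | Some s \<Rightarrow> sphere_pt q (push_out q t s))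
    (insert None {Some s | s. s \<in> topspace (cube q) - cube_boundary q \<and> (\<exists>i<q. s i < 1/4 \<or> s i > 3/4)})"
  (is "well_pointed _ ?r ?N")
proof
  have boundary_closed: "openin (cube q) (topspace (cube q) - cube_boundary q)"
  proof -
    have "closedin (cube q) {s \<in> topspace (cube q). s i \<in> {0, 1}}" for i
      by (rule closedin_continuous_map_preimage[OF continuous_map_cube_coord]) simp
    then have "closedin (cube q) (\<Union>i\<in>{..<q}. {s \<in> topspace (cube q). s i \<in> {0, 1}})"
      by (intro closedin_Union) auto
    then have "openin (cube q) (topspace (cube q) - (\<Union>i\<in>{..<q}. {s \<in> topspace (cube q). s i \<in> {0, 1}}))"
      by (intro openin_diff openin_topspace)
    moreover have "topspace (cube q) - (\<Union>i\<in>{..<q}. {s \<in> topspace (cube q). s i \<in> {0, 1}}) = topspace (cube q) - cube_boundary q"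
      by (auto simp: cube_boundary_def)
    ultimately show ?thesis by (simp only:)
  qed
  show "pt (sphere_pspace q) \<in> topspace (ptop (sphere_pspace q))" by (simp add: topspace_sphere)
  have "openin (ptop (sphere_pspace q)) (topspace (ptop (sphere_pspace q)) - {None})"
  proof -
    have "{s \<in> topspace (cube q). sphere_pt q s \<in> topspace (ptop (sphere_pspace q)) - {None}} = topspace (cube q) - cube_boundary q"
      by (auto simp: sphere_pt_def topspace_sphere)
    then show ?thesis using boundary_closed by (simp add: openin_sphere)
  qed
  then show "closedin (ptop (sphere_pspace q)) {pt (sphere_pspace q)}"
    by (simp add: closedin_def topspace_sphere)
  have r_sphere: "?r t (sphere_pt q s) = sphere_pt q (push_out q t s)" if "s \<in> topspace (cube q)" "t \<in> {0..1}" for s t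
    using push_out_boundary[OF that] by (auto simp: sphere_pt_def)
  have push0: "push_out q 0 s = s" if "s \<in> topspace (cube q)" for s
    using that by (auto simp: push_out_def topspace_cube)
  show "continuous_map (prod_topology unit_interval (ptop (sphere_pspace q))) (ptop (sphere_pspace q)) (\<lambda>(t, u). ?r t u)"
  proof (cases "q = 0")
    case True
    have "continuous_map (prod_topology unit_interval (ptop (sphere_pspace q))) (ptop (sphere_pspace q)) snd"
      by (rule continuous_map_snd)
    then show ?thesis
      by (rule continuous_map_eq)
         (use True in \<open>auto simp: sphere_0_discrete sphere_pt_def cube_boundary_def push_out_def\<close>)
  next
    case False
    then have q: "0 < q" by simp
    show ?thesis
    proof (rule continuous_map_times_interval_quotient[OF sphere_quotient_map[OF q]])
      let ?D = "prod_topology unit_interval (cube q)"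
      have t: "continuous_map ?D euclideanreal fst"
        using continuous_map_fst continuous_map_in_subtopology by blast
      have s: "continuous_map ?D euclideanreal (\<lambda>u. snd u i)" for i
        by (rule continuous_map_compose[OF continuous_map_snd continuous_map_cube_coord, unfolded o_def])
      have "continuous_map ?D euclideanreal (\<lambda>u. push_out q (fst u) (snd u) i)" for i
      proof (cases "i < q")
        case True
        have "continuous_map ?D euclideanreal (\<lambda>u. min 1 (max 0 ((1 + fst u) * (snd u i - 1/2) + 1/2)))"
          by (intro continuous_map_real_min continuous_map_real_max continuous_map_add continuous_map_real_mult
              continuous_map_diff s t) auto
        then show ?thesis using True by (simp add: push_out_def)
      qed (simp add: push_out_def)
      then have "continuous_map ?D (cube q) (\<lambda>u. push_out q (fst u) (snd u))"
        using push_out_cube by (auto simp: continuous_map_into_cube)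
      from continuous_map_compose[OF this continuous_map_sphere_pt]
      show "continuous_map ?D (ptop (sphere_pspace q)) (\<lambda>(t, s). ?r t (sphere_pt q s))"
        by (rule continuous_map_eq) (auto simp: r_sphere)
    qed
  qed
  show "?r 0 u = u" if "u \<in> topspace (ptop (sphere_pspace q))" for u
    using that push0 by (auto simp: topspace_sphere sphere_pt_def)
  show "?r t (pt (sphere_pspace q)) = pt (sphere_pspace q)" if "t \<in> {0..1}" for t by simp
  show "openin (ptop (sphere_pspace q)) ?N"
  proof -
    have "openin (cube q) {s \<in> topspace (cube q). s i \<in> {..<1/4} \<union> {3/4<..}}" for i
      by (rule openin_continuous_map_preimage[OF continuous_map_cube_coord]) (simp add: open_Un)
    then have o: "openin (cube q) (\<Union>i\<in>{..<q}. {s \<in> topspace (cube q). s i \<in> {..<1/4} \<union> {3/4<..}})"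
      by (intro openin_Union) auto
    have "s \<in> cube_boundary q \<Longrightarrow> \<exists>i<q. s i < 1/4 \<or> s i > 3/4" for s
      unfolding cube_boundary_def by force
    then have "{s \<in> topspace (cube q). sphere_pt q s \<in> ?N} = (\<Union>i\<in>{..<q}. {s \<in> topspace (cube q). s i \<in> {..<1/4} \<union> {3/4<..}})"
      by (auto simp: sphere_pt_def)
    then show ?thesis using o by (auto simp: openin_sphere topspace_sphere)
  qed
  show "pt (sphere_pspace q) \<in> ?N" by simp
  show "?r 1 u = pt (sphere_pspace q)" if u: "u \<in> ?N" for u
  proof (cases u)
    case (Some s)
    then obtain i where i: "i < q" "s i < 1/4 \<or> s i > 3/4" using u by auto
    then have "push_out q 1 s i = 0 \<or> push_out q 1 s i = 1" by (auto simp: push_out_def)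
    then show ?thesis using i Some by (auto simp: sphere_pt_def cube_boundary_def)
  qed simp
qed

section \<open>The suspended flag complex\<close>

text \<open>Orbits have p-power size, so those with more than one point contribute a multiple of p
  to the size of \<open>X\<close>. If \<open>x0\<close> were the only fixed point, that size would
  be 1 modulo p.\<close>

lemma p_group_second_fixed_point:
  assumes "prime (p::nat)" and P: "group P" "card (carrier P) = p ^ r"
    and X: "finite X" "p dvd card X"
    and a: "\<And>g x. g \<in> carrier P \<Longrightarrow> x \<in> X \<Longrightarrow> a g x \<in> X"
      "\<And>x. x \<in> X \<Longrightarrow> a \<one>\<^bsub>P\<^esub> x = x"
      "\<And>g h x. g \<in> carrier P \<Longrightarrow> h \<in> carrier P \<Longrightarrow> x \<in> X \<Longrightarrow> a (g \<otimes>\<^bsub>P\<^esub> h) x = a g (a h x)"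
    and x0: "x0 \<in> X" "\<And>g. g \<in> carrier P \<Longrightarrow> a g x0 = x0"
  obtains x where "x \<in> X" "x \<noteq> x0" "\<And>g. g \<in> carrier P \<Longrightarrow> a g x = x"
proof (rule ccontr)
  assume "\<not> thesis"
  with that have only: "x = x0" if "x \<in> X" "\<And>g. g \<in> carrier P \<Longrightarrow> a g x = x" for x
    using \<open>x \<in> X\<close> \<open>\<And>g. g \<in> carrier P \<Longrightarrow> a g x = x\<close> by blast
  interpret P: group P by fact
  let ?f = "\<lambda>g. \<lambda>x\<in>X. a g x"
  have bij: "?f g \<in> Bij X" if "g \<in> carrier P" for g
  proof -
    have "bij_betw (a g) X X"
    proof (rule bij_betwI[where g = "a (inv\<^bsub>P\<^esub> g)"])
      show "a g \<in> X \<rightarrow> X" "a (inv\<^bsub>P\<^esub> g) \<in> X \<rightarrow> X" using a(1) that by auto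
      show "a (inv\<^bsub>P\<^esub> g) (a g x) = x" "a g (a (inv\<^bsub>P\<^esub> g) x) = x" if "x \<in> X" for x
        using \<open>g \<in> carrier P\<close> that a(2) a(3)[symmetric] by auto
    qed
    then have "bij_betw (?f g) X X" by (simp cong: bij_betw_cong)
    then show ?thesis by (simp add: Bij_def)
  qed
  have "group_hom P (BijGroup X) ?f"
  proof (intro group_hom.intro group_hom_axioms.intro group_BijGroup homI P)
    show "?f g \<in> carrier (BijGroup X)" if "g \<in> carrier P" for g
      using bij[OF that] by (simp add: BijGroup_def)
    show "?f (g \<otimes>\<^bsub>P\<^esub> h) = ?f g \<otimes>\<^bsub>BijGroup X\<^esub> ?f h" if "g \<in> carrier P" "h \<in> carrier P" for g h
      using bij that a by (auto simp: BijGroup_def compose_def restrict_def)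
  qed
  then interpret A: group_action P X ?f by (rule group_action.intro)
  have x0_orbit: "orbit P ?f x0 = {x0}"
  proof -
    have "orbit P ?f x0 \<subseteq> {x0}" using x0 by (auto simp: orbit_def)
    then show ?thesis using A.orbit_refl[OF x0(1)] by blast
  qed
  have orbit_dvd: "p dvd card Z" if Z: "Z \<in> orbits P X ?f" "Z \<noteq> {x0}" for Z
  proof -
    obtain x where x: "x \<in> X" "Z = orbit P ?f x" using Z(1) by (auto simp: orbits_def)
    have "card Z dvd p ^ r"
      using A.orbit_stabilizer_theorem[OF x(1)] P(2) x(2) by (metis dvd_triv_left order_def)
    then obtain i where i: "card Z = p ^ i" using divides_primepow_nat[OF \<open>prime p\<close>] by blast
    have "i \<noteq> 0"
    proof
      assume "i = 0"
      then obtain y where y: "Z = {y}" using i by (auto simp: card_1_singleton_iff)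
      have "a g x = y" if "g \<in> carrier P" for g
        using y x that by (force simp: orbit_def)
      then have "a g x = x" if "g \<in> carrier P" for g
        using that a(2)[OF x(1)] P.one_closed by metis
      then have "x = x0" by (rule only[OF x(1)])
      then have "Z = {x0}" using x(2) x0_orbit by simp
      then show False using Z(2) by blast
    qed
    then show ?thesis using i by simp
  qed
  have x0_orbits: "{x0} \<in> orbits P X ?f"
    unfolding orbits_def using x0(1) x0_orbit by blast
  have orbits_finite: "finite (orbits P X ?f)"
    using X(1) by (simp add: orbits_def setcompr_eq_image)
  have "card X = (\<Sum>Z\<in>orbits P X ?f. card Z)"
    using A.disjoint_sum[OF X(1), of "\<lambda>_. 1::nat"] by simp
  also have "\<dots> = 1 + (\<Sum>Z\<in>orbits P X ?f - {{x0}}. card Z)"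
    using sum.remove[OF orbits_finite x0_orbits, of card] by simp
  finally have "card X = 1 + (\<Sum>Z\<in>orbits P X ?f - {{x0}}. card Z)" .
  moreover have "p dvd (\<Sum>Z\<in>orbits P X ?f - {{x0}}. card Z)"
    by (rule dvd_sum) (use orbit_dvd in auto)
  ultimately have "p dvd 1" using X(2) dvd_add_left_iff by metis
  then show False using \<open>prime p\<close> by (simp add: prime_nat_iff)
qed

text \<open>A nonzero vector spans a line with as many elements as the field, and the line is a
  subgroup of \<open>V\<close>, so Lagrange applies.\<close>

lemma card_dvd_subspace:
  fixes V :: "('k::{field,finite} ^ 'n::finite) set"
  assumes V: "vec.subspace V" "V \<noteq> {0}"
  shows "CARD('k) dvd card V"
proof -
  obtain v where v: "v \<in> V" "v \<noteq> 0" using V vec.subspace_0[OF V(1)] by blast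
  let ?G = "\<lparr>carrier = V, mult = (+), one = 0\<rparr>"
  have G: "group ?G"
  proof (rule groupI)
    show "\<exists>y\<in>carrier ?G. y \<otimes>\<^bsub>?G\<^esub> x = \<one>\<^bsub>?G\<^esub>" if "x \<in> carrier ?G" for x
      using that vec.subspace_neg[OF V(1)] by (intro bexI[of _ "- x"]) auto
  qed (auto simp: vec.subspace_0[OF V(1)] vec.subspace_add[OF V(1)])
  interpret G: group ?G by (rule G)
  have inv: "inv\<^bsub>?G\<^esub> x = - x" if "x \<in> V" for x
    by (rule G.inv_equality) (use that vec.subspace_neg[OF V(1)] in auto)
  have "subgroup (range (\<lambda>c. c *s v)) ?G"
  proof (rule G.subgroupI)
    show "range (\<lambda>c. c *s v) \<subseteq> carrier ?G" using vec.subspace_scale[OF V(1) v(1)] by auto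
    show "range (\<lambda>c. c *s v) \<noteq> {}" by blast
    show "inv\<^bsub>?G\<^esub> x \<in> range (\<lambda>c. c *s v)" if x: "x \<in> range (\<lambda>c. c *s v)" for x
    proof -
      obtain c where c: "x = c *s v" using x by blast
      then have "inv\<^bsub>?G\<^esub> x = (- c) *s v" using inv vec.subspace_scale[OF V(1) v(1)] by simp
      then show ?thesis by blast
    qed
    show "x \<otimes>\<^bsub>?G\<^esub> y \<in> range (\<lambda>c. c *s v)" if xy: "x \<in> range (\<lambda>c. c *s v)" "y \<in> range (\<lambda>c. c *s v)" for x y
    proof -
      obtain c d where "x = c *s v" "y = d *s v" using xy by blast
      then have "x \<otimes>\<^bsub>?G\<^esub> y = (c + d) *s v" by (simp add: vec.scale_left_distrib)
      then show ?thesis by blast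
    qed
  qed
  then have "card (range (\<lambda>c. c *s v)) dvd card V"
    using G.lagrange by (metis dvd_triv_right order_def partial_object.select_convs(1))
  moreover have "inj (\<lambda>c. c *s v)"
    using v(2) by (auto intro!: injI simp: vec.scale_cancel_right)
  ultimately show ?thesis by (simp add: card_image)
qed

section \<open>Fixed vectors of p-subgroups and preimages of subspaces\<close>

abbreviation flag_vertices :: "('k::field ^ 'n) set set" where
  "flag_vertices \<equiv> {V. vec.subspace V \<and> V \<noteq> {0} \<and> V \<noteq> UNIV}"

definition fixed_vectors :: "('k::field ^ 'n ^ 'n) set \<Rightarrow> ('k ^ 'n) set" where
  "fixed_vectors P = {v. \<forall>A\<in>P. A *v v = v}"

text \<open>The field has p elements wherever this set is put to work, so powers of its order are
  powers of p. The trivial group is left out because its fixed vectors do not form a proper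
  subspace.\<close>

definition p_subgroups :: "('k::{field,finite} ^ 'n::finite ^ 'n) set set" where
  "p_subgroups = {P. subgroup P GL \<and> P \<noteq> {mat 1} \<and> (\<exists>r. card P = CARD('k) ^ r)}"

lemma subspace_fixed_vectors: "vec.subspace (fixed_vectors P)"
  by (auto simp: fixed_vectors_def vec.subspace_def matrix_vector_right_distrib vector_scalar_commute)

lemma fixed_vectors_proper: "P \<in> p_subgroups \<Longrightarrow> fixed_vectors P \<noteq> UNIV"
proof
  assume P: "P \<in> p_subgroups" and "fixed_vectors P = UNIV"
  then have "A *v v = v" if "A \<in> P" for A v using that by (auto simp: fixed_vectors_def set_eq_iff)
  then have "A = mat 1" if "A \<in> P" for A using that by (simp add: matrix_eq)
  moreover have "mat 1 \<in> P"
    using P subgroup.one_closed[of P GL] by (simp add: p_subgroups_def GL_def)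
  ultimately have "P = {mat 1}" by blast
  then show False using P by (simp add: p_subgroups_def)
qed

lemma matrix_vimage_eq:
  assumes "A ** B = mat 1"
  shows "(*v) B -` ((*v) A -` V) = V"
  using assms by (auto simp: matrix_vector_mul_assoc)

lemma matrix_inverse_vimage:
  assumes "invertible A"
  obtains B where "\<And>V. (*v) A -` ((*v) B -` V) = V" "\<And>V. (*v) B -` ((*v) A -` V) = V" "invertible B"
proof -
  obtain B where B: "A ** B = mat 1" "B ** A = mat 1" using assms by (auto simp: invertible_def)
  show thesis
    by (rule that[of B]) (use B in \<open>auto simp: matrix_vimage_eq matrix_vector_mul_assoc invertible_def\<close>)
qed

lemma bij_matrix_vimage:
  assumes "invertible A"
  shows "bij (\<lambda>V. (*v) A -` V)"
proof -
  obtain B where "\<And>V. (*v) A -` ((*v) B -` V) = V" "\<And>V. (*v) B -` ((*v) A -` V) = V"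
    using matrix_inverse_vimage[OF assms] by metis
  then show ?thesis by (intro o_bij[of "\<lambda>V. (*v) B -` V"] ext) (simp_all only: comp_apply id_apply)
qed

lemma card_matrix_vimage:
  fixes A :: "'k::{field,finite} ^ 'n::finite ^ 'n"
  assumes "invertible A"
  shows "card ((*v) A -` V) = card V"
proof -
  have "bij ((*v) A)"
  proof -
    obtain B where B: "A ** B = mat 1" "B ** A = mat 1" using assms by (auto simp: invertible_def)
    then show ?thesis by (intro o_bij[of "(*v) B"]) (auto simp: matrix_vector_mul_assoc)
  qed
  then show ?thesis by (intro card_vimage_inj) (auto simp: bij_def)
qed

lemma flag_vertex_vimage:
  fixes A :: "'k::field ^ 'n ^ 'n"
  assumes "invertible A"
  shows "(*v) A -` V \<in> flag_vertices \<longleftrightarrow> V \<in> flag_vertices"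
proof -
  have vimage: "(*v) C -` U \<in> flag_vertices" if C: "invertible C" and U: "U \<in> flag_vertices" for C :: "'k ^ 'n ^ 'n" and U
  proof -
    have "vec.subspace ((*v) C -` U)"
      using U by (auto simp: vec.subspace_def matrix_vector_right_distrib vector_scalar_commute)
    moreover have "(*v) C -` U \<noteq> UNIV" "(*v) C -` U \<noteq> {0}"
    proof -
      obtain B where B: "C ** B = mat 1" "B ** C = mat 1" using C by (auto simp: invertible_def)
      have "(*v) C -` {0} = {0}"
        using B by (auto, metis matrix_vector_mul_assoc matrix_vector_mul_lid matrix_vector_mult_0_right)
      then show "(*v) C -` U \<noteq> {0}"
        using U bij_matrix_vimage[OF C] by (metis (mono_tags, lifting) bij_is_inj injD mem_Collect_eq)
      have "(*v) C -` UNIV = UNIV" by simp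
      then show "(*v) C -` U \<noteq> UNIV" using U bij_matrix_vimage[OF C] by (metis (mono_tags, lifting) bij_is_inj injD mem_Collect_eq)
    qed
    ultimately show ?thesis by simp
  qed
  obtain B where B: "\<And>V. (*v) B -` ((*v) A -` V) = V" "invertible B"
    using matrix_inverse_vimage[OF assms] by metis
  show ?thesis
  proof
    assume "(*v) A -` V \<in> flag_vertices"
    then have "(*v) B -` ((*v) A -` V) \<in> flag_vertices" by (rule vimage[OF B(2)])
    then show "V \<in> flag_vertices" by (simp only: B(1))
  qed (rule vimage[OF assms])
qed

text \<open>The zero vector is one fixed point of the p-group on \<open>V\<close>, and the size of
  \<open>V\<close> is divisible by p, so there is a second one.\<close>

lemma fixed_vectors_meet:
  fixes P :: "('k::{field,finite} ^ 'n::finite ^ 'n) set"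
  assumes p: "prime CARD('k)" and P: "P \<in> p_subgroups" and V: "vec.subspace V" "V \<noteq> {0}"
    and inv: "\<And>A v. A \<in> P \<Longrightarrow> v \<in> V \<Longrightarrow> A *v v \<in> V"
  shows "V \<inter> fixed_vectors P \<noteq> {0}"
proof -
  let ?G = "GL\<lparr>carrier := P\<rparr> :: ('k ^ 'n ^ 'n) monoid"
  have sub: "subgroup P GL" using P by (simp add: p_subgroups_def)
  obtain r where r: "card P = CARD('k) ^ r" using P by (auto simp: p_subgroups_def)
  obtain v where "v \<in> V" "v \<noteq> 0" "\<And>A. A \<in> carrier ?G \<Longrightarrow> A *v v = v"
  proof (rule p_group_second_fixed_point[of "CARD('k)" ?G r V "(*v)" 0])
    show "group ?G" by (rule subgroup.subgroup_is_group[OF sub group_GL])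
    show "card (carrier ?G) = CARD('k) ^ r" using r by simp
    show "CARD('k) dvd card V" by (rule card_dvd_subspace[OF V])
  qed (use p inv vec.subspace_0[OF V(1)] in \<open>auto simp: GL_def matrix_vector_mul_assoc\<close>)
  then show ?thesis by (auto simp: fixed_vectors_def)
qed

lemma fixed_vectors_flag_vertex:
  fixes P :: "('k::{field,finite} ^ 'n::finite ^ 'n) set"
  assumes "prime CARD('k)" and P: "P \<in> p_subgroups"
  shows "fixed_vectors P \<in> flag_vertices"
proof -
  have "(UNIV :: ('k ^ 'n) set) \<noteq> {0}"
  proof
    assume *: "(UNIV :: ('k ^ 'n) set) = {0}"
    have "0 \<in> fixed_vectors P" by (rule vec.subspace_0[OF subspace_fixed_vectors])
    then have "fixed_vectors P = {0}" using * by blast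
    then show False using fixed_vectors_proper[OF P] * by simp
  qed
  then have "fixed_vectors P \<noteq> {0}"
    using fixed_vectors_meet[OF assms, of UNIV] vec.subspace_UNIV by auto
  then show ?thesis using fixed_vectors_proper[OF P] by (simp add: subspace_fixed_vectors)
qed

text \<open>The vectors fixed by the conjugate group are the images under \<open>k\<close> of those
  fixed by \<open>P\<close>; preimages are used because \<open>flag_act\<close> is defined by
  them.\<close>

lemma fixed_vectors_conjugate:
  assumes P: "P \<subseteq> carrier GL" and k: "invertible k"
  shows "(*v) k -` fixed_vectors (conjugate GL k P) = fixed_vectors P"
proof -
  interpret GL: group "GL :: ('a ^ 'b ^ 'b) monoid" by (rule group_GL)
  have kc: "k \<in> carrier GL" using k by (simp add: GL_def)
  have i: "k ** inv\<^bsub>GL\<^esub> k = mat 1" "inv\<^bsub>GL\<^esub> k ** k = mat 1"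
    using GL.r_inv[OF kc] GL.l_inv[OF kc] by (simp_all add: GL_def)
  have cancel: "k *v v = k *v w \<longleftrightarrow> v = w" for v w
    using i by (metis matrix_vector_mul_assoc matrix_vector_mul_lid)
  have "(k ** A ** inv\<^bsub>GL\<^esub> k) *v (k *v v) = k *v (A *v v)" for A v
    using i by (metis matrix_mul_assoc matrix_mul_rid matrix_vector_mul_assoc)
  then show ?thesis by (auto simp: fixed_vectors_def GL_def cancel)
qed

section \<open>Realization of a finite poset\<close>

abbreviation realization_points :: "'v::order set \<Rightarrow> ('v \<Rightarrow> real) set" where
  "realization_points P \<equiv>
    {t. (\<forall>v. 0 \<le> t v) \<and> {v. t v \<noteq> 0} \<in> finite_chains P \<and> sum t UNIV = 1}"

text \<open>For a finite poset the realization is a finite union of closed simplices in a product of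
  lines, so the coherent topology is the subspace topology. Maps can from here on be treated with
  \<open>continuous_on\<close>.\<close>

lemma nerve_realization_finite:
  fixes P :: "'v::{order,finite} set"
  shows "nerve_realization P = top_of_set (realization_points P)"
proof -
  have points: "(\<Union>c\<in>finite_chains P. order_simplex c) = realization_points P"
  proof (intro equalityI subsetI)
    fix t assume "t \<in> (\<Union>c\<in>finite_chains P. order_simplex c)"
    then obtain c where c: "c \<in> finite_chains P" "\<And>v. 0 \<le> t v" "\<And>v. v \<notin> c \<Longrightarrow> t v = 0" "sum t c = 1"
      by (auto simp: order_simplex_def)
    then have "{v. t v \<noteq> 0} \<subseteq> c" by blast
    then have "{v. t v \<noteq> 0} \<in> finite_chains P" using c(1) unfolding finite_chains_def by (auto simp: subset_iff)
    moreover have "sum t UNIV = sum t c" using c(3) by (intro sum.mono_neutral_right) auto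
    ultimately show "t \<in> realization_points P" using c by simp
  next
    fix t assume t: "t \<in> realization_points P"
    have "sum t {v. t v \<noteq> 0} = sum t UNIV" by (intro sum.mono_neutral_left) auto
    then have "t \<in> order_simplex {v. t v \<noteq> 0}" using t by (auto simp: order_simplex_def)
    then show "t \<in> (\<Union>c\<in>finite_chains P. order_simplex c)" using t by blast
  qed
  have simplex_closed: "closed (order_simplex c)" for c :: "'v set"
    unfolding order_simplex_def
    by (intro closed_Collect_conj closed_Collect_all closed_Collect_imp closed_Collect_le closed_Collect_eq
        continuous_intros open_Collect_const continuous_on_product_then_coordinatewise)
  have chains_finite: "finite (finite_chains P)" by simp
  have T: "powertop_real (UNIV :: 'v set) = euclidean" by (rule euclidean_product_topology)
  have "openin (nerve_realization P) U \<longleftrightarrow> openin (top_of_set (realization_points P)) U" for U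
  proof
    assume U: "openin (nerve_realization P) U"
    have "closedin (top_of_set (order_simplex c)) (order_simplex c - U)" if "c \<in> finite_chains P" for c
    proof -
      have "openin (top_of_set (order_simplex c)) (U \<inter> order_simplex c)"
        using U that by (simp add: openin_nerve_realization T)
      then have "closedin (top_of_set (order_simplex c)) (order_simplex c - U \<inter> order_simplex c)"
        by (metis closedin_diff closedin_topspace topspace_euclidean_subtopology)
      moreover have "order_simplex c - U \<inter> order_simplex c = order_simplex c - U" by blast
      ultimately show ?thesis by simp
    qed
    then have "closed (\<Union>c\<in>finite_chains P. order_simplex c - U)"
      using simplex_closed chains_finite by (intro closed_UN) (auto intro: closedin_closed_trans)
    moreover have "(\<Union>c\<in>finite_chains P. order_simplex c - U) = realization_points P - U"
      unfolding points[symmetric] by blast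
    ultimately have "closed (realization_points P - U)" by simp
    then have "closedin (top_of_set (realization_points P)) (realization_points P - U)"
      by (rule closed_subset[rotated]) blast
    moreover have "U \<subseteq> realization_points P"
      using U unfolding points[symmetric] by (simp add: openin_nerve_realization)
    ultimately show "openin (top_of_set (realization_points P)) U"
      unfolding openin_closedin_eq by (simp only: topspace_euclidean_subtopology)
  next
    assume "openin (top_of_set (realization_points P)) U"
    then obtain V where V: "open V" "U = realization_points P \<inter> V" unfolding openin_open by blast
    have "U \<inter> order_simplex c = order_simplex c \<inter> V" if "c \<in> finite_chains P" for c
      using that V(2) unfolding points[symmetric] by blast
    then show "openin (nerve_realization P) U"
      unfolding openin_nerve_realization T points using V by (auto simp: openin_open)
  qed
  then show ?thesis by (simp add: topology_eq)
qed

section \<open>Unreduced suspensions\<close>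

lemma topspace_suspension:
  "topspace (suspension X) = {Bot, Top} \<union> {Mid x t |x t. x \<in> topspace X \<and> 0 < t \<and> t < 1}"
  unfolding suspension_def by (rule topspace_final_topology) (auto simp: susp_pt_def)

lemma susp_pt_eq_iff:
  "susp_pt z = susp_pt w \<longleftrightarrow> snd z = snd w \<and> (snd z = 0 \<or> snd z = 1 \<or> fst z = fst w)"
  by (auto simp: susp_pt_def)

lemma susp_pt_in: "x \<in> topspace X \<Longrightarrow> s \<in> {0..1} \<Longrightarrow> susp_pt (x, s) \<in> topspace (suspension X)"
  by (auto simp: topspace_suspension susp_pt_def)

lemma suspension_cases:
  assumes "z \<in> topspace (suspension X)"
  obtains "z = Bot" | "z = Top" | x s where "x \<in> topspace X" "0 < s" "s < 1" "z = susp_pt (x, s)" "z = Mid x s"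
  using assms by (auto simp: topspace_suspension susp_pt_def)

lemma openin_suspension:
  "openin (suspension X) U \<longleftrightarrow> U \<subseteq> topspace (suspension X) \<and>
    openin (prod_topology X unit_interval) {z \<in> topspace X \<times> {0..1}. susp_pt z \<in> U}"
  unfolding topspace_suspension by (simp add: suspension_def openin_final_topology)

lemma closedin_suspension:
  "closedin (suspension X) C \<longleftrightarrow> C \<subseteq> topspace (suspension X) \<and>
    closedin (prod_topology X unit_interval) {z \<in> topspace X \<times> {0..1}. susp_pt z \<in> C}"
proof -
  have "{z \<in> topspace X \<times> {0..1}. susp_pt z \<in> topspace (suspension X) - C} =
      topspace (prod_topology X unit_interval) - {z \<in> topspace X \<times> {0..1}. susp_pt z \<in> C}"
    by (auto intro: susp_pt_in)
  then show ?thesis by (auto simp: closedin_def openin_suspension)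
qed

lemma continuous_map_susp_pt: "continuous_map (prod_topology X unit_interval) (suspension X) susp_pt"
  unfolding continuous_map_def using susp_pt_in[of _ X] by (auto simp: openin_suspension)

lemma continuous_map_suspension:
  assumes "continuous_map (prod_topology X unit_interval) Z (\<lambda>z. f (susp_pt z))"
    and "f Bot \<in> topspace Z" "f Top \<in> topspace Z"
  shows "continuous_map (suspension X) Z f"
  unfolding continuous_map_def
proof (intro conjI funcsetI allI impI)
  show "f z \<in> topspace Z" if "z \<in> topspace (suspension X)" for z
    using that
  proof (cases rule: suspension_cases)
    case (3 x s)
    then have "(x, s) \<in> topspace (prod_topology X unit_interval)" by simp
    then show ?thesis using continuous_map_image_subset_topspace[OF assms(1)] 3(4) by blast
  qed (use assms in auto)
  fix U assume "openin Z U"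
  then have "openin (prod_topology X unit_interval) {z \<in> topspace (prod_topology X unit_interval). f (susp_pt z) \<in> U}"
    by (rule openin_continuous_map_preimage[OF assms(1)])
  moreover have "{z \<in> topspace (prod_topology X unit_interval). f (susp_pt z) \<in> U} =
      {z \<in> topspace X \<times> {0..1}. susp_pt z \<in> {z \<in> topspace (suspension X). f z \<in> U}}"
    using susp_pt_in[of _ X] by auto
  ultimately show "openin (suspension X) {z \<in> topspace (suspension X). f z \<in> U}"
    unfolding openin_suspension by auto
qed

text \<open>The saturation of a closed set is the set itself together with those ends of the
  cylinder that it meets.\<close>

lemma closed_map_susp_pt: "closed_map (prod_topology X unit_interval) (suspension X) susp_pt"
  unfolding closed_map_def
proof (intro allI impI)
  fix C assume C: "closedin (prod_topology X unit_interval) C"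
  let ?D = "\<lambda>s. if \<exists>x. (x, s) \<in> C then topspace X \<times> {s} else {}"
  have sub: "C \<subseteq> topspace X \<times> {0..1}" using closedin_subset[OF C] by simp
  have "{z \<in> topspace X \<times> {0..1}. susp_pt z \<in> susp_pt ` C} = C \<union> ?D 0 \<union> ?D 1"
  proof (intro equalityI subsetI)
    fix z assume z: "z \<in> {z \<in> topspace X \<times> {0..1}. susp_pt z \<in> susp_pt ` C}"
    then obtain w where w: "w \<in> C" "susp_pt z = susp_pt w" by blast
    obtain x s y t where [simp]: "z = (x, s)" "w = (y, t)" by (cases z, cases w)
    show "z \<in> C \<union> ?D 0 \<union> ?D 1"
    proof (cases "s = 0 \<or> s = 1")
      case True
      then have "(y, s) \<in> C" using w by (auto simp: susp_pt_eq_iff)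
      then show ?thesis using True z by auto
    qed (use w in \<open>auto simp: susp_pt_eq_iff\<close>)
  next
    fix z assume z: "z \<in> C \<union> ?D 0 \<union> ?D 1"
    have "susp_pt z \<in> susp_pt ` C"
    proof (cases "z \<in> C")
      case False
      then obtain y where "(y, snd z) \<in> C" "snd z = 0 \<or> snd z = 1" using z by (auto split: if_splits)
      then show ?thesis by (intro rev_image_eqI[of "(y, snd z)"]) (auto simp: susp_pt_eq_iff)
    qed simp
    moreover have "z \<in> topspace X \<times> {0..1}" using z sub by (auto split: if_splits)
    ultimately show "z \<in> {z \<in> topspace X \<times> {0..1}. susp_pt z \<in> susp_pt ` C}" by blast
  qed
  moreover have "closedin (prod_topology X unit_interval) (?D s)" if "s \<in> {0..1}" for s
    using that by (auto simp: closedin_prod_Times_iff closed_subset)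
  then have "closedin (prod_topology X unit_interval) (C \<union> ?D 0 \<union> ?D 1)"
    using C by (intro closedin_Un) simp_all
  moreover have "susp_pt ` C \<subseteq> topspace (suspension X)" using sub by (auto intro!: susp_pt_in)
  ultimately show "closedin (suspension X) (susp_pt ` C)" by (simp only: closedin_suspension simp_thms)
qed

text \<open>A closed map stays closed on a closed subspace. Nonemptiness of \<open>A\<close> ensures
  that the cone points are in the image of the cylinder.\<close>

lemma suspension_closed_subspace:
  assumes A: "closedin X A" "A \<noteq> {}"
    and S: "S = {Bot, Top} \<union> {Mid x t |x t. x \<in> A \<and> 0 < t \<and> t < 1}"
  shows "closedin (suspension X) S"
    and "quotient_map (prod_topology (subtopology X A) unit_interval) (subtopology (suspension X) S) susp_pt"
proof -
  have AX: "A \<subseteq> topspace X" by (rule closedin_subset[OF A(1)])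
  have S_eq: "S = susp_pt ` (A \<times> {0..1})"
  proof (intro equalityI subsetI)
    obtain x where x: "x \<in> A" using A(2) by blast
    fix z assume "z \<in> S"
    then consider "z = susp_pt (x, 0)" | "z = susp_pt (x, 1)" | y t where "z = susp_pt (y, t)" "y \<in> A" "0 < t" "t < 1"
      by (auto simp: S susp_pt_def)
    then show "z \<in> susp_pt ` (A \<times> {0..1})" using x by cases (auto intro!: imageI)
  qed (auto simp: S susp_pt_def)
  have A_I: "closedin (prod_topology X unit_interval) (A \<times> {0..1})"
    using A(1) by (simp add: closedin_prod_Times_iff)
  show S_closed: "closedin (suspension X) S"
    unfolding S_eq using closed_map_susp_pt A_I by (auto simp: closed_map_def)
  have P: "prod_topology (subtopology X A) unit_interval = subtopology (prod_topology X unit_interval) (A \<times> {0..1})"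
    by (simp add: prod_topology_subtopology(1)[of X A unit_interval] subtopology_subtopology prod_topology_subtopology(2)[symmetric])
  have top: "topspace (subtopology (suspension X) S) = S"
    using closedin_subset[OF S_closed] by auto
  show "quotient_map (prod_topology (subtopology X A) unit_interval) (subtopology (suspension X) S) susp_pt"
  proof (rule continuous_closed_imp_quotient_map)
    show "continuous_map (prod_topology (subtopology X A) unit_interval) (subtopology (suspension X) S) susp_pt"
      unfolding P by (rule continuous_map_into_subtopology[OF continuous_map_from_subtopology[OF continuous_map_susp_pt]])
        (auto simp: S_eq)
    show "closed_map (prod_topology (subtopology X A) unit_interval) (subtopology (suspension X) S) susp_pt"
      unfolding P
    proof (rule closed_map_into_subtopology)
      show "closed_map (subtopology (prod_topology X unit_interval) (A \<times> {0..1})) (suspension X) susp_pt"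
        using closed_map_compose[OF closed_map_inclusion[OF A_I] closed_map_susp_pt] by simp
    qed (auto simp: S_eq)
    show "susp_pt ` topspace (prod_topology (subtopology X A) unit_interval) = topspace (subtopology (suspension X) S)"
      unfolding top unfolding S_eq using AX by (simp add: Int_absorb1)
  qed
qed

text \<open>The flag complex is empty for n = 1. Its suspension then consists of the two cone points
  and is not a quotient of the empty cylinder, so the cone points are handled on their own.\<close>

lemma continuous_map_times_suspension:
  fixes X :: "'a topology"
  assumes h: "continuous_map (prod_topology unit_interval (prod_topology X unit_interval)) Z (\<lambda>(u, z). h u (susp_pt z))"
    and pts: "continuous_map unit_interval Z (\<lambda>u. h u Bot)" "continuous_map unit_interval Z (\<lambda>u. h u Top)"
  shows "continuous_map (prod_topology unit_interval (suspension X)) Z (\<lambda>(u, z). h u z)"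
proof (cases "topspace X = {}")
  case False
  have "quotient_map (prod_topology X unit_interval) (suspension X) susp_pt"
    using suspension_closed_subspace(2)[OF closedin_topspace False refl] 
    unfolding topspace_suspension[symmetric] subtopology_topspace .
  then show ?thesis using h by (rule continuous_map_times_interval_quotient)
next
  case True
  have discrete: "openin (suspension X) {z}" if "z = Bot \<or> z = Top" for z
  proof -
    have "{w \<in> topspace X \<times> {0..1}. susp_pt w \<in> {z}} = {}" using True by blast
    then have "openin (prod_topology X unit_interval) {w \<in> topspace X \<times> {0..1}. susp_pt w \<in> {z}}"
      by (simp only: openin_empty)
    then show ?thesis using that unfolding openin_suspension topspace_suspension by blast
  qed
  have top: "topspace (suspension X) = {Bot, Top}" using True by (auto simp: topspace_suspension)
  show ?thesis
    unfolding continuous_map_def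
  proof (intro conjI funcsetI allI impI)
    show "(case w of (u, z) \<Rightarrow> h u z) \<in> topspace Z" if "w \<in> topspace (prod_topology unit_interval (suspension X))" for w
      using that pts top by (auto simp: continuous_map_def Pi_iff)
    fix U assume U: "openin Z U"
    have "{w \<in> topspace (prod_topology unit_interval (suspension X)). (case w of (u, z) \<Rightarrow> h u z) \<in> U} =
        {u \<in> topspace unit_interval. h u Bot \<in> U} \<times> {Bot} \<union> {u \<in> topspace unit_interval. h u Top \<in> U} \<times> {Top}"
      (is "?L = ?R1 \<union> ?R2")
    proof (rule Set.set_eqI)
      fix w :: "real \<times> 'a susp"
      obtain u z where w: "w = (u, z)" by (cases w)
      have "z = Bot \<or> z = Top \<or> z \<notin> topspace (suspension X)" using top by blast
      then show "w \<in> ?L \<longleftrightarrow> w \<in> ?R1 \<union> ?R2" unfolding w using top by (elim disjE) simp_all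
    qed
    moreover have "openin (prod_topology unit_interval (suspension X)) \<dots>"
      using openin_continuous_map_preimage[OF pts(1) U] openin_continuous_map_preimage[OF pts(2) U] discrete
      by (intro openin_Un) (simp_all only: openin_prod_Times_iff simp_thms)
    ultimately show "openin (prod_topology unit_interval (suspension X))
        {w \<in> topspace (prod_topology unit_interval (suspension X)). (case w of (u, z) \<Rightarrow> h u z) \<in> U}" by simp
  qed
qed

section \<open>Points of the flag complex and the action on them\<close>

definition flag_points :: "(('k::{field,finite} ^ 'n::finite) set \<Rightarrow> real) set" where
  "flag_points = realization_points flag_vertices"

lemma flag_complex_eq: "flag_complex = top_of_set flag_points"
  unfolding flag_complex_def flag_points_def by (rule nerve_realization_finite)

lemma flag_pointsI:
  assumes "\<And>V. 0 \<le> t V" and "\<And>V. t V \<noteq> 0 \<Longrightarrow> V \<in> flag_vertices"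
    and "\<And>V V'. t V \<noteq> 0 \<Longrightarrow> t V' \<noteq> 0 \<Longrightarrow> V \<subseteq> V' \<or> V' \<subseteq> V" and "sum t UNIV = 1"
  shows "t \<in> flag_points"
proof -
  have "{V. t V \<noteq> 0} \<subseteq> flag_vertices" using assms(2) by blast
  then have "{V. t V \<noteq> 0} \<in> finite_chains flag_vertices"
    using assms(3) unfolding finite_chains_def by simp
  then show ?thesis using assms(1,4) unfolding flag_points_def by simp
qed

lemma flag_pointsD:
  assumes "t \<in> flag_points"
  shows "0 \<le> t V" and "t V \<noteq> 0 \<Longrightarrow> V \<in> flag_vertices"
    and "t V \<noteq> 0 \<Longrightarrow> t V' \<noteq> 0 \<Longrightarrow> V \<subseteq> V' \<or> V' \<subseteq> V" and "sum t UNIV = 1"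
  using assms unfolding flag_points_def finite_chains_def by (simp_all, blast+)

lemma flag_act_closed:
  assumes A: "invertible A" and t: "t \<in> flag_points"
  shows "flag_act A t \<in> flag_points"
proof (rule flag_pointsI)
  obtain B where B: "\<And>V. (*v) B -` ((*v) A -` V) = V" using matrix_inverse_vimage[OF A] by metis
  show "0 \<le> flag_act A t V" for V using flag_pointsD(1)[OF t] by (simp add: flag_act_def)
  show "V \<in> flag_vertices" if V: "flag_act A t V \<noteq> 0" for V
  proof (rule flag_vertex_vimage[OF A, THEN iffD1])
    show "(*v) A -` V \<in> flag_vertices" by (rule flag_pointsD(2)[OF t]) (use V in \<open>simp add: flag_act_def\<close>)
  qed
  show "V \<subseteq> V' \<or> V' \<subseteq> V" if "flag_act A t V \<noteq> 0" "flag_act A t V' \<noteq> 0" for V V'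
    using flag_pointsD(3)[OF t, of "(*v) A -` V" "(*v) A -` V'"] that B unfolding flag_act_def
    by (metis vimage_mono)
  show "sum (flag_act A t) UNIV = 1"
    using sum.reindex_bij_betw[OF bij_matrix_vimage[OF A], of t] flag_pointsD(4)[OF t] by (simp add: flag_act_def)
qed

lemma flag_act_mult: "flag_act (A ** B) t = flag_act A (flag_act B t)"
proof -
  have "(*v) (A ** B) -` V = (*v) B -` ((*v) A -` V)" for V :: "('a ^ 'b) set"
    by (auto simp: matrix_vector_mul_assoc)
  then show ?thesis by (simp add: flag_act_def)
qed

lemma flag_act_one: "flag_act (mat 1) t = t"
proof -
  have "(*v) (mat 1) -` V = V" for V :: "('a ^ 'b) set" by auto
  then show ?thesis by (simp add: flag_act_def)
qed

lemma B_diamond_act_susp_pt: "B_diamond_act A (susp_pt (t, s)) = susp_pt (flag_act A t, s)"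
  by (simp add: B_diamond_act_def susp_pt_def)

lemma B_diamond_act_cone: "B_diamond_act A Bot = Bot" "B_diamond_act A Top = Top"
  by (simp_all add: B_diamond_act_def)

lemma topspace_flag_complex: "topspace flag_complex = flag_points"
  by (simp add: flag_complex_eq)

lemma flag_cylinder: "prod_topology flag_complex unit_interval = top_of_set (flag_points \<times> {0..1})"
  by (simp add: flag_complex_eq)

lemma continuous_map_susp_pt_comp:
  fixes f :: "'a::topological_space \<Rightarrow> ('k::{field,finite} ^ 'n::finite) set \<Rightarrow> real"
  assumes "continuous_on S f" "continuous_on S g" "\<And>x. x \<in> S \<Longrightarrow> f x \<in> flag_points" "\<And>x. x \<in> S \<Longrightarrow> g x \<in> {0..1}"
  shows "continuous_map (top_of_set S) (suspension flag_complex) (\<lambda>x. susp_pt (f x, g x))"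
proof -
  have "continuous_map (top_of_set S) (prod_topology flag_complex unit_interval) (\<lambda>x. (f x, g x))"
    unfolding flag_cylinder using assms by (auto intro!: continuous_on_Pair)
  from continuous_map_compose[OF this continuous_map_susp_pt] show ?thesis by (simp add: comp_def)
qed

lemma B_diamond_action: "pointed_action GL (B_diamond :: (('k::{field,finite} ^ 'n::finite) set \<Rightarrow> real) susp pspace) B_diamond_act"
  unfolding pointed_action_def continuous_action_def
proof (intro conjI ballI)
  let ?B = "B_diamond :: (('k ^ 'n) set \<Rightarrow> real) susp pspace"
  show "pt ?B \<in> topspace (ptop ?B)" by (simp add: B_diamond_def topspace_suspension)
  show "continuous_map (ptop ?B) (ptop ?B) (B_diamond_act k)" if "k \<in> carrier GL" for k
    unfolding B_diamond_def pspace.simps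
  proof (rule continuous_map_suspension)
    have "continuous_map (top_of_set (flag_points \<times> {0..1})) (suspension flag_complex) (\<lambda>z. susp_pt (flag_act k (fst z), snd z))"
    proof (rule continuous_map_susp_pt_comp)
      show "continuous_on (flag_points \<times> {0..1}) (\<lambda>z. flag_act k (fst z))"
        unfolding flag_act_def
      proof (rule continuous_on_coordinatewise_then_product)
        show "continuous_on (flag_points \<times> {0..1}) (\<lambda>z. fst z ((*v) k -` V))" for V
          by (rule continuous_on_product_then_coordinatewise[OF continuous_on_fst[OF continuous_on_id]])
      qed
    qed (use that in \<open>auto simp: GL_def intro!: flag_act_closed continuous_intros\<close>)
    then show "continuous_map (prod_topology flag_complex unit_interval) (suspension flag_complex) (\<lambda>z. B_diamond_act k (susp_pt z))"
      unfolding flag_cylinder by (auto simp: B_diamond_act_susp_pt case_prod_beta' elim!: continuous_map_eq)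
  qed (simp_all add: B_diamond_act_cone topspace_suspension)
  show "B_diamond_act \<one>\<^bsub>GL\<^esub> x = x" if "x \<in> topspace (ptop ?B)" for x
    by (cases x) (simp_all add: B_diamond_act_def GL_def flag_act_one)
  show "B_diamond_act (k \<otimes>\<^bsub>GL\<^esub> l) x = B_diamond_act k (B_diamond_act l x)" for k l x
    by (cases x) (simp_all add: B_diamond_act_def GL_def flag_act_mult)
  show "B_diamond_act k (pt ?B) = pt ?B" for k
    by (simp add: B_diamond_act_cone B_diamond_def)
qed

definition fixed_flags :: "('k::{field,finite} ^ 'n::finite ^ 'n) set \<Rightarrow> (('k ^ 'n) set \<Rightarrow> real) set" where
  "fixed_flags P = {t \<in> flag_points. \<forall>A\<in>P. flag_act A t = t}"

text \<open>A fixed point has a support that \<open>A\<close> permutes. The support is a chain and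
  \<open>A\<close> preserves the size of a subspace, so each member is mapped to itself.\<close>

lemma fixed_flags_iff:
  assumes "P \<subseteq> carrier GL"
  shows "t \<in> fixed_flags P \<longleftrightarrow> t \<in> flag_points \<and> (\<forall>A\<in>P. \<forall>V. t V \<noteq> 0 \<longrightarrow> (*v) A -` V = V)"
proof (intro iffI conjI ballI allI impI)
  assume t: "t \<in> fixed_flags P"
  then show F: "t \<in> flag_points" by (simp add: fixed_flags_def)
  fix A V assume A: "A \<in> P" and V: "t V \<noteq> 0"
  then have inv: "invertible A" using assms by (auto simp: GL_def)
  have "t ((*v) A -` V) = t V"
    using t A by (auto simp: fixed_flags_def flag_act_def dest!: bspec fun_cong[of _ _ V])
  then have "(*v) A -` V \<subseteq> V \<or> V \<subseteq> (*v) A -` V" using flag_pointsD(3)[OF F] V by simp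
  then show "(*v) A -` V = V" using card_matrix_vimage[OF inv, of V] by (metis card_subset_eq finite)
next
  assume t: "t \<in> flag_points \<and> (\<forall>A\<in>P. \<forall>V. t V \<noteq> 0 \<longrightarrow> (*v) A -` V = V)"
  have "t ((*v) A -` V) = t V" if A: "A \<in> P" for A V
  proof (cases "t V = 0 \<and> t ((*v) A -` V) \<noteq> 0")
    case True
    then have "(*v) A -` ((*v) A -` V) = (*v) A -` V" using t A by blast
    moreover have "inj (\<lambda>V. (*v) A -` V)" using bij_matrix_vimage[of A] assms A by (auto simp: GL_def bij_is_inj)
    ultimately have "(*v) A -` V = V" by (simp add: inj_eq)
    then show ?thesis by simp
  next
    case False
    then show ?thesis
    proof (cases "t V = 0")
      case False
      then have "(*v) A -` V = V" using t A by blast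
      then show ?thesis by simp
    qed simp
  qed
  then show "t \<in> fixed_flags P" using t by (auto simp: fixed_flags_def flag_act_def)
qed

lemma closed_fixed_flags: "closedin flag_complex (fixed_flags P)"
proof -
  have "closed {t. t U = (t V :: real)}" for U V :: "('a ^ 'b) set"
    by (intro closed_Collect_eq continuous_on_product_then_coordinatewise[OF continuous_on_id])
  then have "closed (\<Inter>A\<in>P. \<Inter>V. {t. t ((*v) A -` V) = (t V :: real)})"
    by (intro closed_INT ballI)
  moreover have "fixed_flags P = flag_points \<inter> (\<Inter>A\<in>P. \<Inter>V. {t. t ((*v) A -` V) = t V})"
    by (auto simp: fixed_flags_def flag_act_def fun_eq_iff)
  ultimately show ?thesis unfolding flag_complex_eq closedin_closed by blast
qed

subsection \<open>Pushing flags into a subspace\<close>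

text \<open>The part of \<open>t\<close> of total mass \<open>u\<close> that is carried by the smallest subspaces of the flag.\<close>

definition bottom_mass :: "real \<Rightarrow> ('a::finite set \<Rightarrow> real) \<Rightarrow> 'a set \<Rightarrow> real" where
  "bottom_mass u t V = min (t V) (max 0 (u - (\<Sum>V' | V' \<subset> V. t V')))"

text \<open>The flag below \<open>V\<close> can be intersected with \<open>W\<close> without leaving the order complex as long as
  nothing is moved before everything beneath it; hence the masses are moved from the bottom up.\<close>

definition push_down :: "'a::finite set \<Rightarrow> real \<Rightarrow> ('a set \<Rightarrow> real) \<Rightarrow> 'a set \<Rightarrow> real" where
  "push_down W u t V = t V - bottom_mass u t V + (\<Sum>V'\<in>UNIV. if V' \<inter> W = V then bottom_mass u t V' else 0)"

lemma bottom_mass_bounds: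
  assumes "\<And>V. 0 \<le> t V"
  shows "0 \<le> bottom_mass u t V" "bottom_mass u t V \<le> t V"
  using assms[of V] by (auto simp: bottom_mass_def)

lemma bottom_mass_0: "(\<And>V. 0 \<le> t V) \<Longrightarrow> bottom_mass 0 t V = 0"
  by (simp add: bottom_mass_def sum_nonneg max_absorb1 min_absorb2)

lemma sum_below:
  fixes t :: "'a::finite set \<Rightarrow> real"
  assumes "\<And>V. 0 \<le> t V" and "V \<subset> V'"
  shows "(\<Sum>U | U \<subset> V. t U) + t V \<le> (\<Sum>U | U \<subset> V'. t U)"
proof -
  have "(\<Sum>U | U \<subset> V. t U) + t V = (\<Sum>U\<in>insert V {U. U \<subset> V}. t U)" by simp
  also have "\<dots> \<le> (\<Sum>U | U \<subset> V'. t U)" using assms by (intro sum_mono2) auto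
  finally show ?thesis .
qed

lemma bottom_mass_1:
  assumes "\<And>V. 0 \<le> t V" and "sum t UNIV = 1"
  shows "bottom_mass 1 t V = t V"
proof -
  have "(\<Sum>U | U \<subset> V. t U) + t V = (\<Sum>U\<in>insert V {U. U \<subset> V}. t U)" by simp
  also have "\<dots> \<le> sum t UNIV" using assms(1) by (intro sum_mono2) auto
  finally show ?thesis using assms by (simp add: bottom_mass_def)
qed

text \<open>If something has been taken from V', the budget \<open>u\<close> exceeds the mass
  strictly below V'. The mass of V is part of that, so it has been taken entirely.\<close>

lemma bottom_mass_full:
  assumes "\<And>V. 0 \<le> t V" and "bottom_mass u t V' \<noteq> 0" and "V \<subset> V'"
  shows "bottom_mass u t V = t V"
  using sum_below[of t V V'] assms bottom_mass_bounds[of t u V', OF assms(1)] by (auto simp: bottom_mass_def)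

lemma push_down_nonneg:
  assumes "\<And>V. 0 \<le> t V"
  shows "0 \<le> push_down W u t V"
  unfolding push_down_def using bottom_mass_bounds[of t, OF assms]
  by (intro add_nonneg_nonneg sum_nonneg) auto

lemma sum_push_down: "sum (push_down W u t) UNIV = sum t UNIV"
proof -
  have "(\<Sum>V\<in>UNIV. \<Sum>V'\<in>UNIV. if V' \<inter> W = V then bottom_mass u t V' else 0) = sum (bottom_mass u t) UNIV"
    by (subst sum.swap) simp
  then show ?thesis by (simp add: push_down_def sum.distrib sum_subtractf)
qed

lemma push_down_0: "(\<And>V. 0 \<le> t V) \<Longrightarrow> push_down W 0 t = t"
  by (simp add: push_down_def[abs_def] bottom_mass_0 cong: if_cong)

lemma push_down_nonzero:
  assumes "push_down W u t V \<noteq> 0"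
  obtains "bottom_mass u t V \<noteq> t V" | V' where "bottom_mass u t V' \<noteq> 0" "V' \<inter> W = V"
proof (cases "bottom_mass u t V = t V")
  case True
  have "\<exists>V'. bottom_mass u t V' \<noteq> 0 \<and> V' \<inter> W = V"
  proof (rule ccontr)
    assume "\<not> ?thesis"
    then have "(\<Sum>V'\<in>UNIV. if V' \<inter> W = V then bottom_mass u t V' else 0) = 0"
      by (intro sum.neutral) auto
    then show False using True assms by (simp add: push_down_def)
  qed
  then show ?thesis using that(2) by blast
qed (use that in auto)

text \<open>The critical pair is a \<open>U\<close> of which something is left in place and a
  \<open>U'\<close> of which something has been moved to U' \<inter> W. If \<open>U\<close> were
  strictly below \<open>U'\<close>, it would have been moved completely. So U' \<subseteq> U, and U'
  \<inter> W stays comparable with \<open>U\<close>.\<close>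

lemma push_down_chain:
  assumes t: "\<And>V. 0 \<le> t V" "\<And>V V'. t V \<noteq> 0 \<Longrightarrow> t V' \<noteq> 0 \<Longrightarrow> V \<subseteq> V' \<or> V' \<subseteq> V"
    and "push_down W u t V \<noteq> 0" "push_down W u t V' \<noteq> 0"
  shows "V \<subseteq> V' \<or> V' \<subseteq> V"
proof -
  have moved: "t U \<noteq> 0" if "bottom_mass u t U \<noteq> 0" for U
    using that bottom_mass_bounds[of t u U, OF t(1)] by auto
  have kept: "t U \<noteq> 0" if "bottom_mass u t U \<noteq> t U" for U
    using that bottom_mass_bounds[of t u U, OF t(1)] by auto
  have mixed: "U' \<inter> W \<subseteq> U" if "bottom_mass u t U \<noteq> t U" "bottom_mass u t U' \<noteq> 0" for U U'
    using t(2)[OF kept[OF that(1)] moved[OF that(2)]] bottom_mass_full[of t u U' U, OF t(1) that(2)] that(1) by blast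
  show ?thesis
  proof (rule push_down_nonzero[OF assms(3)]; rule push_down_nonzero[OF assms(4)])
    show ?thesis if "bottom_mass u t V \<noteq> t V" "bottom_mass u t V' \<noteq> t V'"
      using t(2) kept that by blast
    show ?thesis if "bottom_mass u t V \<noteq> t V" "bottom_mass u t U' \<noteq> 0" "U' \<inter> W = V'" for U'
      using mixed that by blast
    show ?thesis if "bottom_mass u t U \<noteq> 0" "U \<inter> W = V" "bottom_mass u t V' \<noteq> t V'" for U
      using mixed that by blast
    show ?thesis if "bottom_mass u t U \<noteq> 0" "U \<inter> W = V" "bottom_mass u t U' \<noteq> 0" "U' \<inter> W = V'" for U U'
      using t(2)[OF moved[OF that(1)] moved[OF that(3)]] that(2,4) by blast
  qed
qed

text \<open>With the whole mass as budget, nothing is left in place.\<close>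

lemma push_down_1_nonzero:
  assumes "\<And>V. 0 \<le> t V" "sum t UNIV = 1" and "push_down W 1 t V \<noteq> 0"
  shows "V \<subseteq> W"
proof (rule push_down_nonzero[OF assms(3)])
  show "V \<subseteq> W" if "bottom_mass 1 t V \<noteq> t V"
    using that bottom_mass_1[of t V, OF assms(1,2)] by simp
qed blast

text \<open>The construction uses only inclusion and intersection of subsets, and preimages respect
  both.\<close>

lemma push_down_vimage:
  fixes g :: "'a::finite \<Rightarrow> 'a"
  assumes g: "bij (\<lambda>V. g -` V)" and mono: "\<And>V V'. g -` V \<subset> g -` V' \<longleftrightarrow> V \<subset> V'" and W: "g -` W' = W"
  shows "push_down W' u (\<lambda>V. t (g -` V)) V = push_down W u t (g -` V)"
proof -
  have inj: "g -` V = g -` V' \<longleftrightarrow> V = V'" for V V' using g by (auto simp: bij_def inj_def)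
  have mass: "bottom_mass u (\<lambda>V. t (g -` V)) V = bottom_mass u t (g -` V)" for V
  proof -
    have "(\<Sum>V' | V' \<subset> V. t (g -` V')) = (\<Sum>V'\<in>UNIV. if V' \<subset> V then t (g -` V') else 0)"
      by (simp add: sum.If_cases)
    also have "\<dots> = (\<Sum>V'\<in>UNIV. if g -` V' \<subset> g -` V then t (g -` V') else 0)" by (simp only: mono)
    also have "\<dots> = (\<Sum>V'\<in>UNIV. if V' \<subset> g -` V then t V' else 0)"
      by (rule sum.reindex_bij_betw[OF g, of "\<lambda>V'. if V' \<subset> g -` V then t V' else 0"])
    also have "\<dots> = (\<Sum>V' | V' \<subset> g -` V. t V')" by (simp add: sum.If_cases)
    finally show ?thesis by (simp add: bottom_mass_def)
  qed
  have "(\<Sum>V'\<in>UNIV. if V' \<inter> W' = V then bottom_mass u t (g -` V') else 0) =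
      (\<Sum>V'\<in>UNIV. if g -` V' \<inter> W = g -` V then bottom_mass u t (g -` V') else 0)"
    by (simp only: W[symmetric] vimage_Int[symmetric] inj)
  also have "\<dots> = (\<Sum>V'\<in>UNIV. if V' \<inter> W = g -` V then bottom_mass u t V' else 0)"
    by (rule sum.reindex_bij_betw[OF g, of "\<lambda>V'. if V' \<inter> W = g -` V then bottom_mass u t V' else 0"])
  finally show ?thesis by (simp add: push_down_def mass cong: if_cong)
qed

lemma vimage_fixed_vectors:
  fixes P :: "('k::field ^ 'n ^ 'n) set"
  assumes "P \<subseteq> carrier GL" and A: "A \<in> P"
  shows "(*v) A -` fixed_vectors P = fixed_vectors P"
proof -
  obtain B where B: "B ** A = mat 1" using assms by (auto simp: GL_def invertible_def)
  have cancel: "v = w" if "A *v v = A *v w" for v w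
    using that B by (metis matrix_vector_mul_assoc matrix_vector_mul_lid)
  have "A *v v = v" if "A *v v \<in> fixed_vectors P" for v
    by (rule cancel) (use that A in \<open>auto simp: fixed_vectors_def\<close>)
  moreover have "A *v v = v" if "v \<in> fixed_vectors P" for v
    using that A by (auto simp: fixed_vectors_def)
  ultimately show ?thesis by (intro equalityI subsetI) (metis vimageE vimageI)+
qed

text \<open>A new vertex V' \<inter> W is proper because V' is, stable because V' and W both are,
  and nonzero by \<open>fixed_vectors_meet\<close>, which is where the order of \<open>P\<close>
  matters.\<close>

lemma push_down_fixed_flags:
  fixes P :: "('k::{field,finite} ^ 'n::finite ^ 'n) set"
  assumes p: "prime CARD('k)" and P: "P \<in> p_subgroups" and t: "t \<in> fixed_flags P"
  shows "push_down (fixed_vectors P) u t \<in> fixed_flags P"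
proof -
  let ?W = "fixed_vectors P"
  have P_sub: "P \<subseteq> carrier GL" using P by (auto simp: p_subgroups_def dest: subgroup.subset)
  have inv: "(*v) A -` V = V" if "A \<in> P" "t V \<noteq> 0" for A V
    using t that unfolding fixed_flags_iff[OF P_sub] by blast
  have F: "t \<in> flag_points" using t by (simp add: fixed_flags_def)
  note nonneg = flag_pointsD(1)[OF F]
  have support: "V \<in> flag_vertices \<and> (\<forall>A\<in>P. (*v) A -` V = V)" if "push_down ?W u t V \<noteq> 0" for V
  proof (rule push_down_nonzero[OF that])
    assume "bottom_mass u t V \<noteq> t V"
    then have "t V \<noteq> 0" using bottom_mass_bounds[of t u V, OF nonneg] by auto
    then show ?thesis using flag_pointsD(2)[OF F] inv by blast
  next
    fix V' assume V': "bottom_mass u t V' \<noteq> 0" "V' \<inter> ?W = V"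
    then have "t V' \<noteq> 0" using bottom_mass_bounds[of t u V', OF nonneg] by auto
    then have vertex: "V' \<in> flag_vertices" and stable: "\<And>A. A \<in> P \<Longrightarrow> (*v) A -` V' = V'"
      using flag_pointsD(2)[OF F] inv by blast+
    have "V' \<inter> ?W \<noteq> {0}"
      by (rule fixed_vectors_meet[OF p P]) (use vertex stable in blast)+
    moreover have "vec.subspace (V' \<inter> ?W)"
      using vertex subspace_fixed_vectors[of P] by (intro vec.subspace_inter) auto
    moreover have "V' \<inter> ?W \<noteq> UNIV" using vertex by blast
    moreover have "(*v) A -` (V' \<inter> ?W) = V' \<inter> ?W" if "A \<in> P" for A
      using stable[OF that] vimage_fixed_vectors[OF P_sub that] by (simp only: vimage_Int)
    ultimately show ?thesis using V'(2) by simp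
  qed
  have "push_down ?W u t \<in> flag_points"
  proof (rule flag_pointsI)
    show "0 \<le> push_down ?W u t V" for V by (rule push_down_nonneg[OF nonneg])
    show "V \<in> flag_vertices" if "push_down ?W u t V \<noteq> 0" for V using support[OF that] by blast
    show "V \<subseteq> V' \<or> V' \<subseteq> V" if "push_down ?W u t V \<noteq> 0" "push_down ?W u t V' \<noteq> 0" for V V'
      by (rule push_down_chain[OF nonneg flag_pointsD(3)[OF F] that])
    show "sum (push_down ?W u t) UNIV = 1" using flag_pointsD(4)[OF F] by (simp add: sum_push_down)
  qed
  then show ?thesis using support by (simp add: fixed_flags_iff[OF P_sub])
qed

abbreviation flag_vertex :: "'a set \<Rightarrow> 'a set \<Rightarrow> real" where
  "flag_vertex W \<equiv> \<lambda>V. if V = W then 1 else 0"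

text \<open>Three phases: until time 1/4 the flag is pushed into \<open>W\<close>, until 1/2 it
  moves along straight lines to the vertex \<open>W\<close>, and then it rests there while
  \<open>contract_susp\<close> contracts the suspension coordinate.\<close>

definition contract_flag :: "'a::finite set \<Rightarrow> real \<Rightarrow> ('a set \<Rightarrow> real) \<Rightarrow> 'a set \<Rightarrow> real" where
  "contract_flag W u t V = (1 - min 1 (max 0 (4 * u - 1))) * push_down W (min 1 (4 * u)) t V
     + min 1 (max 0 (4 * u - 1)) * flag_vertex W V"

lemma flag_vertex_fixed_flags:
  fixes P :: "('k::{field,finite} ^ 'n::finite ^ 'n) set"
  assumes "prime CARD('k)" and P: "P \<in> p_subgroups"
  shows "flag_vertex (fixed_vectors P) \<in> fixed_flags P"
proof -
  have P_sub: "P \<subseteq> carrier GL" using P by (auto simp: p_subgroups_def dest: subgroup.subset)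
  have "flag_vertex (fixed_vectors P) \<in> flag_points"
    using fixed_vectors_flag_vertex[OF assms] by (intro flag_pointsI) (auto split: if_splits)
  then show ?thesis using vimage_fixed_vectors[OF P_sub] by (auto simp: fixed_flags_iff[OF P_sub])
qed

lemma contract_flag_fixed_flags:
  fixes P :: "('k::{field,finite} ^ 'n::finite ^ 'n) set"
  assumes p: "prime CARD('k)" and P: "P \<in> p_subgroups" and t: "t \<in> fixed_flags P"
  shows "contract_flag (fixed_vectors P) u t \<in> fixed_flags P"
proof -
  let ?W = "fixed_vectors P" and ?l = "min 1 (max 0 (4 * u - 1))"
  let ?t = "push_down ?W (min 1 (4 * u)) t"
  have P_sub: "P \<subseteq> carrier GL" using P by (auto simp: p_subgroups_def dest: subgroup.subset)
  have t1: "?t \<in> fixed_flags P" by (rule push_down_fixed_flags[OF p P t])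
  have W: "flag_vertex ?W \<in> fixed_flags P" by (rule flag_vertex_fixed_flags[OF p P])
  have F: "t \<in> flag_points" "?t \<in> flag_points" "flag_vertex ?W \<in> flag_points"
    using t t1 W by (simp_all add: fixed_flags_def)
  have nonzero: "?t V \<noteq> 0 \<or> ?l \<noteq> 0 \<and> V = ?W" if "contract_flag ?W u t V \<noteq> 0" for V
    using that by (auto simp: contract_flag_def split: if_splits)
  \<comment> \<open>Once the straight-line phase has begun, all mass has been pushed, so every
    vertex lies in \<open>W\<close> and is comparable with it.\<close>
  have below: "V \<subseteq> ?W" if "?t V \<noteq> 0" "?l \<noteq> 0" for V
  proof (rule push_down_1_nonzero[of t])
    have "min 1 (4 * u) = 1" using that(2) by (auto simp: min_def max_def split: if_splits)
    then show "push_down ?W 1 t V \<noteq> 0" using that(1) by simp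
  qed (use flag_pointsD[OF F(1)] in auto)
  have "contract_flag ?W u t \<in> flag_points"
  proof (rule flag_pointsI)
    show "0 \<le> contract_flag ?W u t V" for V
      unfolding contract_flag_def using flag_pointsD(1)[OF F(2)]
      by (intro add_nonneg_nonneg mult_nonneg_nonneg) auto
    show "V \<in> flag_vertices" if "contract_flag ?W u t V \<noteq> 0" for V
      using nonzero[OF that] flag_pointsD(2)[OF F(2)] fixed_vectors_flag_vertex[OF p P] by blast
    show "V \<subseteq> V' \<or> V' \<subseteq> V" if "contract_flag ?W u t V \<noteq> 0" "contract_flag ?W u t V' \<noteq> 0" for V V'
      using nonzero[OF that(1)] nonzero[OF that(2)] flag_pointsD(3)[OF F(2)] below by blast
    show "sum (contract_flag ?W u t) UNIV = 1"
      using flag_pointsD(4)[OF F(2)] unfolding contract_flag_def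
      by (simp only: sum.distrib sum_distrib_left[symmetric]) simp
  qed
  moreover have "(*v) A -` V = V" if "A \<in> P" "contract_flag ?W u t V \<noteq> 0" for A V
    using nonzero[OF that(2)] t1 that(1) vimage_fixed_vectors[OF P_sub that(1)]
    unfolding fixed_flags_iff[OF P_sub] by blast
  ultimately show ?thesis by (simp add: fixed_flags_iff[OF P_sub])
qed

lemma contract_flag_0: "t \<in> flag_points \<Longrightarrow> contract_flag W 0 t = t"
  using push_down_0[of t W] flag_pointsD(1)[of t] by (auto simp: contract_flag_def fun_eq_iff)

lemma contract_flag_late: "1 / 2 \<le> u \<Longrightarrow> contract_flag W u t = flag_vertex W"
  by (auto simp: contract_flag_def fun_eq_iff)

lemma contract_flag_act:
  fixes k :: "'k::{field,finite} ^ 'n::finite ^ 'n"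
  assumes k: "invertible k" and W: "(*v) k -` W' = W"
  shows "contract_flag W' u (flag_act k t) = flag_act k (contract_flag W u t)"
proof
  fix V
  obtain B where B: "\<And>V. (*v) B -` ((*v) k -` V) = V" using matrix_inverse_vimage[OF k] by metis
  have sub: "(*v) k -` U \<subseteq> (*v) k -` U' \<longleftrightarrow> U \<subseteq> U'" for U U'
  proof
    assume "(*v) k -` U \<subseteq> (*v) k -` U'"
    then have "(*v) B -` ((*v) k -` U) \<subseteq> (*v) B -` ((*v) k -` U')" by (rule vimage_mono)
    then show "U \<subseteq> U'" by (simp only: B)
  qed (rule vimage_mono)
  have psub: "(*v) k -` U \<subset> (*v) k -` U' \<longleftrightarrow> U \<subset> U'" for U U'
    by (simp only: less_le_not_le sub)
  have "V = W' \<longleftrightarrow> (*v) k -` V = W" unfolding W[symmetric] using sub by (simp only: set_eq_subset)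
  then show "contract_flag W' u (flag_act k t) V = flag_act k (contract_flag W u t) V"
    using push_down_vimage[OF bij_matrix_vimage[OF k] psub W, of "min 1 (4 * u)" t V]
    by (simp add: contract_flag_def flag_act_def)
qed

text \<open>\<open>Top\<close> carries no flag; from time 1/2 on it slides down to
  \<open>Bot\<close> along the meridian through the vertex \<open>W\<close>. Before that the
  suspension coordinate keeps its value, so that all flags have arrived at this vertex when the
  slide begins.\<close>

definition contract_susp :: "'a::finite set \<Rightarrow> real \<Rightarrow> ('a set \<Rightarrow> real) susp \<Rightarrow> ('a set \<Rightarrow> real) susp" where
  "contract_susp W u z = (case z of Bot \<Rightarrow> Bot | Top \<Rightarrow> susp_pt (flag_vertex W, min 1 (2 - 2 * u))
     | Mid t s \<Rightarrow> susp_pt (contract_flag W u t, s * min 1 (2 - 2 * u)))"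

text \<open>The value chosen at \<open>Top\<close> fits: for s = 1 the flag is invisible until time
  1/2, and from then on every flag has become the vertex \<open>W\<close>.\<close>

lemma contract_susp_pt: "contract_susp W u (susp_pt (t, s)) = susp_pt (contract_flag W u t, s * min 1 (2 - 2 * u))"
proof -
  have "susp_pt (flag_vertex W, min 1 (2 - 2 * u)) = susp_pt (contract_flag W u t, min 1 (2 - 2 * u))"
  proof (cases "1 / 2 \<le> u")
    case True
    then show ?thesis by (simp only: contract_flag_late)
  next
    case False
    then have "min 1 (2 - 2 * u) = 1" by simp
    then show ?thesis by (simp only: susp_pt_eq_iff fst_conv snd_conv simp_thms)
  qed
  then show ?thesis by (auto simp: contract_susp_def susp_pt_def[of "(t, s)"], simp add: susp_pt_def)
qed

text \<open>Distances from \<open>Top\<close> are stretched by the factor 1 + u and clipped at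
  \<open>Bot\<close>: \<open>Top\<close> stays where it is, and at u = 1 everything with s \<le> 1/2
  has reached \<open>Bot\<close>.\<close>

definition shrink_susp :: "real \<Rightarrow> 'a susp \<Rightarrow> 'a susp" where
  "shrink_susp u z = (case z of Bot \<Rightarrow> Bot | Top \<Rightarrow> Top | Mid x s \<Rightarrow> susp_pt (x, max 0 ((1 + u) * s - u)))"

lemma shrink_susp_pt: "0 \<le> u \<Longrightarrow> shrink_susp u (susp_pt (x, s)) = susp_pt (x, max 0 ((1 + u) * s - u))"
  by (auto simp: shrink_susp_def susp_pt_def[of "(x, s)"]) (auto simp: susp_pt_def)

lemma fixed_points_B_diamond:
  fixes P :: "('k::{field,finite} ^ 'n::finite ^ 'n) set"
  shows "fixed_points P B_diamond_act B_diamond =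
    {Bot, Top} \<union> {Mid t s |t s. t \<in> fixed_flags P \<and> 0 < s \<and> s < 1}"
  by (auto simp: B_diamond_def topspace_suspension topspace_flag_complex fixed_flags_def B_diamond_act_def)

lemma continuous_on_bottom_mass:
  fixes f :: "'x::topological_space \<Rightarrow> real" and g :: "'x \<Rightarrow> 'a::finite set \<Rightarrow> real"
  assumes "continuous_on S f" "continuous_on S g"
  shows "continuous_on S (\<lambda>x. bottom_mass (f x) (g x) V)"
  unfolding bottom_mass_def
  by (intro continuous_intros assms continuous_on_product_then_coordinatewise[OF assms(2)])

lemma continuous_on_contract_flag:
  fixes S :: "(real \<times> (('a::finite set \<Rightarrow> real) \<times> real)) set"
  shows "continuous_on S (\<lambda>z. contract_flag W (fst z) (fst (snd z)))"
proof (rule continuous_on_coordinatewise_then_product)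
  fix V
  have t: "continuous_on S (\<lambda>z. fst (snd z))" by (intro continuous_intros)
  have u: "continuous_on S (\<lambda>z. min 1 (4 * fst z))" by (intro continuous_intros)
  have sum: "continuous_on S (\<lambda>z. \<Sum>V'\<in>UNIV. if V' \<inter> W = V then bottom_mass (min 1 (4 * fst z)) (fst (snd z)) V' else 0)"
  proof (rule continuous_on_sum)
    show "continuous_on S (\<lambda>z. if V' \<inter> W = V then bottom_mass (min 1 (4 * fst z)) (fst (snd z)) V' else 0)" for V'
      by (cases "V' \<inter> W = V") (simp_all add: continuous_on_bottom_mass[OF u t])
  qed
  show "continuous_on S (\<lambda>z. contract_flag W (fst z) (fst (snd z)) V)"
    unfolding contract_flag_def push_down_def
    by (intro continuous_intros sum continuous_on_bottom_mass[OF u t] continuous_on_product_then_coordinatewise[OF t])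
qed

theorem good_space_B_diamond:
  assumes p: "prime CARD('k::{field,finite})"
  shows "good_space (B_diamond :: (('k ^ 'n::finite) set \<Rightarrow> real) susp pspace) shrink_susp
    ({Bot} \<union> {Mid t s |t s. t \<in> flag_points \<and> 0 < s \<and> s < 1 / 2}) GL B_diamond_act p_subgroups
    (\<lambda>P. contract_susp (fixed_vectors P))"
proof (intro good_space.intro well_pointed.intro good_space_axioms.intro)
  let ?B = "B_diamond :: (('k ^ 'n) set \<Rightarrow> real) susp pspace"
  let ?FP = "flag_points :: (('k ^ 'n) set \<Rightarrow> real) set"
  let ?FC = "flag_complex :: (('k ^ 'n) set \<Rightarrow> real) topology"
  let ?N = "{Bot} \<union> {Mid t s |t s. t \<in> ?FP \<and> 0 < s \<and> s < 1 / 2}"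
  have topB: "ptop ?B = suspension ?FC" "pt ?B = Bot" by (simp_all add: B_diamond_def)
  have cylinder: "prod_topology unit_interval (prod_topology ?FC unit_interval) =
      top_of_set ({0..1} \<times> (?FP \<times> {0..1}))"
    by (simp add: flag_cylinder)
  show "pt ?B \<in> topspace (ptop ?B)" by (simp add: topB topspace_suspension)
  show "closedin (ptop ?B) {pt ?B}"
  proof -
    have "{z \<in> ?FP \<times> {0..1}. susp_pt z \<in> {pt ?B}} = ?FP \<times> {0}" unfolding topB by (auto simp: susp_pt_def split: if_splits)
    moreover have "closedin (prod_topology ?FC unit_interval) (?FP \<times> {0})"
      unfolding closedin_prod_Times_iff topspace_flag_complex[symmetric] by (simp add: closed_subset)
    moreover have "{pt ?B} \<subseteq> topspace (suspension ?FC)" by (simp add: topB topspace_suspension)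
    ultimately show ?thesis unfolding topB(1) closedin_suspension topspace_flag_complex by (simp only: simp_thms)
  qed
  show "continuous_map (prod_topology unit_interval (ptop ?B)) (ptop ?B) (\<lambda>(u, z). shrink_susp u z)"
    unfolding topB
  proof (rule continuous_map_times_suspension)
    have "continuous_map (top_of_set ({0..1} \<times> (?FP \<times> {0..1}))) (suspension ?FC)
        (\<lambda>z. susp_pt (fst (snd z), max 0 ((1 + fst z) * snd (snd z) - fst z)))"
    proof (rule continuous_map_susp_pt_comp)
      fix z :: "real \<times> ((('k ^ 'n) set \<Rightarrow> real) \<times> real)" assume z: "z \<in> {0..1} \<times> (?FP \<times> {0..1})"
      obtain u t s where [simp]: "z = (u, t, s)" by (cases z)
      have "(1 + u) * s \<le> (1 + u) * 1" using z by (intro mult_left_mono) auto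
      then show "max 0 ((1 + fst z) * snd (snd z) - fst z) \<in> {0..1}" by simp
    next
      show "continuous_on ({0..1::real} \<times> (?FP \<times> {0..1::real})) (\<lambda>z. fst (snd z))"
        by (intro continuous_on_fst continuous_on_snd continuous_on_id)
      show "continuous_on ({0..1::real} \<times> (?FP \<times> {0..1::real})) (\<lambda>z. max 0 ((1 + fst z) * snd (snd z) - fst z))"
        by (auto intro!: continuous_intros)
    qed auto
    then show "continuous_map (prod_topology unit_interval (prod_topology ?FC unit_interval)) (suspension ?FC)
        (\<lambda>(u, z). shrink_susp u (susp_pt z))"
      unfolding cylinder by (rule continuous_map_eq) (auto simp: shrink_susp_pt)
  qed (simp_all add: shrink_susp_def topspace_suspension)
  show "shrink_susp 0 x = x" if "x \<in> topspace (ptop ?B)" for x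
    using that unfolding topB by (cases rule: suspension_cases) (auto simp: shrink_susp_def susp_pt_def)
  show "shrink_susp u (pt ?B) = pt ?B" for u by (simp add: topB shrink_susp_def)
  show "openin (ptop ?B) ?N"
  proof -
    have "{z \<in> ?FP \<times> {0..1}. susp_pt z \<in> ?N} = ?FP \<times> {0..<1/2}"
      by (auto simp: susp_pt_def split: if_splits)
    moreover have "openin (prod_topology ?FC unit_interval) (?FP \<times> {0..<1/2})"
    proof -
      have "{0..<1/2} = {0..1} \<inter> {..<1/2::real}" by auto
      then have "openin unit_interval {0..<1/2::real}" unfolding openin_open by (metis open_lessThan)
      then show ?thesis
        unfolding openin_prod_Times_iff using openin_topspace[of ?FC] by (simp add: topspace_flag_complex)
    qed
    moreover have "?N \<subseteq> topspace (suspension ?FC)"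
      by (auto simp: topspace_suspension topspace_flag_complex)
    ultimately show ?thesis unfolding topB openin_suspension topspace_flag_complex by (simp only: simp_thms)
  qed
  show "pt ?B \<in> ?N" by (simp add: topB)
  show "shrink_susp 1 x = pt ?B" if "x \<in> ?N" for x
    using that by (auto simp: topB shrink_susp_def susp_pt_def)
  show "group (GL :: ('k ^ 'n ^ 'n) monoid)" by (rule group_GL)
  show "pointed_action GL ?B B_diamond_act" by (rule B_diamond_action)
  show "shrink_susp u (B_diamond_act k x) = B_diamond_act k (shrink_susp u x)" for u k and x :: "(('k ^ 'n) set \<Rightarrow> real) susp"
    by (cases x) (simp_all add: shrink_susp_def B_diamond_act_susp_pt B_diamond_act_cone, simp add: B_diamond_act_def)
  fix P :: "('k ^ 'n ^ 'n) set" assume P: "P \<in> p_subgroups"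
  let ?F = "fixed_points P B_diamond_act ?B" and ?K = "contract_susp (fixed_vectors P)"
  show P_sub: "P \<subseteq> carrier GL" using P by (auto simp: p_subgroups_def dest: subgroup.subset)
  \<comment> \<open>The vertex given by the fixed vectors is itself fixed, so the suspension of the
    fixed flags is a quotient of their cylinder.\<close>
  have nonempty: "fixed_flags P \<noteq> {}" using flag_vertex_fixed_flags[OF p P] by blast
  note F = suspension_closed_subspace[OF closed_fixed_flags nonempty fixed_points_B_diamond, unfolded topB(1)]
  have F_cases: thesis if "x \<in> ?F" "x = Bot \<Longrightarrow> thesis" "x = Top \<Longrightarrow> thesis"
      "\<And>t s. t \<in> fixed_flags P \<Longrightarrow> 0 < s \<Longrightarrow> s < 1 \<Longrightarrow> x = susp_pt (t, s) \<Longrightarrow> thesis" for x thesis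
    using that unfolding fixed_points_B_diamond by (auto simp: susp_pt_def)
  have susp_F: "susp_pt (t, s) \<in> ?F" if "t \<in> fixed_flags P" "s \<in> {0..1}" for t s
    unfolding fixed_points_B_diamond using that by (auto simp: susp_pt_def)
  have scale: "s * min 1 (2 - 2 * u) \<in> {0..1}" if "s \<in> {0..1}" "u \<in> {0..1}" for s u :: real
    using that by (auto intro: mult_le_one)
  show "closedin (ptop ?B) ?F" unfolding topB(1) by (rule F(1))
  show "continuous_map (prod_topology unit_interval (subtopology (ptop ?B) ?F)) (ptop ?B) (\<lambda>(u, x). ?K u x)"
    unfolding topB(1)
  proof (rule continuous_map_times_interval_quotient[OF F(2)])
    have sub: "fixed_flags P \<subseteq> ?FP" by (auto simp: fixed_flags_def)
    then have "subtopology ?FC (fixed_flags P) = top_of_set (fixed_flags P)"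
      by (simp add: flag_complex_eq subtopology_subtopology Int_absorb1)
    then have eq: "prod_topology unit_interval (prod_topology (subtopology ?FC (fixed_flags P)) unit_interval) =
        top_of_set ({0..1} \<times> (fixed_flags P \<times> {0..1}))" by simp
    have "continuous_map (top_of_set ({0..1} \<times> (fixed_flags P \<times> {0..1}))) (suspension ?FC)
        (\<lambda>z. susp_pt (contract_flag (fixed_vectors P) (fst z) (fst (snd z)), snd (snd z) * min 1 (2 - 2 * fst z)))"
    proof (rule continuous_map_susp_pt_comp[OF continuous_on_contract_flag])
      fix z :: "real \<times> ((('k ^ 'n) set \<Rightarrow> real) \<times> real)" assume z: "z \<in> {0..1} \<times> (fixed_flags P \<times> {0..1})"
      show "contract_flag (fixed_vectors P) (fst z) (fst (snd z)) \<in> ?FP"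
        using contract_flag_fixed_flags[OF p P] z sub by auto
      show "snd (snd z) * min 1 (2 - 2 * fst z) \<in> {0..1}" using scale z by auto
    qed (intro continuous_intros)
    then show "continuous_map (prod_topology unit_interval (prod_topology (subtopology ?FC (fixed_flags P)) unit_interval))
        (suspension ?FC) (\<lambda>(u, z). ?K u (susp_pt z))"
      unfolding eq by (rule continuous_map_eq) (auto simp: contract_susp_pt)
  qed
  show "?K 0 x = x" if "x \<in> ?F" for x
    using that by (rule F_cases) (auto simp: contract_susp_pt contract_flag_0 fixed_flags_def, auto simp: contract_susp_def susp_pt_def)
  show "?K 1 x = pt ?B" for x
    by (cases x) (auto simp: contract_susp_def susp_pt_def topB)
  show "?K u (pt ?B) = pt ?B" for u by (simp add: contract_susp_def topB)
  show "?K u x \<in> ?F" if u: "u \<in> {0..1}" and "x \<in> ?F" for u x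
    using that(2)
  proof (rule F_cases)
    assume "x = Top"
    then have "?K u x = susp_pt (flag_vertex (fixed_vectors P), 1 * min 1 (2 - 2 * u))" by (simp add: contract_susp_def)
    then show ?thesis using susp_F[OF flag_vertex_fixed_flags[OF p P] scale[OF _ u, of 1]] by simp
  next
    fix t s assume "t \<in> fixed_flags P" "0 < s" "s < 1" "x = susp_pt (t, s)"
    then show ?thesis using susp_F[OF contract_flag_fixed_flags[OF p P] scale[OF _ u]] by (simp add: contract_susp_pt)
  qed (use susp_F[of _ 0] in \<open>simp add: contract_susp_def fixed_points_B_diamond\<close>)
  show "contract_susp (fixed_vectors (conjugate GL k P)) u (B_diamond_act k x) = B_diamond_act k (?K u x)"
    if "u \<in> {0..1}" "x \<in> ?F" "k \<in> carrier GL" for u x k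
  proof -
    have k: "invertible k" using that(3) by (simp add: GL_def)
    have W: "(*v) k -` fixed_vectors (conjugate GL k P) = fixed_vectors P" by (rule fixed_vectors_conjugate[OF P_sub k])
    note act = contract_flag_act[OF k W]
    have vertex: "flag_vertex (fixed_vectors (conjugate GL k P)) = flag_act k (flag_vertex (fixed_vectors P))"
      using act[of 1] by (simp add: contract_flag_late)
    show ?thesis using that(2)
    proof (rule F_cases)
      assume "x = Top"
      then show ?thesis by (simp add: contract_susp_def B_diamond_act_cone B_diamond_act_susp_pt vertex)
    next
      fix t s assume "x = susp_pt (t, s)"
      then show ?thesis by (simp add: contract_susp_pt B_diamond_act_susp_pt act)
    qed (simp add: contract_susp_def B_diamond_act_cone)
  qed
qed

section \<open>The equivalence on orbit spaces for an arbitrary universal space\<close>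

lemma biequivariant_equivalenceI:
  assumes G: "group G" "group L" "H \<subseteq> carrier G" and f: "equivariant_homotopy_equivalence (G \<times>\<times> L) E a W c f"
  shows "biequivariant_equivalence L E (snd_act G a) W (snd_act G c) H (fst_act L a) (fst_act L c) f"
proof -
  have one: "\<one>\<^bsub>G\<^esub> \<in> carrier G" "\<one>\<^bsub>L\<^esub> \<in> carrier L"
    using G by (auto intro: monoid.one_closed group.is_monoid)
  have comm: "commutes_on (carrier L) X (snd_act G u) (snd_act G v) h \<and> commutes_on H X (fst_act L u) (fst_act L v) h"
    if "equivariant_map (G \<times>\<times> L) X u Y v h" for X Y u v and h :: "'x \<Rightarrow> 'y"
    using that one G(3) by (auto simp: equivariant_map_def commutes_on_def snd_act_def fst_act_def)
  obtain g where g: "equivariant_map (G \<times>\<times> L) W c E a g"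
      "equivariantly_homotopic (G \<times>\<times> L) E a E a (g \<circ> f) id" "equivariantly_homotopic (G \<times>\<times> L) W c W c (f \<circ> g) id"
      and fm: "equivariant_map (G \<times>\<times> L) E a W c f"
    using f by (auto simp: equivariant_homotopy_equivalence_def)
  have "homotopic_with (\<lambda>f. commutes_on (carrier L) E (snd_act G a) (snd_act G a) f \<and> commutes_on H E (fst_act L a) (fst_act L a) f)
      E E (g \<circ> f) id"
    using g(2) unfolding equivariantly_homotopic_def by (rule homotopic_with_mono) (use comm in blast)
  moreover have "homotopic_with (\<lambda>f. commutes_on (carrier L) W (snd_act G c) (snd_act G c) f \<and> commutes_on H W (fst_act L c) (fst_act L c) f)
      W W (f \<circ> g) id"
    using g(3) unfolding equivariantly_homotopic_def by (rule homotopic_with_mono) (use comm in blast)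
  ultimately show ?thesis
    unfolding biequivariant_equivalence_def using comm[OF fm] comm[OF g(1)] fm g(1)
    by (auto simp: equivariant_map_def)
qed

lemma pt_in_orbit_smash:
  assumes L: "group L" "pointed_action L X a" and E: "continuous_action L E e" "topspace E \<noteq> {}"
  shows "pt (orbit_smash L X a E e) \<in> topspace (ptop (orbit_smash L X a E e))"
proof -
  obtain w where "w \<in> topspace E" using E(2) by blast
  then show ?thesis
    unfolding topspace_orbit_smash[OF L E] pt_orbit_smash[OF L(2), of E e w]
    using L(2) by (intro imageI) (simp add: pointed_action_def)
qed

text \<open>The induced map, followed by the equivalence from the fixed points for \<open>E\<close>
  to those for the CW model \<open>W\<close>, is an equivalence of orbit spaces followed by the
  inclusion of \<open>smash_inclusion_equivalence\<close>. Two out of three gives the claim for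
  \<open>E\<close>.\<close>

theorem universal_orbit_smash_equivalence:
  fixes E :: "'e topology" and E0 :: "'f topology"
  assumes B: "good_space B r N L bL PP K" and L: "finite (carrier L)"
    and PP: "\<And>P. subgroup P L \<Longrightarrow> P \<noteq> {\<one>\<^bsub>L\<^esub>} \<Longrightarrow> card P dvd order G \<Longrightarrow> P \<in> PP"
    and G: "group G" "finite (carrier G)" "subgroup H G"
    and Y: "pointed_action (G \<times>\<times> L) Y aY"
    and E: "universal_space TYPE('w) G L E aE"
    and E0: "continuous_action L E0 a0" "topspace E0 \<noteq> {}"
    and \<phi>: "equivariant_homotopy_equivalence L E0 a0 (fixed_space (carrier G) (fst_act L aE) E) (snd_act G aE) \<phi>"
  shows "pointed_homotopy_equivalence
      (orbit_smash L (smash B (fixed_pspace H (fst_act L aY) Y)) (smash_act bL (snd_act G aY)) E0 a0)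
      (fixed_pspace H (orbit_smash_act (fst_act L aY) (fst_act L aE))
        (orbit_smash L (smash B Y) (smash_act bL (snd_act G aY)) E (snd_act G aE)))
      (orbit_smash_map \<phi>)"
proof -
  interpret B: good_space B r N L bL PP K by fact
  interpret GL: group L by (rule B.group)
  interpret GG: group G by (rule G)
  have H: "H \<subseteq> carrier G" using G(3) by (rule subgroup.subset)
  obtain W :: "'w topology" and c f where c: "continuous_action (G \<times>\<times> L) W c" "Hausdorff_space W"
    and free: "\<And>l w. l \<in> carrier L \<Longrightarrow> w \<in> topspace W \<Longrightarrow> snd_act G c l w = w \<Longrightarrow> l = \<one>\<^bsub>L\<^esub>"
    and WH: "topspace (fixed_space H (fst_act L c) W) \<noteq> {}"
    and f: "equivariant_homotopy_equivalence (G \<times>\<times> L) E aE W c f"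
    and f\<phi>: "equivariant_homotopy_equivalence L E0 a0 (fixed_space H (fst_act L c) W) (snd_act G c) (f \<circ> \<phi>)"
    by (rule universal_space_cw_model[OF G(1) B.group E G(3) \<phi>]) (rule that; assumption)
  have aE: "continuous_action (G \<times>\<times> L) E aE" using E by (simp add: universal_space_def)
  have aY: "continuous_action (G \<times>\<times> L) (ptop Y) aY" "pt Y \<in> topspace (ptop Y)"
    and aY_pt: "\<And>k. k \<in> carrier (G \<times>\<times> L) \<Longrightarrow> aY k (pt Y) = pt Y"
    using Y by (auto simp: pointed_action_def)
  note Wacts = fst_snd_actions[OF G(1) B.group c(1)] and Yacts = fst_snd_actions[OF G(1) B.group aY(1)]
    and Eacts = fst_snd_actions[OF G(1) B.group aE]
  let ?yL = "snd_act G aY" and ?yH = "fst_act L aY"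
  have YL: "pointed_action L Y ?yL" and YG: "pointed_action G Y ?yH"
    using Yacts(1,2) aY(2) aY_pt by (auto simp: pointed_action_def snd_act_def fst_act_def)
  have YH: "pointed_action L (fixed_pspace H ?yH Y) ?yL"
  proof -
    have "continuous_action L (fixed_space H ?yH (ptop Y)) ?yL"
      by (rule fixed_space_action[OF Yacts(2)]) (use Yacts(3) H in blast)
    moreover have "pt Y \<in> topspace (fixed_space H ?yH (ptop Y))"
      using YG H by (auto simp: fixed_space_def pointed_action_def)
    ultimately show ?thesis using YL by (simp add: pointed_action_def fixed_pspace_def)
  qed
  have trivial_action: "pointed_action G B (\<lambda>_. id)"
    using B.pt_B by (simp add: pointed_action_def continuous_action_def)
  have XL: "pointed_action L (smash B Y) (smash_act bL ?yL)"
    by (rule pointed_action_smash[OF B.group B.B_action YL])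
  have XG: "pointed_action G (smash B Y) (smash_act (\<lambda>_. id) ?yH)"
    by (rule pointed_action_smash[OF G(1) trivial_action YG])
  have XL': "pointed_action L (smash B (fixed_pspace H ?yH Y)) (smash_act bL ?yL)"
    by (rule pointed_action_smash[OF B.group B.B_action YH])
  interpret F: fixed_orbits L G H "smash B Y" "smash_act bL ?yL" "smash_act (\<lambda>_. id) ?yH" W "snd_act G c" "fst_act L c"
  proof (intro fixed_orbits.intro)
    show "finite H" using H G(2) by (rule finite_subset)
    show "smash_act bL ?yL l (smash_act (\<lambda>_. id) ?yH g z) = smash_act (\<lambda>_. id) ?yH g (smash_act bL ?yL l z)"
      if "l \<in> carrier L" "g \<in> carrier G" "z \<in> topspace (ptop (smash B Y))" for l g z
    proof -
      have "snd z \<in> topspace (ptop Y)" using smash_sub_prod[OF B.pt_B aY(2)] that(3) by auto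
      then show ?thesis using Yacts(3)[OF that(1,2)] by (simp add: smash_act_def prod_eq_iff)
    qed
  qed (use B.group L G XL XG Wacts c(2) free WH in auto)
  interpret S: smash_fixed_orbits B r N L bL PP K G H Y ?yL ?yH W "snd_act G c" "fst_act L c"
  proof unfold_locales
    show "pointed_action L Y ?yL" by (rule YL)
    show "pointed_action G Y ?yH" by (rule YG)
    show "?yL l (?yH g y) = ?yH g (?yL l y)" if "l \<in> carrier L" "g \<in> carrier G" "y \<in> topspace (ptop Y)" for l g y
      by (rule Yacts(3)[OF that])
    fix w assume w: "w \<in> F.E_fix" and nontrivial: "snd ` F.stab w \<noteq> {\<one>\<^bsub>L\<^esub>}"
    \<comment> \<open>The isotropy group of \<open>w\<close> is the graph of a homomorphism from
      \<open>H\<close> to \<open>L\<close>, and this projection is its image: a subgroup whose order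
      divides that of \<open>H\<close>.\<close>
    show "snd ` F.stab w \<in> PP"
    proof (rule PP)
      have memS: "(h, l) \<in> F.stab w \<longleftrightarrow> h \<in> H \<and> l \<in> carrier L \<and> c (h, l) w = w" for h l
      proof -
        have "snd_act G c l (fst_act L c h w) = c (h, l) w" if hl: "h \<in> H" "l \<in> carrier L"
        proof -
          have "c ((\<one>\<^bsub>G\<^esub>, l) \<otimes>\<^bsub>G \<times>\<times> L\<^esub> (h, \<one>\<^bsub>L\<^esub>)) w = c (\<one>\<^bsub>G\<^esub>, l) (c (h, \<one>\<^bsub>L\<^esub>) w)"
            by (rule conjunct2[OF conjunct2[OF c(1)[unfolded continuous_action_def]], rule_format])
               (use w hl H in \<open>auto simp: F.E_fix_def\<close>)
          then show ?thesis using hl H by (auto simp: snd_act_def fst_act_def)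
        qed
        then show ?thesis by (auto simp: F.stab_def)
      qed
      have mem: "l \<in> snd ` F.stab w \<longleftrightarrow> l \<in> carrier L \<and> (\<exists>h\<in>H. c (h, l) w = w)" for l
        using memS by force
      have W: "w \<in> topspace W" using w by (simp add: F.E_fix_def)
      have mult: "c (g \<otimes>\<^bsub>G\<^esub> g', l \<otimes>\<^bsub>L\<^esub> l') w = c (g, l) (c (g', l') w)"
        if "g \<in> H" "g' \<in> H" "l \<in> carrier L" "l' \<in> carrier L" for g g' l l'
        using conjunct2[OF conjunct2[OF c(1)[unfolded continuous_action_def]], rule_format, of "(g, l)" "(g', l')" w] W that H
        by auto
      have one: "c (\<one>\<^bsub>G\<^esub>, \<one>\<^bsub>L\<^esub>) w = w" using c(1) W by (simp add: continuous_action_def)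
      have inv: "inv\<^bsub>G\<^esub> h \<in> H \<and> c (inv\<^bsub>G\<^esub> h, inv\<^bsub>L\<^esub> l) w = w" if h: "l \<in> carrier L" "h \<in> H" "c (h, l) w = w" for h l
      proof -
        have i: "inv\<^bsub>G\<^esub> h \<in> H" by (rule subgroup.m_inv_closed[OF G(3) h(2)])
        have "c (inv\<^bsub>G\<^esub> h, inv\<^bsub>L\<^esub> l) (c (h, l) w) = c (\<one>\<^bsub>G\<^esub>, \<one>\<^bsub>L\<^esub>) w"
          using mult[OF i h(2) GL.inv_closed[OF h(1)] h(1)] h(1,2) H by (simp add: GG.l_inv GL.l_inv subset_iff)
        then show ?thesis using h(3) one i by simp
      qed
      show sub: "subgroup (snd ` F.stab w) L"
      proof (rule GL.subgroupI)
        show "snd ` F.stab w \<subseteq> carrier L" using mem by blast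
        have "\<one>\<^bsub>L\<^esub> \<in> snd ` F.stab w" using mem one GL.one_closed subgroup.one_closed[OF G(3)] by blast
        then show "snd ` F.stab w \<noteq> {}" by blast
        show "inv\<^bsub>L\<^esub> l \<in> snd ` F.stab w" if l: "l \<in> snd ` F.stab w" for l
          using l mem inv GL.inv_closed by blast
        show "l \<otimes>\<^bsub>L\<^esub> l' \<in> snd ` F.stab w" if l: "l \<in> snd ` F.stab w" "l' \<in> snd ` F.stab w" for l l'
        proof -
          obtain h h' where h: "h \<in> H" "c (h, l) w = w" "h' \<in> H" "c (h', l') w = w" "l \<in> carrier L" "l' \<in> carrier L"
            using l mem by blast
          then have "c (h \<otimes>\<^bsub>G\<^esub> h', l \<otimes>\<^bsub>L\<^esub> l') w = w" using mult by simp
          then show ?thesis using mem subgroup.m_closed[OF G(3) h(1,3)] h(5,6) by blast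
        qed
      qed
      show "snd ` F.stab w \<noteq> {\<one>\<^bsub>L\<^esub>}" by (rule nontrivial)
      show "card (snd ` F.stab w) dvd order G"
      proof -
        \<comment> \<open>The kernel of this homomorphism. Each fibre of the projection of
          \<open>stab w\<close> to \<open>L\<close> has the size of \<open>K0\<close>, and the
          projection to \<open>H\<close> is bijective, so the order of \<open>H\<close> is the
          product of those of the image and of \<open>K0\<close>.\<close>
        define K0 where "K0 = {h \<in> H. c (h, \<one>\<^bsub>L\<^esub>) w = w}"
        have "card {z \<in> F.stab w. snd z = l} = card K0" if l: "l \<in> snd ` F.stab w" for l
        proof -
          obtain h0 where h0: "l \<in> carrier L" "h0 \<in> H" "c (h0, l) w = w" using l mem by blast
          have HG: "h \<in> carrier G" if "h \<in> H" for h using that H by blast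
          have "bij_betw (\<lambda>h. (h0 \<otimes>\<^bsub>G\<^esub> h, l)) K0 {z \<in> F.stab w. snd z = l}"
            unfolding bij_betw_def
          proof (intro conjI equalityI subsetI)
            show "inj_on (\<lambda>h. (h0 \<otimes>\<^bsub>G\<^esub> h, l)) K0"
              using HG h0(2) by (auto simp: inj_on_def K0_def)
          next
            fix z assume "z \<in> (\<lambda>h. (h0 \<otimes>\<^bsub>G\<^esub> h, l)) ` K0"
            then obtain h where h: "h \<in> H" "c (h, \<one>\<^bsub>L\<^esub>) w = w" "z = (h0 \<otimes>\<^bsub>G\<^esub> h, l)" by (auto simp: K0_def)
            have "c (h0 \<otimes>\<^bsub>G\<^esub> h, l) w = w"
              using mult[OF h0(2) h(1) h0(1) GL.one_closed] h(2) h0(1,3) by simp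
            then show "z \<in> {z \<in> F.stab w. snd z = l}"
              using h(3) h0(1) subgroup.m_closed[OF G(3) h0(2) h(1)] by (simp add: memS)
          next
            fix z assume "z \<in> {z \<in> F.stab w. snd z = l}"
            then obtain h where h: "z = (h, l)" "h \<in> H" "c (h, l) w = w" using memS by (cases z) auto
            note i = inv[OF h0]
            have "c (inv\<^bsub>G\<^esub> h0 \<otimes>\<^bsub>G\<^esub> h, \<one>\<^bsub>L\<^esub>) w = w"
              using mult[OF conjunct1[OF i] h(2) GL.inv_closed[OF h0(1)] h0(1)] h(3) i h0(1) by (simp add: GL.l_inv)
            then have "inv\<^bsub>G\<^esub> h0 \<otimes>\<^bsub>G\<^esub> h \<in> K0"
              using subgroup.m_closed[OF G(3) conjunct1[OF i] h(2)] by (simp add: K0_def)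
            moreover have "h0 \<otimes>\<^bsub>G\<^esub> (inv\<^bsub>G\<^esub> h0 \<otimes>\<^bsub>G\<^esub> h) = h"
              using HG[OF h0(2)] HG[OF h(2)] by (simp add: GG.m_assoc[symmetric])
            ultimately show "z \<in> (\<lambda>h. (h0 \<otimes>\<^bsub>G\<^esub> h, l)) ` K0" unfolding h(1) by force
          qed
          from bij_betw_same_card[OF this] show ?thesis by simp
        qed
        moreover have bij: "bij_betw fst (F.stab w) H"
          unfolding bij_betw_def
        proof
          show "inj_on fst (F.stab w)" using F.stab_unique[OF W] by (force simp: inj_on_def)
          show "fst ` F.stab w = H"
          proof (intro equalityI subsetI)
            fix h assume h: "h \<in> H"
            then obtain l where "l \<in> carrier L" "snd_act G c l (fst_act L c h w) = w" using w unfolding F.E_fix_def by blast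
            then have "(h, l) \<in> F.stab w" using h by (simp add: F.stab_def)
            then show "h \<in> fst ` F.stab w" by (rule rev_image_eqI) simp
          qed (auto simp: F.stab_def)
        qed
        moreover have "card (F.stab w) = (\<Sum>l\<in>snd ` F.stab w. card {z \<in> F.stab w. snd z = l})"
        proof -
          have "finite (F.stab w)" using bij H G(2) by (metis bij_betw_finite finite_subset)
          then show ?thesis using sum.image_gen[of "F.stab w" "\<lambda>_. 1::nat" snd] by simp
        qed
        ultimately have "card H = card (snd ` F.stab w) * card K0" by (simp add: bij_betw_same_card)
        moreover have "card H dvd order G" using GG.lagrange[OF G(3)] by (metis dvd_triv_right)
        ultimately show ?thesis by (metis dvd_mult_left)
      qed
    qed
  qed
  have ptH: "smash_act (\<lambda>_. id) ?yH g (pt (smash B Y)) = pt (smash B Y)" if "g \<in> H" for g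
    using XG that H by (auto simp: pointed_action_def)
  have act_eq: "orbit_smash_act ?yH (fst_act L aE) =
      (\<lambda>g Z. smash_act (smash_act (\<lambda>_. id) ?yH) (base_act (fst_act L aE)) g ` Z)"
    by (simp add: orbit_smash_act_def fun_eq_iff)
  have E_ne: "topspace E \<noteq> {}"
  proof -
    have "continuous_map E0 (fixed_space (carrier G) (fst_act L aE) E) \<phi>"
      using \<phi> by (simp add: equivariant_homotopy_equivalence_def equivariant_map_def)
    from continuous_map_image_subset_topspace[OF this] show ?thesis
      using E0(2) unfolding topspace_fixed_space by blast
  qed
  let ?X' = "smash B (fixed_pspace H ?yH Y)"
  \<comment> \<open>Cancellation presupposes a pointed map into the fixed points. The image is fixed
    because the coordinate in \<open>Y\<close> is fixed by \<open>H\<close>, the coordinate in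
    \<open>E\<close> is fixed by all of \<open>G\<close>, and both actions commute with
    \<open>L\<close>.\<close>
  have \<phi>_map: "pointed_map (orbit_smash L ?X' (smash_act bL ?yL) E0 a0)
      (fixed_orbit_smash L (smash B Y) (smash_act bL ?yL) E (snd_act G aE) H (smash_act (\<lambda>_. id) ?yH) (fst_act L aE))
      (orbit_smash_map \<phi>)" (is "pointed_map ?S ?Q _")
    unfolding pointed_map_def
  proof
    let ?p = "orbit_smash_pt L (smash_act bL ?yL) (pt ?X') a0"
      and ?q = "orbit_smash_pt L (smash_act bL ?yL) (pt (smash B Y)) (snd_act G aE)"
    have \<phi>m: "continuous_map E0 E \<phi>"
      and \<phi>_fix: "\<And>g w. g \<in> carrier G \<Longrightarrow> w \<in> topspace E0 \<Longrightarrow> fst_act L aE g (\<phi> w) = \<phi> w"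
      and \<phi>_eqv: "\<And>l w. l \<in> carrier L \<Longrightarrow> w \<in> topspace E0 \<Longrightarrow> \<phi> (a0 l w) = snd_act G aE l (\<phi> w)"
    proof -
      have m: "equivariant_map L E0 a0 (fixed_space (carrier G) (fst_act L aE) E) (snd_act G aE) \<phi>"
        using \<phi> by (simp add: equivariant_homotopy_equivalence_def)
      then show "continuous_map E0 E \<phi>" unfolding equivariant_map_def fixed_space_def continuous_map_in_subtopology by blast
      show "fst_act L aE g (\<phi> w) = \<phi> w" if "g \<in> carrier G" "w \<in> topspace E0" for g w
        using m that unfolding equivariant_map_def fixed_space_def continuous_map_in_subtopology by blast
      show "\<phi> (a0 l w) = snd_act G aE l (\<phi> w)" if "l \<in> carrier L" "w \<in> topspace E0" for l w
        using m that unfolding equivariant_map_def by blast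
    qed
    have \<phi>_in: "\<phi> w \<in> topspace E" if "w \<in> topspace E0" for w
      using continuous_map_image_subset_topspace[OF \<phi>m] that by blast
    have pt_eq: "pt ?X' = pt (smash B Y)" by (simp add: smash_def)
    have eq: "orbit_smash_map \<phi> (?p u) = ?q (fst u, \<phi> (snd u))" if "u \<in> topspace (ptop ?X') \<times> topspace E0" for u
      using orbit_smash_map_pt[OF B.group XL', of "fst u" \<phi> a0 "snd u" "snd_act G aE"] that \<phi>_eqv
      by (auto simp: mem_Times_iff pt_eq)
    have incl: "continuous_map (ptop ?X') (ptop (smash B Y)) (\<lambda>z. z)"
    proof -
      have Y_id: "pointed_map (fixed_pspace H ?yH Y) Y id"
        by (simp add: pointed_map_def fixed_pspace_def fixed_space_def continuous_map_from_subtopology)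
      have B_id: "pointed_map B B id" by (simp add: pointed_map_def)
      from continuous_map_smash[OF B_id Y_id] show ?thesis
        by (rule continuous_map_eq) (auto simp: topspace_smash smash_pt_def)
    qed
    have "continuous_map (prod_topology (ptop ?X') E0) (prod_topology (ptop (smash B Y)) E) (\<lambda>u. (fst u, \<phi> (snd u)))"
      using continuous_map_compose[OF continuous_map_fst incl, of E0] continuous_map_compose[OF continuous_map_snd \<phi>m, of "ptop ?X'"]
      by (simp add: continuous_map_pairwise comp_def)
    from continuous_map_compose[OF this quotient_imp_continuous_map[OF orbit_smash_quotient_map[OF B.group XL Eacts(2) E_ne]]]
    have "continuous_map (prod_topology (ptop ?X') E0) (ptop (orbit_smash L (smash B Y) (smash_act bL ?yL) E (snd_act G aE)))
        (orbit_smash_map \<phi> \<circ> ?p)"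
      by (rule continuous_map_eq) (use eq in auto)
    then have cont: "continuous_map (ptop ?S) (ptop (orbit_smash L (smash B Y) (smash_act bL ?yL) E (snd_act G aE))) (orbit_smash_map \<phi>)"
      by (rule continuous_compose_quotient_map[OF orbit_smash_quotient_map[OF B.group XL' E0]])
    have "smash_act (smash_act (\<lambda>_. id) ?yH) (base_act (fst_act L aE)) g ` orbit_smash_map \<phi> Z = orbit_smash_map \<phi> Z"
      if Z: "Z \<in> topspace (ptop ?S)" and g: "g \<in> H" for Z g
    proof -
      obtain z w where zw: "z \<in> topspace (ptop ?X')" "w \<in> topspace E0" "Z = ?p (z, w)"
        using Z unfolding topspace_orbit_smash[OF B.group XL' E0] by auto
      have gG: "g \<in> carrier G" using g H by blast
      have y: "snd z \<in> topspace (ptop Y)" "?yH g (snd z) = snd z"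
        using subsetD[OF smash_sub_prod[OF B.pt_B] zw(1)] YH g by (auto simp: topspace_fixed_pspace pointed_action_def)
      have y_fix: "?yH g (?yL l (snd z)) = ?yL l (snd z)" if "l \<in> carrier L" for l
        using Yacts(3)[OF that gG y(1)] y(2) by simp
      have pt_fix: "?yH g (?yL l (pt Y)) = ?yL l (pt Y)" if "l \<in> carrier L" for l
        using YL YG that gG by (simp add: pointed_action_def)
      have w_fix: "fst_act L aE g (snd_act G aE l (\<phi> w)) = snd_act G aE l (\<phi> w)" if "l \<in> carrier L" for l
        using Eacts(3)[OF that gG \<phi>_in[OF zw(2)]] \<phi>_fix[OF gG zw(2)] by simp
      have "smash_act (smash_act (\<lambda>_. id) ?yH) (base_act (fst_act L aE)) g u = u" if u: "u \<in> ?q (z, \<phi> w)" for u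
      proof -
        obtain l where l: "l \<in> carrier L"
            "u = smash_act (smash_act bL ?yL) (base_act (snd_act G aE)) l (half_smash_pt (pt (smash B Y)) (z, \<phi> w))"
          using u by (auto simp: orbit_smash_pt_def orbit_of_def)
        show ?thesis
          unfolding l(2) half_smash_pt_def using y_fix[OF l(1)] pt_fix[OF l(1)] w_fix[OF l(1)]
          by (simp add: smash_act_def base_act_def map_prod_def case_prod_beta)
      qed
      then have "smash_act (smash_act (\<lambda>_. id) ?yH) (base_act (fst_act L aE)) g ` ?q (z, \<phi> w) = ?q (z, \<phi> w)"
        by simp
      then show ?thesis using eq[of "(z, w)"] zw by simp
    qed
    then show "continuous_map (ptop ?S) (ptop ?Q) (orbit_smash_map \<phi>)"
      using cont unfolding fixed_pspace_def fixed_space_def by (auto simp: continuous_map_in_subtopology)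
    obtain w where w: "w \<in> topspace E0" using E0(2) by blast
    show "orbit_smash_map \<phi> (pt ?S) = pt ?Q"
    proof -
      have "orbit_smash_map \<phi> (?p (pt ?X', w)) = ?q (pt (smash B Y), \<phi> w)"
        using eq[of "(pt ?X', w)"] w XL' by (auto simp: pointed_action_def pt_eq)
      then show ?thesis using pt_orbit_smash[OF XL', of E0 a0 w] pt_orbit_smash[OF XL, of E "snd_act G aE" "\<phi> w"] by simp
    qed
  qed
  show ?thesis
    unfolding act_eq
  proof (rule pointed_homotopy_equivalence_left_cancel)
    show "pointed_homotopy_equivalence
       (fixed_orbit_smash L (smash B Y) (smash_act bL ?yL) E (snd_act G aE) H (smash_act (\<lambda>_. id) ?yH) (fst_act L aE))
       (fixed_orbit_smash L (smash B Y) (smash_act bL ?yL) W (snd_act G c) H (smash_act (\<lambda>_. id) ?yH) (fst_act L c))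
       (orbit_smash_map f)"
      by (rule fixed_orbit_smash_equivalence[OF B.group XL Eacts(2) E_ne Wacts(2) _ biequivariant_equivalenceI[OF G(1) B.group H f]])
         (rule ptH)
    show "pointed_homotopy_equivalence
       (orbit_smash L (smash B (fixed_pspace H ?yH Y)) (smash_act bL ?yL) E0 a0)
       (fixed_orbit_smash L (smash B Y) (smash_act bL ?yL) W (snd_act G c) H (smash_act (\<lambda>_. id) ?yH) (fst_act L c))
       (id \<circ> orbit_smash_map (f \<circ> \<phi>))"
    proof (rule pointed_homotopy_equivalence_compose[OF orbit_smash_equivalence S.smash_inclusion_equivalence])
      show "continuous_action L (fixed_space H (fst_act L c) W) (snd_act G c)"
        by (rule fixed_space_action[OF Wacts(2)]) (use Wacts(3) H in blast)
    qed (rule B.group XL' E0 f\<phi>)+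
    show "pointed_map (orbit_smash L (smash B (fixed_pspace H ?yH Y)) (smash_act bL ?yL) E0 a0)
       (fixed_orbit_smash L (smash B Y) (smash_act bL ?yL) E (snd_act G aE) H (smash_act (\<lambda>_. id) ?yH) (fst_act L aE))
       (orbit_smash_map \<phi>)"
      by (rule \<phi>_map)
    show "orbit_smash_map f (orbit_smash_map \<phi> Z) = (id \<circ> orbit_smash_map (f \<circ> \<phi>)) Z" for Z
      by (simp add: orbit_smash_map_comp[symmetric])
    show "pt (orbit_smash L (smash B (fixed_pspace H ?yH Y)) (smash_act bL ?yL) E0 a0)
        \<in> topspace (ptop (orbit_smash L (smash B (fixed_pspace H ?yH Y)) (smash_act bL ?yL) E0 a0))"
      by (rule pt_in_orbit_smash[OF B.group XL' E0])
  qed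
qed

section \<open>Spectra\<close>

lemma continuous_map_swap: "continuous_map (prod_topology X Y) (prod_topology Y X) (\<lambda>z. (snd z, fst z))"
  by (simp add: continuous_map_pairwise comp_def continuous_map_fst continuous_map_snd)

lemma continuous_map_interval_left:
  "continuous_map (prod_topology X unit_interval) Z h \<longleftrightarrow>
    continuous_map (prod_topology unit_interval X) Z (\<lambda>(t, x). h (x, t))"
proof
  assume "continuous_map (prod_topology X unit_interval) Z h"
  from continuous_map_compose[OF continuous_map_swap this]
  show "continuous_map (prod_topology unit_interval X) Z (\<lambda>(t, x). h (x, t))"
    by (simp add: comp_def case_prod_beta')
next
  assume "continuous_map (prod_topology unit_interval X) Z (\<lambda>(t, x). h (x, t))"
  from continuous_map_compose[OF continuous_map_swap this]
  show "continuous_map (prod_topology X unit_interval) Z h"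
    by (simp add: comp_def case_prod_beta')
qed

text \<open>For the 0-sphere, which is not a quotient of its cube.\<close>

lemma continuous_map_times_discrete:
  assumes "\<And>z. z \<in> S \<Longrightarrow> continuous_map unit_interval Z (\<lambda>t. h t z)"
  shows "continuous_map (prod_topology unit_interval (discrete_topology S)) Z (\<lambda>(t, z). h t z)"
  unfolding continuous_map_def
proof (intro conjI funcsetI allI impI)
  show "(case w of (t, z) \<Rightarrow> h t z) \<in> topspace Z" if "w \<in> topspace (prod_topology unit_interval (discrete_topology S))" for w
    using that continuous_map_image_subset_topspace[OF assms, of "snd w"] by (auto simp: image_subset_iff)
  fix U assume U: "openin Z U"
  have "{w \<in> topspace (prod_topology unit_interval (discrete_topology S)). (case w of (t, z) \<Rightarrow> h t z) \<in> U} =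
      (\<Union>z\<in>S. {t \<in> topspace unit_interval. h t z \<in> U} \<times> {z})" by auto
  moreover have "openin (prod_topology unit_interval (discrete_topology S))
      ({t \<in> topspace unit_interval. h t z \<in> U} \<times> {z})" if "z \<in> S" for z
    unfolding openin_prod_Times_iff using openin_continuous_map_preimage[OF assms[OF that] U] that by simp
  ultimately show "openin (prod_topology unit_interval (discrete_topology S))
      {w \<in> topspace (prod_topology unit_interval (discrete_topology S)). (case w of (t, z) \<Rightarrow> h t z) \<in> U}"
    by (simp only:) blast
qed

lemma pt_in_sphere: "pt (sphere_pspace q) \<in> topspace (ptop (sphere_pspace q))"
  by (simp add: topspace_sphere)

lemma sphere_bond_sphere_pt:
  assumes "s \<in> topspace (cube q)" "t \<in> {0..1}"
  shows "sphere_bond q (sphere_pt q s, t) = sphere_pt (Suc q) (s(q := t))"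
  using assms by (auto simp: sphere_pt_def cube_boundary_def less_Suc_eq)

lemma continuous_map_cube_extend:
  "continuous_map (prod_topology unit_interval (cube q)) (cube (Suc q)) (\<lambda>(t, s). s(q := t))"
proof -
  have "continuous_map (prod_topology unit_interval (cube q)) euclideanreal (\<lambda>z. if i = q then fst z else snd z i)" for i
  proof (cases "i = q")
    case True
    then show ?thesis using continuous_map_into_fulltopology[OF continuous_map_fst] by simp
  next
    case False
    then show ?thesis using continuous_map_compose[OF continuous_map_snd continuous_map_cube_coord, of unit_interval q i]
      by (simp add: comp_def)
  qed
  then show ?thesis
    unfolding continuous_map_into_cube by (auto simp: case_prod_beta' topspace_cube less_Suc_eq fun_upd_def)
qed

lemma continuous_map_sphere_bond:
  "continuous_map (prod_topology (ptop (sphere_pspace q)) unit_interval) (ptop (sphere_pspace (Suc q))) (sphere_bond q)"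
  unfolding continuous_map_interval_left
proof -
  have ext: "continuous_map (prod_topology unit_interval (cube q)) (ptop (sphere_pspace (Suc q))) (\<lambda>(t, s). sphere_bond q (sphere_pt q s, t))"
    using continuous_map_compose[OF continuous_map_cube_extend continuous_map_sphere_pt]
    by (rule continuous_map_eq) (auto simp: sphere_bond_sphere_pt)
  show "continuous_map (prod_topology unit_interval (ptop (sphere_pspace q))) (ptop (sphere_pspace (Suc q))) (\<lambda>(t, u). sphere_bond q (u, t))"
  proof (cases "q = 0")
    case False
    then show ?thesis using continuous_map_times_interval_quotient[OF sphere_quotient_map ext] by simp
  next
    case True
    show ?thesis
      unfolding True sphere_0_discrete
    proof (rule continuous_map_times_discrete)
      fix u :: "(nat \<Rightarrow> real) option" assume u: "u \<in> {None, Some (\<lambda>_. 0)}"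
      have "continuous_map unit_interval (prod_topology unit_interval (cube 0)) (\<lambda>t. (t, \<lambda>_. 0))"
        by (simp add: continuous_map_pairwise comp_def cube_0)
      from continuous_map_compose[OF this ext[unfolded True]]
      have "continuous_map unit_interval (ptop (sphere_pspace (Suc 0))) (\<lambda>t. sphere_bond 0 (sphere_pt 0 (\<lambda>_. 0), t))"
        by (simp add: comp_def)
      then show "continuous_map unit_interval (ptop (sphere_pspace (Suc 0))) (\<lambda>t. sphere_bond 0 (u, t))"
        using u by (auto simp: sphere_pt_def cube_boundary_def topspace_sphere)
    qed
  qed
qed

lemma continuous_map_smash_bond:
  assumes "continuous_map (prod_topology (ptop A) unit_interval) (ptop A') \<beta>"
    and "\<And>t. t \<in> {0..1} \<Longrightarrow> \<beta> (pt A, t) = pt A'"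
  shows "continuous_map (prod_topology (ptop (smash A X)) unit_interval) (ptop (smash A' X))
    (\<lambda>((x, y), t). smash_pt A' X (\<beta> (x, t), y))"
  unfolding continuous_map_interval_left
  using continuous_map_smash_homotopy[of A A' "\<lambda>t x. \<beta> (x, t)" X X "\<lambda>_ y. y"] assms
  by (simp add: continuous_map_interval_left case_prod_beta' continuous_map_snd)

lemma smash_act_smash_pt:
  assumes "a l x = pt A \<longleftrightarrow> x = pt A" "b l y = pt X \<longleftrightarrow> y = pt X" "a l (pt A) = pt A" "b l (pt X) = pt X"
  shows "smash_act a b l (smash_pt A X (x, y)) = smash_pt A X (a l x, b l y)"
  using assms by (simp add: smash_act_def smash_pt_def)

section \<open>Suspension, desuspension, smash products, orbits and fixed points of spectra\<close>

lemma is_spectrumD: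
  assumes "is_spectrum X"
  shows "pt (level X k) \<in> topspace (ptop (level X k))"
    and "continuous_map (prod_topology (ptop (level X k)) unit_interval) (ptop (level X (Suc k))) (bond X k)"
    and "x \<in> topspace (ptop (level X k)) \<Longrightarrow> bond X k (x, 0) = pt (level X (Suc k))"
    and "x \<in> topspace (ptop (level X k)) \<Longrightarrow> bond X k (x, 1) = pt (level X (Suc k))"
    and "t \<in> {0..1} \<Longrightarrow> bond X k (pt (level X k), t) = pt (level X (Suc k))"
    and "x \<in> topspace (ptop (level X k)) \<Longrightarrow> t \<in> {0..1} \<Longrightarrow> bond X k (x, t) \<in> topspace (ptop (level X (Suc k)))"
proof -
  show c: "continuous_map (prod_topology (ptop (level X k)) unit_interval) (ptop (level X (Suc k))) (bond X k)"
    using assms by (simp add: is_spectrum_def)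
  show "bond X k (x, t) \<in> topspace (ptop (level X (Suc k)))" if "x \<in> topspace (ptop (level X k))" "t \<in> {0..1}"
    using continuous_map_image_subset_topspace[OF c] that by (auto simp: image_subset_iff)
qed (use assms in \<open>auto simp: is_spectrum_def\<close>)

definition spectrum_action :: "('g, 'm) monoid_scheme \<Rightarrow> 'a spectrum \<Rightarrow> ('g \<Rightarrow> 'a \<Rightarrow> 'a) \<Rightarrow> bool" where
  "spectrum_action K X a \<longleftrightarrow> (\<forall>k. pointed_action K (level X k) a \<and>
     (\<forall>g\<in>carrier K. \<forall>x\<in>topspace (ptop (level X k)). \<forall>t\<in>{0..1}. bond X k (a g x, t) = a g (bond X k (x, t))))"

lemma is_spectrum_suspension:
  assumes "pt X \<in> topspace (ptop X)"
  shows "is_spectrum (suspension_spectrum X)"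
  unfolding is_spectrum_def suspension_spectrum_def spectrum.simps
proof (intro allI conjI ballI)
  fix k
  show "pt (smash (sphere_pspace k) X) \<in> topspace (ptop (smash (sphere_pspace k) X))"
    using pt_in_smash[OF pt_in_sphere assms] by simp
  have "sphere_bond k (pt (sphere_pspace k), t) = pt (sphere_pspace (Suc k))" for t by simp
  then show "continuous_map (prod_topology (ptop (smash (sphere_pspace k) X)) unit_interval) (ptop (smash (sphere_pspace (Suc k)) X))
      (\<lambda>((s, x), t). smash_pt (sphere_pspace (Suc k)) X (sphere_bond k (s, t), x))"
    by (rule continuous_map_smash_bond[OF continuous_map_sphere_bond])
  have b: "sphere_bond k (s, 0) = None" "sphere_bond k (s, 1) = None" for s by (cases s; simp)+
  fix z t
  show "(case (z, 0 :: real) of (x, xa) \<Rightarrow> (case x of (s, x) \<Rightarrow> \<lambda>t. smash_pt (sphere_pspace (Suc k)) X (sphere_bond k (s, t), x)) xa)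
      = pt (smash (sphere_pspace (Suc k)) X)"
    by (simp add: b smash_pt_def case_prod_beta')
  show "(case (z, 1 :: real) of (x, xa) \<Rightarrow> (case x of (s, x) \<Rightarrow> \<lambda>t. smash_pt (sphere_pspace (Suc k)) X (sphere_bond k (s, t), x)) xa)
      = pt (smash (sphere_pspace (Suc k)) X)"
    by (simp add: b smash_pt_def case_prod_beta')
  show "(case (pt (smash (sphere_pspace k) X), t) of (x, xa) \<Rightarrow> (case x of (s, x) \<Rightarrow> \<lambda>t. smash_pt (sphere_pspace (Suc k)) X (sphere_bond k (s, t), x)) xa)
      = pt (smash (sphere_pspace (Suc k)) X)"
    by (simp add: smash_pt_def)
qed

lemma spectrum_action_suspension:
  assumes "group K" "pointed_action K X b"
  shows "spectrum_action K (suspension_spectrum X) (smash_act (\<lambda>_. id) b)"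
  unfolding spectrum_action_def suspension_spectrum_def spectrum.simps
proof (intro allI conjI ballI)
  fix k
  have "pointed_action K (sphere_pspace k) (\<lambda>_. id)"
    by (simp add: pointed_action_def continuous_action_def topspace_sphere)
  then show "pointed_action K (smash (sphere_pspace k) X) (smash_act (\<lambda>_. id) b)"
    by (rule pointed_action_smash[OF assms(1) _ assms(2)])
  fix g z and t :: real
  assume g: "g \<in> carrier K" and z: "z \<in> topspace (ptop (smash (sphere_pspace k) X))"
  obtain s x where sx: "z = (s, x)" by (cases z)
  have X: "pt X \<in> topspace (ptop X)" "b g (pt X) = pt X" using assms(2) g by (auto simp: pointed_action_def)
  have "x \<in> topspace (ptop X)" using smash_sub_prod[OF pt_in_sphere X(1)] z sx by auto
  then have "b g x = pt X \<longleftrightarrow> x = pt X" by (rule pointed_action_eq_pt[OF assms g])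
  then show "(\<lambda>((s, x), t). smash_pt (sphere_pspace (Suc k)) X (sphere_bond k (s, t), x)) (smash_act (\<lambda>_. id) b g z, t) =
      smash_act (\<lambda>_. id) b g ((\<lambda>((s, x), t). smash_pt (sphere_pspace (Suc k)) X (sphere_bond k (s, t), x)) (z, t))"
    using X unfolding sx by (simp add: smash_act_smash_pt) (simp add: smash_act_def)
qed

lemma is_spectrum_desuspend:
  assumes "is_spectrum X"
  shows "is_spectrum (desuspend m X)"
  unfolding is_spectrum_def
proof (intro allI)
  fix k
  have lev: "pt (level (desuspend m X) k) \<in> topspace (ptop (level (desuspend m X) k))" for k
    using is_spectrumD(1)[OF assms] by (simp add: desuspend_def)
  \<comment> \<open>If m = Suc k, this is the step from the last padding point to level 0 of
    \<open>X\<close>, whose base point the padding shares.\<close>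
  have pt: "pt (level (desuspend m X) (Suc k)) = pt (level X 0)" if "\<not> m \<le> k"
    using that by (cases "m = Suc k") (auto simp: desuspend_def)
  show "pt (level (desuspend m X) k) \<in> topspace (ptop (level (desuspend m X) k)) \<and>
     continuous_map (prod_topology (ptop (level (desuspend m X) k)) unit_interval)
       (ptop (level (desuspend m X) (Suc k))) (bond (desuspend m X) k) \<and>
     (\<forall>x\<in>topspace (ptop (level (desuspend m X) k)).
        bond (desuspend m X) k (x, 0) = pt (level (desuspend m X) (Suc k)) \<and>
        bond (desuspend m X) k (x, 1) = pt (level (desuspend m X) (Suc k))) \<and>
     (\<forall>t\<in>{0..1}. bond (desuspend m X) k (pt (level (desuspend m X) k), t) = pt (level (desuspend m X) (Suc k)))"
  proof (cases "m \<le> k")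
    case True
    then have "level (desuspend m X) k = level X (k - m)" "level (desuspend m X) (Suc k) = level X (Suc (k - m))"
        "bond (desuspend m X) k = bond X (k - m)"
      by (simp_all add: desuspend_def Suc_diff_le)
    then show ?thesis using assms by (simp add: is_spectrum_def)
  next
    case False
    then have "bond (desuspend m X) k = (\<lambda>_. pt (level (desuspend m X) (Suc k)))"
      using pt[OF False] by (simp add: desuspend_def)
    then show ?thesis using lev by simp
  qed
qed

lemma spectrum_action_desuspend:
  assumes "group K" "spectrum_action K X a"
  shows "spectrum_action K (desuspend m X) a"
  unfolding spectrum_action_def
proof
  fix k
  have pt: "a g (pt (level X 0)) = pt (level X 0)" if "g \<in> carrier K" for g
    using assms(2) that by (auto simp: spectrum_action_def pointed_action_def)
  show "pointed_action K (level (desuspend m X) k) a \<and>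
     (\<forall>g\<in>carrier K. \<forall>x\<in>topspace (ptop (level (desuspend m X) k)). \<forall>t\<in>{0..1}.
        bond (desuspend m X) k (a g x, t) = a g (bond (desuspend m X) k (x, t)))"
  proof (cases "m \<le> k")
    case True
    then show ?thesis using assms(2) by (simp add: desuspend_def spectrum_action_def Suc_diff_le)
  next
    case False
    interpret group K by fact
    have "pt (level X 0) \<in> topspace (ptop (level X 0))"
      using assms(2) by (auto simp: spectrum_action_def pointed_action_def)
    then show ?thesis using False pt m_closed one_closed
      by (auto simp: desuspend_def pointed_action_def continuous_action_def)
  qed
qed

lemma is_spectrum_smash:
  assumes X: "is_spectrum X" and Y: "pt Y \<in> topspace (ptop Y)"
  shows "is_spectrum (spectrum_smash X Y)"
  unfolding is_spectrum_def spectrum_smash_def spectrum.simps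
proof (intro allI conjI ballI)
  fix k
  show "pt (smash (level X k) Y) \<in> topspace (ptop (smash (level X k) Y))"
    using pt_in_smash[OF is_spectrumD(1)[OF X] Y] by simp
  show "continuous_map (prod_topology (ptop (smash (level X k) Y)) unit_interval) (ptop (smash (level X (Suc k)) Y))
      (\<lambda>((x, y), t). smash_pt (level X (Suc k)) Y (bond X k (x, t), y))"
    by (rule continuous_map_smash_bond[OF is_spectrumD(2,5)[OF X]])
  fix z t
  show "(case (pt (smash (level X k) Y), t) of (x, xa) \<Rightarrow> (case x of (x, y) \<Rightarrow> \<lambda>t. smash_pt (level X (Suc k)) Y (bond X k (x, t), y)) xa)
      = pt (smash (level X (Suc k)) Y)"
    by (simp add: smash_pt_def)
  assume z: "z \<in> topspace (ptop (smash (level X k) Y))"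
  then have "fst z \<in> topspace (ptop (level X k))"
    using subsetD[OF smash_sub_prod[OF is_spectrumD(1)[OF X] Y] z] by (simp add: mem_Times_iff)
  note b = is_spectrumD(3,4)[OF X this]
  show "(case (z, 0) of (x, xa) \<Rightarrow> (case x of (x, y) \<Rightarrow> \<lambda>t. smash_pt (level X (Suc k)) Y (bond X k (x, t), y)) xa)
      = pt (smash (level X (Suc k)) Y)"
    using b by (simp add: smash_pt_def case_prod_beta')
  show "(case (z, 1) of (x, xa) \<Rightarrow> (case x of (x, y) \<Rightarrow> \<lambda>t. smash_pt (level X (Suc k)) Y (bond X k (x, t), y)) xa)
      = pt (smash (level X (Suc k)) Y)"
    using b by (simp add: smash_pt_def case_prod_beta')
qed

lemma spectrum_action_smash:
  assumes K: "group K" and X: "is_spectrum X" "spectrum_action K X a" and Y: "pointed_action K Y b"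
  shows "spectrum_action K (spectrum_smash X Y) (smash_act a b)"
  unfolding spectrum_action_def spectrum_smash_def spectrum.simps
proof (intro allI conjI ballI)
  fix k
  have a: "pointed_action K (level X k) a" for k using X(2) by (simp add: spectrum_action_def)
  then show "pointed_action K (smash (level X k) Y) (smash_act a b)" by (rule pointed_action_smash[OF K _ Y])
  fix g z and t :: real
  assume g: "g \<in> carrier K" and z: "z \<in> topspace (ptop (smash (level X k) Y))" and t: "t \<in> {0..1}"
  obtain x y where xy: "z = (x, y)" by (cases z)
  have pt: "pt Y \<in> topspace (ptop Y)" "b g (pt Y) = pt Y" "a g (pt (level X (Suc k))) = pt (level X (Suc k))"
    using Y a[of "Suc k"] g by (auto simp: pointed_action_def)
  have x: "x \<in> topspace (ptop (level X k))" and y: "y \<in> topspace (ptop Y)"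
    using subsetD[OF smash_sub_prod[OF is_spectrumD(1)[OF X(1)] pt(1)] z] xy by simp_all
  have bond: "bond X k (a g x, t) = a g (bond X k (x, t))" using X(2) g x t by (simp add: spectrum_action_def)
  have "b g y = pt Y \<longleftrightarrow> y = pt Y" by (rule pointed_action_eq_pt[OF K Y g y])
  moreover have "a g (bond X k (x, t)) = pt (level X (Suc k)) \<longleftrightarrow> bond X k (x, t) = pt (level X (Suc k))"
    by (rule pointed_action_eq_pt[OF K a g is_spectrumD(6)[OF X(1) x t]])
  ultimately show "(\<lambda>((x, y), t). smash_pt (level X (Suc k)) Y (bond X k (x, t), y)) (smash_act a b g z, t) =
      smash_act a b g ((\<lambda>((x, y), t). smash_pt (level X (Suc k)) Y (bond X k (x, t), y)) (z, t))"
    using pt unfolding xy by (simp add: smash_act_smash_pt) (simp add: smash_act_def bond)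
qed

lemma bond_orbit:
  assumes "spectrum_action K X a" "x \<in> topspace (ptop (level X k))" "t \<in> {0..1}"
  shows "bond (spectrum_orbits K a X) k (orbit_of K a x, t) = orbit_of K a (bond X k (x, t))"
  using assms by (auto simp: spectrum_orbits_def spectrum_action_def orbit_of_def image_image)

lemma is_spectrum_orbits:
  assumes X: "is_spectrum X" and a: "spectrum_action K X a"
  shows "is_spectrum (spectrum_orbits K a X)"
  unfolding is_spectrum_def
proof (intro allI conjI ballI)
  fix k
  let ?O = "spectrum_orbits K a X"
  have lev: "level ?O k = orbit_pspace K a (level X k)" for k by (simp add: spectrum_orbits_def)
  have top: "topspace (ptop (level ?O k)) = orbit_of K a ` topspace (ptop (level X k))" for k
    unfolding lev orbit_pspace_def pspace.simps quotient_topology_def by (rule topspace_final_topology) simp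
  have pt: "pt (level ?O k) = orbit_of K a (pt (level X k))" for k by (simp add: lev orbit_pspace_def)
  have q: "quotient_map (ptop (level X k)) (ptop (level ?O k)) (orbit_of K a)" for k
    unfolding lev orbit_pspace_def pspace.simps by (rule quotient_map_quotient_topology)
  show "pt (level ?O k) \<in> topspace (ptop (level ?O k))"
    unfolding top pt using is_spectrumD(1)[OF X] by blast
  show "continuous_map (prod_topology (ptop (level ?O k)) unit_interval) (ptop (level ?O (Suc k))) (bond ?O k)"
    unfolding continuous_map_interval_left
  proof (rule continuous_map_times_interval_quotient[OF q])
    have "continuous_map (prod_topology unit_interval (ptop (level X k))) (ptop (level ?O (Suc k)))
        (orbit_of K a \<circ> (\<lambda>(t, x). bond X k (x, t)))"
      using is_spectrumD(2)[OF X, of k] quotient_imp_continuous_map[OF q]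
      unfolding continuous_map_interval_left by (rule continuous_map_compose)
    then show "continuous_map (prod_topology unit_interval (ptop (level X k))) (ptop (level ?O (Suc k)))
        (\<lambda>(t, x). bond ?O k (orbit_of K a x, t))"
      by (rule continuous_map_eq) (auto simp: bond_orbit[OF a])
  qed
  show "bond ?O k (Z, 0) = pt (level ?O (Suc k))" "bond ?O k (Z, 1) = pt (level ?O (Suc k))"
    if "Z \<in> topspace (ptop (level ?O k))" for Z
    using that is_spectrumD(3,4)[OF X] unfolding top pt by (auto simp: bond_orbit[OF a])
  show "bond ?O k (pt (level ?O k), t) = pt (level ?O (Suc k))" if "t \<in> {0..1}" for t
    unfolding pt using is_spectrumD(1,5)[OF X] that by (simp add: bond_orbit[OF a])
qed

lemma is_spectrum_fixed:
  assumes X: "is_spectrum X"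
    and pt: "\<And>k h. h \<in> H \<Longrightarrow> a h (pt (level X k)) = pt (level X k)"
    and bond: "\<And>k h x t. h \<in> H \<Longrightarrow> x \<in> topspace (ptop (level X k)) \<Longrightarrow> t \<in> {0..1} \<Longrightarrow> a h x = x \<Longrightarrow>
      a h (bond X k (x, t)) = bond X k (x, t)"
  shows "is_spectrum (fixed_spectrum H a X)"
  unfolding is_spectrum_def fixed_spectrum_def spectrum.simps
proof (intro allI conjI ballI)
  fix k
  show "pt (fixed_pspace H a (level X k)) \<in> topspace (ptop (fixed_pspace H a (level X k)))"
    using is_spectrumD(1)[OF X] pt by (simp add: topspace_fixed_pspace)
  have "prod_topology (ptop (fixed_pspace H a (level X k))) unit_interval =
      subtopology (prod_topology (ptop (level X k)) unit_interval) ({x. \<forall>h\<in>H. a h x = x} \<times> {0..1})"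
    by (simp add: fixed_pspace_def fixed_space_def prod_topology_subtopology(1))
  then have "continuous_map (prod_topology (ptop (fixed_pspace H a (level X k))) unit_interval) (ptop (level X (Suc k))) (bond X k)"
    using continuous_map_from_subtopology[OF is_spectrumD(2)[OF X]] by simp
  moreover have "a h (bond X k z) = bond X k z"
    if "z \<in> topspace (prod_topology (ptop (fixed_pspace H a (level X k))) unit_interval)" "h \<in> H" for z h
    using that bond[of h "fst z" k "snd z"] by (auto simp: topspace_fixed_pspace)
  ultimately show "continuous_map (prod_topology (ptop (fixed_pspace H a (level X k))) unit_interval)
      (ptop (fixed_pspace H a (level X (Suc k)))) (bond X k)"
    unfolding fixed_pspace_def[of _ _ "level X (Suc k)"] fixed_space_def pspace.simps
    by (intro continuous_map_into_subtopology) auto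
qed (use is_spectrumD(3-5)[OF X] in \<open>auto simp: topspace_fixed_pspace\<close>)

section \<open>Stable homotopy groups and levelwise equivalences\<close>

lemma pointed_homotopic_refl:
  "pointed_map X Y f \<Longrightarrow> pt X \<in> topspace (ptop X) \<Longrightarrow> pointed_homotopic X Y f f"
  by (rule pointed_homotopic_equal) auto

text \<open>\<open>stab\<close> is defined through representatives in the open cube. The same
  formula holds on the closed cube, because \<open>f\<close> and the structure map respect base
  points; continuity can then be checked on the cube.\<close>

lemma stab_sphere_pt:
  assumes X: "is_spectrum X" and f: "f None = pt (level X k)"
      "\<And>u. u \<in> topspace (ptop (sphere_pspace q)) \<Longrightarrow> f u \<in> topspace (ptop (level X k))"
    and s: "s \<in> topspace (cube (Suc q))"
  shows "stab X k q f (sphere_pt (Suc q) s) = bond X k (f (sphere_pt q (s(q := 0))), s q)"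
proof -
  have c: "s(q := 0) \<in> topspace (cube q)" "s q \<in> {0..1}" using s by (auto simp: topspace_cube less_Suc_eq)
  have "sphere_pt q (s(q := 0)) \<in> topspace (ptop (sphere_pspace q))"
    using continuous_map_image_subset_topspace[OF continuous_map_sphere_pt] c(1) by blast
  note top = f(2)[OF this]
  show ?thesis
  proof (cases "s \<in> cube_boundary (Suc q)")
    case True
    then obtain i where i: "i < Suc q" "s i = 0 \<or> s i = 1" by (auto simp: cube_boundary_def)
    then have "i < q \<Longrightarrow> s(q := 0) \<in> cube_boundary q" unfolding cube_boundary_def by auto
    then consider "s q = 0" | "s q = 1" | "s(q := 0) \<in> cube_boundary q" using i less_SucE by blast
    then have "bond X k (f (sphere_pt q (s(q := 0))), s q) = pt (level X (Suc k))"
    proof cases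
      case 3
      then show ?thesis using is_spectrumD(5)[OF X c(2)] f(1) by (simp add: sphere_pt_def)
    qed (use is_spectrumD(3,4)[OF X top] in simp_all)
    then show ?thesis using True by (simp add: sphere_pt_def stab_def)
  next
    case False
    then have "s(q := 0) \<notin> cube_boundary q" by (auto simp: cube_boundary_def split: if_splits)
    then show ?thesis using False by (simp add: sphere_pt_def stab_def)
  qed
qed

lemma stab_homotopic:
  assumes X: "is_spectrum X" and h: "pointed_homotopic (sphere_pspace q) (level X k) f g"
  shows "pointed_homotopic (sphere_pspace (Suc q)) (level X (Suc k)) (stab X k q f) (stab X k q g)"
proof -
  obtain h where h: "continuous_map (prod_topology unit_interval (ptop (sphere_pspace q))) (ptop (level X k)) (\<lambda>(t, u). h t u)"
    and h01: "\<And>u. h 0 u = f u" "\<And>u. h 1 u = g u" and hpt: "\<And>t. t \<in> {0..1} \<Longrightarrow> h t None = pt (level X k)"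
    using h by (rule pointed_homotopicE) (use that in auto)
  have h_top: "h t u \<in> topspace (ptop (level X k))" if "t \<in> {0..1}" "u \<in> topspace (ptop (sphere_pspace q))" for t u
    using continuous_map_image_subset_topspace[OF h] that by (auto simp: image_subset_iff)
  show ?thesis
  proof (rule pointed_homotopicI)
    have restrict: "continuous_map (cube (Suc q)) (cube q) (\<lambda>s. s(q := 0))"
      unfolding continuous_map_into_cube
      by (auto simp: topspace_cube less_Suc_eq fun_upd_def continuous_map_cube_coord)
    let ?D = "prod_topology unit_interval (cube (Suc q))"
    have "continuous_map ?D (ptop (sphere_pspace q)) (\<lambda>z. sphere_pt q ((snd z)(q := 0)))"
      using continuous_map_compose[OF continuous_map_compose[OF continuous_map_snd restrict] continuous_map_sphere_pt]
      by (simp add: comp_def)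
    then have "continuous_map ?D (prod_topology unit_interval (ptop (sphere_pspace q))) (\<lambda>z. (fst z, sphere_pt q ((snd z)(q := 0))))"
      by (simp add: continuous_map_pairwise comp_def continuous_map_fst)
    from continuous_map_compose[OF this h]
    have "continuous_map ?D (ptop (level X k)) (\<lambda>z. h (fst z) (sphere_pt q ((snd z)(q := 0))))"
      by (simp add: comp_def)
    moreover have "continuous_map ?D unit_interval (\<lambda>z. snd z q)"
    proof -
      have "continuous_map (cube (Suc q)) unit_interval (\<lambda>s. s q)"
        by (auto simp: continuous_map_in_subtopology continuous_map_cube_coord topspace_cube)
      from continuous_map_compose[OF continuous_map_snd this] show ?thesis by (simp add: comp_def)
    qed
    ultimately have "continuous_map ?D (prod_topology (ptop (level X k)) unit_interval)
        (\<lambda>z. (h (fst z) (sphere_pt q ((snd z)(q := 0))), snd z q))"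
      by (simp add: continuous_map_pairwise comp_def)
    from continuous_map_compose[OF this is_spectrumD(2)[OF X]]
    have "continuous_map ?D (ptop (level X (Suc k))) (\<lambda>(t, s). stab X k q (h t) (sphere_pt (Suc q) s))"
    proof (rule continuous_map_eq)
      fix z assume "z \<in> topspace ?D"
      then have "fst z \<in> {0..1}" "snd z \<in> topspace (cube (Suc q))" by auto
      then show "(bond X k \<circ> (\<lambda>z. (h (fst z) (sphere_pt q ((snd z)(q := 0))), snd z q))) z =
          (case z of (t, s) \<Rightarrow> stab X k q (h t) (sphere_pt (Suc q) s))"
        using stab_sphere_pt[of X "h (fst z)" k q "snd z", OF X hpt h_top] by (simp add: case_prod_beta')
    qed
    then show "continuous_map (prod_topology unit_interval (ptop (sphere_pspace (Suc q)))) (ptop (level X (Suc k)))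
        (\<lambda>(t, u). stab X k q (h t) u)"
      by (rule continuous_map_times_interval_quotient[OF sphere_quotient_map, rotated]) simp
  qed (simp_all add: stab_def h01 topspace_sphere split: option.split)
qed

lemma stab_iter_homotopic:
  assumes "is_spectrum X" and "pointed_homotopic (sphere_pspace q) (level X k) f g"
  shows "pointed_homotopic (sphere_pspace (q + i)) (level X (k + i)) (stab_iter X k q i f) (stab_iter X k q i g)"
  using assms by (induction i) (simp_all add: stab_homotopic)

lemma stab_iter_pointed_map:
  assumes "is_spectrum X" and "pointed_map (sphere_pspace q) (level X k) f"
  shows "pointed_map (sphere_pspace (q + i)) (level X (k + i)) (stab_iter X k q i f)"
  using stab_iter_homotopic[OF assms(1) pointed_homotopic_refl[OF assms(2) pt_in_sphere]] pointed_homotopic_imp_maps by blast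

lemma stab_iter_add: "stab_iter X (k + i) (q + i) j (stab_iter X k q i f) = stab_iter X k q (i + j) f"
  by (induction j) (simp_all add: add.assoc)

lemma stab_iter_natural:
  assumes X: "is_spectrum X" and f: "spectrum_map X Y f" and g: "pointed_map (sphere_pspace q) (level X k) g"
    and u: "u \<in> topspace (ptop (sphere_pspace (q + i)))"
  shows "stab_iter Y k q i (f k \<circ> g) u = f (k + i) (stab_iter X k q i g u)"
  using u
proof (induction i arbitrary: u)
  case (Suc i)
  let ?g = "stab_iter X k q i g"
  have map: "pointed_map (sphere_pspace (q + i)) (level X (k + i)) ?g" by (rule stab_iter_pointed_map[OF X g])
  show ?case
  proof (cases u)
    case None
    then show ?thesis using f by (simp add: stab_def spectrum_map_def pointed_map_def)
  next
    case (Some s)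
    then have s: "s \<in> topspace (cube (Suc (q + i))) - cube_boundary (Suc (q + i))"
      using Suc.prems by (auto simp: topspace_sphere)
    have v: "Some (s(q + i := 0)) \<in> topspace (ptop (sphere_pspace (q + i)))"
    proof -
      have "s(q + i := 0) \<in> topspace (cube (q + i))" using s by (auto simp: topspace_cube less_Suc_eq)
      moreover have "s(q + i := 0) \<notin> cube_boundary (q + i)"
        using s unfolding cube_boundary_def by (auto simp: less_Suc_eq)
      ultimately show ?thesis by (simp add: topspace_sphere)
    qed
    have t: "s (q + i) \<in> {0..1}" using s by (auto simp: topspace_cube)
    have "?g (Some (s(q + i := 0))) \<in> topspace (ptop (level X (k + i)))"
      using map v continuous_map_image_subset_topspace unfolding pointed_map_def by blast
    then show ?thesis
      using f t Suc.IH[OF v] unfolding Some spectrum_map_def by (simp add: stab_def)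
  qed
qed simp

lemma nat_shift: "0 \<le> int k + j \<Longrightarrow> nat (int (k + i) + j) = nat (int k + j) + i"
  by simp

text \<open>In \<open>stable_rel\<close> the dimension of the sphere is computed from the level that
  is reached. As k + j is nonnegative, it is the initial dimension plus the number of
  stabilizations, which is the form that \<open>stab_iter\<close> produces.\<close>

lemma stable_rel_iff:
  "((k, f), (l, g)) \<in> stable_rel X j \<longleftrightarrow> (k, f) \<in> stable_maps X j \<and> (l, g) \<in> stable_maps X j \<and>
    (\<exists>i i'. k + i = l + i' \<and> pointed_homotopic (sphere_pspace (nat (int k + j) + i)) (level X (k + i))
      (stab_iter X k (nat (int k + j)) i f) (stab_iter X l (nat (int l + j)) i' g))"
proof (cases "(k, f) \<in> stable_maps X j")
  case True
  then have "0 \<le> int k + j" by (simp add: stable_maps_def)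
  then show ?thesis unfolding stable_rel_def by (simp only: nat_shift mem_Collect_eq case_prod_conv)
qed (simp add: stable_rel_def)

lemma stable_relE:
  assumes "(a, b) \<in> stable_rel X j"
  obtains k f l g i i' where "a = (k, f)" "b = (l, g)" "(k, f) \<in> stable_maps X j" "(l, g) \<in> stable_maps X j" "k + i = l + i'"
    "pointed_homotopic (sphere_pspace (nat (int k + j) + i)) (level X (k + i))
      (stab_iter X k (nat (int k + j)) i f) (stab_iter X l (nat (int l + j)) i' g)"
proof -
  obtain k f l g where ab: "a = (k, f)" "b = (l, g)" by (cases a, cases b)
  from assms[unfolded ab stable_rel_iff] show thesis using that[OF ab] by blast
qed

text \<open>For transitivity the first homotopy is stabilized \<open>n\<close> more times and the
  second \<open>i'\<close> more times; both then involve the middle map at level l + n + i'.\<close>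

lemma equiv_stable_rel:
  assumes X: "is_spectrum X"
  shows "equiv (stable_maps X j) (stable_rel X j)"
proof (rule equivI)
  show "stable_rel X j \<subseteq> stable_maps X j \<times> stable_maps X j" by (auto simp: stable_rel_def)
  show "refl_on (stable_maps X j) (stable_rel X j)"
  proof (rule refl_onI)
    fix a assume a: "a \<in> stable_maps X j"
    obtain k f where kf: "a = (k, f)" by (cases a)
    have "pointed_homotopic (sphere_pspace (nat (int k + j) + 0)) (level X (k + 0))
        (stab_iter X k (nat (int k + j)) 0 f) (stab_iter X k (nat (int k + j)) 0 f)"
      using a kf by (simp add: stable_maps_def pointed_homotopic_refl[OF _ pt_in_sphere])
    then show "(a, a) \<in> stable_rel X j" using a unfolding kf stable_rel_iff by blast
  qed
  show "sym (stable_rel X j)"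
  proof (rule symI)
    fix a b assume "(a, b) \<in> stable_rel X j"
    then obtain k f l g i i' where ab: "a = (k, f)" "b = (l, g)" "(k, f) \<in> stable_maps X j" "(l, g) \<in> stable_maps X j"
      and kl: "k + i = l + i'"
      and h: "pointed_homotopic (sphere_pspace (nat (int k + j) + i)) (level X (k + i))
          (stab_iter X k (nat (int k + j)) i f) (stab_iter X l (nat (int l + j)) i' g)"
      by (rule stable_relE)
    have q: "nat (int k + j) + i = nat (int l + j) + i'" using ab(3,4) kl by (simp add: stable_maps_def) linarith
    have "pointed_homotopic (sphere_pspace (nat (int l + j) + i')) (level X (l + i'))
          (stab_iter X l (nat (int l + j)) i' g) (stab_iter X k (nat (int k + j)) i f)"
      using pointed_homotopic_sym[OF h] unfolding kl q .
    then show "(b, a) \<in> stable_rel X j" using ab(3,4) kl[symmetric] unfolding ab(1,2) stable_rel_iff by blast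
  qed
  show "trans (stable_rel X j)"
  proof (rule transI)
    fix a b c assume ab: "(a, b) \<in> stable_rel X j" and bc: "(b, c) \<in> stable_rel X j"
    obtain k f l g i i' where kf: "a = (k, f)" "b = (l, g)" "(k, f) \<in> stable_maps X j" "(l, g) \<in> stable_maps X j"
      and kl: "k + i = l + i'"
      and 1: "pointed_homotopic (sphere_pspace (nat (int k + j) + i)) (level X (k + i))
          (stab_iter X k (nat (int k + j)) i f) (stab_iter X l (nat (int l + j)) i' g)"
      using ab by (rule stable_relE)
    obtain n m h n' where mh: "c = (m, h)" "(m, h) \<in> stable_maps X j" and lm: "l + n = m + n'"
      and 2: "pointed_homotopic (sphere_pspace (nat (int l + j) + n)) (level X (l + n))
          (stab_iter X l (nat (int l + j)) n g) (stab_iter X m (nat (int m + j)) n' h)"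
      using bc kf(2) by (auto elim!: stable_relE)
    have pos: "0 \<le> int k + j" "0 \<le> int l + j" "0 \<le> int m + j" using kf mh by (auto simp: stable_maps_def)
    have q: "nat (int k + j) + i = nat (int l + j) + i'" "nat (int l + j) + n = nat (int m + j) + n'"
      using kl lm pos by linarith+
    have e1: "stab_iter X (k + i) (nat (int k + j) + i) n (stab_iter X k (nat (int k + j)) i f) = stab_iter X k (nat (int k + j)) (i + n) f"
        "stab_iter X (k + i) (nat (int k + j) + i) n (stab_iter X l (nat (int l + j)) i' g) = stab_iter X l (nat (int l + j)) (i' + n) g"
      by (rule stab_iter_add) (unfold kl q(1), rule stab_iter_add)
    have e2: "stab_iter X (l + n) (nat (int l + j) + n) i' (stab_iter X l (nat (int l + j)) n g) = stab_iter X l (nat (int l + j)) (n + i') g"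
        "stab_iter X (l + n) (nat (int l + j) + n) i' (stab_iter X m (nat (int m + j)) n' h) = stab_iter X m (nat (int m + j)) (n' + i') h"
      by (rule stab_iter_add) (unfold lm q(2), rule stab_iter_add)
    have A: "pointed_homotopic (sphere_pspace (nat (int k + j) + (i + n))) (level X (k + (i + n)))
          (stab_iter X k (nat (int k + j)) (i + n) f) (stab_iter X l (nat (int l + j)) (i' + n) g)"
      using stab_iter_homotopic[OF X 1, of n] unfolding e1 unfolding add.assoc .
    have B: "pointed_homotopic (sphere_pspace (nat (int l + j) + (n + i'))) (level X (l + (n + i')))
          (stab_iter X l (nat (int l + j)) (n + i') g) (stab_iter X m (nat (int m + j)) (n' + i') h)"
      using stab_iter_homotopic[OF X 2, of i'] unfolding e2 unfolding add.assoc .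
    have eq: "nat (int l + j) + (n + i') = nat (int k + j) + (i + n)" "l + (n + i') = k + (i + n)" "i' + n = n + i'"
      using q kl by linarith+
    have "pointed_homotopic (sphere_pspace (nat (int k + j) + (i + n))) (level X (k + (i + n)))
          (stab_iter X k (nat (int k + j)) (i + n) f) (stab_iter X m (nat (int m + j)) (n' + i') h)"
      by (rule pointed_homotopic_trans[OF A[unfolded eq(3)] B[unfolded eq(1,2)]])
    moreover have "k + (i + n) = m + (n' + i')" using kl lm by simp
    ultimately show "(a, c) \<in> stable_rel X j" using kf mh unfolding kf(1) mh(1) stable_rel_iff by blast
  qed
qed

lemma bij_betw_quotients:
  assumes R: "equiv A R" and S: "equiv B S" and f: "\<And>a. a \<in> A \<Longrightarrow> f a \<in> B"
    and iff: "\<And>a a'. a \<in> A \<Longrightarrow> a' \<in> A \<Longrightarrow> (f a, f a') \<in> S \<longleftrightarrow> (a, a') \<in> R"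
    and surj: "\<And>b. b \<in> B \<Longrightarrow> \<exists>a\<in>A. (f a, b) \<in> S"
  shows "bij_betw (\<lambda>c. S `` (f ` c)) (A // R) (B // S)"
proof -
  have cls: "S `` (f ` (R `` {a})) = S `` {f a}" if a: "a \<in> A" for a
  proof (intro equalityI subsetI)
    fix b assume "b \<in> S `` (f ` (R `` {a}))"
    then obtain a' where a': "(a, a') \<in> R" "(f a', b) \<in> S" by blast
    then have "a' \<in> A" using R by (auto simp: equiv_def refl_on_def)
    then have "(f a, f a') \<in> S" using iff a a'(1) by blast
    then show "b \<in> S `` {f a}" using a'(2) S by (auto simp: equiv_def dest: transD)
  next
    fix b assume "b \<in> S `` {f a}"
    moreover have "(a, a) \<in> R" using equiv_class_self[OF R a] by blast
    ultimately show "b \<in> S `` (f ` (R `` {a}))" by blast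
  qed
  show ?thesis
    unfolding bij_betw_def
  proof
    show "inj_on (\<lambda>c. S `` (f ` c)) (A // R)"
    proof (rule inj_onI)
      fix c c' assume "c \<in> A // R" "c' \<in> A // R" and eq: "S `` (f ` c) = S `` (f ` c')"
      then obtain a a' where a: "a \<in> A" "a' \<in> A" "c = R `` {a}" "c' = R `` {a'}" by (auto elim!: quotientE)
      then have "(f a, f a') \<in> S" using eq cls f eq_equiv_class[OF _ S] by metis
      then show "c = c'" using iff a equiv_class_eq[OF R] by metis
    qed
    show "(\<lambda>c. S `` (f ` c)) ` (A // R) = B // S"
    proof (intro equalityI subsetI)
      fix d assume "d \<in> (\<lambda>c. S `` (f ` c)) ` (A // R)"
      then obtain a where "a \<in> A" "d = S `` {f a}" using cls by (auto elim!: quotientE)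
      then show "d \<in> B // S" using f by (auto intro: quotientI)
    next
      fix d assume "d \<in> B // S"
      then obtain b where b: "b \<in> B" "d = S `` {b}" by (auto elim: quotientE)
      obtain a where a: "a \<in> A" "(f a, b) \<in> S" using surj[OF b(1)] by blast
      have "d = S `` (f ` (R `` {a}))" using equiv_class_eq[OF S a(2)] b(2) cls[OF a(1)] by simp
      then show "d \<in> (\<lambda>c. S `` (f ` c)) ` (A // R)" using quotientI[OF a(1)] by (rule rev_image_eqI[rotated])
    qed
  qed
qed

text \<open>The homotopy inverses at different levels need not commute with the structure maps.
  Injectivity is therefore checked at one common level k + i, using that \<open>f\<close> commutes
  with stabilization, and surjectivity at the level of the given map.\<close>

theorem levelwise_spectrum_equivalence:
  assumes X: "is_spectrum X" and Y: "is_spectrum Y" and f: "spectrum_map X Y f"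
    and eq: "\<And>k. pointed_homotopy_equivalence (level X k) (level Y k) (f k)"
  shows "spectrum_equivalence X Y f"
  unfolding spectrum_equivalence_def
proof (intro conjI allI X Y f)
  fix j
  let ?\<phi> = "\<lambda>(k, g). (k, f k \<circ> g)"
  have fm: "pointed_map (level X k) (level Y k) (f k)" for k using f by (simp add: spectrum_map_def)
  have "bij_betw (\<lambda>c. stable_rel Y j `` (?\<phi> ` c)) (stable_maps X j // stable_rel X j) (stable_maps Y j // stable_rel Y j)"
  proof (rule bij_betw_quotients[OF equiv_stable_rel[OF X] equiv_stable_rel[OF Y]])
    show maps: "?\<phi> a \<in> stable_maps Y j" if "a \<in> stable_maps X j" for a
      using that pointed_map_compose[OF _ fm] by (auto simp: stable_maps_def)
    fix a b assume ab: "a \<in> stable_maps X j" "b \<in> stable_maps X j"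
    obtain k g l h where kg: "a = (k, g)" and lh: "b = (l, h)" by (cases a, cases b)
    have pos: "0 \<le> int k + j" "0 \<le> int l + j"
      and gm: "pointed_map (sphere_pspace (nat (int k + j))) (level X k) g"
      and hm: "pointed_map (sphere_pspace (nat (int l + j))) (level X l) h"
      using ab kg lh by (auto simp: stable_maps_def)
    have iff: "pointed_homotopic (sphere_pspace (nat (int k + j) + i)) (level Y (k + i))
          (stab_iter Y k (nat (int k + j)) i (f k \<circ> g)) (stab_iter Y l (nat (int l + j)) i' (f l \<circ> h)) \<longleftrightarrow>
        pointed_homotopic (sphere_pspace (nat (int k + j) + i)) (level X (k + i))
          (stab_iter X k (nat (int k + j)) i g) (stab_iter X l (nat (int l + j)) i' h)"
      (is "pointed_homotopic ?S ?Y ?g' ?h' \<longleftrightarrow> pointed_homotopic ?S ?X ?g ?h") if i: "k + i = l + i'" for i i'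
    proof -
      have q: "nat (int k + j) + i = nat (int l + j) + i'" using i pos by linarith
      have m: "pointed_map ?S ?X ?g" "pointed_map ?S ?X ?h"
        using stab_iter_pointed_map[OF X gm, of i] stab_iter_pointed_map[OF X hm, of i'] unfolding q i by simp_all
      note fi = fm[of "k + i"]
      have "pointed_homotopic ?S ?Y (f (k + i) \<circ> ?g) ?g'"
        by (rule pointed_homotopic_equal[OF pointed_map_compose[OF m(1) fi] _ pt_in_sphere])
           (use stab_iter_natural[OF X f gm, of _ i] q in auto)
      moreover have "pointed_homotopic ?S ?Y (f (k + i) \<circ> ?h) ?h'"
        by (rule pointed_homotopic_equal[OF pointed_map_compose[OF m(2) fi] _ pt_in_sphere])
           (use stab_iter_natural[OF X f hm, of _ i'] q i in auto)
      ultimately have *: "pointed_homotopic ?S ?Y ?g' ?h' \<longleftrightarrow> pointed_homotopic ?S ?Y (f (k + i) \<circ> ?g) (f (k + i) \<circ> ?h)"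
        by (meson pointed_homotopic_sym pointed_homotopic_trans)
      have "pointed_homotopic ?S ?X ?g ?h" if fh: "pointed_homotopic ?S ?Y (f (k + i) \<circ> ?g) (f (k + i) \<circ> ?h)"
      proof -
        obtain r where r: "pointed_map ?Y ?X r" "pointed_homotopic ?X ?X (r \<circ> f (k + i)) id"
          using eq[of "k + i"] by (auto simp: pointed_homotopy_equivalence_def)
        have "pointed_homotopic ?S ?X (r \<circ> f (k + i) \<circ> ?g) (r \<circ> f (k + i) \<circ> ?h)"
          using pointed_homotopic_comp_left[OF fh r(1)] by (simp add: comp_assoc)
        moreover have "pointed_homotopic ?S ?X (r \<circ> f (k + i) \<circ> u) u" if "pointed_map ?S ?X u" for u
          using pointed_homotopic_comp_right[OF r(2) that] by simp
        ultimately show ?thesis using m by (meson pointed_homotopic_sym pointed_homotopic_trans)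
      qed
      then show ?thesis using * pointed_homotopic_comp_left[OF _ fi] by blast
    qed
    show "(?\<phi> a, ?\<phi> b) \<in> stable_rel Y j \<longleftrightarrow> (a, b) \<in> stable_rel X j"
      using iff maps[OF ab(1)] maps[OF ab(2)] ab unfolding kg lh case_prod_conv stable_rel_iff by blast
  next
    fix b assume b: "b \<in> stable_maps Y j"
    obtain k h where kh: "b = (k, h)" by (cases b)
    have hm: "pointed_map (sphere_pspace (nat (int k + j))) (level Y k) h" and pos: "0 \<le> int k + j"
      using b kh by (auto simp: stable_maps_def)
    obtain r where r: "pointed_map (level Y k) (level X k) r" "pointed_homotopic (level Y k) (level Y k) (f k \<circ> r) id"
      using eq[of k] by (auto simp: pointed_homotopy_equivalence_def)
    have rh: "pointed_map (sphere_pspace (nat (int k + j))) (level X k) (r \<circ> h)" by (rule pointed_map_compose[OF hm r(1)])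
    have "pointed_homotopic (sphere_pspace (nat (int k + j))) (level Y k) (f k \<circ> (r \<circ> h)) h"
      using pointed_homotopic_comp_right[OF r(2) hm] by (simp add: comp_assoc)
    then have "pointed_homotopic (sphere_pspace (nat (int k + j) + 0)) (level Y (k + 0))
        (stab_iter Y k (nat (int k + j)) 0 (f k \<circ> (r \<circ> h))) (stab_iter Y k (nat (int k + j)) 0 h)" by simp
    moreover have "(k, f k \<circ> (r \<circ> h)) \<in> stable_maps Y j"
      using pointed_map_compose[OF rh fm] pos by (simp add: stable_maps_def)
    ultimately have "(?\<phi> (k, r \<circ> h), b) \<in> stable_rel Y j" using b unfolding kh case_prod_conv stable_rel_iff by blast
    moreover have "(k, r \<circ> h) \<in> stable_maps X j" using rh pos by (simp add: stable_maps_def)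
    ultimately show "\<exists>a\<in>stable_maps X j. (?\<phi> a, b) \<in> stable_rel Y j" by blast
  qed
  then show "bij_betw (stable_homotopy_map Y j f) (stable_homotopy X j) (stable_homotopy Y j)"
    by (simp add: stable_homotopy_map_def[abs_def] stable_homotopy_def)
qed

section \<open>Levels and structure maps of the Steinberg summands\<close>

lemma steinberg_level:
  fixes a :: "'k::field ^ 'n ^ 'n \<Rightarrow> 'x \<Rightarrow> 'x"
  shows "level (steinberg X a E e) k = orbit_smash GL
    (smash (level (desuspend (CARD('n) - 1) (suspension_spectrum B_diamond)) k) X)
    (smash_act (smash_act (\<lambda>_. id) B_diamond_act) a) E e"
  by (simp add: steinberg_def spectrum_orbits_def spectrum_smash_def orbit_smash_def)

text \<open>From the shift upwards a level is a sphere smashed with the suspended flag complex, and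
  below it a point.\<close>

lemma good_space_steinberg_factor:
  assumes p: "prime CARD('k::{field,finite})"
  obtains r N K where
    "good_space (level (desuspend m (suspension_spectrum (B_diamond :: (('k ^ 'n::finite) set \<Rightarrow> real) susp pspace))) k)
      r N GL (smash_act (\<lambda>_. id) B_diamond_act) p_subgroups K"
proof -
  let ?B = "B_diamond :: (('k ^ 'n) set \<Rightarrow> real) susp pspace"
  show thesis
  proof (cases "m \<le> k")
    case True
    then have eq: "level (desuspend m (suspension_spectrum ?B)) k = smash (sphere_pspace (k - m)) ?B"
      by (simp add: desuspend_def suspension_spectrum_def)
    show thesis
      by (rule that) (unfold eq, rule good_space_smash[OF well_pointed_sphere good_space_B_diamond[OF p]])
  next
    case False
    then have eq: "level (desuspend m (suspension_spectrum ?B)) k =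
        \<lparr>ptop = discrete_topology {(None, Bot)}, pt = (None, Bot)\<rparr>"
      by (simp add: desuspend_def suspension_spectrum_def smash_def B_diamond_def)
    show thesis
      by (rule that) (unfold eq, rule good_space_point[OF group_GL],
        auto simp: smash_act_def B_diamond_act_cone p_subgroups_def dest: subgroup.subset)
  qed
qed

lemma spectrum_action_trivial: "is_spectrum X \<Longrightarrow> spectrum_action K X (\<lambda>_. id)"
  by (simp add: spectrum_action_def pointed_action_def continuous_action_def is_spectrum_def)

context
  fixes X :: "'x pspace" and a :: "'k::{field,finite} ^ 'n::finite ^ 'n \<Rightarrow> 'x \<Rightarrow> 'x"
    and E :: "'e topology" and e :: "'k ^ 'n ^ 'n \<Rightarrow> 'e \<Rightarrow> 'e"
  assumes X: "pointed_action GL X a" and E: "continuous_action GL E e"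
begin

abbreviation steinberg_factor where
  "steinberg_factor \<equiv> desuspend (CARD('n) - 1) (suspension_spectrum (B_diamond :: (('k ^ 'n) set \<Rightarrow> real) susp pspace))"

abbreviation steinberg_smash where "steinberg_smash \<equiv> spectrum_smash (spectrum_smash steinberg_factor X) (adjoin_base E)"

lemma is_spectrum_factor: "is_spectrum steinberg_factor"
  by (intro is_spectrum_desuspend is_spectrum_suspension) (simp add: B_diamond_def topspace_suspension)

lemma base_points: "pt X \<in> topspace (ptop X)" "pt (adjoin_base E) \<in> topspace (ptop (adjoin_base E))"
  using X pointed_action_adjoin_base[OF E] by (simp_all add: pointed_action_def)

lemma is_spectrum_smash_factor: "is_spectrum steinberg_smash"
  by (intro is_spectrum_smash is_spectrum_factor base_points)

lemma spectrum_action_smash_factor: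
  "spectrum_action GL steinberg_smash (smash_act (smash_act (smash_act (\<lambda>_. id) B_diamond_act) a) (base_act e))"
  by (intro spectrum_action_smash spectrum_action_desuspend spectrum_action_suspension group_GL is_spectrum_smash
      is_spectrum_factor base_points X pointed_action_adjoin_base[OF E] B_diamond_action)

lemma is_spectrum_steinberg: "is_spectrum (steinberg X a E e)"
  unfolding steinberg_def by (rule is_spectrum_orbits[OF is_spectrum_smash_factor spectrum_action_smash_factor])

text \<open>The structure maps act through the sphere coordinate, on which \<open>G\<close> acts
  trivially. So they commute with the action of \<open>G\<close> on representatives, hence with its
  action on orbits, and preserve fixed points.\<close>

lemma is_spectrum_fixed_steinberg:
  assumes G: "group G" "H \<subseteq> carrier G" and u: "pointed_action G X u" and v: "continuous_action G E v"
  shows "is_spectrum (fixed_spectrum H (orbit_smash_act u v) (steinberg X a E e))"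
proof (rule is_spectrum_fixed[OF is_spectrum_steinberg])
  let ?b = "smash_act (smash_act (smash_act (\<lambda>_. id) B_diamond_act) a) (base_act e)"
    and ?h = "smash_act (smash_act (\<lambda>_. id) u) (base_act v)"
  have act: "spectrum_action G steinberg_smash ?h"
    by (intro spectrum_action_smash spectrum_action_trivial G(1) is_spectrum_smash is_spectrum_factor base_points u
        pointed_action_adjoin_base[OF v])
  have lev: "level (steinberg X a E e) k = orbit_pspace GL ?b (level steinberg_smash k)"
    and bond: "bond (steinberg X a E e) k (Z, t) = (\<lambda>x. bond steinberg_smash k (x, t)) ` Z" for k Z t
    by (simp_all add: steinberg_def spectrum_orbits_def)
  have pa: "pointed_action GL (level steinberg_smash k) ?b" for k using spectrum_action_smash_factor by (simp add: spectrum_action_def)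
  fix k h assume h: "h \<in> H"
  then have hG: "h \<in> carrier G" using G(2) by blast
  show "orbit_smash_act u v h (pt (level (steinberg X a E e) k)) = pt (level (steinberg X a E e) k)"
  proof -
    have "orbit_of GL ?b (pt (level steinberg_smash k)) = {pt (level steinberg_smash k)}"
    proof -
      have "?b l (pt (level steinberg_smash k)) = pt (level steinberg_smash k)" if "l \<in> carrier GL" for l
        using pa[of k] that unfolding pointed_action_def by blast
      then have "orbit_of GL ?b (pt (level steinberg_smash k)) = (\<lambda>_. pt (level steinberg_smash k)) ` carrier (GL :: ('k ^ 'n ^ 'n) monoid)"
        unfolding orbit_of_def by (rule image_cong[OF refl])
      then show ?thesis by (simp only: image_constant[OF monoid.one_closed[OF group.is_monoid[OF group_GL]]])
    qed
    moreover have "?h h (pt (level steinberg_smash k)) = pt (level steinberg_smash k)"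
      using act hG unfolding spectrum_action_def pointed_action_def by blast
    ultimately show ?thesis by (simp add: lev orbit_pspace_def orbit_smash_act_def del: spectrum.simps)
  qed
  fix Z and t :: real assume Z: "Z \<in> topspace (ptop (level (steinberg X a E e) k))" and t: "t \<in> {0..1}"
    and fixed: "orbit_smash_act u v h Z = Z"
  have "topspace (ptop (level (steinberg X a E e) k)) = orbit_of GL ?b ` topspace (ptop (level steinberg_smash k))"
    unfolding lev orbit_pspace_def pspace.simps quotient_topology_def by (rule topspace_final_topology) simp
  then obtain x0 where x0: "x0 \<in> topspace (ptop (level steinberg_smash k))" "Z = orbit_of GL ?b x0" using Z by blast
  have cont: "continuous_action GL (ptop (level steinberg_smash k)) ?b" using pa[of k] unfolding pointed_action_def by blast
  have "x \<in> topspace (ptop (level steinberg_smash k))" if x: "x \<in> Z" for x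
  proof -
    obtain l where "l \<in> carrier GL" "x = ?b l x0" using x unfolding x0(2) orbit_of_def by blast
    then show ?thesis using action_closed[OF cont _ x0(1)] by blast
  qed
  then have "?h h (bond steinberg_smash k (x, t)) = bond steinberg_smash k (?h h x, t)" if "x \<in> Z" for x
    using act hG t that unfolding spectrum_action_def by simp
  then have "orbit_smash_act u v h (bond (steinberg X a E e) k (Z, t)) = (\<lambda>x. bond steinberg_smash k (?h h x, t)) ` Z"
    unfolding bond orbit_smash_act_def image_image by (rule image_cong[OF refl])
  also have "\<dots> = bond (steinberg X a E e) k (orbit_smash_act u v h Z, t)"
    unfolding bond orbit_smash_act_def image_image ..
  finally show "orbit_smash_act u v h (bond (steinberg X a E e) k (Z, t)) = bond (steinberg X a E e) k (Z, t)"
    by (simp only: fixed)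
qed

end

lemma smash_pt_map_option:
  "pt A = pt A' \<Longrightarrow> map_prod id (map_option \<phi>) (smash_pt A (adjoin_base E0) (z, w)) =
    smash_pt A' (adjoin_base E) (z, map_option \<phi> w)"
  by (simp add: smash_pt_def collapse_def)

text \<open>The structure maps act through the sphere coordinate and \<phi> on the coordinate in the
  universal space. Both spectra choose the same representatives, since the base points of
  \<open>Y\<close> and \<open>Y'\<close> agree.\<close>

lemma steinberg_bond_map:
  assumes "pt Y' = pt Y"
  shows "orbit_smash_map \<phi> (bond (steinberg Y' a E0 a0) k (Z, t)) = bond (steinberg Y a' E e) k (orbit_smash_map \<phi> Z, t)"
proof -
  have 1: "smash_pt A Y' = smash_pt A Y" for A :: "'z pspace"
    using assms by (simp add: smash_pt_def fun_eq_iff)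
  have 2: "pt (smash A Y') = pt (smash A Y)" for A :: "'z pspace"
    using assms by (simp add: smash_def)
  show ?thesis
    unfolding orbit_smash_map_def steinberg_def spectrum_orbits_def spectrum_smash_def spectrum.simps case_prod_conv image_image
    using assms
    by (intro image_cong[OF refl])
       (auto simp: case_prod_beta' smash_pt_map_option[where A = "smash _ Y'" and A' = "smash _ Y"] smash_def[of _ Y] smash_def[of _ Y']
         smash_pt_def)
qed

theorem theorem13:
  fixes p :: nat
    and G :: "('g, 'm) monoid_scheme" and H :: "'g set"
    and Y :: "'y pspace" and aY :: "'g \<times> ('k::{field,finite} ^ 'n::finite ^ 'n) \<Rightarrow> 'y \<Rightarrow> 'y"
    and E :: "'e topology" and aE :: "'g \<times> ('k ^ 'n ^ 'n) \<Rightarrow> 'e \<Rightarrow> 'e"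
    and E\<^sub>0 :: "'f topology" and aE\<^sub>0 :: "'k ^ 'n ^ 'n \<Rightarrow> 'f \<Rightarrow> 'f"
    and \<phi> :: "'f \<Rightarrow> 'e"
  assumes "prime p" and "CARD('k) = p"
    and "group G" and "finite (carrier G)" and "\<exists>r. order G = p ^ r"
    and "subgroup H G"
    and "pointed_action (G \<times>\<times> GL) Y aY"
    and "universal_space TYPE('w) G (GL :: ('k ^ 'n ^ 'n) monoid) E aE"
    and "contractible_free_space GL E\<^sub>0 aE\<^sub>0"
    and "equivariant_homotopy_equivalence GL E\<^sub>0 aE\<^sub>0
           (fixed_space (carrier G) (fst_act GL aE) E) (snd_act G aE) \<phi>"
  shows "pointed_homotopy_equivalence
           (orbit_smash GL
              (smash B_diamond (fixed_pspace H (fst_act GL aY) Y))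
              (smash_act B_diamond_act (snd_act G aY)) E\<^sub>0 aE\<^sub>0)
           (fixed_pspace H (orbit_smash_act (fst_act GL aY) (fst_act GL aE))
              (orbit_smash GL
                 (smash B_diamond Y)
                 (smash_act B_diamond_act (snd_act G aY)) E (snd_act G aE)))
           (orbit_smash_map \<phi>) \<and>
         spectrum_equivalence
           (steinberg (fixed_pspace H (fst_act GL aY) Y) (snd_act G aY) E\<^sub>0 aE\<^sub>0)
           (fixed_spectrum H (orbit_smash_act (fst_act GL aY) (fst_act GL aE))
              (steinberg Y (snd_act G aY) E (snd_act G aE)))
           (\<lambda>_. orbit_smash_map \<phi>)"
proof -
  have p: "prime CARD('k)" using assms(1,2) by simp
  have HG: "H \<subseteq> carrier G" using assms(6) by (rule subgroup.subset)
  \<comment> \<open>A divisor of a power of p is a power of p; this is where the order of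
    \<open>G\<close> is used.\<close>
  have p_subgroup: "P \<in> p_subgroups"
    if "subgroup P (GL :: ('k ^ 'n ^ 'n) monoid)" "P \<noteq> {\<one>\<^bsub>GL\<^esub>}" "card P dvd order G" for P
    using that assms(1,2,5) divides_primepow_nat[OF assms(1)] by (auto simp: p_subgroups_def GL_def)
  have E0: "continuous_action GL E\<^sub>0 aE\<^sub>0" "topspace E\<^sub>0 \<noteq> {}"
    using assms(9) by (auto simp: contractible_free_space_def)
  have fin: "finite (carrier (GL :: ('k ^ 'n ^ 'n) monoid))" by (rule finite)
  \<comment> \<open>Stated for every good space, since it is applied to the suspended flag complex
    itself and to the factor at each level of the spectra.\<close>
  have equivalence: "pointed_homotopy_equivalence
      (orbit_smash GL (smash B (fixed_pspace H (fst_act GL aY) Y)) (smash_act b (snd_act G aY)) E\<^sub>0 aE\<^sub>0)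
      (fixed_pspace H (orbit_smash_act (fst_act GL aY) (fst_act GL aE))
        (orbit_smash GL (smash B Y) (smash_act b (snd_act G aY)) E (snd_act G aE)))
      (orbit_smash_map \<phi>)" if "good_space B r N GL b p_subgroups K" for B :: "'b pspace" and r N b K
    by (rule universal_orbit_smash_equivalence[OF that fin p_subgroup assms(3,4,6,7,8) E0 assms(10)])
  have aE: "continuous_action (G \<times>\<times> GL) E aE" using assms(8) by (simp add: universal_space_def)
  have aY: "continuous_action (G \<times>\<times> GL) (ptop Y) aY" using assms(7) by (simp add: pointed_action_def)
  note Eacts = fst_snd_actions[OF assms(3) group_GL aE] and Yacts = fst_snd_actions[OF assms(3) group_GL aY]
  have one: "\<one>\<^bsub>G\<^esub> \<in> carrier G" "\<one>\<^bsub>GL\<^esub> \<in> carrier (GL :: ('k ^ 'n ^ 'n) monoid)"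
    using assms(3) group_GL by (auto intro: monoid.one_closed group.is_monoid)
  have YL: "pointed_action GL Y (snd_act G aY)" and YG: "pointed_action G Y (fst_act GL aY)"
    using Yacts(1,2) assms(7) one by (auto simp: pointed_action_def snd_act_def fst_act_def)
  have YH: "pointed_action GL (fixed_pspace H (fst_act GL aY) Y) (snd_act G aY)"
  proof -
    have "continuous_action GL (fixed_space H (fst_act GL aY) (ptop Y)) (snd_act G aY)"
      by (rule fixed_space_action[OF Yacts(2)]) (use Yacts(3) HG in blast)
    moreover have "pt Y \<in> topspace (fixed_space H (fst_act GL aY) (ptop Y))"
      using YG HG by (auto simp: fixed_space_def pointed_action_def)
    ultimately show ?thesis using YL by (simp add: pointed_action_def fixed_pspace_def)
  qed
  let ?X = "steinberg (fixed_pspace H (fst_act GL aY) Y) (snd_act G aY) E\<^sub>0 aE\<^sub>0"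
    and ?Y = "fixed_spectrum H (orbit_smash_act (fst_act GL aY) (fst_act GL aE)) (steinberg Y (snd_act G aY) E (snd_act G aE))"
  have levels: "pointed_homotopy_equivalence (level ?X k) (level ?Y k) (orbit_smash_map \<phi>)" for k
  proof -
    obtain r N K where "good_space (level (desuspend (CARD('n) - 1) (suspension_spectrum (B_diamond :: (('k ^ 'n) set \<Rightarrow> real) susp pspace))) k)
        r N GL (smash_act (\<lambda>_. id) B_diamond_act) p_subgroups K"
      by (rule good_space_steinberg_factor[OF p])
    \<comment> \<open>A level of a Steinberg summand is an orbit space of the same shape, with a
      level of the desuspended suspension spectrum in place of the suspended flag complex.\<close>
    from equivalence[OF this] show ?thesis by (simp add: steinberg_level fixed_spectrum_def)
  qed
  have "spectrum_equivalence ?X ?Y (\<lambda>_. orbit_smash_map \<phi>)"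
  proof (rule levelwise_spectrum_equivalence)
    show "is_spectrum ?X" by (rule is_spectrum_steinberg[OF YH E0(1)])
    show "is_spectrum ?Y" by (rule is_spectrum_fixed_steinberg[OF YL Eacts(2) assms(3) HG YG Eacts(1)])
    show "spectrum_map ?X ?Y (\<lambda>_. orbit_smash_map \<phi>)"
      using levels by (simp add: spectrum_map_def pointed_homotopy_equivalence_def fixed_spectrum_def steinberg_bond_map)
  qed (rule levels)
  then show ?thesis using equivalence[OF good_space_B_diamond[OF p]] by blast
qed

end
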